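(* The following functions are in $\mathrm{B\text{-}QNC}_{\mathrm f}^0$: addition and multiplication of $n$ integers, division of integers with remainder, and sorting of $n$ integers.
   Context: The circuits computing these functions take as part of the input an ancilla register in state $|0\rangle$ and output the result of the computation in that register. A quantum circuit is a sequence of quantum gates ordered into layers; gates in one layer are applied in parallel. The size of a gate is the number of qubits it acts on, the depth of a circuit is its number of layers, and its size is the total size of all its gates. Besides input/output qubits, a circuit may use ancilla qubits initialised to $|0\rangle$. The (unbounded) fan-out gate maps $|y_1\rangle\cdots|y_k\rangle|x\rangle\mapsto|y_1\oplus x\rangle\cdots|y_k\oplus x\rangle|x\rangle$, for any $k$, and counts as one gate. Circuits with fan-out use fan-out gates together with gates from a fixed universal basis (the Hadamard gate, a rotation by an irrational multiple of $\pi$, and the controlled-not gate). Circuit families are uniform: a description of the circuit for each input size is generated by a log-space Turing machine. $\mathrm{B\text{-}QNC}_{\mathrm f}^0$ is the class of operators approximated with two-sided, polynomially small error by uniform families of quantum circuits with fan-out, of constant depth and polynomial size, over the fixed basis. *)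

theory Defs
  imports Complex_Main "Jordan_Normal_Form.Matrix" "Jordan_Normal_Form.Conjugate"
begin

section \<open>Quantum circuits with fan-out\<close>

text \<open>
  The computational basis state of \<open>N\<close> qubits in which qubit \<open>q\<close> has value \<open>b\<^sub>q\<close> is identified with
  the index \<open>i < 2 ^ N\<close> whose binary digits are \<open>bit i q = b\<^sub>q\<close>.  States are vectors of dimension
  \<open>2 ^ N\<close> and operators are \<open>2 ^ N \<times> 2 ^ N\<close> matrices.
\<close>

datatype gate =
    Hadamard nat
  | Rotation nat
  | Cnot nat nat           \<comment> \<open>control, target\<close>
  | Fanout "nat list" nat  \<comment> \<open>targets \<open>y\<^sub>1, \<dots>, y\<^sub>k\<close>, source \<open>x\<close>\<close>

fun gate_qubits :: "gate \<Rightarrow> nat list" where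
  "gate_qubits (Hadamard q) = [q]"
| "gate_qubits (Rotation q) = [q]"
| "gate_qubits (Cnot c t) = [c, t]"
| "gate_qubits (Fanout ys x) = ys @ [x]"

text \<open>The irrational multiple of \<open>\<pi>\<close> used in the fixed basis.\<close>

definition rotation_angle :: real where
  "rotation_angle = sqrt 2 * pi"

text \<open>
  The unitary of a gate, on its own qubits: digit \<open>l\<close> of a row or column index belongs to the
  qubit \<open>gate_qubits g ! l\<close>.  In the fan-out gate the digits \<open>0, \<dots>, k - 1\<close> are the targets,
  which are all flipped if digit \<open>k\<close> is set.
\<close>

fun gate_matrix :: "gate \<Rightarrow> complex mat" where
  "gate_matrix (Hadamard q) =
     mat 2 2 (\<lambda>(i, j). (if i = 1 \<and> j = 1 then - 1 else 1) / complex_of_real (sqrt 2))"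
| "gate_matrix (Rotation q) =
     mat 2 2 (\<lambda>(i, j). if i = j then (if j = 1 then cis rotation_angle else 1) else 0)"
| "gate_matrix (Cnot c t) =
     mat 4 4 (\<lambda>(i, j). of_bool (i = (if bit j 0 then flip_bit 1 j else j)))"
| "gate_matrix (Fanout ys x) =
     (let k = length ys in
      mat (2 ^ (k + 1)) (2 ^ (k + 1))
        (\<lambda>(i, j). of_bool (i = (if bit j k then Bit_Operations.xor j (mask k) else j))))"

text \<open>The values of the qubits \<open>qs\<close> in the basis state \<open>i\<close>, read as a basis state of those qubits.\<close>

definition restrict_index :: "nat list \<Rightarrow> nat \<Rightarrow> nat" where
  "restrict_index qs i = horner_sum of_bool 2 (map (bit i) qs)"

text \<open>The matrix \<open>G\<close> acting on the qubits \<open>qs\<close>, tensored with the identity on the others.\<close>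

definition act_on :: "nat \<Rightarrow> nat list \<Rightarrow> complex mat \<Rightarrow> complex mat" where
  "act_on N qs G = mat (2 ^ N) (2 ^ N) (\<lambda>(i, j).
     if \<forall>q<N. q \<notin> set qs \<longrightarrow> bit i q = bit j q
     then G $$ (restrict_index qs i, restrict_index qs j) else 0)"

type_synonym layer = "gate list"

datatype circuit = Circuit (circuit_width: nat) (circuit_layers: "layer list")

text \<open>Gates of one layer act on disjoint sets of qubits, so they can be applied in parallel.\<close>

definition wf_circuit :: "circuit \<Rightarrow> bool" where
  "wf_circuit C \<longleftrightarrow> (\<forall>L \<in> set (circuit_layers C).
     distinct (concat (map gate_qubits L)) \<and>
     (\<forall>q \<in> set (concat (map gate_qubits L)). q < circuit_width C))"

definition circuit_depth :: "circuit \<Rightarrow> nat" where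
  "circuit_depth C = length (circuit_layers C)"

definition gate_size :: "gate \<Rightarrow> nat" where
  "gate_size g = length (gate_qubits g)"

definition circuit_size :: "circuit \<Rightarrow> nat" where
  "circuit_size C = sum_list (map gate_size (concat (circuit_layers C)))"

definition layer_matrix :: "nat \<Rightarrow> layer \<Rightarrow> complex mat" where
  "layer_matrix N L = foldl (\<lambda>A g. act_on N (gate_qubits g) (gate_matrix g) * A) (1\<^sub>m (2 ^ N)) L"

definition circuit_matrix :: "circuit \<Rightarrow> complex mat" where
  "circuit_matrix C =
     foldl (\<lambda>A L. layer_matrix (circuit_width C) L * A) (1\<^sub>m (2 ^ circuit_width C)) (circuit_layers C)"


section \<open>Approximation of operators\<close>

text \<open>
  An operator on \<open>op_qubits\<close> input/output qubits, considered on the subspace spanned by the basis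
  states in \<open>op_dom\<close>; its action on other states does not matter.
\<close>

record qoperator =
  op_qubits :: nat
  op_dom :: "nat set"
  op_matrix :: "complex mat"

definition vec_norm2 :: "complex vec \<Rightarrow> real" where
  "vec_norm2 v = sqrt (Re (v \<bullet>c v))"

text \<open>The state \<open>\<psi> \<otimes> |0\<dots>0\<rangle>\<close>: qubits \<open>k, \<dots>, N - 1\<close> are ancillas.\<close>

definition with_ancillas :: "nat \<Rightarrow> nat \<Rightarrow> complex vec \<Rightarrow> complex vec" where
  "with_ancillas N k \<psi> = vec (2 ^ N) (\<lambda>i. if i < 2 ^ k then \<psi> $ i else 0)"

definition approximates :: "circuit \<Rightarrow> qoperator \<Rightarrow> real \<Rightarrow> bool" where
  "approximates C U \<epsilon> \<longleftrightarrow>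
     wf_circuit C \<and> op_qubits U \<le> circuit_width C \<and>
     (\<forall>\<psi> \<in> carrier_vec (2 ^ op_qubits U).
        (\<forall>i < 2 ^ op_qubits U. i \<notin> op_dom U \<longrightarrow> \<psi> $ i = 0) \<longrightarrow>
        vec_norm2
          (circuit_matrix C *\<^sub>v with_ancillas (circuit_width C) (op_qubits U) \<psi>
           - with_ancillas (circuit_width C) (op_qubits U) (op_matrix U *\<^sub>v \<psi>))
        \<le> \<epsilon> * vec_norm2 \<psi>)"


section \<open>Logarithmic-space Turing machines\<close>

datatype direction = Left | Stay | Right

datatype input_symbol = Left_End | Letter bool | Right_End

text \<open>
  Deterministic machines with a read-only input tape, one work tape (infinite to the right) and a
  write-only output tape.  States are \<open>0, \<dots>, tm_states - 1\<close> with initial state \<open>0\<close>; work symbols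
  are \<open>0, \<dots>, tm_symbols - 1\<close> with blank \<open>0\<close>.  A transition yields the new state, the symbol
  written, the moves of the input head and of the work head, and the letters appended to the output;
  \<open>None\<close> means that the machine halts.
\<close>

record turing_machine =
  tm_states :: nat
  tm_symbols :: nat
  tm_delta :: "nat \<Rightarrow> input_symbol \<Rightarrow> nat \<Rightarrow> (nat \<times> nat \<times> direction \<times> direction \<times> bool list) option"

definition wf_tm :: "turing_machine \<Rightarrow> bool" where
  "wf_tm M \<longleftrightarrow> 0 < tm_states M \<and> 0 < tm_symbols M \<and>
     (\<forall>q < tm_states M. \<forall>a. \<forall>s < tm_symbols M.
        case tm_delta M q a s of
          None \<Rightarrow> True
        | Some (q', s', _) \<Rightarrow> q' < tm_states M \<and> s' < tm_symbols M)"

record config =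
  cf_state :: nat
  cf_input_pos :: nat
  cf_work :: "nat \<Rightarrow> nat"
  cf_work_pos :: nat
  cf_output :: "bool list"

definition input_at :: "bool list \<Rightarrow> nat \<Rightarrow> input_symbol" where
  "input_at w p = (if p = 0 then Left_End
                   else if p \<le> length w then Letter (w ! (p - 1)) else Right_End)"

fun move :: "direction \<Rightarrow> nat \<Rightarrow> nat" where
  "move Left p = p - 1"
| "move Stay p = p"
| "move Right p = p + 1"

definition init_config :: config where
  "init_config = \<lparr>cf_state = 0, cf_input_pos = 0, cf_work = (\<lambda>_. 0), cf_work_pos = 0, cf_output = []\<rparr>"

definition tm_action ::
  "turing_machine \<Rightarrow> bool list \<Rightarrow> config \<Rightarrow> (nat \<times> nat \<times> direction \<times> direction \<times> bool list) option" where
  "tm_action M w c =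
     tm_delta M (cf_state c) (input_at w (cf_input_pos c)) (cf_work c (cf_work_pos c))"

text \<open>A halted configuration is repeated; the input head never leaves the end markers.\<close>

definition tm_step :: "turing_machine \<Rightarrow> bool list \<Rightarrow> config \<Rightarrow> config" where
  "tm_step M w c = (case tm_action M w c of
     None \<Rightarrow> c
   | Some (q, s, di, dw, out) \<Rightarrow>
       \<lparr>cf_state = q,
        cf_input_pos = min (move di (cf_input_pos c)) (length w + 1),
        cf_work = (cf_work c)(cf_work_pos c := s),
        cf_work_pos = move dw (cf_work_pos c),
        cf_output = cf_output c @ out\<rparr>)"

text \<open>The machine halts on \<open>w\<close> with output \<open>v\<close>, and its work head stays within \<open>S\<close> cells.\<close>

definition tm_computes :: "turing_machine \<Rightarrow> bool list \<Rightarrow> bool list \<Rightarrow> real \<Rightarrow> bool" where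
  "tm_computes M w v S \<longleftrightarrow> (\<exists>t.
     tm_action M w ((tm_step M w ^^ t) init_config) = None \<and>
     cf_output ((tm_step M w ^^ t) init_config) = v \<and>
     (\<forall>t' \<le> t. real (cf_work_pos ((tm_step M w ^^ t') init_config) + 1) \<le> S))"


section \<open>Uniform circuit families and the class B-QNC\<close>

definition encode_nat :: "nat \<Rightarrow> bool list" where
  "encode_nat n = replicate n True @ [False]"

definition encode_list :: "('a \<Rightarrow> bool list) \<Rightarrow> 'a list \<Rightarrow> bool list" where
  "encode_list e xs = concat (map (\<lambda>x. True # e x) xs) @ [False]"

fun encode_gate :: "gate \<Rightarrow> bool list" where
  "encode_gate (Hadamard q) = [False, False] @ encode_nat q"
| "encode_gate (Rotation q) = [False, True] @ encode_nat q"
| "encode_gate (Cnot c t) = [True, False] @ encode_nat c @ encode_nat t"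
| "encode_gate (Fanout ys x) = [True, True] @ encode_list encode_nat ys @ encode_nat x"

definition encode_circuit :: "circuit \<Rightarrow> bool list" where
  "encode_circuit C =
     encode_nat (circuit_width C) @ encode_list (encode_list encode_gate) (circuit_layers C)"

text \<open>
  Families are indexed by two positive size parameters, such as the number of the input integers
  and their bit length.  The machine generating a family gets both in unary.
\<close>

definition size_word :: "nat \<Rightarrow> nat \<Rightarrow> bool list" where
  "size_word n m = replicate n True @ [False] @ replicate m True"

definition uniform_family :: "(nat \<Rightarrow> nat \<Rightarrow> circuit) \<Rightarrow> bool" where
  "uniform_family C \<longleftrightarrow> (\<exists>M a. wf_tm M \<and>
     (\<forall>n>0. \<forall>m>0. tm_computes M (size_word n m) (encode_circuit (C n m))
                    (a * log 2 (real (length (size_word n m)) + 2))))"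

text \<open>
  ``Polynomially small error'' means that the error can be made smaller than the inverse of any
  given polynomial; depth bound, size bound and machine may depend on that polynomial.
\<close>

definition BQNC0f :: "(nat \<Rightarrow> nat \<Rightarrow> qoperator) set" where
  "BQNC0f = {U. \<forall>e::nat. \<exists>C.
     uniform_family C \<and>
     (\<exists>d. \<forall>n>0. \<forall>m>0. circuit_depth (C n m) \<le> d) \<and>
     (\<exists>c. \<forall>n>0. \<forall>m>0. circuit_size (C n m) \<le> c * (n + m) ^ c) \<and>
     (\<forall>n>0. \<forall>m>0. approximates (C n m) (U n m) (1 / real (n + m) ^ e))}"


section \<open>The functions\<close>

text \<open>
  The operator \<open>|x\<rangle>|y\<rangle> \<mapsto> |x\<rangle>|y \<oplus> f x\<rangle>\<close> for an input register of \<open>a\<close> qubits (low digits) and an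
  output register of \<open>b\<close> qubits (high digits), restricted to \<open>y = 0\<close> and \<open>x\<close> in the domain \<open>D\<close>.
\<close>

definition fun_operator :: "nat \<Rightarrow> nat \<Rightarrow> nat set \<Rightarrow> (nat \<Rightarrow> nat) \<Rightarrow> qoperator" where
  "fun_operator a b D f =
     \<lparr>op_qubits = a + b,
      op_dom = {x. x < 2 ^ a \<and> x \<in> D},
      op_matrix = mat (2 ^ (a + b)) (2 ^ (a + b)) (\<lambda>(i, j).
        of_bool (i = Bit_Operations.xor j (push_bit a (take_bit b (f (take_bit a j))))))\<rparr>"

text \<open>Integers are stored in two's complement, lists of them as consecutive blocks of digits.\<close>

definition encode_int :: "nat \<Rightarrow> int \<Rightarrow> nat" where
  "encode_int w z = nat (take_bit w z)"

definition encode_ints :: "nat \<Rightarrow> int list \<Rightarrow> nat" where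
  "encode_ints w zs = horner_sum (encode_int w) (2 ^ w) zs"

text \<open>The integer of \<open>w \<ge> 1\<close> bits whose lowest digit is digit \<open>p\<close> of the register content \<open>x\<close>.\<close>

definition int_at :: "nat \<Rightarrow> nat \<Rightarrow> nat \<Rightarrow> int" where
  "int_at p w x = signed_take_bit (w - 1) (drop_bit p (int x))"

definition decode_ints :: "nat \<Rightarrow> nat \<Rightarrow> nat \<Rightarrow> int list" where
  "decode_ints n w x = map (\<lambda>i. int_at (w * i) w x) [0..<n]"

text \<open>
  In the first three operators the output registers are wide enough to hold the results without
  overflow.
\<close>

definition addition_op :: "nat \<Rightarrow> nat \<Rightarrow> qoperator" where
  "addition_op n m = fun_operator (n * m) (n + m) UNIV
     (\<lambda>x. encode_int (n + m) (sum_list (decode_ints n m x)))"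

definition multiplication_op :: "nat \<Rightarrow> nat \<Rightarrow> qoperator" where
  "multiplication_op n m = fun_operator (n * m) (n * m) UNIV
     (\<lambda>x. encode_int (n * m) (prod_list (decode_ints n m x)))"

text \<open>
  Division of an integer \<open>u\<close> of \<open>n\<close> bits by \<open>v \<noteq> 0\<close> of \<open>m\<close> bits: \<open>u = q * v + r\<close> with
  \<open>0 \<le> r < \<bar>v\<bar>\<close>.  The quotient has \<open>n + 1\<close> bits since \<open>v\<close> may be \<open>- 1\<close>.
\<close>

definition division_op :: "nat \<Rightarrow> nat \<Rightarrow> qoperator" where
  "division_op n m = fun_operator (n + m) (n + 1 + m) {x. int_at n m x \<noteq> 0}
     (\<lambda>x. let u = int_at 0 n x; v = int_at n m x;
              q = sgn v * (u div \<bar>v\<bar>); r = u mod \<bar>v\<bar>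
          in encode_int (n + 1) q + 2 ^ (n + 1) * encode_int m r)"

definition sorting_op :: "nat \<Rightarrow> nat \<Rightarrow> qoperator" where
  "sorting_op n m = fun_operator (n * m) (n * m) UNIV
     (\<lambda>x. encode_ints m (sort (decode_ints n m x)))"

end

theory Submission
  imports Defs "HOL-Analysis.L2_Norm" "HOL-Library.Nat_Bijection" "HOL-Number_Theory.Residue_Primitive_Roots"
begin

text \<open>
  A gate testing \<open>(\<Sum>v. c v * x v) = t\<close> has a constant-depth circuit with fan-out.  Phase kickback gives
  ancilla \<open>k\<close> the phase \<open>\<pi> / 2 ^ k * (t - (\<Sum>v. c v * x v))\<close>; if the test fails, then this is an odd multiple
  of \<open>\<pi>\<close> for some \<open>k\<close>.  The disjunction of these logarithmically many ancillas is a normalised sum of their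
  parities, and a parity is a fan-out gate conjugated by Hadamard gates.  The small angles are
  multiples of \<open>sqrt 2 * \<pi>\<close> up to an error that solutions of Pell's equation make polynomially small.

  Nets of such gates with weights computable in logarithmic space compute the functions of uniform
  \<open>TC\<^sup>0\<close>.  Sums are column sums with carry lookahead.  For products, residues modulo small primes are
  multiplied by means of discrete logarithms, and the binary digits are read off a Chinese remainder
  representation in which the product of the moduli is replaced by nearly a power of two.  Quotients
  come from a truncated geometric series, and sorted lists from the ranks of their elements.
\<close>


section \<open>Logarithmic-space functions\<close>

text \<open>The machine printing a circuit has logarithmic space, while the circuit handles numbers
  with polynomially many bits. Hence three classes of functions: \<open>lsf\<close>, polynomially
  bounded and depending on the sizes only; \<open>tcn\<close>, polynomially bounded and depending on
  the input too; \<open>tcb\<close>, numbers given by one \<open>tcn\<close> predicate for all their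
  bits. Data that depend on small numbers only (primes, generators, discrete logarithms, solutions
  of Pell's equation) are found by exhaustive search inside \<open>lsf\<close>.

  Equality tests suffice because wires are one-hot: each says that some bounded quantity has one
  particular value. An arbitrary function of the quantity is then linear in its wires, and a sum of
  such functions is compared with every possible value.

  With ideal angles the circuit is exact: a failed test has amplitude exactly 0 where it matters,
  ancillas return to zero, and a level is its own inverse, so a net is erased by running it again in
  reverse order. Only rotations cause error. The ideal angles are free parameters, since only a
  whole bundle of equal rotations has to add up to the right angle, and errors of unitary gates are
  additive.\<close>

type_synonym env = "nat => nat"

definition push :: "nat => env => env" where
 "push x E = (\<lambda>k. case k of 0 => x | Suc j => E j)"

lemma push_simps [simp]:
 "push x E 0 = x"
 "push x E (Suc k) = E k"
 "push x E (numeral l) = E (pred_numeral l)"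
 "push x E 1 = E 0"
 "(\<lambda>k. push x E (Suc k)) = E"
 "push (E 0) (\<lambda>k. E (Suc k)) = E"
 by (auto simp: push_def numeral_eq_Suc fun_eq_iff split: nat.split)

datatype expr =
  Var nat
 | Zero
 | Succ expr
 | Mul expr expr
 | Iter expr expr expr expr  \<comment> \<open>number of rounds, start value, cap, step (of accumulator and round number)\<close>

text \<open>The cap truncates the accumulator of \<open>Iter\<close> in every round. This keeps
  every expression below a polynomial in its variables, so that its evaluation needs logarithmic
  space only; iterated doubling without a cap would be exponential. Variables are de Bruijn indices:
  the step sees the accumulator at 0 and the round number at 1.\<close>

fun eval :: "expr => env => nat" where
 "eval (Var k) E = E k"
| "eval Zero E = 0"
| "eval (Succ e) E = Suc (eval e E)"
| "eval (Mul e1 e2) E = eval e1 E * eval e2 E"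
| "eval (Iter b z c s) E =
   rec_nat (min (eval z E) (eval c E))
    (\<lambda>i acc. min (eval s (push acc (push i E))) (eval c E)) (eval b E)"

text \<open>Membership is a property of functions rather than of terms, so closure properties become
  introduction rules. A bound variable is index 0 above the shifted environment, whence the premises
  of the shape \<open>f (E 0) (\<lambda>k. E (Suc k))\<close> in all rules for binders.\<close>

definition lsf :: "(env => nat) => bool" where
 "lsf f \<longleftrightarrow> (\<exists>e. f = eval e)"

definition lsp :: "(env => bool) => bool" where
 "lsp P \<longleftrightarrow> lsf (\<lambda>E. of_bool (P E))"

named_theorems lsf_intros

lemma lsf_var [lsf_intros]: "lsf (\<lambda>E. E k)"
 unfolding lsf_def by (rule exI[of _ "Var k"]) auto

lemma lsf_Suc [lsf_intros]: "lsf f ==> lsf (\<lambda>E. Suc (f E))"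
 unfolding lsf_def by (elim exE, rule_tac x = "Succ e" in exI) (auto simp: fun_eq_iff)

lemma lsf_mult [lsf_intros]: "lsf f ==> lsf g ==> lsf (\<lambda>E. f E * g E)"
 unfolding lsf_def by (elim exE, rule_tac x = "Mul e ea" in exI) (auto simp: fun_eq_iff)

lemma lsf_const [lsf_intros]: "lsf (\<lambda>E. c)"
proof (induction c)
 case 0
 show ?case unfolding lsf_def by (rule exI[of _ Zero]) auto
qed (rule lsf_Suc)

lemma lsf_iter:
 assumes "lsf b" "lsf z" "lsf c" "lsf (\<lambda>E. s (E 0) (E (Suc 0)) (\<lambda>k. E (Suc (Suc k))))"
 shows "lsf (\<lambda>E. rec_nat (min (z E) (c E)) (\<lambda>i acc. min (s acc i E) (c E)) (b E))"
proof -
 obtain eb ez ec es where e: "b = eval eb" "z = eval ez" "c = eval ec"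
  "(\<lambda>E. s (E 0) (E (Suc 0)) (\<lambda>k. E (Suc (Suc k)))) = eval es"
  using assms unfolding lsf_def by (elim exE) blast
 have "s acc i E = eval es (push acc (push i E))" for acc i E
  using fun_cong[OF e(4), of "push acc (push i E)"] by simp
 then show ?thesis
  unfolding lsf_def e(1-3) by (intro exI[of _ "Iter eb ez ec es"]) auto
qed

text \<open>As long as the untruncated recursion stays below \<open>c\<close>, the truncation in
  \<open>Iter\<close> never takes effect, and both recursions agree round by round.\<close>

lemma lsf_rec:
 assumes "lsf b" "lsf z" "lsf c" "lsf (\<lambda>E. s (E 0) (E (Suc 0)) (\<lambda>k. E (Suc (Suc k))))"
  and le: "!!E i. i <= b E ==> rec_nat (z E) (\<lambda>i acc. s acc i E) i <= c E"
 shows "lsf (\<lambda>E. rec_nat (z E) (\<lambda>i acc. s acc i E) (b E))"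
proof -
 have "rec_nat (min (z E) (c E)) (\<lambda>i acc. min (s acc i E) (c E)) i
   = rec_nat (z E) (\<lambda>i acc. s acc i E) i" if "i <= b E" for i E
  using that
 proof (induction i)
  case 0
  then show ?case using le[of 0 E] by simp
 next
  case (Suc i)
  then show ?case using le[of "Suc i" E] by simp
 qed
 then show ?thesis using lsf_iter[OF assms(1-4)] by simp
qed

lemma lsf_add [lsf_intros]:
 assumes "lsf f" "lsf g"
 shows "lsf (\<lambda>E. f E + g E)"
proof -
 have eq: "rec_nat x (\<lambda>i acc. Suc acc) y = x + y" for x y :: nat
  by (induction y) auto
 have "lsf (\<lambda>E. rec_nat (f E) (\<lambda>i acc. Suc acc) (g E))"
  by (rule lsf_rec[where s = "\<lambda>acc i E. Suc acc" and c = "\<lambda>E. Suc (f E) * Suc (g E)"];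
    (intro lsf_intros assms)?) (simp add: eq algebra_simps trans_le_add2)
 then show ?thesis by (simp add: eq)
qed

text \<open>The step forgets the accumulator and returns the round number; the last of
  \<open>f E\<close> rounds has number \<open>f E - 1\<close>, and without rounds the start value 0
  remains.\<close>

lemma lsf_diff_1: "lsf f ==> lsf (\<lambda>E. f E - 1)"
proof -
 assume f: "lsf f"
 have eq: "rec_nat 0 (\<lambda>i acc. i) x = x - 1" for x :: nat
  by (cases x) auto
 have "lsf (\<lambda>E. rec_nat 0 (\<lambda>i acc. i) (f E))"
  by (rule lsf_rec[where s = "\<lambda>acc i E. i" and c = f]) (auto intro!: lsf_intros f simp: eq)
 then show ?thesis by (simp add: eq)
qed

lemma lsf_diff [lsf_intros]:
 assumes "lsf f" "lsf g"
 shows "lsf (\<lambda>E. f E - g E)"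
proof -
 have eq: "rec_nat x (\<lambda>i acc. acc - 1) y = x - y" for x y :: nat
  by (induction y) auto
 have "lsf (\<lambda>E. rec_nat (f E) (\<lambda>i acc. acc - 1) (g E))"
  by (rule lsf_rec[where s = "\<lambda>acc i E. acc - 1" and c = f])
    (auto intro!: lsf_diff_1[unfolded One_nat_def] lsf_var assms simp: eq[unfolded One_nat_def])
 then show ?thesis by (simp only: eq)
qed

lemma lsp_le [lsf_intros]: "lsf f ==> lsf g ==> lsp (\<lambda>E. f E <= g E)"
proof -
 assume "lsf f" "lsf g"
 then have "lsf (\<lambda>E. 1 - (f E - g E))" by (intro lsf_intros)
 moreover have "(\<lambda>E. 1 - (f E - g E)) = (\<lambda>E. of_bool (f E <= g E))"
  by (auto simp: fun_eq_iff)
 ultimately show ?thesis by (simp add: lsp_def)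
qed

lemma lsp_less [lsf_intros]: "lsf f ==> lsf g ==> lsp (\<lambda>E. f E < g E)"
 unfolding less_eq_Suc_le by (intro lsf_intros)

lemma lsf_of_bool [lsf_intros]: "lsp P ==> lsf (\<lambda>E. of_bool (P E))"
 by (simp add: lsp_def)

lemma lsp_conj [lsf_intros]: "lsp P ==> lsp Q ==> lsp (\<lambda>E. P E \<and> Q E)"
 unfolding lsp_def of_bool_conj by (rule lsf_mult)

lemma lsp_not [lsf_intros]: "lsp P ==> lsp (\<lambda>E. \<not> P E)"
proof -
 assume "lsp P"
 then have "lsf (\<lambda>E. 1 - of_bool (P E))" by (intro lsf_intros)
 moreover have "(\<lambda>E. 1 - of_bool (P E)) = (\<lambda>E. of_bool (\<not> P E) :: nat)"
  by (auto simp: fun_eq_iff)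
 ultimately show ?thesis by (simp only: lsp_def)
qed

lemma lsp_disj [lsf_intros]: "lsp P ==> lsp Q ==> lsp (\<lambda>E. P E \<or> Q E)"
 using lsp_not[OF lsp_conj[OF lsp_not lsp_not], of P Q] by simp

lemma lsp_imp [lsf_intros]: "lsp P ==> lsp Q ==> lsp (\<lambda>E. P E --> Q E)"
 using lsp_disj[OF lsp_not, of P Q] by (simp only: imp_conv_disj)

lemma lsp_eq [lsf_intros]: "lsf f ==> lsf g ==> lsp (\<lambda>E. f E = g E)"
 unfolding order_eq_iff[of "f _" "g _"] by (intro lsf_intros)

lemma lsf_if [lsf_intros]:
 assumes "lsp P" "lsf f" "lsf g"
 shows "lsf (\<lambda>E. if P E then f E else g E)"
proof -
 have "lsf (\<lambda>E. of_bool (P E) * f E + of_bool (\<not> P E) * g E)"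
  by (intro lsf_intros assms)
 moreover have "(\<lambda>E. of_bool (P E) * f E + of_bool (\<not> P E) * g E)
   = (\<lambda>E. if P E then f E else g E)"
  by (auto simp: fun_eq_iff)
 ultimately show ?thesis by simp
qed

lemma lsf_min [lsf_intros]: "lsf f ==> lsf g ==> lsf (\<lambda>E. min (f E) (g E))"
 unfolding min_def by (intro lsf_intros)

lemma lsf_max [lsf_intros]: "lsf f ==> lsf g ==> lsf (\<lambda>E. max (f E) (g E))"
 unfolding max_def by (intro lsf_intros)

lemma lsf_const_power: "lsf f ==> lsf (\<lambda>E. f E ^ c)"
 by (induction c) (auto intro!: lsf_intros)

lemma lsf_sum_vars: "lsf (\<lambda>E. \<Sum>i<k. E i)"
 by (induction k) (auto intro!: lsf_intros)


section \<open>Polynomial bounds for expressions\<close>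

definition poly_bound :: "nat => nat => env => nat" where
 "poly_bound k c E = (2 + (\<Sum>i<k. E i)) ^ c"

lemma lsf_poly_bound: "lsf (poly_bound k c)"
 unfolding poly_bound_def [abs_def]
 by (intro lsf_const_power lsf_add lsf_const lsf_sum_vars)

lemma mono_poly_bound: "mono (poly_bound k c)"
 by (auto simp: mono_def poly_bound_def le_fun_def intro!: power_mono sum_mono)

lemma poly_bound_le: "k <= k' ==> c <= c' ==> poly_bound k c E <= poly_bound k' c' E"
proof -
 assume "k <= k'" "c <= c'"
 then have "(2 + (\<Sum>i<k. E i)) ^ c <= (2 + (\<Sum>i<k'. E i)) ^ c"
  by (intro power_mono add_left_mono sum_mono2) auto
 also have "... <= (2 + (\<Sum>i<k'. E i)) ^ c'"
  using \<open>c <= c'\<close> by (intro power_increasing) auto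
 finally show ?thesis by (simp add: poly_bound_def)
qed

lemma eval_poly_bound: "\<exists>k c. \<forall>E. eval e E <= poly_bound k c E"
proof (induction e)
 case (Var k)
 have "E k <= (\<Sum>i<Suc k. E i)" for E :: env
  by simp
 then have "E k <= poly_bound (Suc k) 1 E" for E
  unfolding poly_bound_def by (metis power_one_right trans_le_add2)
 then show ?case by auto
next
 case Zero
 then show ?case by auto
next
 case (Succ e)
 then obtain k c where kc: "!!E. eval e E <= poly_bound k c E" by auto
 have "Suc (eval e E) <= poly_bound k (Suc c) E" for E
 proof -
  have "1 <= poly_bound k c E" by (simp add: poly_bound_def)
  then have "Suc (poly_bound k c E) <= 2 * poly_bound k c E" by simp
  also have "... <= poly_bound k (Suc c) E" by (simp add: poly_bound_def)
  finally show ?thesis using kc[of E] by linarith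
 qed
 then show ?case by auto
next
 case (Mul e1 e2)
 then obtain k c k' c' where kc: "!!E. eval e1 E <= poly_bound k c E"
  "!!E. eval e2 E <= poly_bound k' c' E" by auto
 have "eval e1 E * eval e2 E <= poly_bound (max k k') (c + c') E" for E
 proof -
  have "eval e1 E * eval e2 E <= poly_bound (max k k') c E * poly_bound (max k k') c' E"
   by (intro mult_le_mono order_trans[OF kc(1)] order_trans[OF kc(2)] poly_bound_le) auto
  then show ?thesis by (simp add: poly_bound_def power_add)
 qed
 then show ?case by auto
next
 case (Iter b z c s)
 then obtain k d where kd: "!!E. eval c E <= poly_bound k d E" by auto
 have "eval (Iter b z c s) E <= eval c E" for E
  by (cases "eval b E") auto
 then show ?case using kd order_trans by blast
qed

lemma lsf_poly_boundE:
 assumes "lsf f"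
 obtains k c where "!!E. f E <= poly_bound k c E"
 using assms eval_poly_bound unfolding lsf_def by blast

lemma lsf_monoE:
 assumes "lsf f"
 obtains g where "lsf g" "mono g" "!!E. f E <= g E"
 using lsf_poly_boundE[OF assms] lsf_poly_bound mono_poly_bound by metis


section \<open>Renaming and substitution of variables\<close>

definition lift_ren :: "(nat => nat) => nat => nat" where
 "lift_ren h = push 0 (Suc \<circ> h)"

fun rename :: "(nat => nat) => expr => expr" where
 "rename h (Var k) = Var (h k)"
| "rename h Zero = Zero"
| "rename h (Succ e) = Succ (rename h e)"
| "rename h (Mul e1 e2) = Mul (rename h e1) (rename h e2)"
| "rename h (Iter b z c s) = Iter (rename h b) (rename h z) (rename h c)
   (rename (lift_ren (lift_ren h)) s)"

lemma push_lift_ren: "push x E \<circ> lift_ren h = push x (E \<circ> h)"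
 by (auto simp: fun_eq_iff push_def lift_ren_def split: nat.split)

lemma eval_rename: "eval (rename h e) E = eval e (E \<circ> h)"
 by (induction e arbitrary: h E) (auto simp: push_lift_ren)

definition lift_subst :: "(nat => expr) => nat => expr" where
 "lift_subst h = (\<lambda>k. case k of 0 => Var 0 | Suc j => rename Suc (h j))"

fun subst :: "(nat => expr) => expr => expr" where
 "subst h (Var k) = h k"
| "subst h Zero = Zero"
| "subst h (Succ e) = Succ (subst h e)"
| "subst h (Mul e1 e2) = Mul (subst h e1) (subst h e2)"
| "subst h (Iter b z c s) = Iter (subst h b) (subst h z) (subst h c)
   (subst (lift_subst (lift_subst h)) s)"

lemma eval_lift_subst: "(\<lambda>k. eval (lift_subst h k) (push x E)) = push x (\<lambda>k. eval (h k) E)"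
 by (auto simp: fun_eq_iff lift_subst_def push_def eval_rename o_def split: nat.split)

lemma eval_subst: "eval (subst h e) E = eval e (\<lambda>k. eval (h k) E)"
 by (induction e arbitrary: h E) (auto simp: eval_lift_subst)

lemma lsf_subst:
 assumes "lsf f" "!!k. lsf (a k)"
 shows "lsf (\<lambda>E. f (\<lambda>k. a k E))"
proof -
 obtain e where e: "f = eval e" using assms(1) unfolding lsf_def by auto
 obtain h where h: "!!k. a k = eval (h k)" using assms(2) unfolding lsf_def by metis
 show ?thesis
  unfolding lsf_def by (rule exI[of _ "subst h e"]) (auto simp: eval_subst e h)
qed

lemma lsf_push: "lsf (\<lambda>E. f (E 0) (\<lambda>k. E (Suc k))) ==> lsf a ==> lsf (\<lambda>E. f (a E) E)"
proof -
 assume f: "lsf (\<lambda>E. f (E 0) (\<lambda>k. E (Suc k)))" and a: "lsf a"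
 have "lsf (\<lambda>E. push (a E) E k)" for k
  by (cases k) (auto intro!: lsf_intros a)
 from lsf_subst[OF f, of "\<lambda>k E. push (a E) E k", OF this] show ?thesis by simp
qed

lemma lsf_weaken: "lsf f ==> lsf (\<lambda>E. f (\<lambda>k. E (Suc k)))"
 by (rule lsf_subst[where a = "\<lambda>k E. E (Suc k)"]) (auto intro: lsf_var)

lemma lsf_comp: "lsf (\<lambda>E. f (E 0)) ==> lsf a ==> lsf (\<lambda>E. f (a E))"
 using lsf_push[of "\<lambda>x E. f x" a] by simp

lemma lsf_comp2: "lsf (\<lambda>E. f (E 0) (E 1)) ==> lsf a ==> lsf b ==> lsf (\<lambda>E. f (a E) (b E))"
 using lsf_subst[of "\<lambda>E. f (E 0) (E 1)" "\<lambda>k. if k = 0 then a else b"] by simp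

text \<open>The cap of the iteration must not depend on the round. A monotone bound \<open>g\<close>
  of the summand, taken at the largest index \<open>b E\<close>, serves for all rounds at
  once.\<close>

lemma lsf_sum [lsf_intros]:
 assumes "lsf b" "lsf (\<lambda>E. f (E 0) (\<lambda>k. E (Suc k)))"
 shows "lsf (\<lambda>E. \<Sum>i<b E. f i E)"
proof -
 obtain g where g: "lsf g" "mono g" "!!E. f (E 0) (\<lambda>k. E (Suc k)) <= g E"
  using lsf_monoE[OF assms(2)] by metis
 have le: "f i E <= g (push i E)" for i E
  using g(3)[of "push i E"] by simp
 have eq: "rec_nat 0 (\<lambda>i acc. acc + f i E) n = (\<Sum>i<n. f i E)" for n E
  by (induction n) auto
 have bound: "(\<Sum>i<n. f i E) <= b E * g (push (b E) E)" if "n <= b E" for n E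
 proof -
  have "(\<Sum>i<n. f i E) <= (\<Sum>i<n. g (push (b E) E))"
   by (rule sum_mono, rule order_trans[OF le], rule monoD[OF g(2)])
     (use that in "auto simp: le_fun_def push_def split: nat.split")
  also have "... <= b E * g (push (b E) E)" using that by simp
  finally show ?thesis .
 qed
 have "lsf (\<lambda>E. g (push (b E) E))"
  by (rule lsf_push[where f = "\<lambda>x E. g (push x E)"]) (use g(1) assms(1) in simp_all)
 moreover have "lsf (\<lambda>E. f (E (Suc 0)) (\<lambda>k. E (Suc (Suc k))))"
  by (rule lsf_weaken[OF assms(2)])
 ultimately have "lsf (\<lambda>E. rec_nat 0 (\<lambda>i acc. acc + f i E) (b E))"
  using bound
  by (intro lsf_rec[where s = "\<lambda>acc i E. acc + f i E" and c = "\<lambda>E. b E * g (push (b E) E)"])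
    (auto intro!: lsf_intros assms simp: eq)
 then show ?thesis by (simp add: eq)
qed

lemma lsp_ex [lsf_intros]:
 assumes "lsf b" "lsp (\<lambda>E. P (E 0) (\<lambda>k. E (Suc k)))"
 shows "lsp (\<lambda>E. \<exists>i<b E. P i E)"
proof -
 have "lsp (\<lambda>E. \<not> (\<Sum>i<b E. of_bool (P i E)) = (0::nat))"
  by (intro lsf_intros assms)
 moreover have "(\<not> (\<Sum>i<b E. of_bool (P i E)) = (0::nat)) = (\<exists>i<b E. P i E)" for E
  by auto
 ultimately show ?thesis by simp
qed

lemma lsp_all [lsf_intros]:
 assumes "lsf b" "lsp (\<lambda>E. P (E 0) (\<lambda>k. E (Suc k)))"
 shows "lsp (\<lambda>E. \<forall>i<b E. P i E)"
proof -
 have "lsp (\<lambda>E. \<not> (\<exists>i<b E. \<not> P i E))"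
  by (intro lsf_intros assms)
 then show ?thesis by simp
qed

text \<open>A quotient counts the positive multiples of \<open>y\<close> up to \<open>x\<close>;
  candidates below \<open>x\<close> suffice because the quotient is at most \<open>x\<close>. The
  conjunct \<open>0 < y\<close> reproduces the convention that division by zero gives 0.\<close>

lemma lsf_div [lsf_intros]:
 assumes "lsf f" "lsf g"
 shows "lsf (\<lambda>E. f E div g E)"
proof -
 have eq: "(\<Sum>i<x. of_bool (Suc i * y <= x \<and> 0 < y)) = x div y" for x y :: nat
 proof (cases "y = 0")
  case False
  have "{i. i < x \<and> Suc i * y <= x \<and> 0 < y} = {..<x div y}"
  proof (safe)
   fix i assume "Suc i * y <= x" "0 < y"
   then show "i < x div y" by (simp add: less_eq_Suc_le less_eq_div_iff_mult_less_eq)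
  next
   fix i assume i: "i < x div y"
   then show "Suc i * y <= x" using False by (simp add: less_eq_Suc_le less_eq_div_iff_mult_less_eq)
   show "i < x" using i div_le_dividend[of x y] by linarith
  qed (use False in auto)
  then show ?thesis by (simp add: sum_of_bool_eq Int_def lessThan_def)
 qed auto
 have "lsf (\<lambda>E. (\<lambda>x y. (\<Sum>i<x. of_bool (Suc i * y <= x \<and> 0 < y))) (f E) (g E))"
  by (rule lsf_comp2[OF _ assms]) (intro lsf_intros)
 then show ?thesis by (simp only: eq)
qed

lemma lsf_mod [lsf_intros]: "lsf f ==> lsf g ==> lsf (\<lambda>E. f E mod g E)"
 unfolding modulo_nat_def by (intro lsf_intros)

lemma lsp_dvd [lsf_intros]: "lsf f ==> lsf g ==> lsp (\<lambda>E. f E dvd g E)"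
 unfolding dvd_eq_mod_eq_0 by (intro lsf_intros)

text \<open>The product itself may be exponentially large; reducing after every factor keeps the
  accumulator below the modulus.\<close>

lemma lsf_prod_mod:
 assumes "lsf b" "lsf (\<lambda>E. f (E 0) (\<lambda>k. E (Suc k)))" "lsf p" "!!E. 0 < p E"
 shows "lsf (\<lambda>E. (\<Prod>i<b E. f i E) mod p E)"
proof -
 have eq: "rec_nat (1 mod p E) (\<lambda>i acc. acc * f i E mod p E) n = (\<Prod>i<n. f i E) mod p E" for n E
  by (induction n) (auto simp: mod_mult_left_eq)
 have le: "rec_nat (1 mod p E) (\<lambda>i acc. acc * f i E mod p E) n <= p E" for n E
  unfolding eq using assms(4) by (simp add: less_imp_le)
 have "lsf (\<lambda>E. f (E (Suc 0)) (\<lambda>k. E (Suc (Suc k))))"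
  by (rule lsf_weaken[OF assms(2)])
 then have "lsf (\<lambda>E. rec_nat (1 mod p E) (\<lambda>i acc. acc * f i E mod p E) (b E))"
  using lsf_weaken[OF lsf_weaken[OF assms(3)]] assms(4)
  by (intro lsf_rec[where s = "\<lambda>acc i E. acc * f i E mod p E" and c = p])
    (intro lsf_intros assms(1,3) le | assumption)+
 then show ?thesis by (simp only: eq)
qed

lemma lsf_power_mod:
 assumes "lsf x" "lsf y" "lsf p" "!!E. 0 < p E"
 shows "lsf (\<lambda>E. x E ^ y E mod p E)"
 using lsf_prod_mod[of y "\<lambda>i. x" p] lsf_weaken[OF assms(1)] assms by simp

section \<open>Counter programs on Turing machines\<close>

datatype com =
  Inc nat
 | Dec nat
 | Out "bool list"
 | Seq com com  (infixr ";;" 60)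
 | While nat com
 | If nat com

text \<open>Registers grow by \<open>Inc\<close> only, whose premise enforces the bound. A
  derivation therefore certifies the space needed together with termination and the result.\<close>

inductive exec :: "nat => com => env => bool list => env => bool" for B where
 exec_Inc: "s r + 1 < B ==> exec B (Inc r) s [] (s(r := s r + 1))"
| exec_Dec: "0 < s r ==> exec B (Dec r) s [] (s(r := s r - 1))"
| exec_Out: "exec B (Out bs) s bs s"
| exec_Seq: "exec B c1 s1 o1 s2 ==> exec B c2 s2 o2 s3 ==> exec B (c1 ;; c2) s1 (o1 @ o2) s3"
| exec_While_0: "s r = 0 ==> exec B (While r c) s [] s"
| exec_While: "0 < s1 r ==> exec B c s1 o1 s2 ==> exec B (While r c) s2 o2 s3 ==>
  exec B (While r c) s1 (o1 @ o2) s3"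
| exec_If_0: "s r = 0 ==> exec B (If r c) s [] s"
| exec_If: "0 < s1 r ==> exec B c s1 out s2 ==> exec B (If r c) s1 out s2"

lemma exec_mono: "exec B c s out s' ==> B <= B' ==> exec B' c s out s'"
 by (induction rule: exec.induct) (rule exec.intros; simp)+


section \<open>Jump code and its compilation\<close>

datatype instr =
  IInc nat
 | IDec nat
 | IOut "bool list"
 | IJz nat nat
 | IJmp nat
 | IMove      \<comment> \<open>advance the input head\<close>
 | IJnt nat   \<comment> \<open>jump unless the input head reads the letter \<open>True\<close>\<close>

fun instr_regs :: "instr => nat set" where
 "instr_regs (IInc r) = {r}"
| "instr_regs (IDec r) = {r}"
| "instr_regs (IJz r a) = {r}"
| "instr_regs _ = {}"

fun instr_targets :: "instr => nat set" where
 "instr_targets (IJz r a) = {a}"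
| "instr_targets (IJmp a) = {a}"
| "instr_targets (IJnt a) = {a}"
| "instr_targets _ = {}"

type_synonym iconfig = "nat \<times> env \<times> nat \<times> bool list"

inductive istep :: "nat => bool list => instr list => iconfig => iconfig => bool" for B w P where
 "pc < length P ==> P ! pc = IInc r ==> s r + 1 < B ==>
   istep B w P (pc, s, ip, out) (pc + 1, s(r := s r + 1), ip, out)"
| "pc < length P ==> P ! pc = IDec r ==> 0 < s r ==>
   istep B w P (pc, s, ip, out) (pc + 1, s(r := s r - 1), ip, out)"
| "pc < length P ==> P ! pc = IOut bs ==> istep B w P (pc, s, ip, out) (pc + 1, s, ip, out @ bs)"
| "pc < length P ==> P ! pc = IJz r a ==>
   istep B w P (pc, s, ip, out) (if s r = 0 then a else pc + 1, s, ip, out)"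
| "pc < length P ==> P ! pc = IJmp a ==> istep B w P (pc, s, ip, out) (a, s, ip, out)"
| "pc < length P ==> P ! pc = IMove ==>
   istep B w P (pc, s, ip, out) (pc + 1, s, min (ip + 1) (length w + 1), out)"
| "pc < length P ==> P ! pc = IJnt a ==>
   istep B w P (pc, s, ip, out) (if input_at w ip = Letter True then pc + 1 else a, s, ip, out)"

fun compile :: "nat => com => instr list" where
 "compile a (Inc r) = [IInc r]"
| "compile a (Dec r) = [IDec r]"
| "compile a (Out bs) = [IOut bs]"
| "compile a (c1 ;; c2) = compile a c1 @ compile (a + length (compile a c1)) c2"
| "compile a (While r c) =
   IJz r (a + length (compile (a + 1) c) + 2) # compile (a + 1) c @ [IJmp a]"
| "compile a (If r c) = IJz r (a + length (compile (a + 1) c) + 1) # compile (a + 1) c"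

text \<open>Jump addresses are absolute, so the code is considered at its place between arbitrary
  \<open>pre\<close> and \<open>post\<close>. Induction on the derivation makes the remaining rounds
  of a loop an induction hypothesis about the very same piece of code.\<close>

lemma compile_correct:
 assumes "exec B c s out s'" "P = pre @ compile (length pre) c @ post"
 shows "(istep B w P)\<^sup>*\<^sup>* (length pre, s, ip, v) (length pre + length (compile (length pre) c), s', ip, v @ out)"
 using assms
proof (induction arbitrary: pre post v rule: exec.induct)
 case (exec_Inc s r)
 have "istep B w P (length pre, s, ip, v) (length pre + 1, s(r := s r + 1), ip, v)"
  by (rule istep.intros(1)) (use exec_Inc in auto)
 then show ?case by (simp add: r_into_rtranclp fun_upd_def)
next
 case (exec_Dec s r)
 have "istep B w P (length pre, s, ip, v) (length pre + 1, s(r := s r - 1), ip, v)"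
  by (rule istep.intros(2)) (use exec_Dec in auto)
 then show ?case by (simp add: r_into_rtranclp fun_upd_def)
next
 case (exec_Out bs s)
 have "istep B w P (length pre, s, ip, v) (length pre + 1, s, ip, v @ bs)"
  by (rule istep.intros(3)) (use exec_Out in auto)
 then show ?case by (simp add: r_into_rtranclp fun_upd_def)
next
 case (exec_Seq c1 s1 o1 s2 c2 o2 s3)
 show ?case
  using exec_Seq.IH(1)[of pre "compile (length pre + length (compile (length pre) c1)) c2 @ post" v]
   exec_Seq.IH(2)[of "pre @ compile (length pre) c1" post "v @ o1"] exec_Seq.prems
  by (auto simp: add.assoc elim!: rtranclp_trans)
next
 case (exec_While_0 s r c)
 have "istep B w P (length pre, s, ip, v)
   (if s r = 0 then length pre + length (compile (length pre + 1) c) + 2 else length pre + 1, s, ip, v)"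
  by (rule istep.intros(4)) (use exec_While_0 in auto)
 then show ?case using exec_While_0 by (auto intro!: r_into_rtranclp)
next
 case (exec_While s1 r c o1 s2 o2 s3)
 let ?n = "length pre" and ?l = "length (compile (length pre + 1) c)"
 have "istep B w P (?n, s1, ip, v) (if s1 r = 0 then ?n + ?l + 2 else ?n + 1, s1, ip, v)"
  by (rule istep.intros(4)) (use exec_While in auto)
 also have "(istep B w P)\<^sup>*\<^sup>* (if s1 r = 0 then ?n + ?l + 2 else ?n + 1, s1, ip, v) (?n + 1 + ?l, s2, ip, v @ o1)"
  using exec_While.IH(1)[of "pre @ [IJz r (?n + ?l + 2)]" "IJmp ?n # post" v] exec_While by auto
 also have "istep B w P (?n + 1 + ?l, s2, ip, v @ o1) (?n, s2, ip, v @ o1)"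
  by (rule istep.intros(5)) (use exec_While in "auto simp: nth_append")
 also have "(istep B w P)\<^sup>*\<^sup>* (?n, s2, ip, v @ o1) (?n + length (compile ?n (While r c)), s3, ip, (v @ o1) @ o2)"
  by (rule exec_While.IH(2)) (use exec_While in auto)
 finally show ?case by simp
next
 case (exec_If_0 s r c)
 have "istep B w P (length pre, s, ip, v)
   (if s r = 0 then length pre + length (compile (length pre + 1) c) + 1 else length pre + 1, s, ip, v)"
  by (rule istep.intros(4)) (use exec_If_0 in auto)
 then show ?case using exec_If_0 by (auto intro!: r_into_rtranclp)
next
 case (exec_If s1 r c out s2)
 let ?n = "length pre" and ?l = "length (compile (length pre + 1) c)"
 have "istep B w P (?n, s1, ip, v) (if s1 r = 0 then ?n + ?l + 1 else ?n + 1, s1, ip, v)"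
  by (rule istep.intros(4)) (use exec_If in auto)
 also have "(istep B w P)\<^sup>*\<^sup>* (if s1 r = 0 then ?n + ?l + 1 else ?n + 1, s1, ip, v) (?n + 1 + ?l, s2, ip, v @ out)"
  using exec_If.IH[of "pre @ [IJz r (?n + ?l + 1)]" "post" v] exec_If by auto
 finally show ?case by simp
qed

lemma compile_targets: "instr \<in> set (compile a c) ==> t \<in> instr_targets instr ==> t <= a + length (compile a c)"
 by (induction a c arbitrary: t rule: compile.induct) (force simp: add.assoc)+

lemma finite_instr_regs: "finite (\<Union>i \<in> set P. instr_regs i)"
proof -
 have "finite (instr_regs i)" for i by (cases i) auto
 then show ?thesis by auto
qed


text \<open>
 Register \<open>r\<close> is stored in binary in the bits \<open>r\<close> of the work symbols.  Bit \<open>k\<close> marks the leftmost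
 cell, bit \<open>k + 1\<close> the cells visited so far; the latter makes testing for zero possible.
 State \<open>4 * pc\<close> starts instruction \<open>pc\<close>, state \<open>4 * pc + 1\<close> moves right through the digits,
 and states \<open>4 * pc + 2\<close>, \<open>4 * pc + 3\<close> return to the leftmost cell before the next instruction or a jump.
\<close>

definition delta ::
 "instr list => nat => nat => input_symbol => nat => (nat \<times> nat \<times> direction \<times> direction \<times> bool list) option" where
 "delta P k q a s = (let pc = q div 4; ph = q mod 4; vis = set_bit (k + 1) in
   if length P <= pc then None
   else if ph = 0 then Some (case P ! pc of
     IOut bs => (4 * (pc + 1), s, Stay, Stay, bs)
    | IJmp t => (4 * t, s, Stay, Stay, [])
    | IMove => (4 * (pc + 1), s, Right, Stay, [])
    | IJnt t => (4 * (if a = Letter True then pc + 1 else t), s, Stay, Stay, [])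
    | _ => (4 * pc + 1, set_bit k s, Stay, Stay, []))
   else if ph = 1 then Some (case P ! pc of
     IInc r => if bit s r then (q, vis (unset_bit r s), Stay, Right, [])
          else (q + 1, vis (set_bit r s), Stay, Stay, [])
    | IDec r => if bit s r then (q + 1, vis (unset_bit r s), Stay, Stay, [])
          else (q, vis (set_bit r s), Stay, Right, [])
    | _ => if bit s (SOME r. r \<in> instr_regs (P ! pc)) then (q + 1, s, Stay, Stay, [])
       else if bit s (k + 1) then (q, s, Stay, Right, []) else (q + 2, s, Stay, Stay, []))
   else if \<not> bit s k then Some (q, s, Stay, Left, [])
   else Some (4 * (if ph = 2 then pc + 1 else (case P ! pc of IJz r t => t | _ => 0)), s, Stay, Stay, []))"

lemma phase_div: "i < 4 ==> (4 * pc + i) div 4 = pc \<and> (4 * pc + i) mod 4 = (i::nat)"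
 by auto

lemma delta_0: "pc < length P ==>
  delta P k (4 * pc) a s = Some (case P ! pc of
     IOut bs => (4 * (pc + 1), s, Stay, Stay, bs)
    | IJmp t => (4 * t, s, Stay, Stay, [])
    | IMove => (4 * (pc + 1), s, Right, Stay, [])
    | IJnt t => (4 * (if a = Letter True then pc + 1 else t), s, Stay, Stay, [])
    | _ => (4 * pc + 1, set_bit k s, Stay, Stay, []))"
 using phase_div[of 0 pc] by (cases "P ! pc") (simp_all add: delta_def Let_def)

text \<open>In the simulation the last alternative is entered for \<open>IJz\<close> only, whose
  register set is a singleton, so that the choice operator yields its register.\<close>

lemma delta_1: "pc < length P ==>
  delta P k (4 * pc + 1) a s = Some (case P ! pc of
     IInc r => if bit s r then (4 * pc + 1, set_bit (k + 1) (unset_bit r s), Stay, Right, [])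
          else (4 * pc + 2, set_bit (k + 1) (set_bit r s), Stay, Stay, [])
    | IDec r => if bit s r then (4 * pc + 2, set_bit (k + 1) (unset_bit r s), Stay, Stay, [])
          else (4 * pc + 1, set_bit (k + 1) (set_bit r s), Stay, Right, [])
    | _ => if bit s (SOME r. r \<in> instr_regs (P ! pc)) then (4 * pc + 2, s, Stay, Stay, [])
       else if bit s (k + 1) then (4 * pc + 1, s, Stay, Right, []) else (4 * pc + 3, s, Stay, Stay, []))"
 using phase_div[of 1 pc] by (cases "P ! pc") (simp_all add: delta_def Let_def)

lemma delta_2: "pc < length P ==>
  delta P k (4 * pc + 2) a s = (if \<not> bit s k then Some (4 * pc + 2, s, Stay, Left, [])
    else Some (4 * (pc + 1), s, Stay, Stay, []))"
 using phase_div[of 2 pc] by (cases "P ! pc") (simp_all add: delta_def Let_def)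

lemma delta_3: "pc < length P ==>
  delta P k (4 * pc + 3) a s = (if \<not> bit s k then Some (4 * pc + 3, s, Stay, Left, [])
    else Some (4 * (case P ! pc of IJz r t => t | _ => 0), s, Stay, Stay, []))"
 using phase_div[of 3 pc] by (cases "P ! pc") (simp_all add: delta_def Let_def)

definition machine :: "instr list => nat => turing_machine" where
 "machine P k = \<lparr>tm_states = 4 * (length P + 1), tm_symbols = 2 ^ (k + 2), tm_delta = delta P k\<rparr>"

lemma set_bit_less: "s < 2 ^ K ==> r < K ==> set_bit r s < (2 ^ K :: nat)"
 unfolding take_bit_nat_eq_self_iff[symmetric]
 by (rule bit_eqI) (metis bit_set_bit_iff bit_take_bit_iff)

lemma unset_bit_less: "s < 2 ^ K ==> unset_bit r s < (2 ^ K :: nat)"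
 unfolding take_bit_nat_eq_self_iff[symmetric]
 by (rule bit_eqI) (metis bit_unset_bit_iff bit_take_bit_iff)

lemma delta_bounds:
 assumes "P ! pc = i" "pc < length P" "!!r. r \<in> instr_regs i ==> r < k"
  "!!t. t \<in> instr_targets i ==> t <= length P" "s < K" "K = 2 ^ (k + 2)" "ph < 4"
 shows "case delta P k (4 * pc + ph) a s of None => True
   | Some (q', s', _) => q' < 4 * (length P + 1) \<and> s' < K"
proof -
 obtain k' where k': "K = 2 ^ k'" "k < k'" "Suc k < k'" by (rule that[of "k + 2"]) (simp_all add: assms(6))
 have sb: "set_bit k s < K" "set_bit (k + 1) (set_bit r s) < K" "set_bit (k + 1) (unset_bit r s) < K" if "r < k" for r
  using assms(5) that k' by (auto intro!: set_bit_less unset_bit_less)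
 have sb': "set_bit k s < K" using assms(5) k' by (auto intro!: set_bit_less)
 have dm: "(4 * pc + ph) div 4 = pc" "(4 * pc + ph) mod 4 = ph" using assms(7) by auto
 consider "ph = 0" | "ph = 1" | "ph = 2" | "ph = 3" using assms(7) by linarith
 then show ?thesis
  using assms(1-5) dm sb sb'
  by cases (cases i; simp add: delta_def Let_def del: set_bit_Suc unset_bit_Suc bit_Suc add_Suc_right Suc_eq_plus1_left)+
qed

lemma wf_machine:
 assumes "!!i r. i \<in> set P ==> r \<in> instr_regs i ==> r < k"
  and "!!i t. i \<in> set P ==> t \<in> instr_targets i ==> t <= length P"
 shows "wf_tm (machine P k)"
proof -
 have bounds: "case delta P k q a s of None => True
   | Some (q', s', _) => q' < 4 * (length P + 1) \<and> s' < 2 ^ (k + 2)"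
  if q: "q < 4 * (length P + 1)" and s: "s < 2 ^ (k + 2)" for q a s
 proof -
  obtain pc ph where q_eq: "q = 4 * pc + ph" "ph < 4"
   by (metis mod_less_divisor mult_div_mod_eq zero_less_numeral)
  show ?thesis
  proof (cases "pc < length P")
   case True
   then show ?thesis
    unfolding q_eq(1) using assms nth_mem[OF True] q_eq(2) s
    by (intro delta_bounds[OF refl True]) blast+
  qed (use q_eq in "auto simp: delta_def")
 qed
 then show ?thesis
  unfolding wf_tm_def machine_def turing_machine.select_convs
  by (intro conjI allI impI bounds; assumption?) simp_all
qed

text \<open>Here \<open>h\<close> is the number of visited cells. The mark \<open>k\<close> is only
  forbidden to the right of the leftmost cell and not demanded in it: the start of every register
  instruction sets it, so the blank tape is a valid representation too.\<close>

definition tape :: "nat => nat => env => (nat => nat) => bool" where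
 "tape k h s f \<longleftrightarrow> (\<forall>j. \<forall>r<k. bit (f j) r = bit (s r) j) \<and> (\<forall>j. bit (f j) (k + 1) = (j < h)) \<and>
   (\<forall>j>0. \<not> bit (f j) k) \<and> (\<forall>r<k. s r < 2 ^ h)"

lemma tape_mark: "tape k h s f ==> tape k h s (f(0 := set_bit k (f 0)))"
 by (auto simp: tape_def bit_set_bit_iff)

lemma tape_set:
 assumes "tape k h s f" "r < k" "j <= h"
 shows "tape k (max h (Suc j)) (s(r := set_bit j (s r))) (f(j := set_bit (k + 1) (set_bit r (f j))))"
proof -
 have "s r' < 2 ^ max h (Suc j)" if "r' < k" for r'
  using assms that unfolding tape_def
  by (meson less_le_trans max.cobounded1 one_le_numeral power_increasing)
 moreover have "set_bit j (s r) < 2 ^ max h (Suc j)"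
  using calculation assms(2) by (intro set_bit_less) auto
 ultimately show ?thesis
  using assms by (auto simp: tape_def bit_set_bit_iff)
qed

lemma tape_unset:
 assumes "tape k h s f" "r < k" "j < h"
 shows "tape k h (s(r := unset_bit j (s r))) (f(j := set_bit (k + 1) (unset_bit r (f j))))"
 using assms by (auto simp: tape_def bit_set_bit_iff bit_unset_bit_iff unset_bit_less)

lemma bit_imp_less: "x < 2 ^ h ==> bit (x :: nat) j ==> j < h"
 by (metis bit_take_bit_iff take_bit_nat_eq_self_iff)

lemma set_bit_nat_eq: "\<not> bit x j ==> set_bit j x = x + (2 ^ j :: nat)"
 by (simp add: set_bit_eq)

lemma unset_bit_nat_eq: "bit x j ==> unset_bit j x + (2 ^ j :: nat) = x"
proof -
 assume "bit x j"
 moreover have "\<not> bit (unset_bit j x) j" by (simp add: bit_unset_bit_iff)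
 moreover have "set_bit j (unset_bit j x) = x"
  using \<open>bit x j\<close> by (intro bit_eqI) (auto simp: bit_set_bit_iff bit_unset_bit_iff)
 ultimately show ?thesis using set_bit_nat_eq[of "unset_bit j x" j] by simp
qed

locale counter_machine =
 fixes P :: "instr list" and k L :: nat and w :: "bool list"
 assumes regs: "!!i r. i \<in> set P ==> r \<in> instr_regs i ==> r < k"
begin

abbreviation "step \<equiv> tm_step (machine P k) w"

definition reach :: "config => config => bool" where
 "reach = (\<lambda>c c'. c' = step c \<and> cf_work_pos c' <= L)\<^sup>*\<^sup>*"

definition cfg :: "nat => nat => (nat => nat) => nat => bool list => config" where
 "cfg q ip f j v = \<lparr>cf_state = q, cf_input_pos = ip, cf_work = f, cf_work_pos = j, cf_output = v\<rparr>"

lemma cfg_pos: "cf_work_pos (cfg q ip f j v) = j"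
 by (simp add: cfg_def)

lemma step_cfg:
 "step (cfg q ip f j v) = (case delta P k q (input_at w ip) (f j) of
   None => cfg q ip f j v
  | Some (q', s', di, dw, u) =>
    cfg q' (min (move di ip) (length w + 1)) (f(j := s')) (move dw j) (v @ u))"
 by (auto simp: tm_step_def tm_action_def machine_def cfg_def split: option.split)

lemma reach_refl: "reach c c"
 by (simp add: reach_def)

lemma reach_trans [trans]: "reach a b ==> reach b c ==> reach a c"
 unfolding reach_def by (rule rtranclp_trans)

lemma reach_step:
 assumes "delta P k q (input_at w ip) (f j) = Some (q', s', di, dw, u)" "ip <= length w + 1" "move dw j <= L"
 shows "reach (cfg q ip f j v) (cfg q' (min (move di ip) (length w + 1)) (f(j := s')) (move dw j) (v @ u))"
 unfolding reach_def by (rule r_into_rtranclp) (use assms in "simp add: step_cfg cfg_pos")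

lemma return_next:
 assumes "ip <= length w + 1" "j <= L" "pc < length P" "bit (f 0) k" "\<forall>j>0. \<not> bit (f j) k"
 shows "reach (cfg (4 * pc + 2) ip f j v) (cfg (4 * (pc + 1)) ip f 0 v)"
 using assms(2)
proof (induction j)
 case 0
 have "delta P k (4 * pc + 2) (input_at w ip) (f 0) = Some (4 * (pc + 1), f 0, Stay, Stay, [])"
  by (subst delta_2) (use assms in auto)
 from reach_step[where f = f and j = 0, OF this, of v] show ?case using assms by auto
next
 case (Suc j)
 have "delta P k (4 * pc + 2) (input_at w ip) (f (Suc j)) = Some (4 * pc + 2, f (Suc j), Stay, Left, [])"
  by (subst delta_2) (use assms in auto)
 from reach_step[where f = f and j = "(Suc j)", OF this, of v] have "reach (cfg (4 * pc + 2) ip f (Suc j) v) (cfg (4 * pc + 2) ip f j v)"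
  using assms Suc.prems by auto
 also note Suc.IH
 finally show ?case using Suc.prems by auto
qed

lemma return_jump:
 assumes "ip <= length w + 1" "j <= L" "pc < length P" "bit (f 0) k" "\<forall>j>0. \<not> bit (f j) k" "P ! pc = IJz r t"
 shows "reach (cfg (4 * pc + 3) ip f j v) (cfg (4 * t) ip f 0 v)"
 using assms(2)
proof (induction j)
 case 0
 have "delta P k (4 * pc + 3) (input_at w ip) (f 0) = Some (4 * t, f 0, Stay, Stay, [])"
  by (subst delta_3) (use assms in auto)
 from reach_step[where f = f and j = 0, OF this, of v] show ?case using assms by auto
next
 case (Suc j)
 have "delta P k (4 * pc + 3) (input_at w ip) (f (Suc j)) = Some (4 * pc + 3, f (Suc j), Stay, Left, [])"
  by (subst delta_3) (use assms in auto)
 from reach_step[where f = f and j = "(Suc j)", OF this, of v] have "reach (cfg (4 * pc + 3) ip f (Suc j) v) (cfg (4 * pc + 3) ip f j v)"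
  using assms Suc.prems by auto
 also note Suc.IH
 finally show ?case using Suc.prems by auto
qed

definition rep :: "iconfig => config => bool" where
 "rep = (\<lambda>(pc, s, ip, v) c. \<exists>h f. h <= L \<and> tape k h s f \<and> ip <= length w + 1 \<and> c = cfg (4 * pc) ip f 0 v)"

text \<open>Generalised from adding 1 to adding \<open>2 ^ j\<close> with the head on cell
  \<open>j\<close>: clearing a digit 1 turns the task into adding \<open>2 ^ Suc j\<close> one cell
  further right. The space bound stops the carry before cell \<open>L\<close>.\<close>

lemma inc_loop:
 assumes "pc < length P" "P ! pc = IInc r" "r < k" "ip <= length w + 1"
  and "tape k h s f" "bit (f 0) k" "j <= h" "h <= L" "s r + 2 ^ j < 2 ^ L"
 shows "\<exists>h f'. h <= L \<and> tape k h (s(r := s r + 2 ^ j)) f' \<and> bit (f' 0) k \<and>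
   reach (cfg (4 * pc + 1) ip f j v) (cfg (4 * (pc + 1)) ip f' 0 v)"
 using assms(5-)
proof (induction "L - j" arbitrary: j h s f rule: less_induct)
 case less
 have "(2::nat) ^ j < 2 ^ L" using less.prems(5) by linarith
 then have jL: "j < L" by simp
 have bit_eq: "bit (f j) r = bit (s r) j" using less.prems(1) assms(3) by (auto simp: tape_def)
 show ?case
 proof (cases "bit (s r) j")
  case True
  have jh: "j < h" using True less.prems(1) assms(3) bit_imp_less[of "s r" h j] by (auto simp: tape_def)
  define s' where "s' = s(r := unset_bit j (s r))"
  define f' where "f' = f(j := set_bit (k + 1) (unset_bit r (f j)))"
  have sr: "s' r + 2 ^ j = s r" using unset_bit_nat_eq[OF True] by (simp add: s'_def)
  have t: "tape k h s' f'"
   unfolding s'_def f'_def by (rule tape_unset) (use less.prems assms jh in auto)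
  have "delta P k (4 * pc + 1) (input_at w ip) (f j)
    = Some (4 * pc + 1, set_bit (k + 1) (unset_bit r (f j)), Stay, Right, [])"
   by (subst delta_1) (use assms True bit_eq in auto)
  from reach_step[where f = f and j = j, OF this, of v]
  have "reach (cfg (4 * pc + 1) ip f j v) (cfg (4 * pc + 1) ip f' (Suc j) v)"
   using assms jL by (auto simp: f'_def)
  moreover have "\<exists>h f''. h <= L \<and> tape k h (s'(r := s' r + 2 ^ Suc j)) f'' \<and> bit (f'' 0) k \<and>
    reach (cfg (4 * pc + 1) ip f' (Suc j) v) (cfg (4 * (pc + 1)) ip f'' 0 v)"
   by (rule less.hyps[OF _ t])
    (use less.prems assms jL jh sr in "auto simp: f'_def bit_set_bit_iff bit_unset_bit_iff")
  moreover have "s'(r := s' r + 2 ^ Suc j) = s(r := s r + 2 ^ j)"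
   using sr by (auto simp: s'_def)
  ultimately show ?thesis by (metis reach_trans)
 next
  case False
  define f' where "f' = f(j := set_bit (k + 1) (set_bit r (f j)))"
  have t: "tape k (max h (Suc j)) (s(r := s r + 2 ^ j)) f'"
   using tape_set[OF less.prems(1) assms(3) less.prems(3)] set_bit_nat_eq[OF False]
   by (simp add: f'_def)
  have "delta P k (4 * pc + 1) (input_at w ip) (f j)
    = Some (4 * pc + 2, set_bit (k + 1) (set_bit r (f j)), Stay, Stay, [])"
   by (subst delta_1) (use assms False bit_eq in auto)
  from reach_step[where f = f and j = j, OF this, of v]
  have "reach (cfg (4 * pc + 1) ip f j v) (cfg (4 * pc + 2) ip f' j v)"
   using assms jL by (auto simp: f'_def)
  also have "reach (cfg (4 * pc + 2) ip f' j v) (cfg (4 * (pc + 1)) ip f' 0 v)"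
   by (rule return_next) (use less.prems assms jL t in "auto simp: tape_def f'_def bit_set_bit_iff")
  finally show ?thesis
   using t jL less.prems
   by (intro exI[of _ "max h (Suc j)"] exI[of _ f']) (auto simp: f'_def bit_set_bit_iff)
 qed
qed

text \<open>The mirror image of incrementing: setting a digit 0 adds \<open>2 ^ j\<close>, which
  leaves \<open>2 ^ Suc j\<close> to be subtracted. The borrow ends inside the visited cells because
  the register is at least \<open>2 ^ j\<close>.\<close>

lemma dec_loop:
 assumes "pc < length P" "P ! pc = IDec r" "r < k" "ip <= length w + 1"
  and "tape k h s f" "bit (f 0) k" "h <= L" "2 ^ j <= s r"
 shows "\<exists>h f'. h <= L \<and> tape k h (s(r := s r - 2 ^ j)) f' \<and> bit (f' 0) k \<and>
   reach (cfg (4 * pc + 1) ip f j v) (cfg (4 * (pc + 1)) ip f' 0 v)"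
 using assms(5-)
proof (induction "h - j" arbitrary: j s f rule: less_induct)
 case less
 have "s r < 2 ^ h" using less.prems(1) assms(3) by (auto simp: tape_def)
 then have "(2::nat) ^ j < 2 ^ h" using less.prems(4) by (rule le_less_trans[rotated])
 then have jh: "j < h" by simp
 have bit_eq: "bit (f j) r = bit (s r) j" using less.prems(1) assms(3) by (auto simp: tape_def)
 show ?case
 proof (cases "bit (s r) j")
  case False
  define s' where "s' = s(r := set_bit j (s r))"
  define f' where "f' = f(j := set_bit (k + 1) (set_bit r (f j)))"
  have sr: "s' r = s r + 2 ^ j" using set_bit_nat_eq[OF False] by (simp add: s'_def)
  have t: "tape k h s' f'"
   using tape_set[OF less.prems(1) assms(3), of j] jh
   by (simp add: max_absorb1 Suc_le_eq s'_def f'_def)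
  have "delta P k (4 * pc + 1) (input_at w ip) (f j)
    = Some (4 * pc + 1, set_bit (k + 1) (set_bit r (f j)), Stay, Right, [])"
   by (subst delta_1) (use assms False bit_eq in auto)
  from reach_step[where f = f and j = j, OF this, of v]
  have "reach (cfg (4 * pc + 1) ip f j v) (cfg (4 * pc + 1) ip f' (Suc j) v)"
   using assms jh less.prems by (auto simp: f'_def)
  moreover have "\<exists>h f''. h <= L \<and> tape k h (s'(r := s' r - 2 ^ Suc j)) f'' \<and> bit (f'' 0) k \<and>
    reach (cfg (4 * pc + 1) ip f' (Suc j) v) (cfg (4 * (pc + 1)) ip f'' 0 v)"
   by (rule less.hyps[OF _ t])
    (use less.prems assms jh sr in "auto simp: f'_def bit_set_bit_iff")
  moreover have "s'(r := s' r - 2 ^ Suc j) = s(r := s r - 2 ^ j)"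
   using sr by (auto simp: s'_def)
  ultimately show ?thesis by (metis reach_trans)
 next
  case True
  define f' where "f' = f(j := set_bit (k + 1) (unset_bit r (f j)))"
  have "unset_bit j (s r) = s r - 2 ^ j"
   using unset_bit_nat_eq[OF True] by linarith
  then have t: "tape k h (s(r := s r - 2 ^ j)) f'"
   using tape_unset[OF less.prems(1) assms(3) jh] by (simp add: f'_def)
  have "delta P k (4 * pc + 1) (input_at w ip) (f j)
    = Some (4 * pc + 2, set_bit (k + 1) (unset_bit r (f j)), Stay, Stay, [])"
   by (subst delta_1) (use assms True bit_eq in auto)
  from reach_step[where f = f and j = j, OF this, of v]
  have "reach (cfg (4 * pc + 1) ip f j v) (cfg (4 * pc + 2) ip f' j v)"
   using assms jh less.prems by (auto simp: f'_def)
  also have "reach (cfg (4 * pc + 2) ip f' j v) (cfg (4 * (pc + 1)) ip f' 0 v)"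
   by (rule return_next)
    (use less.prems assms jh t in "auto simp: tape_def f'_def bit_set_bit_iff bit_unset_bit_iff")
  finally show ?thesis
   using t jh less.prems assms(3)
   by (intro exI[of _ h] exI[of _ f']) (auto simp: f'_def bit_set_bit_iff bit_unset_bit_iff)
 qed
qed

text \<open>All digits beyond the visited cells are 0, so reaching an unvisited cell without having
  met a digit 1 proves that the register is zero.\<close>

lemma test_loop:
 assumes "pc < length P" "P ! pc = IJz r t" "r < k" "ip <= length w + 1"
  and "tape k h s f" "bit (f 0) k" "h <= L" "j <= h" "\<forall>i<j. \<not> bit (s r) i"
 shows "reach (cfg (4 * pc + 1) ip f j v) (cfg (4 * (if s r = 0 then t else pc + 1)) ip f 0 v)"
 using assms(8-)
proof (induction "h - j" arbitrary: j)
 case 0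
 then have "j = h" by simp
 have sr: "\<not> bit (s r) i" for i
  using 0 assms(3,5) bit_imp_less[of "s r" h i] \<open>j = h\<close> by (auto simp: tape_def)
 then have z: "s r = 0" by (intro bit_eqI) auto
 have "\<not> bit (f h) (k + 1)" "\<not> bit (f h) r"
  using assms(3,5) sr by (auto simp: tape_def)
 then have "delta P k (4 * pc + 1) (input_at w ip) (f j) = Some (4 * pc + 3, f j, Stay, Stay, [])"
  by (subst delta_1) (use assms \<open>j = h\<close> in auto)
 from reach_step[where f = f and j = j, OF this, of v] have "reach (cfg (4 * pc + 1) ip f j v) (cfg (4 * pc + 3) ip f j v)"
  using assms 0 by auto
 also have "reach (cfg (4 * pc + 3) ip f j v) (cfg (4 * t) ip f 0 v)"
  by (rule return_jump) (use assms \<open>j = h\<close> in "auto simp: tape_def")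
 finally show ?case using z by simp
next
 case (Suc d)
 then have jh: "j < h" by simp
 have bit_eq: "bit (f j) r = bit (s r) j" using assms by (auto simp: tape_def)
 show ?case
 proof (cases "bit (s r) j")
  case True
  then have nz: "s r ~= 0" by (metis bit_0_eq bot_apply bot_bool_def)
  have "delta P k (4 * pc + 1) (input_at w ip) (f j) = Some (4 * pc + 2, f j, Stay, Stay, [])"
   by (subst delta_1) (use assms True bit_eq in auto)
  from reach_step[where f = f and j = j, OF this, of v] have "reach (cfg (4 * pc + 1) ip f j v) (cfg (4 * pc + 2) ip f j v)"
   using assms jh by auto
  also have "reach (cfg (4 * pc + 2) ip f j v) (cfg (4 * (pc + 1)) ip f 0 v)"
   by (rule return_next) (use assms jh in "auto simp: tape_def")
  finally show ?thesis using nz by simp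
 next
  case False
  have "bit (f j) (k + 1)" using assms(5) jh by (auto simp: tape_def)
  then have "delta P k (4 * pc + 1) (input_at w ip) (f j) = Some (4 * pc + 1, f j, Stay, Right, [])"
   by (subst delta_1) (use assms False bit_eq in auto)
  from reach_step[where f = f and j = j, OF this, of v] have "reach (cfg (4 * pc + 1) ip f j v) (cfg (4 * pc + 1) ip f (Suc j) v)"
   using assms jh by auto
  also have "reach (cfg (4 * pc + 1) ip f (Suc j) v) (cfg (4 * (if s r = 0 then t else pc + 1)) ip f 0 v)"
   by (rule Suc.hyps(1)) (use Suc jh False in "auto simp: less_Suc_eq")
  finally show ?thesis .
 qed
qed

lemma start_loop:
 assumes "pc < length P" "instr_regs (P ! pc) ~= {}" "ip <= length w + 1"
 shows "reach (cfg (4 * pc) ip f 0 v) (cfg (4 * pc + 1) ip (f(0 := set_bit k (f 0))) 0 v)"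
proof -
 have "delta P k (4 * pc) (input_at w ip) (f 0) = Some (4 * pc + 1, set_bit k (f 0), Stay, Stay, [])"
  using assms by (cases "P ! pc") (auto simp: delta_def)
 from reach_step[where f = f and j = 0, OF this, of v] show ?thesis using assms by auto
qed

lemma simulate_step:
 assumes "istep (2 ^ L) w P x y" "rep x c"
 shows "\<exists>c'. reach c c' \<and> rep y c'"
 using assms(1)
proof cases
 case (1 pc r s ip out)
 have "r < k" using regs[of "P ! pc" r] 1 nth_mem[of pc P] by auto
 obtain h f where hf: "h <= L" "tape k h s f" "ip <= length w + 1" "c = cfg (4 * pc) ip f 0 out"
  using assms(2) 1 by (auto simp: rep_def)
 obtain h' f' where f': "h' <= L" "tape k h' (s(r := s r + 2 ^ 0)) f'"
   "reach (cfg (4 * pc + 1) ip (f(0 := set_bit k (f 0))) 0 out) (cfg (4 * (pc + 1)) ip f' 0 out)"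
  using inc_loop[OF _ _ \<open>r < k\<close> hf(3) tape_mark[OF hf(2)], of pc 0 out] 1 hf
  by (auto simp: bit_set_bit_iff)
 with start_loop[of pc ip f out] 1 hf show ?thesis
  by (intro exI[of _ "cfg (4 * (pc + 1)) ip f' 0 out"]) (auto simp: rep_def intro: reach_trans)
next
 case (2 pc r s ip out)
 have "r < k" using regs[of "P ! pc" r] 2 nth_mem[of pc P] by auto
 obtain h f where hf: "h <= L" "tape k h s f" "ip <= length w + 1" "c = cfg (4 * pc) ip f 0 out"
  using assms(2) 2 by (auto simp: rep_def)
 obtain h' f' where f': "h' <= L" "tape k h' (s(r := s r - 2 ^ 0)) f'"
   "reach (cfg (4 * pc + 1) ip (f(0 := set_bit k (f 0))) 0 out) (cfg (4 * (pc + 1)) ip f' 0 out)"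
  using dec_loop[OF _ _ \<open>r < k\<close> hf(3) tape_mark[OF hf(2)], of pc 0 out] 2 hf
  by (auto simp: bit_set_bit_iff)
 with start_loop[of pc ip f out] 2 hf show ?thesis
  by (intro exI[of _ "cfg (4 * (pc + 1)) ip f' 0 out"]) (auto simp: rep_def intro: reach_trans)
next
 case (4 pc r a s ip out)
 have "r < k" using regs[of "P ! pc" r] 4 nth_mem[of pc P] by auto
 obtain h f where hf: "h <= L" "tape k h s f" "ip <= length w + 1" "c = cfg (4 * pc) ip f 0 out"
  using assms(2) 4 by (auto simp: rep_def)
 let ?f = "f(0 := set_bit k (f 0))"
 have "reach (cfg (4 * pc + 1) ip ?f 0 out) (cfg (4 * (if s r = 0 then a else pc + 1)) ip ?f 0 out)"
  by (rule test_loop[OF _ _ \<open>r < k\<close> hf(3) tape_mark[OF hf(2)]])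
    (use 4 hf in "auto simp: bit_set_bit_iff")
 with start_loop[of pc ip f out] 4 hf tape_mark[OF hf(2)] show ?thesis
  by (intro exI[of _ "cfg (4 * (if s r = 0 then a else pc + 1)) ip ?f 0 out"])
    (auto simp: rep_def intro: reach_trans)
next
 case (3 pc bs s ip out)
 obtain h f where hf: "h <= L" "tape k h s f" "ip <= length w + 1" "c = cfg (4 * pc) ip f 0 out"
  using assms(2) 3 by (auto simp: rep_def)
 have "delta P k (4 * pc) (input_at w ip) (f 0) = Some (4 * (pc + 1), f 0, Stay, Stay, bs)"
  by (subst delta_0) (use 3 in auto)
 from reach_step[where f = f and j = 0, OF this, of out] hf 3 show ?thesis
  by (intro exI[of _ "cfg (4 * (pc + 1)) ip f 0 (out @ bs)"]) (auto simp: rep_def)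
next
 case (5 pc a s ip out)
 obtain h f where hf: "h <= L" "tape k h s f" "ip <= length w + 1" "c = cfg (4 * pc) ip f 0 out"
  using assms(2) 5 by (auto simp: rep_def)
 have "delta P k (4 * pc) (input_at w ip) (f 0) = Some (4 * a, f 0, Stay, Stay, [])"
  by (subst delta_0) (use 5 in auto)
 from reach_step[where f = f and j = 0, OF this, of out] hf 5 show ?thesis
  by (intro exI[of _ "cfg (4 * a) ip f 0 out"]) (auto simp: rep_def)
next
 case (6 pc s ip out)
 obtain h f where hf: "h <= L" "tape k h s f" "ip <= length w + 1" "c = cfg (4 * pc) ip f 0 out"
  using assms(2) 6 by (auto simp: rep_def)
 have "delta P k (4 * pc) (input_at w ip) (f 0) = Some (4 * (pc + 1), f 0, Right, Stay, [])"
  by (subst delta_0) (use 6 in auto)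
 from reach_step[where f = f and j = 0, OF this, of out] hf 6 show ?thesis
  by (intro exI[of _ "cfg (4 * (pc + 1)) (min (ip + 1) (length w + 1)) f 0 out"]) (auto simp: rep_def)
next
 case (7 pc a s ip out)
 obtain h f where hf: "h <= L" "tape k h s f" "ip <= length w + 1" "c = cfg (4 * pc) ip f 0 out"
  using assms(2) 7 by (auto simp: rep_def)
 let ?a = "if input_at w ip = Letter True then pc + 1 else a"
 have "delta P k (4 * pc) (input_at w ip) (f 0) = Some (4 * ?a, f 0, Stay, Stay, [])"
  by (subst delta_0) (use 7 in auto)
 from reach_step[where f = f and j = 0, OF this, of out] hf 7 show ?thesis
  by (intro exI[of _ "cfg (4 * ?a) ip f 0 out"]) (auto simp: rep_def)
qed

lemma simulate:
 assumes "(istep (2 ^ L) w P)\<^sup>*\<^sup>* x y" "rep x c"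
 shows "\<exists>c'. reach c c' \<and> rep y c'"
 using assms
proof (induction rule: rtranclp_induct)
 case base
 then show ?case using reach_refl by auto
next
 case (step y z)
 then show ?case using simulate_step reach_trans by meson
qed

lemma reach_funpow:
 assumes "reach c c'" "cf_work_pos c <= L"
 shows "\<exists>t. (step ^^ t) c = c' \<and> (\<forall>t'\<le>t. cf_work_pos ((step ^^ t') c) <= L)"
 using assms(1) unfolding reach_def
proof (induction rule: rtranclp_induct)
 case base
 show ?case by (rule exI[of _ 0]) (use assms(2) in auto)
next
 case (step y z)
 then obtain t where t: "(step ^^ t) c = y" "\<forall>t'\<le>t. cf_work_pos ((step ^^ t') c) <= L" by auto
 then show ?case using step by (intro exI[of _ "Suc t"]) (auto simp: le_Suc_eq)
qed

lemma computes:
 assumes "(istep (2 ^ L) w P)\<^sup>*\<^sup>* (0, \<lambda>_. 0, 0, []) (length P, s, ip, v)" "real (L + 1) <= S"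
 shows "tm_computes (machine P k) w v S"
proof -
 have init: "init_config = cfg 0 0 (\<lambda>_. 0) 0 []" by (simp add: init_config_def cfg_def)
 have "rep (0, \<lambda>_. 0, 0, []) init_config"
  by (auto simp: rep_def init tape_def intro!: exI[of _ 0] exI[of _ "\<lambda>_. 0"])
 from simulate[OF assms(1) this] obtain c' where c': "reach init_config c'" "rep (length P, s, ip, v) c'"
  by auto
 obtain t where t: "(step ^^ t) init_config = c'" "\<forall>t'\<le>t. cf_work_pos ((step ^^ t') init_config) <= L"
  using reach_funpow[OF c'(1)] by (auto simp: init_config_def)
 have "tm_action (machine P k) w c' = None" "cf_output c' = v"
  using c'(2) by (auto simp: rep_def cfg_def tm_action_def machine_def delta_def)
 then show ?thesis
  unfolding tm_computes_def using t assms(2) by (intro exI[of _ t]) force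
qed

end


text \<open>Each of the two loops counts the letters \<open>True\<close> of one unary block, into
  register 0 and register 1; the separator and the right end marker end them. The head is advanced
  before reading because it starts on the left end marker.\<close>

definition load_input :: "instr list" where
 "load_input = [IMove, IJnt 4, IInc 0, IJmp 0, IMove, IJnt 8, IInc 1, IJmp 4]"

definition program :: "com => instr list" where
 "program c = load_input @ compile 8 c"

lemma input_at_size_word:
 "i <= n ==> input_at (size_word n m) (Suc i) = Letter (i < n)"
 "i <= m ==> input_at (size_word n m) (n + 2 + i) = (if i < m then Letter True else Right_End)"
 by (auto simp: input_at_def size_word_def nth_append nth_Cons' split: if_splits)

lemma length_size_word: "length (size_word n m) = n + m + 1"
 by (simp add: size_word_def)

lemma load_n:
 assumes "n < B" "i <= n"
 shows "(istep B (size_word n m) (program c))\<^sup>*\<^sup>* (0, (\<lambda>_. 0)(0 := n - i), n - i, [])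
   (4, (\<lambda>_. 0)(0 := n), n + 1, [])"
 using assms(2)
proof (induction i)
 case 0
 let ?P = "program c" and ?w = "size_word n m"
 have P: "length ?P > 7" "?P ! 0 = IMove" "?P ! 1 = IJnt 4"
  by (auto simp: program_def load_input_def)
 have "(istep B ?w ?P)\<^sup>*\<^sup>* (0, (\<lambda>_. 0)(0 := n), n, []) (0 + 1, (\<lambda>_. 0)(0 := n), min (n + 1) (length ?w + 1), [])"
  by (rule r_into_rtranclp, rule istep.intros(6)) (use P in auto)
 also have "min (n + 1) (length ?w + 1) = n + 1" by (simp add: length_size_word)
 also have "istep B ?w ?P (0 + 1, (\<lambda>_. 0)(0 := n), n + 1, [])
   (if input_at ?w (n + 1) = Letter True then (0 + 1) + 1 else 4, (\<lambda>_. 0)(0 := n), n + 1, [])"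
  by (rule istep.intros(7)) (use P in auto)
 finally show ?case using input_at_size_word(1)[of n n m] by (simp add: fun_upd_def)
next
 case (Suc i)
 let ?P = "program c" and ?w = "size_word n m"
 let ?s = "(\<lambda>_ :: nat. 0)(0 := n - Suc i)"
 have P: "length ?P > 7" "?P ! 0 = IMove" "?P ! 1 = IJnt 4" "?P ! 2 = IInc 0" "?P ! 3 = IJmp 0"
  by (auto simp: program_def load_input_def)
 have "(istep B ?w ?P)\<^sup>*\<^sup>* (0, ?s, n - Suc i, []) (0 + 1, ?s, min (n - Suc i + 1) (length ?w + 1), [])"
  by (rule r_into_rtranclp, rule istep.intros(6)) (use P in auto)
 also have "min (n - Suc i + 1) (length ?w + 1) = n - i" using Suc.prems by (simp add: length_size_word)
 also have "istep B ?w ?P (0 + 1, ?s, n - i, [])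
   (if input_at ?w (n - i) = Letter True then (0 + 1) + 1 else 4, ?s, n - i, [])"
  by (rule istep.intros(7)) (use P in auto)
 also have "(if input_at ?w (n - i) = Letter True then (0 + 1) + 1 else 4) = (2::nat)"
  using input_at_size_word(1)[of "n - Suc i" n m] Suc.prems by (simp add: Suc_diff_Suc)
 also have "istep B ?w ?P (2, ?s, n - i, []) (2 + 1, (\<lambda>_. 0)(0 := n - i), n - i, [])"
 proof -
  have "istep B ?w ?P (2, ?s, n - i, []) (2 + 1, ?s(0 := ?s 0 + 1), n - i, [])"
   by (rule istep.intros(1)) (use P Suc.prems assms in auto)
  moreover have "?s(0 := ?s 0 + 1) = (\<lambda>_. 0)(0 := n - i)"
   using Suc.prems by (simp add: Suc_diff_Suc)
  ultimately show ?thesis by (simp only:)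
 qed
 also have "istep B ?w ?P (2 + 1, (\<lambda>_. 0)(0 := n - i), n - i, []) (0, (\<lambda>_. 0)(0 := n - i), n - i, [])"
  by (rule istep.intros(5)) (use P in auto)
 also note Suc.IH
 finally show ?case using Suc.prems by simp
qed

definition loaded :: "nat => nat => env" where
 "loaded n m = (\<lambda>_. 0)(0 := n, 1 := m)"

lemma load_m:
 assumes "m < B" "i <= m"
 shows "(istep B (size_word n m) (program c))\<^sup>*\<^sup>* (4, loaded n (m - i), n + 1 + (m - i), [])
   (8, loaded n m, n + m + 2, [])"
 using assms(2)
proof (induction i)
 case 0
 let ?P = "program c" and ?w = "size_word n m" and ?s = "loaded n m"
 have P: "length ?P > 7" "?P ! 4 = IMove" "?P ! 5 = IJnt 8"
  by (auto simp: program_def load_input_def)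
 have "(istep B ?w ?P)\<^sup>*\<^sup>* (4, ?s, n + 1 + m, []) (4 + 1, ?s, min (n + 1 + m + 1) (length ?w + 1), [])"
  by (rule r_into_rtranclp, rule istep.intros(6)) (use P in auto)
 also have "min (n + 1 + m + 1) (length ?w + 1) = n + 2 + m" by (simp add: length_size_word)
 also have "istep B ?w ?P (4 + 1, ?s, n + 2 + m, [])
   (if input_at ?w (n + 2 + m) = Letter True then (4 + 1) + 1 else 8, ?s, n + 2 + m, [])"
  by (rule istep.intros(7)) (use P in auto)
 also have "n + 2 + m = n + m + 2" by simp
 finally show ?case using input_at_size_word(2)[of m m n] by (simp add: ac_simps)
next
 case (Suc i)
 let ?P = "program c" and ?w = "size_word n m"
 let ?s = "loaded n (m - Suc i)"
 let ?p = "n + 2 + (m - Suc i)"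
 have P: "length ?P > 7" "?P ! 4 = IMove" "?P ! 5 = IJnt 8" "?P ! 6 = IInc 1" "?P ! 7 = IJmp 4"
  by (auto simp: program_def load_input_def)
 have "(istep B ?w ?P)\<^sup>*\<^sup>* (4, ?s, n + 1 + (m - Suc i), [])
   (4 + 1, ?s, min (n + 1 + (m - Suc i) + 1) (length ?w + 1), [])"
  by (rule r_into_rtranclp, rule istep.intros(6)) (use P in auto)
 also have "min (n + 1 + (m - Suc i) + 1) (length ?w + 1) = ?p" using Suc.prems by (simp add: length_size_word)
 also have "istep B ?w ?P (4 + 1, ?s, ?p, [])
   (if input_at ?w ?p = Letter True then (4 + 1) + 1 else 8, ?s, ?p, [])"
  by (rule istep.intros(7)) (use P in auto)
 also have "(if input_at ?w ?p = Letter True then (4 + 1) + 1 else 8) = (6::nat)"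
  using input_at_size_word(2)[of "m - Suc i" m n] Suc.prems by simp
 also have "istep B ?w ?P (6, ?s, ?p, []) (6 + 1, loaded n (m - i), ?p, [])"
 proof -
  have "istep B ?w ?P (6, ?s, ?p, []) (6 + 1, ?s(1 := ?s 1 + 1), ?p, [])"
   by (rule istep.intros(1)) (use P Suc.prems assms in "auto simp: loaded_def")
  moreover have "?s(1 := ?s 1 + 1) = loaded n (m - i)"
   by (rule ext) (use Suc.prems in "auto simp: loaded_def")
  ultimately show ?thesis by (simp only:)
 qed
 also have "istep B ?w ?P (6 + 1, loaded n (m - i), ?p, [])
   (4, loaded n (m - i), ?p, [])"
  by (rule istep.intros(5)) (use P in auto)
 also have "?p = n + 1 + (m - i)" using Suc.prems by simp
 also note Suc.IH
 finally show ?case using Suc.prems by simp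
qed

theorem com_computable:
 obtains M where "wf_tm M"
  and "!!n m L v s. exec (2 ^ L) c (loaded n m) v s ==> n < 2 ^ L ==> m < 2 ^ L ==>
      tm_computes M (size_word n m) v (real (L + 1))"
proof -
 let ?P = "program c"
 obtain k where k: "!!i r. i \<in> set ?P ==> r \<in> instr_regs i ==> r < k"
  using finite_nat_set_iff_bounded[of "\<Union>i \<in> set ?P. instr_regs i"] finite_instr_regs by blast
 have "t <= length ?P" if "i \<in> set ?P" "t \<in> instr_targets i" for i t
  using that compile_targets[of i 8 c t] by (auto simp: program_def load_input_def)
 then have "wf_tm (machine ?P k)" using k by (intro wf_machine) auto
 moreover have "tm_computes (machine ?P k) (size_word n m) v (real (L + 1))"
  if ex: "exec (2 ^ L) c (loaded n m) v s" and nm: "n < 2 ^ L" "m < 2 ^ L" for n m L v s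
 proof -
  interpret counter_machine ?P k L "size_word n m"
   by unfold_locales (rule k)
  define s0 s1 :: env where "s0 = (\<lambda>_. 0)" and "s1 = (\<lambda>_. 0)(0 := n)"
  have s: "(\<lambda>_. 0)(0 := n - n) = s0" "loaded n (m - m) = s1"
   by (auto simp: fun_eq_iff s0_def s1_def loaded_def)
  have "(istep (2 ^ L) (size_word n m) ?P)\<^sup>*\<^sup>* (0, s0, 0, []) (4, s1, n + 1, [])"
   using load_n[OF nm(1) order_refl, of m c] unfolding s s1_def[symmetric] by simp
  also have "(istep (2 ^ L) (size_word n m) ?P)\<^sup>*\<^sup>* (4, s1, n + 1, []) (8, loaded n m, n + m + 2, [])"
   using load_m[OF nm(2) order_refl, of n c] unfolding s by simp
  also have "(istep (2 ^ L) (size_word n m) ?P)\<^sup>*\<^sup>* (8, loaded n m, n + m + 2, [])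
    (length ?P, s, n + m + 2, [] @ v)"
  proof -
   have l: "length load_input = 8" by (simp add: load_input_def)
   then show ?thesis
    using compile_correct[OF ex, of ?P load_input "[]" "size_word n m" "n + m + 2" "[]"]
    by (simp only: program_def l length_append append_Nil2)
  qed
  finally show ?thesis using computes by (simp add: s0_def)
 qed
 ultimately show ?thesis using that by blast
qed

section \<open>Printing programs\<close>

text \<open>Prescribing the state before round \<open>i\<close> as \<open>S i\<close> replaces a
  loop invariant and also collects the output round by round.\<close>

lemma exec_While_count:
 assumes "!!i. i < n ==> exec B c (S i) (out i) (S (Suc i))" "!!i. i < n ==> 0 < S i r" "S n r = 0"
 shows "exec B (While r c) (S 0) (concat (map out [0..<n])) (S n)"
proof -
 have "exec B (While r c) (S (n - i)) (concat (map out [n - i..<n])) (S n)" if "i <= n" for i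
  using that
 proof (induction i)
  case 0
  then show ?case using assms(3) by (auto intro: exec_While_0)
 next
  case (Suc i)
  have "[n - Suc i..<n] = (n - Suc i) # [n - i..<n]"
   using Suc.prems by (subst upt_conv_Cons) (auto simp: Suc_diff_Suc)
  moreover have "exec B (While r c) (S (n - Suc i))
    (out (n - Suc i) @ concat (map out [n - i..<n])) (S n)"
   by (rule exec_While[of _ _ _ _ _ "S (n - i)"])
    (use Suc assms(1,2)[of "n - Suc i"] in "auto simp: Suc_diff_Suc")
  ultimately show ?case by simp
 qed
 from this[of n] show ?thesis by simp
qed

lemma exec_While_silent:
 assumes "!!i. i < n ==> exec B c (S i) [] (S (Suc i))" "!!i. i < n ==> 0 < S i r" "S n r = 0"
  "s = S 0" "s' = S n"
 shows "exec B (While r c) s [] s'"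
proof -
 have "concat (map (\<lambda>i. []) [0..<n]) = ([] :: bool list)" by (induction n) auto
 moreover have "exec B (While r c) (S 0) (concat (map (\<lambda>i. []) [0..<n])) (S n)"
  by (rule exec_While_count) (use assms in auto)
 ultimately show ?thesis by (simp only: assms(4,5))
qed

lemma exec_Seq_silent: "exec B c1 s1 [] s2 ==> exec B c2 s2 out s3 ==> exec B (c1 ;; c2) s1 out s3"
 using exec_Seq[of B c1 s1 "[]" s2 c2 out s3] by simp

lemma exec_Inc': "s r + 1 < B ==> s' = s(r := s r + 1) ==> exec B (Inc r) s [] s'"
 using exec_Inc by simp

lemma exec_Dec': "0 < s r ==> s' = s(r := s r - 1) ==> exec B (Dec r) s [] s'"
 using exec_Dec by simp

definition clear :: "nat => com" where
 "clear r = While r (Dec r)"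

lemma exec_clear: "s' = s(r := 0) ==> exec B (clear r) s [] s'"
 unfolding clear_def
 by (rule exec_While_silent[where n = "s r" and S = "\<lambda>i. s(r := s r - i)"])
  (auto intro!: exec_Dec')

text \<open>A counter can be read only by counting it down. The source is therefore moved to the
  destination and to a temporary register simultaneously, and restored from the latter.\<close>

definition add_to :: "nat => nat => nat => com" where
 "add_to r d t = While r (Dec r ;; Inc d ;; Inc t) ;; While t (Dec t ;; Inc r)"

lemma exec_add_to:
 assumes "s t = 0" "r ~= d" "r ~= t" "d ~= t" "s d + s r < B" "s' = s(d := s d + s r)"
 shows "exec B (add_to r d t) s [] s'"
proof -
 have "exec B (While r (Dec r ;; Inc d ;; Inc t)) s [] (s(r := 0, d := s d + s r, t := s r))"
 proof (rule exec_While_silent[where n = "s r" and S = "\<lambda>i. s(r := s r - i, d := s d + i, t := i)"])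
  fix i assume i: "i < s r"
  let ?S = "s(r := s r - i, d := s d + i, t := i)"
  have "exec B (Dec r) ?S [] (s(r := s r - Suc i, d := s d + i, t := i))"
   by (rule exec_Dec') (use i assms in auto)
  moreover have "exec B (Inc d) (s(r := s r - Suc i, d := s d + i, t := i)) []
    (s(r := s r - Suc i, d := s d + Suc i, t := i))"
   by (rule exec_Inc') (use i assms in auto)
  moreover have "exec B (Inc t) (s(r := s r - Suc i, d := s d + Suc i, t := i)) []
    (s(r := s r - Suc i, d := s d + Suc i, t := Suc i))"
   by (rule exec_Inc') (use i assms in auto)
  ultimately show "exec B (Dec r ;; Inc d ;; Inc t) ?S [] (s(r := s r - Suc i, d := s d + Suc i, t := Suc i))"
   by (intro exec_Seq_silent)
 qed (use assms in auto)
 moreover have "exec B (While t (Dec t ;; Inc r)) (s(r := 0, d := s d + s r, t := s r)) [] s'"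
 proof (rule exec_While_silent[where n = "s r" and S = "\<lambda>i. s(r := i, d := s d + s r, t := s r - i)"])
  fix i assume i: "i < s r"
  have "exec B (Dec t) (s(r := i, d := s d + s r, t := s r - i)) [] (s(r := i, d := s d + s r, t := s r - Suc i))"
   by (rule exec_Dec') (use i assms in auto)
  moreover have "exec B (Inc r) (s(r := i, d := s d + s r, t := s r - Suc i)) []
    (s(r := Suc i, d := s d + s r, t := s r - Suc i))"
   by (rule exec_Inc') (use i assms in auto)
  ultimately show "exec B (Dec t ;; Inc r) (s(r := i, d := s d + s r, t := s r - i)) []
    (s(r := Suc i, d := s d + s r, t := s r - Suc i))"
   by (intro exec_Seq_silent)
 qed (use assms in auto)
 ultimately show ?thesis unfolding add_to_def by (rule exec_Seq_silent)
qed

text \<open>Destructively adds the minimum of registers \<open>v\<close> and \<open>c\<close> to register \<open>d\<close>; only \<open>v\<close> is lost.\<close>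

definition add_min_to :: "nat => nat => nat => nat => nat => com" where
 "add_min_to v c d t t' = add_to c t t' ;; While v (Dec v ;; If t (Dec t ;; Inc d)) ;; clear t"

lemma exec_add_min_to:
 assumes "s t = 0" "s t' = 0" "distinct [v, c, d, t, t']" "s c < B" "s v < B" "s d = 0" "s' = s(v := 0, d := min (s v) (s c))"
 shows "exec B (add_min_to v c d t t') s [] s'"
proof -
 have "exec B (add_to c t t') s [] (s(t := s c))"
  by (rule exec_add_to) (use assms in auto)
 moreover have "exec B (While v (Dec v ;; If t (Dec t ;; Inc d))) (s(t := s c)) []
   (s(v := 0, d := min (s v) (s c), t := s c - s v))"
 proof (rule exec_While_silent[where n = "s v" and S = "\<lambda>i. s(v := s v - i, d := min i (s c), t := s c - i)"])
  fix i assume i: "i < s v"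
  let ?S = "s(v := s v - i, d := min i (s c), t := s c - i)"
  let ?S1 = "s(v := s v - Suc i, d := min i (s c), t := s c - i)"
  let ?S3 = "s(v := s v - Suc i, d := min (Suc i) (s c), t := s c - Suc i)"
  have "exec B (Dec v) ?S [] ?S1"
   by (rule exec_Dec') (use i assms in auto)
  moreover have "exec B (If t (Dec t ;; Inc d)) ?S1 [] ?S3"
  proof (cases "i < s c")
   case True
   have "exec B (Dec t) ?S1 [] (s(v := s v - Suc i, d := min i (s c), t := s c - Suc i))"
    by (rule exec_Dec') (use True assms in auto)
   moreover have "exec B (Inc d) (s(v := s v - Suc i, d := min i (s c), t := s c - Suc i)) [] ?S3"
    by (rule exec_Inc') (use True assms in auto)
   ultimately show ?thesis
    by (intro exec_If exec_Seq_silent) (use True in auto)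
  next
   case False
   then have "?S3 = ?S1" by (auto simp: fun_eq_iff)
   moreover have "exec B (If t (Dec t ;; Inc d)) ?S1 [] ?S1"
    by (rule exec_If_0) (use False in auto)
   ultimately show ?thesis by simp
  qed
  ultimately show "exec B (Dec v ;; If t (Dec t ;; Inc d)) ?S [] ?S3"
   by (intro exec_Seq_silent)
 qed (use assms in "auto simp: fun_eq_iff")
 moreover have "exec B (clear t) (s(v := 0, d := min (s v) (s c), t := s c - s v)) [] s'"
  by (rule exec_clear) (use assms in "auto simp: fun_eq_iff")
 ultimately show ?thesis unfolding add_min_to_def by (intro exec_Seq_silent)
qed

text \<open>
 Variable \<open>k\<close> lives in register \<open>J k < d\<close>; the registers from \<open>d\<close> on are zero, and \<open>d\<close> receives the value.
\<close>

fun comp_expr :: "(nat => nat) => nat => expr => com" where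
 "comp_expr J d (Var k) = add_to (J k) d (d + 1)"
| "comp_expr J d Zero = Out []"
| "comp_expr J d (Succ e) = comp_expr J d e ;; Inc d"
| "comp_expr J d (Mul e1 e2) = comp_expr J (d + 1) e1 ;; (comp_expr J (d + 2) e2 ;;
   (While (d + 1) (Dec (d + 1) ;; add_to (d + 2) d (d + 3)) ;; clear (d + 2)))"
| "comp_expr J d (Iter b z c s) = comp_expr J (d + 1) b ;; (comp_expr J (d + 2) c ;;
   (comp_expr J (d + 4) z ;; (add_min_to (d + 4) (d + 2) d (d + 5) (d + 6) ;;
   (While (d + 1) (Dec (d + 1) ;; (comp_expr (push d (push (d + 3) J)) (d + 4) s ;;
    (clear d ;; (add_min_to (d + 4) (d + 2) d (d + 5) (d + 6) ;; Inc (d + 3))))) ;;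
   (clear (d + 2) ;; clear (d + 3))))))"

text \<open>The bound is a power of a common bound \<open>V\<close> of the variables because such
  bounds compose: adding an intermediate result to the variables replaces \<open>V\<close> by a
  power of \<open>V\<close>, and exponents multiply.\<close>

lemma eval_less_power: "\<exists>c. \<forall>E V. 2 <= V --> (\<forall>k. E k <= V) --> eval e E < V ^ c"
proof -
 obtain k c where kc: "!!E. eval e E <= poly_bound k c E" using eval_poly_bound by blast
 have "eval e E < V ^ ((k + 2) * c + 1)" if V: "2 <= V" "!!k. E k <= V" for E V
 proof -
  have "2 + (\<Sum>i<k. E i) <= V + (\<Sum>i<k. V)"
   using V by (intro add_mono sum_mono) auto
  also have "... = (k + 1) * V" by simp
  also have "... <= 2 ^ (k + 1) * V"
   using less_exp[of "k + 1"] by (intro mult_right_mono) (auto intro: less_imp_le)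
  also have "... <= V ^ (k + 1) * V" by (intro mult_right_mono power_mono) (use V in auto)
  finally have "2 + (\<Sum>i<k. E i) <= V ^ (k + 2)" by (simp add: mult_ac)
  then have "poly_bound k c E <= V ^ ((k + 2) * c)"
   unfolding poly_bound_def power_mult by (rule power_mono) simp
  also have "... < V ^ ((k + 2) * c + 1)" using V by (intro power_strict_increasing) auto
  finally show ?thesis using kc[of E] by linarith
 qed
 then show ?thesis by blast
qed

definition frame :: "nat => (nat => nat) => nat => env => bool" where
 "frame V J d s \<longleftrightarrow> 2 <= V \<and> (\<forall>k. J k < d) \<and> (\<forall>r. s r <= V) \<and> (\<forall>r\<ge>d. s r = 0)"

lemma frame_eval:
 assumes "!!E V. 2 <= V ==> (!!k. E k <= V) ==> eval e E < V ^ c" "frame V J d s"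
 shows "eval e (\<lambda>k. s (J k)) < V ^ c"
 using assms by (auto simp: frame_def)

lemma power_le_power: "2 <= (V::nat) ==> c <= c' ==> V ^ c <= V ^ c'"
 by (intro power_increasing) auto

text \<open>The exponent depends on the expression alone, so the registers keep logarithmically many
  digits. Subexpressions run in frames that already contain intermediate results; their induction
  hypotheses are used with a power of \<open>V\<close> in place of \<open>V\<close>.\<close>

lemma comp_expr_correct:
 "\<exists>c. \<forall>V J d s. frame V J d s -->
   exec (V ^ c) (comp_expr J d e) s [] (s(d := eval e (\<lambda>k. s (J k))))"
proof (induction e)
 case (Var k)
 have "exec (V ^ 2) (comp_expr J d (Var k)) s [] (s(d := eval (Var k) (\<lambda>k. s (J k))))"
  if "frame V J d s" for V J d s
 proof -
  have "V < V ^ 2" using that by (auto simp: frame_def power2_eq_square)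
  moreover have "J k < d" "s (J k) <= V" using that by (auto simp: frame_def)
  ultimately have "s (J k) < V ^ 2" by linarith
  moreover have "J k ~= d" "J k ~= d + 1"
   using \<open>J k < d\<close> by auto
  moreover have "s d = 0" "s (d + 1) = 0"
   using that by (auto simp: frame_def)
  ultimately show ?thesis by (auto intro!: exec_add_to)
 qed
 then show ?case by blast
next
 case Zero
 then show ?case by (auto simp: frame_def intro!: exI[of _ 0] exec_Out[THEN back_subst[of "exec _ _ _ _"]])
next
 case (Succ e)
 then obtain c where c: "!!V J d s. frame V J d s ==>
   exec (V ^ c) (comp_expr J d e) s [] (s(d := eval e (\<lambda>k. s (J k))))" by blast
 obtain c' where c': "!!E V. 2 <= V ==> (!!k. E k <= V) ==> eval (Succ e) E < V ^ c'"
  using eval_less_power[of "Succ e"] by blast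
 have "exec (V ^ (c + c')) (comp_expr J d (Succ e)) s [] (s(d := eval (Succ e) (\<lambda>k. s (J k))))"
  if f: "frame V J d s" for V J d s
 proof -
  have V: "2 <= V" using f by (simp add: frame_def)
  have "exec (V ^ (c + c')) (comp_expr J d e) s [] (s(d := eval e (\<lambda>k. s (J k))))"
   by (rule exec_mono[OF c[OF f]]) (simp add: power_le_power V)
  moreover have "V ^ c' <= V ^ (c + c')" by (simp add: power_le_power V)
  then have "exec (V ^ (c + c')) (Inc d) (s(d := eval e (\<lambda>k. s (J k)))) [] (s(d := eval (Succ e) (\<lambda>k. s (J k))))"
   by (intro exec_Inc') (use frame_eval[OF c' f] in auto)
  ultimately show ?thesis by (auto intro: exec_Seq_silent)
 qed
 then show ?case by blast
next
 case (Mul e1 e2)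
 then obtain c1 c2 where c1: "!!V J d s. frame V J d s ==>
    exec (V ^ c1) (comp_expr J d e1) s [] (s(d := eval e1 (\<lambda>k. s (J k))))"
  and c2: "!!V J d s. frame V J d s ==>
    exec (V ^ c2) (comp_expr J d e2) s [] (s(d := eval e2 (\<lambda>k. s (J k))))" by blast
 obtain b1 b2 b where b1: "!!E V. 2 <= V ==> (!!k. E k <= V) ==> eval e1 E < V ^ b1"
  and b2: "!!E V. 2 <= V ==> (!!k. E k <= V) ==> eval e2 E < V ^ b2"
  and b: "!!E V. 2 <= V ==> (!!k. E k <= V) ==> eval (Mul e1 e2) E < V ^ b"
  using eval_less_power[of e1] eval_less_power[of e2] eval_less_power[of "Mul e1 e2"] by blast
 define C where "C = c1 + Suc b1 * c2 + b + b1 + b2"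
 have "exec (V ^ C) (comp_expr J d (Mul e1 e2)) s [] (s(d := eval (Mul e1 e2) (\<lambda>k. s (J k))))"
  if f: "frame V J d s" for V J d s
 proof -
  have V: "2 <= V" using f by (simp add: frame_def)
  have less: "J k < d" "J k ~= d" "J k ~= Suc d" for k
  proof -
   show "J k < d" using f by (auto simp: frame_def)
   then show "J k ~= d" "J k ~= Suc d" by auto
  qed
  have z: "s r = 0" if "d <= r" for r using f that by (auto simp: frame_def)
  define x1 x2 where "x1 = eval e1 (\<lambda>k. s (J k))" and "x2 = eval e2 (\<lambda>k. s (J k))"
  have bounds: "x1 < V ^ b1" "x2 < V ^ b2" "x1 * x2 < V ^ b"
   using frame_eval[OF b1 f] frame_eval[OF b2 f] frame_eval[OF b f] by (auto simp: x1_def x2_def)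
  have f1: "frame V J (d + 1) s" using f by (auto simp: frame_def less_SucI)
  have e1: "exec (V ^ C) (comp_expr J (d + 1) e1) s [] (s(d + 1 := x1))"
   unfolding x1_def by (rule exec_mono[OF c1[OF f1]]) (rule power_le_power[OF V], simp add: C_def)
  have f2: "frame (V ^ Suc b1) J (d + 2) (s(d + 1 := x1))"
  proof -
   have "V <= V ^ Suc b1" "V ^ b1 <= V ^ Suc b1"
    using power_le_power[OF V, of 1 "Suc b1"] power_le_power[OF V, of b1 "Suc b1"] by auto
   moreover from this have "x1 <= V ^ Suc b1" "2 <= V ^ Suc b1" using bounds V by linarith+
   ultimately show ?thesis
    using f by (auto simp: frame_def less_SucI simp del: power_Suc intro: order_trans)
  qed
  have "exec ((V ^ Suc b1) ^ c2) (comp_expr J (d + 2) e2) (s(d + 1 := x1)) [] (s(d + 1 := x1, d + 2 := x2))"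
   using c2[OF f2] less by (simp add: x2_def)
  then have e2: "exec (V ^ C) (comp_expr J (d + 2) e2) (s(d + 1 := x1)) [] (s(d + 1 := x1, d + 2 := x2))"
   by (rule exec_mono) (unfold power_mult[symmetric], rule power_le_power[OF V], simp add: C_def)
  have e3: "exec (V ^ C) (While (d + 1) (Dec (d + 1) ;; add_to (d + 2) d (d + 3))) (s(d + 1 := x1, d + 2 := x2)) []
    (s(d + 2 := x2, d := x1 * x2))"
  proof (rule exec_While_silent[where n = x1 and S = "\<lambda>i. s(d + 1 := x1 - i, d + 2 := x2, d := i * x2)"])
   fix i assume i: "i < x1"
   let ?S = "s(d + 1 := x1 - i, d + 2 := x2, d := i * x2)"
   have "Suc i * x2 <= x1 * x2" using i by (intro mult_right_mono) auto
   then have "Suc i * x2 < V ^ b" using bounds by linarith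
   moreover have "V ^ b <= V ^ C" by (rule power_le_power[OF V]) (simp add: C_def)
   ultimately have lt: "i * x2 + x2 < V ^ C" by simp
   have "exec (V ^ C) (Dec (d + 1)) ?S [] (s(d + 1 := x1 - Suc i, d + 2 := x2, d := i * x2))"
    by (rule exec_Dec') (use i in auto)
   moreover have "exec (V ^ C) (add_to (d + 2) d (d + 3)) (s(d + 1 := x1 - Suc i, d + 2 := x2, d := i * x2)) []
     (s(d + 1 := x1 - Suc i, d + 2 := x2, d := Suc i * x2))"
    by (rule exec_add_to) (use lt z in auto)
   ultimately show "exec (V ^ C) (Dec (d + 1) ;; add_to (d + 2) d (d + 3)) ?S []
     (s(d + 1 := x1 - Suc i, d + 2 := x2, d := Suc i * x2))"
    by (rule exec_Seq_silent)
  qed (use z in "auto simp: fun_eq_iff")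
  have e4: "exec (V ^ C) (clear (d + 2)) (s(d + 2 := x2, d := x1 * x2)) []
    (s(d := eval (Mul e1 e2) (\<lambda>k. s (J k))))"
   by (rule exec_clear) (use z in "auto simp: fun_eq_iff x1_def x2_def")
  show ?thesis
   using e1 e2 e3 e4 by (auto intro!: exec_Seq_silent)
 qed
 then show ?case by blast
next
 case (Iter b z c s)
 obtain cb cz cc cs where cb: "!!V J d s. frame V J d s ==>
    exec (V ^ cb) (comp_expr J d b) s [] (s(d := eval b (\<lambda>k. s (J k))))"
  and cz: "!!V J d s. frame V J d s ==>
    exec (V ^ cz) (comp_expr J d z) s [] (s(d := eval z (\<lambda>k. s (J k))))"
  and cc: "!!V J d s. frame V J d s ==>
    exec (V ^ cc) (comp_expr J d c) s [] (s(d := eval c (\<lambda>k. s (J k))))"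
  and cs: "!!V J d st. frame V J d st ==>
    exec (V ^ cs) (comp_expr J d s) st [] (st(d := eval s (\<lambda>k. st (J k))))"
  using Iter.IH by blast
 obtain bb bz bc bs where bb: "!!E V. 2 <= V ==> (!!k. E k <= V) ==> eval b E < V ^ bb"
  and bz: "!!E V. 2 <= V ==> (!!k. E k <= V) ==> eval z E < V ^ bz"
  and bc: "!!E V. 2 <= V ==> (!!k. E k <= V) ==> eval c E < V ^ bc"
  and bs: "!!E V. 2 <= V ==> (!!k. E k <= V) ==> eval s E < V ^ bs"
  using eval_less_power[of b] eval_less_power[of z] eval_less_power[of c] eval_less_power[of s] by blast
 \<comment> \<open>\<open>V ^ W\<close> bounds the number of rounds and the cap, hence also the
   accumulator and the round number, that is, every register that a subprogram can see.\<close>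
 define W where "W = bb + bc + 1"
 define C where "C = W * (cb + cz + cc + cs + bz + bs + bb + bc + 2)"
 have "exec (V ^ C) (comp_expr J d (Iter b z c s)) st [] (st(d := eval (Iter b z c s) (\<lambda>k. st (J k))))"
  if f: "frame V J d st" for V J d st
 proof -
  have V: "2 <= V" using f by (simp add: frame_def)
  define U where "U = V ^ W"
  have VU: "V <= U" using power_le_power[OF V, of 1 W] by (simp add: U_def W_def)
  have U2: "2 <= U" using V VU by linarith
  have Upow: "U ^ a <= V ^ C" if "a <= cb + cz + cc + cs + bz + bs + bb + bc + 1" for a
   unfolding U_def power_mult[symmetric] C_def using that by (intro power_le_power V mult_le_mono2) simp
  have Vpow: "V ^ a <= U" if "a <= W" for a
   unfolding U_def using that by (intro power_le_power V)
  have J: "J k < d" for k using f by (auto simp: frame_def)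
  have J': "J k ~= d + i" "J k ~= d" "J k ~= Suc d" "J k ~= Suc (Suc d)" for k i using J[of k] by auto
  have zero: "st r = 0" if "d <= r" for r using f that by (auto simp: frame_def)
  have st_le: "st r <= V" for r using f by (auto simp: frame_def)
  define E where "E = (\<lambda>k. st (J k))"
  define xb xz xc where "xb = eval b E" and "xz = eval z E" and "xc = eval c E"
  have \<sigma>V: "E k <= V" for k using st_le by (simp add: E_def)
  have xb: "xb <= U"
   unfolding xb_def using less_le_trans[OF bb[of V E, OF V \<sigma>V] Vpow[of bb]] by (simp add: W_def)
  have xc: "xc <= U"
   unfolding xc_def using less_le_trans[OF bc[of V E, OF V \<sigma>V] Vpow[of bc]] by (simp add: W_def)
  have \<sigma>U: "E k <= U" for k using order_trans[OF \<sigma>V VU] .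
  have xz: "xz < V ^ C"
   unfolding xz_def using less_le_trans[OF bz[of U E, OF U2 \<sigma>U] Upow[of bz]] by simp
  have U_less: "U < V ^ C"
  proof -
   have "V ^ W < V ^ C"
    using V by (intro power_strict_increasing) (auto simp: C_def W_def)
   then show ?thesis by (simp add: U_def)
  qed
  define acc where "acc = rec_nat (min xz xc) (\<lambda>i a. min (eval s (push a (push i E))) xc)"
  have acc_le: "acc i <= xc" for i by (cases i) (auto simp: acc_def)
  have fb: "frame V J (d + 1) st" using f by (auto simp: frame_def less_SucI)
  have e1: "exec (V ^ C) (comp_expr J (d + 1) b) st [] (st(d + 1 := xb))"
   using exec_mono[OF cb[OF fb], of "V ^ C"] Upow[of cb] power_mono[OF VU, of cb]
   by (simp add: xb_def E_def)
  have fc: "frame U J (d + 2) (st(d + 1 := xb))"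
   using J zero st_le xb U2 VU by (auto simp: frame_def less_SucI intro: order_trans)
  have e2: "exec (V ^ C) (comp_expr J (d + 2) c) (st(d + 1 := xb)) [] (st(d + 1 := xb, d + 2 := xc))"
   using exec_mono[OF cc[OF fc], of "V ^ C"] Upow[of cc] J'
   by (simp add: xc_def E_def)
  have fz: "frame U J (d + 4) (st(d + 1 := xb, d + 2 := xc))"
   using J zero st_le xb xc U2 VU by (auto simp: frame_def trans_less_add1 intro: order_trans)
  have "exec (V ^ C) (comp_expr J (d + 4) z) (st(d + 1 := xb, d + 2 := xc)) []
    ((st(d + 1 := xb, d + 2 := xc))(d + 4 := eval z (\<lambda>k. (st(d + 1 := xb, d + 2 := xc)) (J k))))"
   by (rule exec_mono[OF cz[OF fz]]) (rule Upow, simp)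
  moreover have "(\<lambda>k. (st(d + 1 := xb, d + 2 := xc)) (J k)) = E"
   using J' by (auto simp: E_def)
  ultimately have e3: "exec (V ^ C) (comp_expr J (d + 4) z) (st(d + 1 := xb, d + 2 := xc)) []
    (st(d + 1 := xb, d + 2 := xc, d + 4 := xz))"
   by (simp add: xz_def)
  have e4: "exec (V ^ C) (add_min_to (d + 4) (d + 2) d (d + 5) (d + 6)) (st(d + 1 := xb, d + 2 := xc, d + 4 := xz)) []
    (st(d + 1 := xb, d + 2 := xc, d := acc 0))"
   by (rule exec_add_min_to) (use zero xc U_less xz in "auto simp: fun_eq_iff acc_def")
  let ?body = "Dec (d + 1) ;; (comp_expr (push d (push (d + 3) J)) (d + 4) s ;;
    (clear d ;; (add_min_to (d + 4) (d + 2) d (d + 5) (d + 6) ;; Inc (d + 3))))"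
  let ?S = "\<lambda>i. st(d + 1 := xb - i, d + 2 := xc, d + 3 := i, d := acc i)"
  have e5: "exec (V ^ C) (While (d + 1) ?body) (st(d + 1 := xb, d + 2 := xc, d := acc 0)) []
    (st(d + 2 := xc, d + 3 := xb, d := acc xb))"
  proof (rule exec_While_silent[where n = xb and S = ?S])
   fix i assume i: "i < xb"
   define y where "y = eval s (push (acc i) (push i E))"
   have b1: "exec (V ^ C) (Dec (d + 1)) (?S i) [] (st(d + 1 := xb - Suc i, d + 2 := xc, d + 3 := i, d := acc i))"
    by (rule exec_Dec') (use i in auto)
   let ?T = "st(d + 1 := xb - Suc i, d + 2 := xc, d + 3 := i, d := acc i)"
   have T_eq: "(\<lambda>k. ?T (push d (push (d + 3) J) k)) = push (acc i) (push i E)"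
    using J' by (auto simp: fun_eq_iff push_def E_def split: nat.split)
   have T_le: "?T r <= U" for r
    using st_le[of r] VU xb xc acc_le[of i] i by (auto intro: order_trans)
   have fs: "frame U (push d (push (d + 3) J)) (d + 4) ?T"
    using J zero T_le U2 by (auto simp: frame_def push_def trans_less_add1 split: nat.split)
   have b2: "exec (V ^ C) (comp_expr (push d (push (d + 3) J)) (d + 4) s) ?T [] (?T(d + 4 := y))"
    unfolding y_def T_eq[symmetric] by (rule exec_mono[OF cs[OF fs]]) (rule Upow, simp)
   have "push (acc i) (push i E) k <= U" for k
    using T_le unfolding T_eq[symmetric] by blast
   then have y: "y < V ^ C"
    unfolding y_def using less_le_trans[OF bs[OF U2] Upow[of bs]] by simp
   have b3: "exec (V ^ C) (clear d) (?T(d + 4 := y)) []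
     (st(d + 1 := xb - Suc i, d + 2 := xc, d + 3 := i, d := 0, d + 4 := y))"
    by (rule exec_clear) (auto simp: fun_eq_iff)
   have b4: "exec (V ^ C) (add_min_to (d + 4) (d + 2) d (d + 5) (d + 6))
     (st(d + 1 := xb - Suc i, d + 2 := xc, d + 3 := i, d := 0, d + 4 := y)) []
     (st(d + 1 := xb - Suc i, d + 2 := xc, d + 3 := i, d := acc (Suc i)))"
    by (rule exec_add_min_to) (use zero xc U_less y in "auto simp: fun_eq_iff acc_def y_def")
   have b5: "exec (V ^ C) (Inc (d + 3)) (st(d + 1 := xb - Suc i, d + 2 := xc, d + 3 := i, d := acc (Suc i))) [] (?S (Suc i))"
    by (rule exec_Inc') (use i xb U_less in "auto simp: fun_eq_iff")
   show "exec (V ^ C) ?body (?S i) [] (?S (Suc i))"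
    using b1 b2 b3 b4 b5 by (intro exec_Seq_silent)
  qed (use zero in "auto simp: fun_eq_iff")
  have e6: "exec (V ^ C) (clear (d + 2)) (st(d + 2 := xc, d + 3 := xb, d := acc xb)) [] (st(d + 3 := xb, d := acc xb))"
   by (rule exec_clear) (use zero in "auto simp: fun_eq_iff")
  have e7: "exec (V ^ C) (clear (d + 3)) (st(d + 3 := xb, d := acc xb)) [] (st(d := acc xb))"
   by (rule exec_clear) (use zero in "auto simp: fun_eq_iff")
  have eq: "eval (Iter b z c s) E = acc xb"
   by (simp add: acc_def xb_def xz_def xc_def)
  show ?thesis
   unfolding comp_expr.simps E_def[symmetric] eq
   by (rule exec_Seq_silent[OF e1 exec_Seq_silent[OF e2 exec_Seq_silent[OF e3
      exec_Seq_silent[OF e4 exec_Seq_silent[OF e5 exec_Seq_silent[OF e6 e7]]]]]])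
 qed
 then show ?case by blast
qed


section \<open>Printers and the words they write\<close>

datatype printer =
  PStr "bool list"
 | PNum expr
 | PSeq printer printer
 | PFor expr printer
 | PIf expr printer

fun print :: "printer => env => bool list" where
 "print (PStr bs) E = bs"
| "print (PNum e) E = replicate (eval e E) True @ [False]"
| "print (PSeq p q) E = print p E @ print q E"
| "print (PFor e p) E = concat (map (\<lambda>i. print p (push i E)) [0..<eval e E])"
| "print (PIf e p) E = (if eval e E = 0 then [] else print p E)"

fun comp_printer :: "(nat => nat) => nat => printer => com" where
 "comp_printer J d (PStr bs) = Out bs"
| "comp_printer J d (PNum e) = comp_expr J d e ;; (While d (Dec d ;; Out [True]) ;; Out [False])"
| "comp_printer J d (PSeq p q) = comp_printer J d p ;; comp_printer J d q"
| "comp_printer J d (PFor e p) = comp_expr J d e ;;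
   (While d (Dec d ;; (comp_printer (push (d + 1) J) (d + 2) p ;; Inc (d + 1))) ;; clear (d + 1))"
| "comp_printer J d (PIf e p) = comp_expr J d e ;; (If d (comp_printer J (d + 1) p) ;; clear d)"

text \<open>A printer leaves all registers as it found them. Hence pieces can be put in sequence and
  repeated without any change of the frame.\<close>

lemma comp_printer_correct:
 "\<exists>c. \<forall>V J d s. frame V J d s --> exec (V ^ c) (comp_printer J d p) s (print p (\<lambda>k. s (J k))) s"
proof (induction p)
 case (PStr bs)
 then show ?case by (auto intro: exec_Out)
next
 case (PNum e)
 obtain c where c: "!!V J d s. frame V J d s ==>
   exec (V ^ c) (comp_expr J d e) s [] (s(d := eval e (\<lambda>k. s (J k))))"
  using comp_expr_correct by blast
 have "exec (V ^ c) (comp_printer J d (PNum e)) s (print (PNum e) (\<lambda>k. s (J k))) s"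
  if f: "frame V J d s" for V J d s
 proof -
  define x where "x = eval e (\<lambda>k. s (J k))"
  have "s d = 0" using f by (auto simp: frame_def)
  have "exec (V ^ c) (While d (Dec d ;; Out [True])) ((\<lambda>i. s(d := x - i)) 0) (concat (map (\<lambda>i. [True]) [0..<x])) ((\<lambda>i. s(d := x - i)) x)"
  proof (rule exec_While_count)
   fix i assume "i < x"
   then have "exec (V ^ c) (Dec d) (s(d := x - i)) [] (s(d := x - Suc i))"
    by (intro exec_Dec') auto
   from exec_Seq[OF this exec_Out[of _ "[True]"]]
   show "exec (V ^ c) (Dec d ;; Out [True]) (s(d := x - i)) [True] (s(d := x - Suc i))" by simp
  qed auto
  moreover have "concat (map (\<lambda>i. [True]) [0..<x]) = replicate x True"
   by (induction x) (auto simp: replicate_append_same)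
  moreover have "s(d := 0) = s" using \<open>s d = 0\<close> by auto
  ultimately have w: "exec (V ^ c) (While d (Dec d ;; Out [True])) (s(d := x)) (replicate x True) s"
   by simp
  show ?thesis
   using exec_Seq[OF c[OF f] exec_Seq[OF w[unfolded x_def] exec_Out[of _ "[False]"]]] by simp
 qed
 then show ?case by blast
next
 case (PSeq p q)
 then obtain c1 c2 where c1: "!!V J d s. frame V J d s ==> exec (V ^ c1) (comp_printer J d p) s (print p (\<lambda>k. s (J k))) s"
  and c2: "!!V J d s. frame V J d s ==> exec (V ^ c2) (comp_printer J d q) s (print q (\<lambda>k. s (J k))) s"
  by blast
 have "exec (V ^ (c1 + c2)) (comp_printer J d (PSeq p q)) s (print (PSeq p q) (\<lambda>k. s (J k))) s"
  if f: "frame V J d s" for V J d s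
 proof -
  have V: "2 <= V" using f by (simp add: frame_def)
  have "exec (V ^ (c1 + c2)) (comp_printer J d p) s (print p (\<lambda>k. s (J k))) s"
   "exec (V ^ (c1 + c2)) (comp_printer J d q) s (print q (\<lambda>k. s (J k))) s"
   by (rule exec_mono[OF c1[OF f]] exec_mono[OF c2[OF f]], simp add: power_le_power V)+
  then show ?thesis by (auto intro: exec_Seq)
 qed
 then show ?case by blast
next
 case (PFor e p)
 then obtain cp where cp: "!!V J d s. frame V J d s ==> exec (V ^ cp) (comp_printer J d p) s (print p (\<lambda>k. s (J k))) s"
  by blast
 obtain c where c: "!!V J d s. frame V J d s ==>
   exec (V ^ c) (comp_expr J d e) s [] (s(d := eval e (\<lambda>k. s (J k))))"
  using comp_expr_correct by blast
 obtain b where b: "!!E V. 2 <= V ==> (!!k. E k <= V) ==> eval e E < V ^ b"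
  using eval_less_power[of e] by blast
 define C where "C = c + Suc b * cp + Suc b"
 have "exec (V ^ C) (comp_printer J d (PFor e p)) s (print (PFor e p) (\<lambda>k. s (J k))) s"
  if f: "frame V J d s" for V J d s
 proof -
  have V: "2 <= V" using f by (simp add: frame_def)
  have J: "J k < d" for k using f by (auto simp: frame_def)
  have J': "J k ~= d + i" "J k ~= d" "J k ~= Suc d" "J k ~= Suc (Suc d)" for k i using J[of k] by auto
  have zero: "s r = 0" if "d <= r" for r using f that by (auto simp: frame_def)
  define E where "E = (\<lambda>k. s (J k))"
  define x where "x = eval e E"
  have x: "x < V ^ b" using frame_eval[OF b f] by (simp add: x_def E_def)
  let ?U = "V ^ Suc b"
  have VU: "V <= ?U" "V ^ b <= ?U"
   using power_le_power[OF V, of 1 "Suc b"] power_le_power[OF V, of b "Suc b"] by auto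
  have UC: "?U ^ cp <= V ^ C" "V ^ b <= V ^ C"
   unfolding power_mult[symmetric] by (intro power_le_power V; simp add: C_def)+
  let ?S = "\<lambda>i. s(d := x - i, d + 1 := i)"
  let ?body = "Dec d ;; (comp_printer (push (d + 1) J) (d + 2) p ;; Inc (d + 1))"
  have "exec (V ^ C) (comp_expr J d e) s [] (s(d := x))"
   unfolding x_def E_def by (rule exec_mono[OF c[OF f]]) (rule power_le_power[OF V], simp add: C_def)
  moreover have "?S 0 = s(d := x)" by (rule ext) (simp add: zero)
  ultimately have e1: "exec (V ^ C) (comp_expr J d e) s [] (?S 0)" by (simp only:)
  have e2: "exec (V ^ C) (While d ?body) (?S 0) (concat (map (\<lambda>i. print p (push i E)) [0..<x])) (?S x)"
  proof (rule exec_While_count)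
   fix i assume i: "i < x"
   let ?T = "s(d := x - Suc i, d + 1 := i)"
   have b1: "exec (V ^ C) (Dec d) (?S i) [] ?T"
    by (rule exec_Dec') (use i in auto)
   have T_eq: "(\<lambda>k. ?T (push (d + 1) J k)) = push i E"
    using J' by (auto simp: fun_eq_iff push_def E_def split: nat.split)
   have "?T r <= ?U" for r
   proof -
    have "s r <= V" using f by (auto simp: frame_def)
    moreover have "i <= ?U" "x - Suc i <= ?U" "s r <= ?U" using calculation x VU i by linarith+
    ultimately show ?thesis by (simp del: power_Suc)
   qed
   moreover have "2 <= ?U" using V VU by linarith
   ultimately have fp: "frame ?U (push (d + 1) J) (d + 2) ?T"
    using J zero by (auto simp: frame_def push_def trans_less_add1 less_SucI split: nat.split)
   have b2: "exec (V ^ C) (comp_printer (push (d + 1) J) (d + 2) p) ?T (print p (push i E)) ?T"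
    unfolding T_eq[symmetric] by (rule exec_mono[OF cp[OF fp] UC(1)])
   have b3: "exec (V ^ C) (Inc (d + 1)) ?T [] (?S (Suc i))"
    by (rule exec_Inc') (use i x UC in "auto simp: fun_eq_iff")
   show "exec (V ^ C) ?body (?S i) (print p (push i E)) (?S (Suc i))"
    using exec_Seq[OF b1 exec_Seq[OF b2 b3]] by simp
  qed auto
  have e3: "exec (V ^ C) (clear (d + 1)) (?S x) [] s"
   by (rule exec_clear) (use zero in "auto simp: fun_eq_iff")
  show ?thesis
   using exec_Seq[OF e1 exec_Seq[OF e2 e3]] by (simp add: x_def E_def)
 qed
 then show ?case by blast
next
 case (PIf e p)
 then obtain cp where cp: "!!V J d s. frame V J d s ==> exec (V ^ cp) (comp_printer J d p) s (print p (\<lambda>k. s (J k))) s"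
  by blast
 obtain c where c: "!!V J d s. frame V J d s ==>
   exec (V ^ c) (comp_expr J d e) s [] (s(d := eval e (\<lambda>k. s (J k))))"
  using comp_expr_correct by blast
 obtain b where b: "!!E V. 2 <= V ==> (!!k. E k <= V) ==> eval e E < V ^ b"
  using eval_less_power[of e] by blast
 define C where "C = c + Suc b * cp + Suc b"
 have "exec (V ^ C) (comp_printer J d (PIf e p)) s (print (PIf e p) (\<lambda>k. s (J k))) s"
  if f: "frame V J d s" for V J d s
 proof -
  have V: "2 <= V" using f by (simp add: frame_def)
  have J: "J k < d" for k using f by (auto simp: frame_def)
  have J': "J k ~= d" for k using J[of k] by auto
  have zero: "s r = 0" if "d <= r" for r using f that by (auto simp: frame_def)
  define x where "x = eval e (\<lambda>k. s (J k))"
  have x: "x < V ^ b" using frame_eval[OF b f] by (simp add: x_def)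
  let ?U = "V ^ Suc b"
  have VU: "V <= ?U" "V ^ b <= ?U"
   using power_le_power[OF V, of 1 "Suc b"] power_le_power[OF V, of b "Suc b"] by auto
  have UC: "?U ^ cp <= V ^ C"
   unfolding power_mult[symmetric] by (intro power_le_power V; simp add: C_def)
  have e1: "exec (V ^ C) (comp_expr J d e) s [] (s(d := x))"
   unfolding x_def by (rule exec_mono[OF c[OF f]]) (rule power_le_power[OF V], simp add: C_def)
  have "(s(d := x)) r <= ?U" for r
  proof -
   have "s r <= V" using f by (auto simp: frame_def)
   moreover have "x <= ?U" "s r <= ?U" using calculation x VU by linarith+
   ultimately show ?thesis by (simp del: power_Suc)
  qed
  moreover have "2 <= ?U" using V VU by linarith
  ultimately have "frame ?U J (d + 1) (s(d := x))"
   using J zero by (auto simp: frame_def less_SucI)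
  from exec_mono[OF cp[OF this] UC] have
   "exec (V ^ C) (comp_printer J (d + 1) p) (s(d := x)) (print p (\<lambda>k. s (J k))) (s(d := x))"
   using J' by simp
  then have e2: "exec (V ^ C) (If d (comp_printer J (d + 1) p)) (s(d := x)) (print (PIf e p) (\<lambda>k. s (J k))) (s(d := x))"
   by (cases "x = 0") (auto simp: x_def intro: exec_If exec_If_0)
  have e3: "exec (V ^ C) (clear d) (s(d := x)) [] s"
   by (rule exec_clear) (use zero in "auto simp: fun_eq_iff")
  show ?thesis
   using exec_Seq[OF e1 exec_Seq[OF e2 e3]] by simp
 qed
 then show ?case by blast
qed

theorem printer_computable:
 "\<exists>M a. wf_tm M \<and> (\<forall>n m. tm_computes M (size_word n m) (print p (push n (push m (\<lambda>_. 0))))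
    (a * log 2 (real (length (size_word n m)) + 2)))"
proof -
 \<comment> \<open>Registers 0 and 1 hold the two sizes; all further variables share register 2,
   which is always zero.\<close>
 define J where "J = (\<lambda>k. min k 2 :: nat)"
 obtain c where c: "!!V J d s. frame V J d s ==> exec (V ^ c) (comp_printer J d p) s (print p (\<lambda>k. s (J k))) s"
  using comp_printer_correct by blast
 obtain M where M: "wf_tm M" "!!n m L v s. exec (2 ^ L) (comp_printer J 3 p) (loaded n m) v s ==>
   n < 2 ^ L ==> m < 2 ^ L ==> tm_computes M (size_word n m) v (real (L + 1))"
  using com_computable by blast
 have "tm_computes M (size_word n m) (print p (push n (push m (\<lambda>_. 0))))
    (real (c + 3) * log 2 (real (length (size_word n m)) + 2))" for n m
 proof -
  define V where "V = n + m + 3"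
  \<comment> \<open>Chosen such that \<open>V ^ Suc c <= 2 ^ L\<close>. Since \<open>V\<close> is
    the length of the input word plus 2, this is linear in the logarithm required; rounding up and
    the one extra cell are paid for by \<open>log 2 V >= 1\<close>, which gives the factor
    \<open>c + 3\<close>.\<close>
  define L where "L = nat \<lceil>(real c + 1) * log 2 (real V)\<rceil>"
  have log1: "log 2 (real V) \<ge> 1" by (simp add: V_def le_log_iff)
  have V: "V ^ Suc c <= 2 ^ L"
  proof -
   have V0: "0 < real V" by (simp add: V_def)
   have "real (V ^ Suc c) = real V powr real (Suc c)"
    by (subst powr_realpow[OF V0]) (rule of_nat_power)
   also have "... = (2 powr log 2 (real V)) powr real (Suc c)"
    using V0 by simp
   also have "... = 2 powr (log 2 (real V) * real (Suc c))"
    by (rule powr_powr)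
   also have "... = 2 powr ((real c + 1) * log 2 (real V))"
    by (simp add: mult.commute add.commute)
   also have "... <= 2 powr real L"
    unfolding L_def by (intro powr_mono) (auto intro: real_nat_ceiling_ge)
   also have "... = real (2 ^ L)" by (simp add: powr_realpow)
   finally show ?thesis by (simp only: of_nat_le_iff)
  qed
  have Vc: "V ^ c <= V ^ Suc c" "V <= V ^ Suc c"
   using power_le_power[of V c "Suc c"] power_le_power[of V 1 "Suc c"] by (auto simp: V_def)
  have fr: "frame V J 3 (loaded n m)"
   by (auto simp: frame_def V_def J_def loaded_def)
  have eq: "(\<lambda>k. loaded n m (J k)) = push n (push m (\<lambda>_. 0))"
   by (auto simp: fun_eq_iff J_def loaded_def push_def min_def split: nat.split)
  have "exec (2 ^ L) (comp_printer J 3 p) (loaded n m) (print p (push n (push m (\<lambda>_. 0)))) (loaded n m)"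
   using exec_mono[OF c[OF fr]] V Vc unfolding eq by (meson order_trans)
  then have "tm_computes M (size_word n m) (print p (push n (push m (\<lambda>_. 0)))) (real (L + 1))"
   by (rule M(2)) (use V Vc in "simp_all add: V_def del: power_Suc")
  moreover have "real (L + 1) <= real (c + 3) * log 2 (real (length (size_word n m)) + 2)"
  proof -
   have "real L <= (real c + 1) * log 2 (real V) + 1"
    unfolding L_def using log1 by (auto intro!: of_int_ceiling_le_add_one less_imp_le simp: le_of_int_ceiling)
   then have "real (L + 1) <= (real c + 1) * log 2 (real V) + 2 * log 2 (real V)"
    using log1 by simp
   also have "... = real (c + 3) * log 2 (real V)" by (simp add: algebra_simps)
   also have "real V = real (length (size_word n m)) + 2"
    by (simp add: V_def length_size_word)
   finally show ?thesis .
  qed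
  ultimately show ?thesis
   unfolding tm_computes_def by (meson order_trans)
 qed
 with M(1) show ?thesis by blast
qed


definition prn :: "(env => bool list) => bool" where
 "prn w \<longleftrightarrow> (\<exists>p. w = print p)"

named_theorems prn_intros

lemma prn_str [prn_intros]: "prn (\<lambda>E. bs)"
 unfolding prn_def by (rule exI[of _ "PStr bs"]) auto

lemma prn_append [prn_intros]: "prn v ==> prn w ==> prn (\<lambda>E. v E @ w E)"
 unfolding prn_def by (elim exE, rule_tac x = "PSeq p pa" in exI) (auto simp: fun_eq_iff)

lemma prn_num [prn_intros]: "lsf f ==> prn (\<lambda>E. replicate (f E) True @ [False])"
 unfolding prn_def lsf_def by (elim exE, rule_tac x = "PNum e" in exI) (auto simp: fun_eq_iff)

lemma prn_concat [prn_intros]: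
 assumes "lsf f" "prn (\<lambda>E. w (E 0) (\<lambda>k. E (Suc k)))"
 shows "prn (\<lambda>E. concat (map (\<lambda>i. w i E) [0..<f E]))"
proof -
 obtain e p where e: "f = eval e" and p: "(\<lambda>E. w (E 0) (\<lambda>k. E (Suc k))) = print p"
  using assms unfolding lsf_def prn_def by blast
 have "w i E = print p (push i E)" for i E
  using fun_cong[OF p, of "push i E"] by simp
 then show ?thesis unfolding prn_def e by (intro exI[of _ "PFor e p"]) auto
qed

lemma prn_if [prn_intros]:
 assumes "lsp P" "prn w"
 shows "prn (\<lambda>E. if P E then w E else [])"
proof -
 obtain e p where e: "(\<lambda>E. of_bool (P E)) = eval e" and p: "w = print p"
  using assms unfolding lsp_def lsf_def prn_def by blast
 show ?thesis
  unfolding prn_def by (rule exI[of _ "PIf e p"]) (auto simp: fun_eq_iff p e[symmetric])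
qed

section \<open>States as amplitude functions\<close>

definition bits_nat :: "nat set => nat" where
 "bits_nat A = (\<Sum>q\<in>A. 2 ^ q)"

lemma bit_bits_nat: "finite A ==> bit (bits_nat A) q \<longleftrightarrow> q \<in> A"
proof (induction A arbitrary: q rule: finite_induct)
 case (insert a A)
 then have "bits_nat (insert a A) = set_bit a (bits_nat A)"
  by (simp add: bits_nat_def set_bit_eq add.commute)
 then show ?case using insert by (auto simp: bit_set_bit_iff)
qed (simp add: bits_nat_def)

definition flipset :: "nat set => nat => nat" where
 "flipset A i = Bit_Operations.xor i (bits_nat A)"

lemma bit_flipset: "finite A ==> bit (flipset A i) q \<longleftrightarrow> bit i q ~= (q \<in> A)"
 by (simp add: flipset_def bit_xor_iff bit_bits_nat)

lemma flipset_empty [simp]: "flipset {} i = i"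
 by (simp add: flipset_def bits_nat_def)

lemma flipset_flipset: "finite A ==> finite B ==> flipset A (flipset B i) = flipset ((A - B) \<union> (B - A)) i"
 by (rule bit_eqI) (auto simp: bit_flipset)

lemma flipset_same [simp]: "finite A ==> flipset A (flipset A i) = i"
 by (simp add: flipset_flipset)

lemma less_exp_bits: "i < 2 ^ N \<longleftrightarrow> (\<forall>q. bit (i::nat) q --> q < N)"
 by (metis bit_take_bit_iff take_bit_nat_eq_self_iff bit_eq_iff)

lemma flipset_less: "finite A ==> A \<subseteq> {..<N} ==> flipset A i < 2 ^ N \<longleftrightarrow> i < 2 ^ N"
 by (auto simp: less_exp_bits bit_flipset)

lemma bij_flipset: "finite A ==> A \<subseteq> {..<N} ==> bij_betw (flipset A) {..<2 ^ N} {..<2 ^ N}"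
 by (rule bij_betw_byWitness[where f' = "flipset A"]) (auto simp: flipset_less)


type_synonym state = "nat => complex"

text \<open>Phases carry arbitrary angles, so the ideal circuit and the actual one live in the same
  language and differ in angles only. States are amplitude functions on all natural numbers, which
  makes the action of a gate independent of the number of qubits.\<close>

datatype xgate = XH nat | XP real nat | XF "nat list" nat

fun xqubits :: "xgate => nat set" where
 "xqubits (XH q) = {q}"
| "xqubits (XP \<alpha> q) = {q}"
| "xqubits (XF ys x) = insert x (set ys)"

definition fan :: "nat list => nat => nat => nat" where
 "fan ys x i = (if bit i x then flipset (set ys) i else i)"

definition isq2 :: complex where
 "isq2 = complex_of_real (1 / sqrt 2)"

lemma isq2_sq: "isq2 * isq2 = 1 / 2"
 by (simp add: isq2_def flip: of_real_mult)

fun xact :: "xgate => state => state" where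
 "xact (XH q) v = (\<lambda>i. isq2 * ((if bit i q then - v i else v i) + v (flipset {q} i)))"
| "xact (XP \<alpha> q) v = (\<lambda>i. (if bit i q then cis \<alpha> else 1) * v i)"
| "xact (XF ys x) v = (\<lambda>i. v (fan ys x i))"

definition xrun :: "xgate list => state => state" where
 "xrun = fold xact"

lemma xrun_simps [simp]: "xrun [] v = v" "xrun (g # gs) v = xrun gs (xact g v)"
 "xrun (gs @ hs) v = xrun hs (xrun gs v)"
 by (simp_all add: xrun_def)

definition xwf :: "nat => xgate => bool" where
 "xwf N g \<longleftrightarrow> xqubits g \<subseteq> {..<N} \<and> (\<forall>ys x. g = XF ys x --> x \<notin> set ys)"

lemma bit_fan: "bit (fan ys x i) q \<longleftrightarrow> bit i q ~= (bit i x \<and> q \<in> set ys)"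
 by (auto simp: fan_def bit_flipset)

lemma fan_fan: "x \<notin> set ys ==> fan ys x (fan ys x i) = i"
 by (rule bit_eqI) (auto simp: bit_fan)

lemma xact_add: "xact g (\<lambda>i. J i + v i) = (\<lambda>i. xact g J i + xact g v i)"
 by (cases g) (auto simp: fun_eq_iff algebra_simps)

lemma xact_scale: "xact g (\<lambda>i. c * v i) = (\<lambda>i. c * xact g v i)"
 by (cases g) (auto simp: fun_eq_iff algebra_simps)

lemma xrun_add: "xrun gs (\<lambda>i. J i + v i) = (\<lambda>i. xrun gs J i + xrun gs v i)"
 by (induction gs arbitrary: J v) (auto simp: xact_add)

lemma xrun_scale: "xrun gs (\<lambda>i. c * v i) = (\<lambda>i. c * xrun gs v i)"
 by (induction gs arbitrary: v) (auto simp: xact_scale)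

lemma xrun_zero: "xrun gs (\<lambda>i. 0) = (\<lambda>i. 0)"
 using xrun_scale[of gs 0 "\<lambda>i. 0"] by simp

lemma xrun_sum: "finite A ==> xrun gs (\<lambda>i. \<Sum>a\<in>A. f a i) = (\<lambda>i. \<Sum>a\<in>A. xrun gs (f a) i)"
 by (induction A rule: finite_induct) (auto simp: xrun_add xrun_zero)


section \<open>The Euclidean norm and the propagation of errors\<close>

definition nrm :: "nat => state => real" where
 "nrm N v = L2_set (\<lambda>i. cmod (v i)) {..<2 ^ N}"

lemma nrm_nonneg [simp]: "0 <= nrm N v"
 by (simp add: nrm_def L2_set_nonneg)

lemma nrm_triangle: "nrm N (\<lambda>i. J i + v i) <= nrm N J + nrm N v"
proof -
 have "nrm N (\<lambda>i. J i + v i) <= L2_set (\<lambda>i. cmod (J i) + cmod (v i)) {..<2 ^ N}"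
  unfolding nrm_def by (rule L2_set_mono) (auto intro: norm_triangle_ineq)
 also have "... <= nrm N J + nrm N v"
  unfolding nrm_def by (rule L2_set_triangle_ineq)
 finally show ?thesis .
qed

lemma nrm_bound:
 assumes "!!i. i < 2 ^ N ==> cmod (J i) <= c * cmod (v i)" "0 <= c"
 shows "nrm N J <= c * nrm N v"
proof -
 have "nrm N J <= L2_set (\<lambda>i. c * cmod (v i)) {..<2 ^ N}"
  unfolding nrm_def by (rule L2_set_mono) (use assms in auto)
 then show ?thesis using assms(2) by (simp add: L2_set_right_distrib nrm_def)
qed

lemma nrm_reindex:
 assumes "bij_betw p {..<2 ^ N} {..<2 ^ N}"
 shows "nrm N (\<lambda>i. v (p i)) = nrm N v"
 using sum.reindex_bij_betw[OF assms, of "\<lambda>i. (cmod (v i))\<^sup>2"] by (simp add: nrm_def L2_set_def)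

lemma nrm_xact:
 assumes "xwf N g"
 shows "nrm N (xact g v) = nrm N v"
proof (cases g)
 case (XH q)
 then have q: "q < N" using assms by (auto simp: xwf_def)
 let ?f = "\<lambda>i. (cmod (xact g v i))\<^sup>2"
 have bij: "bij_betw (flipset {q}) {..<2 ^ N} {..<2 ^ N}"
  by (rule bij_flipset) (use q in auto)
 \<comment> \<open>The parallelogram law on the pair formed by an index and its flip; summing over
   all indices counts each pair twice on both sides.\<close>
 have "?f i + ?f (flipset {q} i) = (cmod (v i))\<^sup>2 + (cmod (v (flipset {q} i)))\<^sup>2" for i
 proof -
  have "(cmod (isq2 * (a + b)))\<^sup>2 + (cmod (isq2 * (- b + a)))\<^sup>2
    = (cmod a)\<^sup>2 + (cmod b)\<^sup>2" for a b
  proof -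
   have "(cmod (a + b))\<^sup>2 + (cmod (- b + a))\<^sup>2 = 2 * (cmod a)\<^sup>2 + 2 * (cmod b)\<^sup>2"
    unfolding cmod_power2 by (simp add: algebra_simps power2_eq_square)
   then show ?thesis by (simp add: norm_mult norm_divide power_mult_distrib power_divide isq2_def)
  qed
  from this[of "v i" "v (flipset {q} i)"] this[of "v (flipset {q} i)" "v i"] show ?thesis
   by (auto simp: XH bit_flipset add.commute)
 qed
 then have "(\<Sum>i<2 ^ N. ?f i + ?f (flipset {q} i)) = (\<Sum>i<2 ^ N. (cmod (v i))\<^sup>2 + (cmod (v (flipset {q} i)))\<^sup>2)"
  by simp
 moreover have "(\<Sum>i<2 ^ N. ?f (flipset {q} i)) = (\<Sum>i<2 ^ N. ?f i)"
  "(\<Sum>i<2 ^ N. (cmod (v (flipset {q} i)))\<^sup>2) = (\<Sum>i<2 ^ N. (cmod (v i))\<^sup>2)"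
  using sum.reindex_bij_betw[OF bij, of ?f] sum.reindex_bij_betw[OF bij, of "\<lambda>i. (cmod (v i))\<^sup>2"] by simp_all
 ultimately have "(\<Sum>i<2 ^ N. ?f i) = (\<Sum>i<2 ^ N. (cmod (v i))\<^sup>2)"
  by (simp add: sum.distrib)
 then show ?thesis by (simp add: nrm_def L2_set_def)
next
 case (XP \<alpha> q)
 then have "cmod (xact g v i) = cmod (v i)" for i by (simp add: norm_mult)
 then show ?thesis by (simp add: nrm_def)
next
 case (XF ys x)
 have "bij_betw (fan ys x) {..<2 ^ N} {..<2 ^ N}"
  by (rule bij_betw_byWitness[where f' = "fan ys x"])
    (use assms XF in "auto simp: xwf_def fan_fan less_exp_bits bit_fan")
 then show ?thesis using nrm_reindex[of "fan ys x" N v] by (simp add: XF)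
qed

lemma nrm_xrun: "\<forall>g \<in> set gs. xwf N g ==> nrm N (xrun gs v) = nrm N v"
 by (induction gs arbitrary: v) (auto simp: nrm_xact)


fun gate_error :: "xgate => xgate => real" where
 "gate_error (XP \<alpha> q) (XP \<beta> q') = cmod (cis \<alpha> - cis \<beta>)"
| "gate_error _ _ = 0"

definition similar_gate :: "xgate => xgate => bool" where
 "similar_gate g h \<longleftrightarrow> g = h \<or> (\<exists>\<alpha> \<beta> q. g = XP \<alpha> q \<and> h = XP \<beta> q)"

lemma xact_error:
 assumes "similar_gate g h"
 shows "nrm N (\<lambda>i. xact g v i - xact h v i) <= gate_error g h * nrm N v"
proof (rule nrm_bound)
 show "0 <= gate_error g h" by (cases "(g, h)" rule: gate_error.cases) auto
 show "cmod (xact g v i - xact h v i) <= gate_error g h * cmod (v i)" for i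
  using assms by (auto simp: similar_gate_def norm_mult left_diff_distrib[symmetric])
    (cases h; auto)
qed

text \<open>A hybrid argument: gates are exchanged one at a time, and the gates after the exchanged
  one preserve the norm, so the single errors just add up.\<close>

lemma xrun_error:
 assumes "list_all2 similar_gate gs hs" "\<forall>g \<in> set hs. xwf N g"
 shows "nrm N (\<lambda>i. xrun gs v i - xrun hs v i) <= (\<Sum>(g, h)\<leftarrow>zip gs hs. gate_error g h) * nrm N v"
 using assms
proof (induction gs hs arbitrary: v rule: list_all2_induct)
 case Nil
 then show ?case by (simp add: nrm_def L2_set_def)
next
 case (Cons g gs h hs)
 have wf_g: "xwf N g"
  using Cons.hyps Cons.prems by (auto simp: similar_gate_def xwf_def)
 have "(\<lambda>i. xrun (g # gs) v i - xrun (h # hs) v i)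
   = (\<lambda>i. (xrun gs (xact g v) i - xrun hs (xact g v) i) + (xrun hs (\<lambda>i. xact g v i - xact h v i) i))"
  using xrun_add[of hs "xact g v" "\<lambda>i. - 1 * xact h v i"] xrun_scale[of hs "- 1" "xact h v"]
  by (auto simp: fun_eq_iff)
 then have "nrm N (\<lambda>i. xrun (g # gs) v i - xrun (h # hs) v i)
   <= nrm N (\<lambda>i. xrun gs (xact g v) i - xrun hs (xact g v) i) + nrm N (xrun hs (\<lambda>i. xact g v i - xact h v i))"
  using nrm_triangle by presburger
 also have "nrm N (xrun hs (\<lambda>i. xact g v i - xact h v i)) = nrm N (\<lambda>i. xact g v i - xact h v i)"
  by (rule nrm_xrun) (use Cons.prems in auto)
 also have "... <= gate_error g h * nrm N v" by (rule xact_error) (rule Cons.hyps)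
 also have "nrm N (\<lambda>i. xrun gs (xact g v) i - xrun hs (xact g v) i)
   <= (\<Sum>(g, h)\<leftarrow>zip gs hs. gate_error g h) * nrm N v"
  using Cons.IH[of "xact g v"] Cons.prems nrm_xact[OF wf_g] by simp
 finally show ?case by (simp add: algebra_simps)
qed


section \<open>Gates on disjoint qubits\<close>

lemma xact_commute:
 assumes "xqubits g \<inter> xqubits h = {}"
 shows "xact g (xact h v) = xact h (xact g v)"
proof -
 have HH: "xact (XH p) (xact (XH q) v) = xact (XH q) (xact (XH p) v)" if "p ~= q" for p q v
 proof -
  have "flipset {p} (flipset {q} i) = flipset {q} (flipset {p} i)" for i
   by (rule bit_eqI) (auto simp: bit_flipset)
  then show ?thesis using that by (auto simp: fun_eq_iff bit_flipset algebra_simps)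
 qed
 have HP: "xact (XH p) (xact (XP \<alpha> q) v) = xact (XP \<alpha> q) (xact (XH p) v)" if "p ~= q" for p q \<alpha> v
  using that by (auto simp: fun_eq_iff bit_flipset algebra_simps)
 have HF: "xact (XH p) (xact (XF ys x) v) = xact (XF ys x) (xact (XH p) v)" if "p ~= x" "p \<notin> set ys" for p ys x v
 proof -
  have "fan ys x (flipset {p} i) = flipset {p} (fan ys x i)" for i
   using that by (intro bit_eqI) (auto simp: bit_flipset bit_fan)
  then show ?thesis using that by (auto simp: fun_eq_iff bit_fan)
 qed
 have PP: "xact (XP \<alpha> p) (xact (XP \<beta> q) v) = xact (XP \<beta> q) (xact (XP \<alpha> p) v)" for \<alpha> \<beta> p q v
  by (auto simp: fun_eq_iff)
 have PF: "xact (XP \<alpha> p) (xact (XF ys x) v) = xact (XF ys x) (xact (XP \<alpha> p) v)" if "p ~= x" "p \<notin> set ys" for \<alpha> p ys x v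
  using that by (auto simp: fun_eq_iff bit_fan)
 have FF: "xact (XF ys x) (xact (XF zs z) v) = xact (XF zs z) (xact (XF ys x) v)"
  if "z \<notin> set ys" "x \<notin> set zs" for ys x zs z v
 proof -
  have "fan ys x (fan zs z i) = fan zs z (fan ys x i)" for i
   using that by (intro bit_eqI) (auto simp: bit_fan)
  then show ?thesis by (auto simp: fun_eq_iff)
 qed
 show ?thesis
  using assms
  by (cases g; cases h; simp only: xqubits.simps)
    (metis HH HP HF PP PF FF disjoint_iff insert_iff singletonI)+
qed

lemma xrun_xact_commute:
 "(!!h. h \<in> set hs ==> xqubits g \<inter> xqubits h = {}) ==> xrun hs (xact g v) = xact g (xrun hs v)"
proof (induction hs arbitrary: v)
 case (Cons h hs)
 have "xact h (xact g v) = xact g (xact h v)"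
  by (rule xact_commute) (use Cons.prems in auto)
 then show ?case using Cons by simp
qed simp

lemma xrun_commute:
 "(!!g h. g \<in> set gs ==> h \<in> set hs ==> xqubits g \<inter> xqubits h = {}) ==>
  xrun hs (xrun gs v) = xrun gs (xrun hs v)"
proof (induction gs arbitrary: v)
 case (Cons g gs)
 have "xrun hs (xact g v) = xact g (xrun hs v)"
  by (rule xrun_xact_commute) (use Cons.prems in auto)
 then show ?case using Cons by simp
qed simp

text \<open>A table of stages \<open>l\<close> and groups \<open>i\<close> may be executed by
  stages, as in a circuit, or by groups, as in its analysis, because different groups touch
  different qubits. The last group is split off by commuting it past the others.\<close>

lemma xrun_groups:
 assumes "!!l l' i j g h. l < D ==> l' < D ==> i < n ==> j < n ==> i ~= j ==>
   g \<in> set (f l i) ==> h \<in> set (f l' j) ==> xqubits g \<inter> xqubits h = {}"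
 shows "xrun (concat (map (\<lambda>l. concat (map (f l) [0..<n])) [0..<D])) v
    = xrun (concat (map (\<lambda>i. concat (map (\<lambda>l. f l i) [0..<D])) [0..<n])) v"
 using assms
proof (induction n arbitrary: v)
 case 0
 have "concat (map (\<lambda>l. []) [0..<D]) = ([] :: xgate list)" by (induction D) auto
 then show ?case by (simp del: concat_eq_Nil_conv)
next
 case (Suc n)
 note disj = Suc.prems
 have split: "xrun (concat (map (\<lambda>l. concat (map (f l) [0..<Suc n])) [0..<D'])) v
   = xrun (concat (map (\<lambda>l. f l n) [0..<D'])) (xrun (concat (map (\<lambda>l. concat (map (f l) [0..<n])) [0..<D'])) v)"
  if "D' <= D" for D' v
  using that
 proof (induction D' arbitrary: v)
  case (Suc D')
  have c: "xrun (concat (map (f D') [0..<n])) (xrun (concat (map (\<lambda>l. f l n) [0..<D'])) J)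
    = xrun (concat (map (\<lambda>l. f l n) [0..<D'])) (xrun (concat (map (f D') [0..<n])) J)" for J
  proof (rule xrun_commute)
   fix g h
   assume "g \<in> set (concat (map (\<lambda>l. f l n) [0..<D']))" "h \<in> set (concat (map (f D') [0..<n]))"
   then obtain l i where "l < D'" "g \<in> set (f l n)" "i < n" "h \<in> set (f D' i)" by auto
   then show "xqubits g \<inter> xqubits h = {}"
    using disj[of l D' n i g h] Suc.prems(1) by simp
  qed
  show ?case using Suc.IH Suc.prems(1) by (simp add: c)
 qed simp
 have "xrun (concat (map (\<lambda>l. concat (map (f l) [0..<n])) [0..<D])) v
   = xrun (concat (map (\<lambda>i. concat (map (\<lambda>l. f l i) [0..<D])) [0..<n])) v"
  by (rule Suc.IH) (use disj less_SucI in blast)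
 then show ?case using split[of D] by simp
qed

section \<open>Phase gadgets\<close>

definition ket :: "nat => state" where
 "ket s = (\<lambda>i. of_bool (i = s))"

definition hads :: "nat list => state => state" where
 "hads qs = xrun (map XH qs)"

definition diag :: "(nat => complex) => state => state" where
 "diag d v = (\<lambda>i. d i * v i)"

definition off :: "nat set => nat => nat => bool" where
 "off A i s \<longleftrightarrow> (\<forall>q. q \<notin> A --> bit i q = bit s q)"

lemma hads_scale: "hads qs (\<lambda>i. c * v i) = (\<lambda>i. c * hads qs v i)"
 by (simp add: hads_def xrun_scale)

lemma hads_add: "hads qs (\<lambda>i. J i + v i) = (\<lambda>i. hads qs J i + hads qs v i)"
 by (simp add: hads_def xrun_add)

lemma hads_Cons: "q \<notin> set qs ==> hads (q # qs) v = xact (XH q) (hads qs v)"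
 by (simp add: hads_def del: xact.simps) (rule xrun_xact_commute, auto)

lemma XH_XH: "xact (XH q) (xact (XH q) v) = v"
proof
 fix i
 have "isq2 * (isq2 * x) = x / 2" for x
  by (simp add: mult.assoc[symmetric] isq2_sq)
 then show "xact (XH q) (xact (XH q) v) i = v i"
  by (simp add: bit_flipset algebra_simps)
qed

lemma hads_hads: "distinct qs ==> hads qs (hads qs v) = v"
proof (induction qs arbitrary: v)
 case (Cons q qs)
 have "hads (q # qs) (hads (q # qs) v) = xact (XH q) (hads qs (xact (XH q) (hads qs v)))"
  using Cons.prems hads_Cons[of q qs] by (auto simp del: xact.simps)
 also have "hads qs (xact (XH q) (hads qs v)) = xact (XH q) (hads qs (hads qs v))"
  unfolding hads_def by (rule xrun_xact_commute) (use Cons.prems in auto)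
 finally show ?case using Cons by (simp add: XH_XH del: xact.simps)
qed (simp add: hads_def)

lemma hads_ket:
 assumes "distinct qs" "!!q. q \<in> set qs ==> \<not> bit s q"
 shows "hads qs (ket s) = (\<lambda>i. if off (set qs) i s then isq2 ^ length qs else 0)"
 using assms
proof (induction qs)
 case Nil
 have "off {} i s \<longleftrightarrow> i = s" for i by (auto simp: off_def bit_eq_iff)
 then show ?case by (auto simp: hads_def ket_def fun_eq_iff)
next
 case (Cons q qs)
 let ?f = "\<lambda>i. if off (set qs) i s then isq2 ^ length qs else 0"
 have "hads (q # qs) (ket s) = xact (XH q) ?f"
  using Cons by (simp add: hads_Cons del: xact.simps)
 also have "... = (\<lambda>i. if off (set (q # qs)) i s then isq2 ^ length (q # qs) else 0)"
 proof
  fix i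
  have sq: "\<not> bit s q" and qn: "q \<notin> set qs" using Cons.prems by auto
  have 1: "off (set qs) i s \<longleftrightarrow> off (set (q # qs)) i s \<and> \<not> bit i q"
   using sq qn by (auto simp: off_def)
  have 2: "off (set qs) (flipset {q} i) s \<longleftrightarrow> off (set (q # qs)) i s \<and> bit i q"
   using sq qn by (auto simp: off_def bit_flipset)
  show "xact (XH q) ?f i = (if off (set (q # qs)) i s then isq2 ^ length (q # qs) else 0)"
   unfolding xact.simps 1 2 by auto
 qed
 finally show ?case .
qed

text \<open>In the row of the all-zero string the entries of the Hadamard matrix are all positive,
  so its amplitude is the plain normalised sum over the flips.\<close>

lemma hads_at_zero:
 assumes "distinct qs" "!!q. q \<in> set qs ==> \<not> bit i q"
 shows "hads qs v i = isq2 ^ length qs * (\<Sum>T\<in>Pow (set qs). v (flipset T i))"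
 using assms
proof (induction qs arbitrary: v)
 case Nil
 then show ?case by (simp add: hads_def)
next
 case (Cons q qs)
 have "hads (q # qs) v i = hads qs (xact (XH q) v) i"
  by (simp add: hads_def)
 also have "... = isq2 ^ length qs * (\<Sum>T\<in>Pow (set qs). xact (XH q) v (flipset T i))"
  using Cons by auto
 also have "(\<Sum>T\<in>Pow (set qs). xact (XH q) v (flipset T i))
   = isq2 * (\<Sum>T\<in>Pow (set qs). v (flipset T i) + v (flipset (insert q T) i))"
  unfolding sum_distrib_left
 proof (rule sum.cong)
  fix T assume T: "T \<in> Pow (set qs)"
  then have fin: "finite T" "q \<notin> T" using Cons.prems(1) by (auto intro: finite_subset)
  have "flipset {q} (flipset T i) = flipset (insert q T) i"
   using fin by (intro bit_eqI) (auto simp: bit_flipset)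
  then show "xact (XH q) v (flipset T i) = isq2 * (v (flipset T i) + v (flipset (insert q T) i))"
   using fin Cons.prems(2)[of q] by (simp add: bit_flipset)
 qed simp
 also have "(\<Sum>T\<in>Pow (set qs). v (flipset T i) + v (flipset (insert q T) i))
   = (\<Sum>T\<in>Pow (set (q # qs)). v (flipset T i))"
 proof -
  have inj: "inj_on (insert q) (Pow (set qs))" using Cons.prems(1) by (auto simp: inj_on_def)
  have "(\<Sum>T\<in>Pow (set (q # qs)). v (flipset T i))
   = (\<Sum>T\<in>Pow (set qs). v (flipset T i)) + (\<Sum>T\<in>insert q ` Pow (set qs). v (flipset T i))"
   unfolding list.set Pow_insert using Cons.prems(1) by (intro sum.union_disjoint) auto
  then show ?thesis by (simp add: sum.reindex[OF inj] sum.distrib)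
 qed
 finally show ?case by (simp add: mult.assoc)
qed

lemma off_flipset: "q \<in> A ==> off A (flipset {q} i) s = off A i s"
 by (auto simp: off_def bit_flipset)

text \<open>
 \<open>d\<^sub>1\<close> is the phase by which the input distinguishes the states of the qubits \<open>as\<close>; the phase \<open>z\<close>
 acts only at the all-zero state of \<open>as\<close>.
\<close>

lemma kickback:
 assumes as: "distinct as" "!!a. a \<in> set as ==> \<not> bit s a"
  and inv: "!!i. off (set as) i s ==> d1 i * d2 i = 1"
  and z: "!!i. off (set as) i s ==> z i = (if i = s then \<tau> else 1)"
  and E: "E ==> (!!i. off (set as) i s ==> d1 i = d1 s)"
  and not_E: "\<not> E ==> (\<Sum>T\<in>Pow (set as). d1 (flipset T s)) = 0"
 shows "hads as (diag d2 (hads as (diag z (hads as (diag d1 (hads as (ket s)))))))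
    = (\<lambda>i. (if E then \<tau> else 1) * ket s i)"
proof -
 let ?u = "hads as (ket s)"
 have u: "?u = (\<lambda>i. if off (set as) i s then isq2 ^ length as else 0)"
  by (rule hads_ket[OF as])
 show ?thesis
 proof (cases E)
  case True
  \<comment> \<open>If the test succeeds, \<open>d1\<close> is one global factor on the
    superposition: the second round of Hadamard gates returns to \<open>ket s\<close>, where
    \<open>z\<close> contributes \<open>\<tau>\<close>, and \<open>d2\<close> cancels the factor
    later.\<close>
  have 1: "diag d1 ?u = (\<lambda>i. d1 s * ?u i)"
   using E[OF True] by (auto simp: u diag_def)
  have 2: "hads as (diag d1 ?u) = (\<lambda>i. d1 s * ket s i)"
   unfolding 1 hads_scale by (simp add: hads_hads[OF as(1)])
  have off_s: "off (set as) s s" by (simp add: off_def)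
  have 3: "diag z (hads as (diag d1 ?u)) = (\<lambda>i. (\<tau> * d1 s) * ket s i)"
   unfolding 2 using z[OF off_s] by (auto simp: diag_def ket_def)
  have 4: "diag d2 (\<lambda>i. (\<tau> * d1 s) * ?u i) = (\<lambda>i. \<tau> * ?u i)"
  proof
   fix i
   show "diag d2 (\<lambda>i. (\<tau> * d1 s) * ?u i) i = \<tau> * ?u i"
   proof (cases "off (set as) i s")
    case off: True
    then have "d1 s * d2 i = 1" using E[OF True off] inv[OF off] by simp
    then have "d2 i * (\<tau> * d1 s * ?u i) = \<tau> * ?u i"
     by (metis mult.assoc mult.commute mult_1)
    then show ?thesis by (simp add: diag_def)
   qed (simp add: diag_def u)
  qed
  show ?thesis
   unfolding 3 hads_scale 4 using True by (simp add: hads_hads[OF as(1)])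
 next
  case False
  \<comment> \<open>If the test fails, the amplitude at \<open>s\<close> vanishes exactly. As
    \<open>z\<close> is 1 at the other states that can occur, it does nothing, and the remaining
    gates cancel in pairs.\<close>
  have "hads as (diag d1 ?u) s = isq2 ^ length as * (\<Sum>T\<in>Pow (set as). diag d1 ?u (flipset T s))"
   by (rule hads_at_zero[OF as])
  also have "(\<Sum>T\<in>Pow (set as). diag d1 ?u (flipset T s)) = (\<Sum>T\<in>Pow (set as). d1 (flipset T s) * isq2 ^ length as)"
  proof (rule sum.cong)
   fix T assume "T \<in> Pow (set as)"
   then have "off (set as) (flipset T s) s"
    using finite_subset[of T "set as"] by (auto simp: off_def bit_flipset)
   then show "diag d1 ?u (flipset T s) = d1 (flipset T s) * isq2 ^ length as" by (simp add: u diag_def)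
  qed simp
  also have "... = 0" using not_E[OF False] by (simp add: sum_distrib_right[symmetric])
  finally have zero: "hads as (diag d1 ?u) s = 0" by simp
  have supp: "hads as (diag d1 ?u) i = 0" if "\<not> off (set as) i s" for i
  proof -
   have "hads qs J i = 0" if "set qs \<subseteq> set as" "\<not> off (set as) i s" "!!j. \<not> off (set as) j s ==> J j = 0" for qs J
    using that
   proof (induction qs arbitrary: J)
    case (Cons q qs)
    have "hads (q # qs) J i = hads qs (xact (XH q) J) i" by (simp add: hads_def)
    also have "... = 0"
     by (rule Cons.IH) (use Cons.prems in "auto simp: off_flipset")
    finally show ?case .
   qed (simp add: hads_def)
   then show ?thesis using that by (auto simp: diag_def u)
  qed
  have 1: "diag z (hads as (diag d1 ?u)) = hads as (diag d1 ?u)"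
  proof
   fix i
   show "diag z (hads as (diag d1 ?u)) i = hads as (diag d1 ?u) i"
    by (cases "off (set as) i s"; cases "i = s") (use zero supp z in "auto simp: diag_def")
  qed
  have 2: "diag d2 (diag d1 ?u) = ?u"
  proof
   fix i
   show "diag d2 (diag d1 ?u) i = ?u i"
   proof (cases "off (set as) i s")
    case off: True
    then have "d2 i * (d1 i * ?u i) = ?u i"
     using inv[OF off] by (metis mult.assoc mult.commute mult_1)
    then show ?thesis by (simp add: diag_def)
   qed (simp add: diag_def u)
  qed
  show ?thesis
   unfolding 1 hads_hads[OF as(1)] 2 using False by simp
 qed
qed

lemma XH_ket:
 "xact (XH y) (ket s) = (\<lambda>i. isq2 * ((if bit s y then - 1 else 1) * ket s i + ket (flipset {y} s) i))"
proof
 fix i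
 have "flipset {y} i = s \<longleftrightarrow> i = flipset {y} s" by auto
 then show "xact (XH y) (ket s) i = isq2 * ((if bit s y then - 1 else 1) * ket s i + ket (flipset {y} s) i)"
  by (auto simp: ket_def)
qed

text \<open>On the two values of \<open>y\<close> the inner circuit is the identity or, if
  \<open>E\<close> holds, a sign controlled by \<open>y\<close>. Hadamard gates on \<open>y\<close>
  around it turn this sign into a flip of \<open>y\<close>.\<close>

lemma gadget:
 assumes as: "distinct as" "!!a. a \<in> set as ==> \<not> bit s a" "y \<notin> set as"
  and inv: "!!i. off (insert y (set as)) i s ==> d1 i * d2 i = 1"
  and z: "!!i. off (insert y (set as)) i s ==> z i = (if bit i y \<and> (\<forall>a\<in>set as. \<not> bit i a) then - 1 else 1)"
  and E: "!!i s'. E ==> s' \<in> {s, flipset {y} s} ==> off (set as) i s' ==> d1 i = d1 s'"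
  and not_E: "!!s'. \<not> E ==> s' \<in> {s, flipset {y} s} ==> (\<Sum>T\<in>Pow (set as). d1 (flipset T s')) = 0"
 shows "xact (XH y) (hads as (diag d2 (hads as (diag z (hads as (diag d1 (hads as (xact (XH y) (ket s)))))))))
    = ket (if E then flipset {y} s else s)"
proof -
 let ?\<Omega> = "\<lambda>v. hads as (diag d2 (hads as (diag z (hads as (diag d1 (hads as v))))))"
 let ?s = "flipset {y} s"
 have diag_add: "diag d (\<lambda>i. J i + v i) = (\<lambda>i. diag d J i + diag d v i)" for d J v
  by (auto simp: diag_def algebra_simps)
 have diag_scale: "diag d (\<lambda>i. c * v i) = (\<lambda>i. c * diag d v i)" for d c v
  by (auto simp: diag_def)
 have lin: "?\<Omega> (\<lambda>i. c * (a * J i + v i)) = (\<lambda>i. c * (a * ?\<Omega> J i + ?\<Omega> v i))" for c a J v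
  by (simp add: hads_add hads_scale diag_add diag_scale)
 have core: "?\<Omega> (ket s') = (\<lambda>i. (if E then (if bit s' y then - 1 else 1) else 1) * ket s' i)"
  if s': "s' \<in> {s, ?s}" for s'
 proof (rule kickback[OF as(1)])
  show bs': "\<not> bit s' a" if "a \<in> set as" for a
   using that as s' by (auto simp: bit_flipset)
  have off: "off (insert y (set as)) i s" if "off (set as) i s'" for i
   using that s' by (auto simp: off_def bit_flipset)
  show "d1 i * d2 i = 1" if "off (set as) i s'" for i using inv off that by blast
  show "z i = (if i = s' then if bit s' y then - 1 else 1 else 1)" if i: "off (set as) i s'" for i
  proof -
   have "i = s' \<longleftrightarrow> (\<forall>a\<in>set as. \<not> bit i a)"
    using i bs' by (auto simp: off_def bit_eq_iff)
   moreover have "bit i y = bit s' y" using i as(3) by (auto simp: off_def)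
   ultimately show ?thesis using z[OF off[OF i]] by auto
  qed
  show "d1 i = d1 s'" if E "off (set as) i s'" for i using E that s' by blast
  show "(\<Sum>T\<in>Pow (set as). d1 (flipset T s')) = 0" if "\<not> E" using not_E that s' by blast
 qed
 have half: "isq2 * (isq2 * x) = x / 2" for x
  by (simp add: mult.assoc[symmetric] isq2_sq)
 have lin2: "xact (XH y) (\<lambda>i. c * (a * J i + b * v i)) = (\<lambda>i. c * (a * xact (XH y) J i + b * xact (XH y) v i))"
  for c a b J v
  using xact_add[of "XH y" "\<lambda>i. a * J i" "\<lambda>i. b * v i"]
  unfolding xact_scale by simp
 have e: "?\<Omega> (xact (XH y) (ket s)) = (\<lambda>i. isq2 *
   ((if bit s y then - 1 else 1) * (if E then (if bit s y then - 1 else 1) else 1) * ket s i +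
    (if E then (if bit s y then 1 else - 1) else 1) * ket ?s i))"
  unfolding XH_ket[of y s] lin core[of s, OF insertI1] core[of ?s, OF insertI2[OF singletonI]]
  by (auto simp: bit_flipset fun_eq_iff)
 show ?thesis
  unfolding e unfolding lin2 XH_ket by (auto simp: bit_flipset fun_eq_iff half algebra_simps)
qed


definition acts :: "xgate list => (nat => nat) => bool" where
 "acts gs p \<longleftrightarrow> (\<forall>v. xrun gs v = (\<lambda>i. v (p i)))"

lemma acts_append: "acts gs p ==> acts hs q ==> acts (gs @ hs) (\<lambda>i. p (q i))"
 by (simp add: acts_def)

lemma acts_fan: "acts [XF ys x] (fan ys x)"
 by (simp add: acts_def)

lemma xrun_phases:
 "xrun (map (\<lambda>q. XP (\<alpha> q) q) qs) v = diag (\<lambda>i. \<Prod>q\<leftarrow>qs. if bit i q then cis (\<alpha> q) else 1) v"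
 by (induction qs arbitrary: v) (auto simp: diag_def fun_eq_iff)

lemma acts_conj_diag:
 assumes "acts F p" "acts F' p'" "!!i. p (p' i) = i" "!!v. xrun R v = diag d v"
 shows "xrun (F @ R @ F') v = diag (\<lambda>i. d (p' i)) v"
 using assms by (simp add: acts_def diag_def)

text \<open>Conjugation by Hadamard gates exchanges control and target of a controlled-not gate.
  Four factors \<open>isq2\<close> make up the 1/4 that normalises the sums.\<close>

lemma cnot_reversal:
 assumes "b ~= c"
 shows "xrun [XH b, XH c, XF [c] b, XH c, XH b] v = (\<lambda>i. v (fan [b] c i))"
proof
 fix i
 have f1: "flipset {b} (flipset {c} j) = flipset {b, c} j" "flipset {c} (flipset {b} j) = flipset {b, c} j"
  "flipset {c} (flipset {b, c} j) = flipset {b} j" "flipset {b} (flipset {b, c} j) = flipset {c} j"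
  "flipset {b, c} (flipset {c} j) = flipset {b} j" "flipset {b, c} (flipset {b} j) = flipset {c} j" for j
  using assms by (auto simp: flipset_flipset intro!: arg_cong[where f = "\<lambda>A. flipset A j"])
 have q: "isq2 * (isq2 * (isq2 * (isq2 * x))) = x / 4" for x
 proof -
  have h: "isq2 * (isq2 * y) = y / 2" for y by (simp add: mult.assoc[symmetric] isq2_sq)
  show ?thesis by (simp only: h) simp
 qed
 have q': "isq2 * (2 * x) = 2 * (isq2 * x)" for x
  by simp
 show "xrun [XH b, XH c, XF [c] b, XH c, XH b] v i = v (fan [b] c i)"
  using assms
  by (cases "bit i b"; cases "bit i c") (simp_all add: fan_def bit_flipset f1 distrib_left right_diff_distrib q q')
qed

definition par :: "nat list => nat => nat => nat" where
 "par cs b i = (if odd (card {c \<in> set cs. bit i c}) then flipset {b} i else i)"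

lemma par_Cons:
 assumes "distinct (b # c # cs)"
 shows "par (c # cs) b i = par cs b (fan [b] c i)"
proof -
 have "{x \<in> set cs. bit (fan [b] c i) x} = {x \<in> set cs. bit i x}"
  using assms by (auto simp: bit_fan)
 moreover have "{x \<in> set (c # cs). bit i x} = (if bit i c then insert c {x \<in> set cs. bit i x} else {x \<in> set cs. bit i x})"
  by auto
 moreover have "c \<notin> {x \<in> set cs. bit i x}" using assms by auto
 ultimately show ?thesis by (auto simp: par_def fan_def)
qed

text \<open>A fan-out is a product of controlled-not gates with common control \<open>b\<close>.
  Conjugation reverses every one of them, so \<open>b\<close> receives the parity of the former
  targets; the induction peels off one target.\<close>

lemma acts_parity:
 assumes "distinct (b # cs)"
 shows "acts (map XH (b # cs) @ [XF cs b] @ map XH (b # cs)) (par cs b)"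
 using assms
proof (induction cs)
 case Nil
 have "fan [] b = (\<lambda>i. i)" by (auto simp: fan_def)
 then show ?case by (simp add: acts_def par_def XH_XH del: xact.simps(1))
next
 case (Cons c cs)
 have "xrun (map XH (b # c # cs) @ [XF (c # cs) b] @ map XH (b # c # cs)) v = (\<lambda>i. v (par (c # cs) b i))" for v
 proof -
  let ?A = "xact (XH b)" and ?C = "xact (XH c)" and ?S = "xrun (map XH cs)"
  let ?X1 = "xact (XF [c] b)" and ?X2 = "xact (XF cs b)"
  have d: "b ~= c" "b \<notin> set cs" "c \<notin> set cs" "distinct cs" using Cons.prems by auto
  have X: "xact (XF (c # cs) b) J = ?X1 (?X2 J)" for J
  proof -
   have "fan (c # cs) b i = fan cs b (fan [c] b i)" for i
    using d by (intro bit_eqI) (auto simp: bit_fan)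
   then show ?thesis by simp
  qed
  have SA: "?S (?A J) = ?A (?S J)" and SC: "?S (?C J) = ?C (?S J)" for J
   by (rule xrun_xact_commute; use d in auto)+
  have SX: "?S (?X1 J) = ?X1 (?S J)" for J
   by (rule xrun_xact_commute) (use d in auto)
  have AC: "?A (?C J) = ?C (?A J)" for J
   by (rule xact_commute) (use d in auto)
  have CX: "?C (?X2 J) = ?X2 (?C J)" for J
   by (rule xact_commute) (use d in auto)
  have IH: "?S (?A (?X2 (?S (?A J)))) = (\<lambda>i. J (par cs b i))" for J
   using Cons.IH Cons.prems by (simp add: acts_def)
  have cn: "?A (?C (?X1 (?C (?A J)))) = (\<lambda>i. J (fan [b] c i))" for J
   using cnot_reversal[OF d(1), of J] by simp
  have "xrun (map XH (b # c # cs) @ [XF (c # cs) b] @ map XH (b # c # cs)) v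
    = ?S (?C (?A (?X1 (?X2 (?S (?C (?A v)))))))"
   by (simp only: xrun_simps list.map X append.simps)
  also have "... = ?A (?C (?X1 (?S (?X2 (?C (?S (?A v)))))))"
   by (simp only: SA SC SX AC)
  also have "... = ?A (?C (?X1 (?C (?S (?X2 (?S (?A v)))))))"
   by (simp only: CX[symmetric] SC)
  \<comment> \<open>Inserting the identity \<open>?A (?A _)\<close> splits the circuit into one
    reversed controlled-not gate and an instance of the induction hypothesis.\<close>
  also have "... = ?A (?C (?X1 (?C (?A (?A (?S (?X2 (?S (?A v)))))))))"
   by (simp only: XH_XH)
  also have "?A (?S (?X2 (?S (?A v)))) = (\<lambda>i. v (par cs b i))"
   by (simp only: IH SA[symmetric])
  also have "?A (?C (?X1 (?C (?A (\<lambda>i. v (par cs b i)))))) = (\<lambda>i. v (par cs b (fan [b] c i)))"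
   by (simp only: cn)
  finally show ?thesis using par_Cons[OF Cons.prems] by simp
 qed
 then show ?case by (simp add: acts_def)
qed

section \<open>A constant-depth circuit for exact threshold gates\<close>

definition fans :: "nat => (nat => nat list) => (nat => nat) => nat => nat" where
 "fans n ys x i = flipset {q. \<exists>v<n. q \<in> set (ys v) \<and> bit i (x v)} i"

lemma bit_fans: "bit (fans n ys x i) q \<longleftrightarrow> bit i q ~= (\<exists>v<n. q \<in> set (ys v) \<and> bit i (x v))"
proof -
 have "finite {q. \<exists>v<n. q \<in> set (ys v) \<and> bit i (x v)}"
  by (rule finite_subset[of _ "\<Union>v<n. set (ys v)"]) auto
 then show ?thesis by (auto simp: fans_def bit_flipset)
qed

lemma acts_fans:
 assumes "!!v w. v < n ==> w < n ==> x v \<notin> set (ys w)"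
  and "!!v w q. v < n ==> w < n ==> q \<in> set (ys v) ==> q \<in> set (ys w) ==> v = w"
 shows "acts (map (\<lambda>v. XF (ys v) (x v)) [0..<n]) (fans n ys x)"
 using assms
proof (induction n)
 case 0
 have "fans 0 ys x = (\<lambda>i. i)" by (auto simp: fans_def)
 then show ?case by (simp add: acts_def)
next
 case (Suc n)
 have eq: "fans n ys x (fan (ys n) (x n) i) = fans (Suc n) ys x i" for i
 proof (rule bit_eqI)
  fix q
  have 1: "bit (fan (ys n) (x n) i) (x v) = bit i (x v)" if "v < n" for v
   using Suc.prems(1)[of v n] that by (simp add: bit_fan)
  have 2: "\<not> (q \<in> set (ys n) \<and> (\<exists>v<n. q \<in> set (ys v)))"
   using Suc.prems(2)[of n _ q] by (metis lessI less_SucI less_irrefl)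
  show "bit (fans n ys x (fan (ys n) (x n) i)) q = bit (fans (Suc n) ys x i) q"
   using 1 2 by (auto simp: bit_fans bit_fan less_Suc_eq)
 qed
 have "acts (map (\<lambda>v. XF (ys v) (x v)) [0..<n]) (fans n ys x)"
  by (rule Suc.IH; use Suc.prems in "meson less_SucI")
 from acts_append[OF this acts_fan[of "ys n" "x n"]] show ?case
  by (simp add: eq)
qed

lemma fans_fans:
 assumes "!!v w. v < n ==> w < n ==> x v \<notin> set (ys w)"
 shows "fans n ys x (fans n ys x i) = i"
proof (rule bit_eqI)
 fix q
 have "bit (fans n ys x i) (x v) = bit i (x v)" if "v < n" for v
  using assms that by (auto simp: bit_fans)
 then have "(\<exists>v<n. q \<in> set (ys v) \<and> bit (fans n ys x i) (x v)) = (\<exists>v<n. q \<in> set (ys v) \<and> bit i (x v))"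
  by blast
 then show "bit (fans n ys x (fans n ys x i)) q = bit i q"
  unfolding bit_fans[of n ys x "fans n ys x i" q] by (auto simp: bit_fans)
qed

definition pars :: "nat => (nat => nat list) => (nat => nat) => nat => nat" where
 "pars n cs b i = flipset {q. \<exists>v<n. q = b v \<and> odd (card {c \<in> set (cs v). bit i c})} i"

lemma bit_pars: "bit (pars n cs b i) q \<longleftrightarrow> bit i q ~= (\<exists>v<n. q = b v \<and> odd (card {c \<in> set (cs v). bit i c}))"
proof -
 have "finite {q. \<exists>v<n. q = b v \<and> odd (card {c \<in> set (cs v). bit i c})}"
  by (rule finite_subset[of _ "b ` {..<n}"]) auto
 then show ?thesis by (auto simp: pars_def bit_flipset)
qed

lemma bit_par: "bit (par cs b i) q \<longleftrightarrow> bit i q ~= (q = b \<and> odd (card {c \<in> set cs. bit i c}))"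
 by (auto simp: par_def bit_flipset)

text \<open>All parities are formed at once in the three stages Hadamard, fan-out, Hadamard;
  regrouping the stages by \<open>v\<close> reduces this to single parities.\<close>

lemma acts_pars:
 assumes "!!v. v < n ==> distinct (b v # cs v)"
  and disj: "!!v w. v < n ==> w < n ==> v ~= w ==> set (b v # cs v) \<inter> set (b w # cs w) = {}"
 shows "acts (concat (map (\<lambda>v. map XH (b v # cs v)) [0..<n]) @ map (\<lambda>v. XF (cs v) (b v)) [0..<n] @
   concat (map (\<lambda>v. map XH (b v # cs v)) [0..<n])) (pars n cs b)"
proof -
 define f where "f l v = (if l = (1::nat) then [XF (cs v) (b v)] else map XH (b v # cs v))" for l v
 have f: "f 0 = (\<lambda>v. map XH (b v # cs v))" "f (Suc 0) = (\<lambda>v. [XF (cs v) (b v)])"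
  "f (Suc (Suc 0)) = (\<lambda>v. map XH (b v # cs v))"
  by (auto simp: f_def)
 have "concat (map (\<lambda>v. map XH (b v # cs v)) [0..<n]) @ map (\<lambda>v. XF (cs v) (b v)) [0..<n] @
   concat (map (\<lambda>v. map XH (b v # cs v)) [0..<n])
   = concat (map (\<lambda>l. concat (map (f l) [0..<n])) [0..<3])"
  by (simp add: f numeral_3_eq_3 concat_map_singleton)
 also have "xrun ... J = xrun (concat (map (\<lambda>v. concat (map (\<lambda>l. f l v) [0..<3])) [0..<n])) J" for J
  by (rule xrun_groups) (use disj in "fastforce simp: f_def split: if_splits")
 moreover have "acts (concat (map (\<lambda>v. concat (map (\<lambda>l. f l v) [0..<3])) [0..<k])) (pars k cs b)" if "k <= n" for k
  using that
 proof (induction k)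
  case 0
  have "pars 0 cs b = (\<lambda>i. i)" by (auto simp: pars_def)
  then show ?case by (simp add: acts_def)
 next
  case (Suc k)
  have eq: "pars k cs b (par (cs k) (b k) i) = pars (Suc k) cs b i" for i
  proof (rule bit_eqI)
   fix q
   have 1: "{c \<in> set (cs v). bit (par (cs k) (b k) i) c} = {c \<in> set (cs v). bit i c}" if "v < k" for v
    using disj[of v k] that Suc.prems by (auto simp: bit_par)
   have 2: "\<not> (q = b k \<and> (\<exists>v<k. q = b v))"
   proof
    assume "q = b k \<and> (\<exists>v<k. q = b v)"
    then obtain v where "v < k" "b k = b v" by auto
    with disj[of k v] Suc.prems show False by auto
   qed
   show "bit (pars k cs b (par (cs k) (b k) i)) q = bit (pars (Suc k) cs b i) q"
    using 1 2 by (auto simp: bit_pars bit_par less_Suc_eq)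
  qed
  have "acts (concat (map (\<lambda>l. f l k) [0..<3])) (par (cs k) (b k))"
   using acts_parity[OF assms(1)[of k]] Suc.prems by (simp add: f_def numeral_3_eq_3)
  from acts_append[OF Suc.IH this] Suc.prems show ?case by (simp add: eq)
 qed
 ultimately show ?thesis by (simp add: acts_def)
qed

lemma pars_pars:
 assumes "!!v w. v < n ==> w < n ==> b v \<notin> set (cs w)"
 shows "pars n cs b (pars n cs b i) = i"
proof (rule bit_eqI)
 fix q
 have "{c \<in> set (cs v). bit (pars n cs b i) c} = {c \<in> set (cs v). bit i c}" if "v < n" for v
  using assms that by (auto simp: bit_pars)
 then have "(\<exists>v<n. q = b v \<and> odd (card {c \<in> set (cs v). bit (pars n cs b i) c}))
   = (\<exists>v<n. q = b v \<and> odd (card {c \<in> set (cs v). bit i c}))"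
  by auto
 then show "bit (pars n cs b (pars n cs b i)) q = bit i q"
  unfolding bit_pars[of n cs b "pars n cs b i" q] by (auto simp: bit_pars)
qed


lemma prod_list_concat: "prod_list (map f (concat (map g [0..<n]))) = (\<Prod>v<n. prod_list (map f (g v)))"
 by (induction n) auto

lemma prod_cis: "(\<Prod>v<(n::nat). cis (f v)) = cis (\<Sum>v<n. f v)"
 by (induction n) (auto simp: cis_mult)

definition odd_overlap :: "nat => nat => (nat => bool) => bool" where
 "odd_overlap K T a \<longleftrightarrow> odd (card {k. k < K \<and> bit T k \<and> a k})"

text \<open>A nontrivial character of the group of bit strings sums to zero: flipping digit
  \<open>k\<close> of \<open>T\<close> is a bijection that reverses the sign of every term.\<close>

lemma sum_odd_overlap:
 assumes "k < K" "a k"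
 shows "(\<Sum>T<2 ^ K. if odd_overlap K T a then - 1 else 1 :: real) = 0"
proof -
 let ?f = "\<lambda>T. if odd_overlap K T a then - 1 else 1 :: real"
 have flip: "?f (flipset {k} T) = - ?f T" for T
 proof -
  let ?A = "{j. j < K \<and> bit T j \<and> a j \<and> j ~= k}"
  have fin: "finite ?A" by (rule finite_subset[of _ "{..<K}"]) auto
  have "{j. j < K \<and> bit T j \<and> a j} = (if bit T k then insert k ?A else ?A)"
   "{j. j < K \<and> bit (flipset {k} T) j \<and> a j} = (if bit T k then ?A else insert k ?A)"
   using assms by (auto simp: bit_flipset)
  then show ?thesis using fin by (auto simp: odd_overlap_def)
 qed
 have "(\<Sum>T<2 ^ K. ?f T) = (\<Sum>T<2 ^ K. ?f (flipset {k} T))"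
  by (rule sum.reindex_bij_betw[symmetric, OF bij_flipset]) (use assms in auto)
 then show ?thesis unfolding flip sum_negf by linarith
qed


fun to_xgate :: "(nat => real) => gate => xgate" where
 "to_xgate ang (Hadamard q) = XH q"
| "to_xgate ang (Rotation q) = XP (ang q) q"
| "to_xgate ang (Cnot c t) = XF [t] c"
| "to_xgate ang (Fanout ys x) = XF ys x"

lemma xqubits_to_xgate: "xqubits (to_xgate ang g) = set (gate_qubits g)"
 by (cases g) auto

text \<open>
 A layer of gates \<open>i < G\<close>, each flipping \<open>tgt i\<close> if the wires \<open>v < W\<close> satisfy
 \<open>(\<Sum>v<W. cf i v * x\<^sub>v) = tf i\<close>.  Ancilla \<open>anc 0 i k 0 0\<close> receives the phase
 \<open>\<pi> / 2 ^ k * (t - w)\<close>, which is an odd multiple of \<open>\<pi>\<close> for some \<open>k\<close> unless \<open>w = t\<close>.  The or of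
 these ancillas is the normalised sum of all their parities, held by \<open>anc 8 i 0 T 0\<close>.
 A rotation by \<open>\<pm> \<pi> / 2 ^ (k + 1)\<close> is spread over \<open>rp k\<close> or \<open>rm k\<close> copies of a qubit.
\<close>

locale exact_layer =
 fixes G K W :: nat and cf :: "nat => nat => nat" and tf wire tgt :: "nat => nat"
  and anc :: "nat => nat => nat => nat => nat => nat" and rp rm :: "nat => nat"
begin

definition block :: "nat => nat => nat => nat => nat => nat list" where
 "block t i k v n = map (anc t i k v) [0..<n]"

text \<open>Blocks of type 1 hold \<open>x xor a\<close>, where \<open>a\<close> is the value of
  \<open>A i k\<close>, and rotate by a positive angle; types 2 and 3 hold \<open>a\<close> and
  rotate by negative and positive angles. Since \<open>(x xor a) - a\<close> is \<open>x\<close> or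
  \<open>- x\<close>, setting \<open>a\<close> changes the phase from \<open>w\<close> to
  \<open>2 * tf i - w\<close> units of \<open>\<pi> / 2 ^ (k + 1)\<close>. The difference,
  \<open>2 * (tf i - w)\<close> units, is the kickback; this is why the target is doubled and the
  angle halved.\<close>

definition P1 :: "nat => nat => nat list" where
 "P1 i k = concat (map (\<lambda>v. block 1 i k v (cf i v * rp k) @ block 2 i k v (cf i v * rm k)) [0..<W]) @
   block 3 i k 0 (2 * tf i * rp k)"

text \<open>The inverse phase. A qubit has one fixed rotation angle, so opposite signs need blocks
  of their own; types 4, 5, 6 mirror 1, 2, 3.\<close>

definition P2 :: "nat => nat => nat list" where
 "P2 i k = concat (map (\<lambda>v. block 4 i k v (cf i v * rm k) @ block 5 i k v (cf i v * rp k)) [0..<W]) @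
   block 6 i k 0 (2 * tf i * rm k)"

definition A :: "nat => nat => nat" where
 "A i k = anc 0 i k 0 0"

definition Bq :: "nat => nat => nat" where
 "Bq i T = anc 8 i 0 T 0"

text \<open>Qubit \<open>anc 7 i k T 0\<close> is a copy of \<open>A i k\<close> made for the parity
  of the subset \<open>T\<close>. The same qubits are listed by their source in \<open>C1\<close>
  and by the parity that consumes them in \<open>C2\<close>.\<close>

definition C1 :: "nat => nat => nat list" where
 "C1 i k = concat (map (\<lambda>T. if bit T k then [anc 7 i k T 0] else []) [0..<2 ^ K])"

definition C2 :: "nat => nat => nat list" where
 "C2 i T = concat (map (\<lambda>k. if bit T k then [anc 7 i k T 0] else []) [0..<K])"

text \<open>\<open>D1\<close> gets the parity and \<open>D2\<close> the parity xor the target, with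
  opposite angles \<open>\<pi> / 2 ^ K\<close>. If the target is 0, both phases cancel; if it is 1,
  the exponent is minus the character sum over all \<open>T\<close>, times
  \<open>\<pi> / 2 ^ K\<close>.\<close>

definition D1 :: "nat => nat => nat list" where
 "D1 i T = block 9 i 0 T (rp (K - 1))"

definition D2 :: "nat => nat => nat list" where
 "D2 i T = block 10 i 0 T (rm (K - 1))"

definition copies :: "nat => nat list" where
 "copies v = concat (map (\<lambda>i. concat (map (\<lambda>k. block 1 i k v (cf i v * rp k) @ block 4 i k v (cf i v * rm k)) [0..<K])) [0..<G])"

definition copy_layer :: "gate list" where
 "copy_layer = map (\<lambda>v. Fanout (copies v) (wire v)) [0..<W]"

definition HA :: "nat => gate list" where
 "HA i = map (\<lambda>k. Hadamard (A i k)) [0..<K]"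

definition HYA :: "nat => gate list" where
 "HYA i = Hadamard (tgt i) # HA i"

definition FA :: "nat => gate list" where
 "FA i = map (\<lambda>k. Fanout (P1 i k @ P2 i k) (A i k)) [0..<K]"

definition R1 :: "nat => gate list" where
 "R1 i = concat (map (\<lambda>k. map Rotation (P1 i k)) [0..<K])"

definition R2 :: "nat => gate list" where
 "R2 i = concat (map (\<lambda>k. map Rotation (P2 i k)) [0..<K])"

definition FC :: "nat => gate list" where
 "FC i = map (\<lambda>k. Fanout (C1 i k) (A i k)) [0..<K]"

definition HB :: "nat => gate list" where
 "HB i = concat (map (\<lambda>T. map Hadamard (Bq i T # C2 i T)) [0..<2 ^ K])"

definition FB :: "nat => gate list" where
 "FB i = map (\<lambda>T. Fanout (C2 i T) (Bq i T)) [0..<2 ^ K]"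

definition FD :: "nat => gate list" where
 "FD i = map (\<lambda>T. Fanout (D1 i T @ D2 i T) (Bq i T)) [0..<2 ^ K]"

definition FY :: "nat => gate list" where
 "FY i = [Fanout (concat (map (D2 i) [0..<2 ^ K])) (tgt i)]"

definition RD :: "nat => gate list" where
 "RD i = concat (map (\<lambda>T. map Rotation (D1 i T @ D2 i T)) [0..<2 ^ K])"

text \<open>The list is a palindrome except that \<open>R2\<close> stands opposite to
  \<open>R1\<close>: everything that is computed into ancillas is also uncomputed, and the phase of
  \<open>R1\<close> is taken back.\<close>

definition stages :: "(nat => gate list) list" where
 "stages = [HYA, FA, R1, FA, HA, FC, HB, FB, HB, FD, FY, RD, FY, FD, HB, FB, HB, FC, HA, FA, R2, FA, HYA]"

definition layers :: "gate list list" where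
 "layers = copy_layer # map (\<lambda>f. concat (map f [0..<G])) stages @ [copy_layer]"

end


lemma flipset_insert: "finite S ==> a \<notin> S ==> flipset {a} (flipset S j) = flipset (insert a S) j"
 by (rule bit_eqI) (auto simp: bit_flipset)

lemma cis_of_nat_mult: "cis x = cis y ==> cis (of_nat c * x) = cis (of_nat c * y)"
 by (metis Complex.DeMoivre)

text \<open>Applied to the distance of weighted sum and target: \<open>K\<close> angles suffice
  because the 2-adic valuation of a nonzero number below \<open>2 ^ K\<close> is below
  \<open>K\<close>, and with that \<open>k\<close> the phase is an odd multiple of
  \<open>\<pi>\<close>.\<close>

lemma exists_odd_part: "0 < d ==> d < 2 ^ K ==> \<exists>k<K. \<exists>m. odd m \<and> d = 2 ^ k * (m::nat)"
proof (induction K arbitrary: d)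
 case (Suc K)
 show ?case
 proof (cases "odd d")
  case True
  then show ?thesis by (intro exI[of _ 0]) auto
 next
  case False
  then obtain e where e: "d = 2 * e" by auto
  with Suc.prems Suc.IH[of e] obtain k m where "k < K" "odd m" "e = 2 ^ k * m" by auto
  with e show ?thesis by (intro exI[of _ "Suc k"]) auto
 qed
qed simp

lemma cis_odd_pi: "odd m ==> cis (pi * of_nat m) = - 1"
proof -
 assume "odd m"
 have "cis (pi * of_nat m) = cis pi ^ m" by (metis Complex.DeMoivre mult.commute)
 with \<open>odd m\<close> show ?thesis by simp
qed

lemma sum_Pow_prod:
 fixes f :: "nat => complex"
 assumes "finite B"
 shows "(\<Sum>T\<in>Pow B. \<Prod>b\<in>B. if b \<in> T then f b else 1) = (\<Prod>b\<in>B. 1 + f b)"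
proof -
 have "(\<Prod>b\<in>B. if b \<in> T then f b else 1) = prod f T" if "T \<in> Pow B" for T
  using that assms by (simp add: prod.inter_restrict[symmetric] Int_absorb1)
 moreover have "(\<Prod>b\<in>B. 1 + f b) = (\<Sum>T\<in>Pow B. prod f T)"
  using prod_add[OF assms, of f "\<lambda>_. 1"] by (simp add: add.commute)
 ultimately show ?thesis by simp
qed


text \<open>The ideal angles \<open>ap k\<close> and \<open>am k\<close> are constrained only
  through bundles: \<open>rp k\<close> (or \<open>rm k\<close>) equal rotations must compose to
  \<open>\<pi> / 2 ^ Suc k\<close> (or its negative). This freedom permits ideal angles very close
  to the irrational angle of the basis.\<close>

locale exact_layer_sem = exact_layer +
 fixes ap am :: "nat => real" and ang :: "nat => real"
 assumes anc_eq: "!!t i k v u t' i' k' v' u'. anc t i k v u = anc t' i' k' v' u' \<longleftrightarrow>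
   t = t' \<and> i = i' \<and> k = k' \<and> v = v' \<and> u = u'"
  and wire_anc: "!!v t i k v' u. wire v ~= anc t i k v' u"
  and tgt_anc: "!!j t i k v u. tgt j ~= anc t i k v u"
  and tgt_inj: "!!i j. i < G ==> j < G ==> tgt i = tgt j ==> i = j"
  and wire_inj: "!!v w. v < W ==> w < W ==> wire v = wire w ==> v = w"
  and tgt_wire: "!!i v. i < G ==> v < W ==> tgt i ~= wire v"
  and K_pos: "0 < K"
  and weight_bound: "!!i. i < G ==> (\<Sum>v<W. cf i v) < 2 ^ K"
  and target_bound: "!!i. i < G ==> tf i < 2 ^ K"
  and angp: "!!k. k < K ==> cis (of_nat (rp k) * ap k) = cis (pi / 2 ^ Suc k)"
  and angm: "!!k. k < K ==> cis (of_nat (rm k) * am k) = cis (- (pi / 2 ^ Suc k))"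
  and ang: "!!i k v u. ang (anc 1 i k v u) = ap k" "!!i k v u. ang (anc 2 i k v u) = am k"
   "!!i k v u. ang (anc 3 i k v u) = ap k" "!!i k v u. ang (anc 4 i k v u) = am k"
   "!!i k v u. ang (anc 5 i k v u) = ap k" "!!i k v u. ang (anc 6 i k v u) = am k"
   "!!i v u. ang (anc 9 i 0 v u) = ap (K - 1)" "!!i v u. ang (anc 10 i 0 v u) = am (K - 1)"
begin

abbreviation run :: "gate list => state => state" where
 "run gs \<equiv> xrun (map (to_xgate ang) gs)"

lemma set_block: "q \<in> set (block t i k v n) \<longleftrightarrow> (\<exists>u<n. q = anc t i k v u)"
 by (auto simp: block_def)

definition phase :: "nat => nat list => complex" where
 "phase j qs = (\<Prod>q\<leftarrow>qs. if bit j q then cis (ang q) else 1)"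

lemma phase_append: "phase j (qs @ rs) = phase j qs * phase j rs"
 by (simp add: phase_def)

lemma phase_concat: "phase j (concat (map g [0..<n])) = (\<Prod>v<n. phase j (g v))"
 unfolding phase_def by (rule prod_list_concat)

lemma phase_block:
 assumes "!!u. u < c * r ==> bit j (anc t i k v u) = Y" "!!u. ang (anc t i k v u) = \<theta>"
  "cis (of_nat r * \<theta>) = cis \<alpha>"
 shows "phase j (block t i k v (c * r)) = cis (of_bool Y * of_nat c * \<alpha>)"
proof -
 have "phase j (block t i k v n) = (if Y then cis \<theta> else 1) ^ n" if "n <= c * r" for n
  using that
 proof (induction n)
  case (Suc n)
  have "phase j (block t i k v (Suc n)) = phase j (block t i k v n) * (if Y then cis \<theta> else 1)"
   using assms Suc.prems by (simp add: phase_def block_def)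
  then show ?case using Suc by simp
 qed (simp add: phase_def block_def)
 from this[of "c * r"] have "phase j (block t i k v (c * r)) = (if Y then cis \<theta> else 1) ^ (c * r)" by simp
 also have "... = (if Y then cis (of_nat c * (of_nat r * \<theta>)) else 1)"
  by (simp add: Complex.DeMoivre mult.assoc)
 also have "... = cis (of_bool Y * of_nat c * \<alpha>)"
  using cis_of_nat_mult[OF assms(3), of c] by simp
 finally show ?thesis .
qed

definition \<alpha> :: "nat => real" where
 "\<alpha> k = pi / 2 ^ Suc k"

lemma phase_block_angle:
 assumes "!!u. u < c * rp k ==> bit j (anc t i l v u) = Y" "!!u. ang (anc t i l v u) = ap k" "k < K"
 shows "phase j (block t i l v (c * rp k)) = cis (of_bool Y * of_nat c * \<alpha> k)"
 using assms by (intro phase_block) (auto simp: \<alpha>_def angp)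

lemma phase_block_minus_angle:
 assumes "!!u. u < c * rm k ==> bit j (anc t i l v u) = Y" "!!u. ang (anc t i l v u) = am k" "k < K"
 shows "phase j (block t i l v (c * rm k)) = cis (of_bool Y * of_nat c * (- \<alpha> k))"
 using assms by (intro phase_block) (auto simp: \<alpha>_def angm)

lemma run_rotations: "run (map Rotation qs) J = diag (\<lambda>j. phase j qs) J"
 using xrun_phases[of ang qs J] by (simp add: o_def phase_def)

text \<open>\<open>s\<close> is a basis state in which gate \<open>i\<close> starts: the copy layer
  has filled types 1 and 4 with copies of the wires, and all other ancillas of gate \<open>i\<close>
  are zero.\<close>

context
 fixes i s :: nat and x :: "nat => bool"
 assumes i: "i < G"
  and x: "!!v. v < W ==> bit s (wire v) = x v"
  and clean: "!!t k v u. bit s (anc t i k v u) \<longleftrightarrow> k < K \<and> v < W \<and> x v \<and>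
    (t = 1 \<and> u < cf i v * rp k \<or> t = 4 \<and> u < cf i v * rm k)"
begin

definition as :: "nat list" where
 "as = map (A i) [0..<K]"

abbreviation "y \<equiv> tgt i"

definition w :: nat where
 "w = (\<Sum>v<W. cf i v * of_bool (x v))"

abbreviation close :: "nat => bool" where
 "close j \<equiv> off (insert y (set as)) j s"

lemma A_eq: "A i k = A i l \<longleftrightarrow> k = l"
 by (auto simp: A_def anc_eq)

lemma set_as: "q \<in> set as \<longleftrightarrow> (\<exists>k<K. q = A i k)"
 by (auto simp: as_def)

lemma distinct_as: "distinct as"
 by (auto simp: as_def distinct_map inj_on_def A_eq)

lemma y_not_as: "y \<notin> set as"
 by (auto simp: set_as A_def tgt_anc)

lemma close_anc: "close j ==> t ~= 0 ==> bit j (anc t i k v u) = bit s (anc t i k v u)"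
proof -
 assume c: "close j" and t: "t ~= 0"
 have "anc t i k v u \<notin> insert y (set as)"
  using t tgt_anc[of i t i k v u] by (auto simp: set_as A_def anc_eq)
 with c show ?thesis by (simp add: off_def)
qed

definition fA :: "nat => nat" where
 "fA = fans K (\<lambda>k. P1 i k @ P2 i k) (A i)"

lemma set_P: "q \<in> set (P1 i k @ P2 i k) \<longleftrightarrow>
  (\<exists>v<W. \<exists>u. q = anc 1 i k v u \<and> u < cf i v * rp k \<or> q = anc 2 i k v u \<and> u < cf i v * rm k \<or>
       q = anc 4 i k v u \<and> u < cf i v * rm k \<or> q = anc 5 i k v u \<and> u < cf i v * rp k) \<or>
  (\<exists>u. q = anc 3 i k 0 u \<and> u < 2 * tf i * rp k \<or> q = anc 6 i k 0 u \<and> u < 2 * tf i * rm k)"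
 unfolding P1_def P2_def set_append set_concat Un_iff set_block by (auto simp: set_block)

lemma bit_fA:
 assumes "close j" "k < K"
 shows "v < W ==> u < cf i v * rp k ==> bit (fA j) (anc 1 i k v u) = (x v ~= bit j (A i k))"
  and "v < W ==> u < cf i v * rm k ==> bit (fA j) (anc 2 i k v u) = bit j (A i k)"
  and "u < 2 * tf i * rp k ==> bit (fA j) (anc 3 i k 0 u) = bit j (A i k)"
  and "v < W ==> u < cf i v * rm k ==> bit (fA j) (anc 4 i k v u) = (x v ~= bit j (A i k))"
  and "v < W ==> u < cf i v * rp k ==> bit (fA j) (anc 5 i k v u) = bit j (A i k)"
  and "u < 2 * tf i * rm k ==> bit (fA j) (anc 6 i k 0 u) = bit j (A i k)"
 unfolding fA_def bit_fans set_P using assms(2)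
 by (auto simp: anc_eq close_anc[OF assms(1)] clean)

lemma run_FA: "acts (map (to_xgate ang) (FA i)) fA"
proof -
 have "map (to_xgate ang) (FA i) = map (\<lambda>k. XF (P1 i k @ P2 i k) (A i k)) [0..<K]"
  by (simp add: FA_def)
 moreover have "acts (map (\<lambda>k. XF (P1 i k @ P2 i k) (A i k)) [0..<K]) fA"
  unfolding fA_def by (rule acts_fans) (unfold set_P A_def, auto simp: anc_eq)
 ultimately show ?thesis by simp
qed

lemma fA_fA: "fA (fA j) = j"
 unfolding fA_def by (rule fans_fans) (unfold set_P A_def, auto simp: anc_eq)

definition d1 :: "nat => complex" where
 "d1 j = phase (fA j) (concat (map (P1 i) [0..<K]))"

definition d2 :: "nat => complex" where
 "d2 j = phase (fA j) (concat (map (P2 i) [0..<K]))"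

lemma run_R: "run (FA i @ R1 i @ FA i) J = diag d1 J" "run (FA i @ R2 i @ FA i) J = diag d2 J"
proof -
 have R: "R1 i = map Rotation (concat (map (P1 i) [0..<K]))" "R2 i = map Rotation (concat (map (P2 i) [0..<K]))"
  by (simp_all add: R1_def R2_def map_concat o_def)
 show "run (FA i @ R1 i @ FA i) J = diag d1 J" "run (FA i @ R2 i @ FA i) J = diag d2 J"
  using acts_conj_diag[OF run_FA run_FA fA_fA run_rotations] unfolding R d1_def d2_def by simp_all
qed

text \<open>The sign trick behind the phases: \<open>(x xor a) - a\<close> equals \<open>x\<close>
  for \<open>a = 0\<close> and \<open>- x\<close> for \<open>a = 1\<close>, so an ancilla controls a
  linear phase although only single-qubit rotations are applied.\<close>

lemma weights: "(\<Sum>v<W. real (cf i v) * (of_bool (x v ~= a) - of_bool a)) = (if a then - real w else real w)"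
proof -
 have "real (cf i v) * (of_bool (x v ~= a) - of_bool a) = (if a then - 1 else 1) * real (cf i v * of_bool (x v))" for v
  by (cases "x v") auto
 then show ?thesis
  by (simp only: w_def of_nat_sum sum_distrib_left[symmetric]) simp
qed

lemma phase_P1:
 assumes "close j" "k < K"
 shows "phase (fA j) (P1 i k) = cis (\<alpha> k * w) * (if bit j (A i k) then cis (2 * \<alpha> k * (real (tf i) - real w)) else 1)"
proof -
 let ?a = "bit j (A i k)"
 have "phase (fA j) (P1 i k) = (\<Prod>v<W. cis (of_bool (x v ~= ?a) * real (cf i v) * \<alpha> k) * cis (of_bool ?a * real (cf i v) * (- \<alpha> k)))
   * cis (of_bool ?a * real (2 * tf i) * \<alpha> k)"
  unfolding P1_def phase_append phase_concat
  by (intro arg_cong2[where f = "(*)"] prod.cong phase_block_angle phase_block_minus_angle refl ang bit_fA assms) auto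
 also have "... = cis (\<alpha> k * (\<Sum>v<W. real (cf i v) * (of_bool (x v ~= ?a) - of_bool ?a)) + of_bool ?a * real (2 * tf i) * \<alpha> k)"
  by (simp add: cis_mult prod_cis sum_distrib_left algebra_simps)
 also have "... = cis (\<alpha> k * w) * (if ?a then cis (2 * \<alpha> k * (real (tf i) - real w)) else 1)"
  unfolding weights by (simp add: cis_mult algebra_simps)
 finally show ?thesis .
qed

lemma phase_P2:
 assumes "close j" "k < K"
 shows "phase (fA j) (P2 i k) = cis (- (\<alpha> k * w)) * (if bit j (A i k) then cis (- (2 * \<alpha> k * (real (tf i) - real w))) else 1)"
proof -
 let ?a = "bit j (A i k)"
 have "phase (fA j) (P2 i k) = (\<Prod>v<W. cis (of_bool (x v ~= ?a) * real (cf i v) * (- \<alpha> k)) * cis (of_bool ?a * real (cf i v) * \<alpha> k))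
   * cis (of_bool ?a * real (2 * tf i) * (- \<alpha> k))"
  unfolding P2_def phase_append phase_concat
  by (intro arg_cong2[where f = "(*)"] prod.cong phase_block_angle phase_block_minus_angle refl ang bit_fA assms) auto
 also have "... = cis (- (\<alpha> k * (\<Sum>v<W. real (cf i v) * (of_bool (x v ~= ?a) - of_bool ?a)) + of_bool ?a * real (2 * tf i) * \<alpha> k))"
  by (simp add: cis_mult prod_cis sum_distrib_left algebra_simps sum_negf[symmetric])
 also have "... = cis (- (\<alpha> k * w)) * (if ?a then cis (- (2 * \<alpha> k * (real (tf i) - real w))) else 1)"
  unfolding weights by (simp add: cis_mult algebra_simps)
 finally show ?thesis .
qed

lemma d1_eq:
 "close j ==> d1 j = (\<Prod>k<K. cis (\<alpha> k * w)) * (\<Prod>k<K. if bit j (A i k) then cis (2 * \<alpha> k * (real (tf i) - real w)) else 1)"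
 unfolding d1_def phase_concat by (simp add: phase_P1 prod.distrib)

lemma d1_d2: "close j ==> d1 j * d2 j = 1"
 unfolding d1_def d2_def phase_concat prod.distrib[symmetric]
 by (rule prod.neutral) (auto simp: phase_P1 phase_P2 cis_mult)

text \<open>The phase is a product over the ancillas, so its sum over all their states factors into
  the terms \<open>1 + Y k\<close>. For the \<open>k\<close> given by the valuation of the distance,
  \<open>Y k = - 1\<close> and the product vanishes.\<close>

lemma d1_sum:
 assumes "w ~= tf i" "s' \<in> {s, flipset {y} s}"
 shows "(\<Sum>T\<in>Pow (set as). d1 (flipset T s')) = 0"
proof -
 define Y where "Y k = cis (2 * \<alpha> k * (real (tf i) - real w))" for k
 define Y' where "Y' q = Y (the_inv_into {..<K} (A i) q)" for q
 have inj: "inj_on (A i) {..<K}" by (auto simp: inj_on_def A_eq)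
 have Y': "Y' (A i k) = Y k" if "k < K" for k
  using the_inv_into_f_f[OF inj] that by (simp add: Y'_def)
 have as_img: "set as = A i ` {..<K}" by (auto simp: as_def)
 have "d1 (flipset T s') = (\<Prod>k<K. cis (\<alpha> k * w)) * (\<Prod>q\<in>set as. if q \<in> T then Y' q else 1)"
  if T: "T \<in> Pow (set as)" for T
 proof -
  have fin: "finite T" using T finite_subset by auto
  have "\<not> bit s' (A i k)" for k
   using assms(2) by (auto simp: A_def clean bit_flipset tgt_anc[symmetric])
  then have 1: "bit (flipset T s') (A i k) = (A i k \<in> T)" for k using fin by (simp add: bit_flipset)
  have "close (flipset T s')"
   using assms(2) T fin by (auto simp: off_def bit_flipset)
  then have "d1 (flipset T s') = (\<Prod>k<K. cis (\<alpha> k * w)) * (\<Prod>k<K. if A i k \<in> T then Y k else 1)"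
   unfolding Y_def by (simp only: d1_eq 1)
  also have "(\<Prod>k<K. if A i k \<in> T then Y k else 1) = (\<Prod>q\<in>set as. if q \<in> T then Y' q else 1)"
   unfolding as_img prod.reindex[OF inj] o_def by (rule prod.cong) (auto simp: Y')
  finally show ?thesis .
 qed
 then have "(\<Sum>T\<in>Pow (set as). d1 (flipset T s'))
   = (\<Prod>k<K. cis (\<alpha> k * w)) * (\<Sum>T\<in>Pow (set as). \<Prod>q\<in>set as. if q \<in> T then Y' q else 1)"
  by (simp add: sum_distrib_left)
 also have "(\<Sum>T\<in>Pow (set as). \<Prod>q\<in>set as. if q \<in> T then Y' q else 1) = (\<Prod>q\<in>set as. 1 + Y' q)"
  by (rule sum_Pow_prod) simp
 also have "(\<Prod>q\<in>set as. 1 + Y' q) = (\<Prod>k<K. 1 + Y k)"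
  unfolding as_img prod.reindex[OF inj] o_def by (rule prod.cong) (auto simp: Y')
 also have "(\<Prod>k<K. 1 + Y k) = 0"
 proof -
  have w_less: "w < 2 ^ K"
  proof -
   have "w <= (\<Sum>v<W. cf i v)" unfolding w_def by (rule sum_mono) auto
   then show ?thesis using weight_bound[OF i] by linarith
  qed
  define d where "d = (if tf i < w then w - tf i else tf i - w)"
  have "0 < d" "d < 2 ^ K" using assms(1) w_less target_bound[OF i] by (auto simp: d_def)
  then obtain k m where km: "k < K" "odd m" "d = 2 ^ k * m" using exists_odd_part by blast
  have d_eq: "real (tf i) - real w = (if tf i < w then - real d else real d)"
   by (auto simp: d_def of_nat_diff)
  have c: "cis (2 * \<alpha> k * real d) = - 1"
   using cis_odd_pi[OF km(2)] by (simp add: \<alpha>_def km(3))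
  then have "cis (- (2 * \<alpha> k * real d)) = - 1"
   by (metis cis_cnj complex_cnj_minus complex_cnj_one)
  with c have "Y k = - 1" by (auto simp: Y_def d_eq)
  then show ?thesis using km(1) by (intro prod_zero) (auto intro!: bexI[of _ k])
 qed
 finally show ?thesis by simp
qed

definition fC :: "nat => nat" where
 "fC = fans K (C1 i) (A i)"

definition pB :: "nat => nat" where
 "pB = pars (2 ^ K) (C2 i) (Bq i)"

definition fD :: "nat => nat" where
 "fD = fans (2 ^ K) (\<lambda>T. D1 i T @ D2 i T) (Bq i)"

definition fY :: "nat => nat" where
 "fY = fan (concat (map (D2 i) [0..<2 ^ K])) y"

lemma set_C1: "q \<in> set (C1 i k) \<longleftrightarrow> (\<exists>T<2 ^ K. bit T k \<and> q = anc 7 i k T 0)"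
 by (auto simp: C1_def)

lemma set_C2: "q \<in> set (C2 i T) \<longleftrightarrow> (\<exists>k<K. bit T k \<and> q = anc 7 i k T 0)"
 by (auto simp: C2_def)

lemma set_D: "q \<in> set (D1 i T @ D2 i T) \<longleftrightarrow>
  (\<exists>u. q = anc 9 i 0 T u \<and> u < rp (K - 1) \<or> q = anc 10 i 0 T u \<and> u < rm (K - 1))"
 by (auto simp: D1_def D2_def set_block)

lemma set_D2: "q \<in> set (concat (map (D2 i) [0..<2 ^ K])) \<longleftrightarrow> (\<exists>T<2 ^ K. \<exists>u<rm (K - 1). q = anc 10 i 0 T u)"
 by (auto simp: D2_def set_block)

lemma distinct_C2: "distinct (Bq i T # C2 i T)"
proof -
 have "distinct (concat (map (\<lambda>k. if bit T k then [anc 7 i k T 0] else []) [0..<n]))" for n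
  by (induction n) (auto simp: anc_eq)
 then show ?thesis by (auto simp: C2_def Bq_def anc_eq)
qed

lemma acts_FC: "acts (map (to_xgate ang) (FC i)) fC"
proof -
 have "map (to_xgate ang) (FC i) = map (\<lambda>k. XF (C1 i k) (A i k)) [0..<K]"
  by (simp add: FC_def)
 moreover have "acts (map (\<lambda>k. XF (C1 i k) (A i k)) [0..<K]) fC"
  unfolding fC_def by (rule acts_fans) (unfold set_C1 A_def, auto simp: anc_eq)
 ultimately show ?thesis by simp
qed

lemma acts_HB: "acts (map (to_xgate ang) (HB i @ FB i @ HB i)) pB"
proof -
 have "map (to_xgate ang) (HB i @ FB i @ HB i) = concat (map (\<lambda>T. map XH (Bq i T # C2 i T)) [0..<2 ^ K]) @
   map (\<lambda>T. XF (C2 i T) (Bq i T)) [0..<2 ^ K] @ concat (map (\<lambda>T. map XH (Bq i T # C2 i T)) [0..<2 ^ K])"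
  by (simp add: HB_def FB_def map_concat o_def)
 moreover have "set (Bq i T # C2 i T) \<inter> set (Bq i T' # C2 i T') = {}" if "T ~= T'" for T T'
  using that by (auto simp: Bq_def set_C2 anc_eq)
 ultimately show ?thesis
  unfolding pB_def using acts_pars[OF distinct_C2] by simp
qed

lemma acts_FD: "acts (map (to_xgate ang) (FD i)) fD"
proof -
 have "map (to_xgate ang) (FD i) = map (\<lambda>T. XF (D1 i T @ D2 i T) (Bq i T)) [0..<2 ^ K]"
  by (simp add: FD_def)
 moreover have "acts (map (\<lambda>T. XF (D1 i T @ D2 i T) (Bq i T)) [0..<2 ^ K]) fD"
  unfolding fD_def by (rule acts_fans) (unfold set_D Bq_def, auto simp: anc_eq)
 ultimately show ?thesis by simp
qed

lemma acts_FY: "acts (map (to_xgate ang) (FY i)) fY"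
 by (simp add: FY_def fY_def acts_fan)

lemma involutions: "fC (fC j) = j" "pB (pB j) = j" "fD (fD j) = j" "fY (fY j) = j"
proof -
 show "fC (fC j) = j"
  unfolding fC_def by (rule fans_fans) (unfold set_C1 A_def, auto simp: anc_eq)
 show "pB (pB j) = j"
  unfolding pB_def by (rule pars_pars) (unfold set_C2 Bq_def, auto simp: anc_eq)
 show "fD (fD j) = j"
  unfolding fD_def by (rule fans_fans) (unfold set_D Bq_def, auto simp: anc_eq)
 show "fY (fY j) = j"
  unfolding fY_def by (rule fan_fan) (unfold set_D2, auto simp: tgt_anc)
qed

definition z :: "nat => complex" where
 "z j = phase (fY (fD (pB (fC j)))) (concat (map (\<lambda>T. D1 i T @ D2 i T) [0..<2 ^ K]))"

lemma run_Z: "run (FC i @ (HB i @ FB i @ HB i) @ FD i @ FY i @ RD i @ FY i @ FD i @ (HB i @ FB i @ HB i) @ FC i) J = diag z J"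
proof -
 have 1: "acts (map (to_xgate ang) (FC i @ (HB i @ FB i @ HB i) @ FD i @ FY i)) (\<lambda>j. fC (pB (fD (fY j))))"
  unfolding map_append[of _ "FC i"] map_append[of _ "HB i @ FB i @ HB i"] map_append[of _ "FD i"]
  by (intro acts_append[OF acts_FC] acts_append[OF acts_HB] acts_append[OF acts_FD] acts_FY)
 have 2: "acts (map (to_xgate ang) (FY i @ FD i @ (HB i @ FB i @ HB i) @ FC i)) (\<lambda>j. fY (fD (pB (fC j))))"
  unfolding map_append[of _ "FY i"] map_append[of _ "HB i @ FB i @ HB i"] map_append[of _ "FD i"]
  by (intro acts_append[OF acts_FY] acts_append[OF acts_FD] acts_append[OF acts_HB] acts_FC)
 have R: "RD i = map Rotation (concat (map (\<lambda>T. D1 i T @ D2 i T) [0..<2 ^ K]))"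
  by (simp add: RD_def map_concat o_def)
 have "xrun (map (to_xgate ang) (FC i @ (HB i @ FB i @ HB i) @ FD i @ FY i) @ map (to_xgate ang) (RD i) @
   map (to_xgate ang) (FY i @ FD i @ (HB i @ FB i @ HB i) @ FC i)) J = diag z J"
  unfolding R z_def by (rule acts_conj_diag[OF 1 2 _ run_rotations]) (simp add: involutions)
 then show ?thesis by simp
qed

definition par_at :: "nat => nat => bool" where
 "par_at j T \<longleftrightarrow> odd_overlap K T (\<lambda>k. bit j (A i k))"

lemma bit_pB_fC:
 assumes "close j" "T < 2 ^ K"
 shows "bit (pB (fC j)) (Bq i T) \<longleftrightarrow> par_at j T"
proof -
 have C: "bit (fC j) (anc 7 i k T 0) = bit j (A i k)" if "k < K" "bit T k" for k
  unfolding fC_def bit_fans set_C1 using that assms(2)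
  by (auto simp: anc_eq close_anc[OF assms(1)] clean)
 have "\<not> bit (fC j) (Bq i T)"
  unfolding fC_def bit_fans set_C1 Bq_def using assms(2)
  by (auto simp: anc_eq close_anc[OF assms(1)] clean)
 moreover have "card {c \<in> set (C2 i T). bit (fC j) c} = card {k. k < K \<and> bit T k \<and> bit j (A i k)}"
 proof -
  have "{c \<in> set (C2 i T). bit (fC j) c} = (\<lambda>k. anc 7 i k T 0) ` {k. k < K \<and> bit T k \<and> bit j (A i k)}"
   by (auto simp: set_C2 C)
  moreover have "inj_on (\<lambda>k. anc 7 i k T 0) S" for S by (auto simp: inj_on_def anc_eq)
  ultimately show ?thesis by (simp add: card_image)
 qed
 ultimately show ?thesis
  unfolding pB_def bit_pars par_at_def odd_overlap_def using assms(2) by (auto simp: Bq_def anc_eq)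
qed

lemma bit_pB_fC_other:
 assumes "close j" "q ~= anc 7 i k T 0" "q ~= anc 8 i 0 T 0" "!!k T. q ~= anc 7 i k T 0" "!!T. q ~= anc 8 i 0 T 0"
 shows "bit (pB (fC j)) q = bit j q"
 unfolding pB_def bit_pars fC_def bit_fans set_C1 using assms by (auto simp: Bq_def)

lemma bit_D:
 assumes "close j" "T < 2 ^ K"
 shows "u < rp (K - 1) ==> bit (fY (fD (pB (fC j)))) (anc 9 i 0 T u) = par_at j T"
  and "u < rm (K - 1) ==> bit (fY (fD (pB (fC j)))) (anc 10 i 0 T u) = (par_at j T ~= bit j y)"
proof -
 let ?j = "pB (fC j)"
 have zero: "\<not> bit ?j (anc 9 i 0 T u)" "\<not> bit ?j (anc 10 i 0 T u)" for u
  using bit_pB_fC_other[OF assms(1), of "anc 9 i 0 T u"] bit_pB_fC_other[OF assms(1), of "anc 10 i 0 T u"]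
  by (auto simp: anc_eq close_anc[OF assms(1)] clean)
 have y: "bit (fD ?j) y = bit j y"
  using bit_pB_fC_other[OF assms(1), of y] unfolding fD_def bit_fans set_D by (auto simp: tgt_anc)
 have D: "u < rp (K - 1) ==> bit (fD ?j) (anc 9 i 0 T u) = par_at j T"
  "u < rm (K - 1) ==> bit (fD ?j) (anc 10 i 0 T u) = par_at j T" for u
  unfolding fD_def bit_fans set_D using assms(2) by (auto simp: zero anc_eq bit_pB_fC[OF assms])
 show "u < rp (K - 1) ==> bit (fY (fD ?j)) (anc 9 i 0 T u) = par_at j T"
  unfolding fY_def bit_fan set_D2 by (auto simp: D anc_eq)
 show "u < rm (K - 1) ==> bit (fY (fD ?j)) (anc 10 i 0 T u) = (par_at j T ~= bit j y)"
  unfolding fY_def bit_fan set_D2 using assms(2) by (auto simp: D anc_eq y)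
qed

text \<open>With the target set, the exponent is \<open>- \<pi> / 2 ^ K\<close> times the sum of all
  characters at the content of \<open>as\<close>. This sum is \<open>2 ^ K\<close> at the zero
  string and 0 elsewhere, which yields exactly -1 or 1.\<close>

lemma z_eq:
 assumes "close j"
 shows "z j = (if bit j y \<and> (\<forall>a\<in>set as. \<not> bit j a) then - 1 else 1)"
proof -
 let ?\<gamma> = "\<alpha> (K - 1)"
 have K1: "K - 1 < K" using K_pos by simp
 have "phase (fY (fD (pB (fC j)))) (D1 i T) = cis (of_bool (par_at j T) * of_nat 1 * ?\<gamma>)" if "T < 2 ^ K" for T
  using phase_block_angle[where c = 1 and k = "K - 1" and j = "fY (fD (pB (fC j)))" and t = 9 and i = i and l = 0 and v = T and Y = "par_at j T"] bit_D[OF assms that] K1 ang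
  by (simp add: D1_def)
 moreover have "phase (fY (fD (pB (fC j)))) (D2 i T) = cis (of_bool (par_at j T ~= bit j y) * of_nat 1 * (- ?\<gamma>))"
  if "T < 2 ^ K" for T
  using phase_block_minus_angle[where c = 1 and k = "K - 1" and j = "fY (fD (pB (fC j)))" and t = 10 and i = i and l = 0 and v = T and Y = "par_at j T ~= bit j y"] bit_D[OF assms that] K1 ang
  by (simp add: D2_def)
 ultimately have "z j = (\<Prod>T<2 ^ K. cis (of_bool (par_at j T) * ?\<gamma>) * cis (of_bool (par_at j T ~= bit j y) * - ?\<gamma>))"
  unfolding z_def phase_concat phase_append by (intro prod.cong) auto
 also have "... = cis (?\<gamma> * (\<Sum>T<2 ^ K. of_bool (par_at j T) - of_bool (par_at j T ~= bit j y)))"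
  by (simp add: cis_mult prod_cis sum_distrib_left algebra_simps)
 also have "... = (if bit j y \<and> (\<forall>a\<in>set as. \<not> bit j a) then - 1 else 1)"
 proof (cases "bit j y")
  case True
  have "(\<Sum>T<2 ^ K. of_bool (par_at j T) - of_bool (par_at j T ~= bit j y)) = (\<Sum>T<2 ^ K. - (if par_at j T then - 1 else 1 :: real))"
   by (rule sum.cong) (auto simp: True)
  also have "... = - (\<Sum>T<2 ^ K. if par_at j T then - 1 else 1 :: real)"
   by (simp add: sum_negf)
  finally have eq: "(\<Sum>T<2 ^ K. of_bool (par_at j T) - of_bool (par_at j T ~= bit j y)) = - (\<Sum>T<2 ^ K. if par_at j T then - 1 else 1 :: real)" .
  show ?thesis
  proof (cases "\<forall>a\<in>set as. \<not> bit j a")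
   case none: True
   have empty: "{k. k < K \<and> bit T k \<and> bit j (A i k)} = {}" for T
    using none set_as by blast
   then have "\<not> par_at j T" for T
    unfolding par_at_def odd_overlap_def empty by simp
   then have "(\<Sum>T<2 ^ K. if par_at j T then - 1 else 1 :: real) = 2 ^ K" by simp
   moreover have "?\<gamma> * 2 ^ K = pi" using K_pos by (simp add: \<alpha>_def)
   ultimately show ?thesis
    unfolding eq using True none by (simp add: complex_eq_iff)
  next
   case False
   then obtain k where "k < K" "bit j (A i k)" by (auto simp: set_as)
   then have "(\<Sum>T<2 ^ K. if par_at j T then - 1 else 1 :: real) = 0"
    unfolding par_at_def by (rule sum_odd_overlap)
   then show ?thesis unfolding eq using False by simp
  qed
 qed simp
 finally show ?thesis .
qed

lemma run_HA: "run (HA i) J = hads as J" "run (HYA i) J = xact (XH y) (hads as J)" "run (HYA i) J = hads as (xact (XH y) J)"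
proof -
 have HA: "map (to_xgate ang) (HA i) = map XH as" by (simp add: HA_def as_def)
 show "run (HA i) J = hads as J" unfolding HA hads_def ..
 show "run (HYA i) J = hads as (xact (XH y) J)"
  by (simp add: HYA_def HA hads_def)
 also have "... = xact (XH y) (hads as J)"
  unfolding hads_def by (rule xrun_xact_commute) (use y_not_as in auto)
 finally show "run (HYA i) J = xact (XH y) (hads as J)" .
qed

lemma HA_commute: "hads as (xact (XH y) J) = xact (XH y) (hads as J)"
 using run_HA(2,3)[of J] by simp

theorem run_gate:
 "run (concat (map (\<lambda>f. f i) stages)) (ket s) = ket (if w = tf i then flipset {y} s else s)"
proof -
 have run_append: "run (gs @ hs) J = run hs (run gs J)" for gs hs J by simp
 have "concat (map (\<lambda>f. f i) stages) = HYA i @ (FA i @ R1 i @ FA i) @ HA i @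
   (FC i @ (HB i @ FB i @ HB i) @ FD i @ FY i @ RD i @ FY i @ FD i @ (HB i @ FB i @ HB i) @ FC i) @
   HA i @ (FA i @ R2 i @ FA i) @ HYA i"
  by (simp add: stages_def)
 then have "run (concat (map (\<lambda>f. f i) stages)) (ket s)
   = xact (XH y) (hads as (diag d2 (hads as (diag z (hads as (diag d1 (hads as (xact (XH y) (ket s)))))))))"
  by (simp only: run_append[of "HYA i"] run_append[of "FA i @ R1 i @ FA i"] run_append[of "HA i"]
    run_append[of "FC i @ (HB i @ FB i @ HB i) @ FD i @ FY i @ RD i @ FY i @ FD i @ (HB i @ FB i @ HB i) @ FC i"]
    run_append[of "FA i @ R2 i @ FA i"] run_HA(1,2) run_R run_Z HA_commute)
 also have "... = ket (if w = tf i then flipset {y} s else s)"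
 proof (rule gadget[OF distinct_as])
  show "\<not> bit s a" if "a \<in> set as" for a using that by (auto simp: set_as A_def clean)
  show "y \<notin> set as" by (rule y_not_as)
  show "d1 j * d2 j = 1" if "close j" for j using d1_d2[OF that] .
  show "z j = (if bit j y \<and> (\<forall>a\<in>set as. \<not> bit j a) then - 1 else 1)" if "close j" for j
   by (rule z_eq[OF that])
  show "d1 j = d1 s'" if "w = tf i" "s' \<in> {s, flipset {y} s}" "off (set as) j s'" for j s'
  proof -
   have "close j" "close s'" using that(2,3) by (auto simp: off_def bit_flipset)
   have "real (tf i) - real w = 0" using that(1) by simp
   then show ?thesis unfolding d1_eq[OF \<open>close j\<close>] d1_eq[OF \<open>close s'\<close>] by (simp cong: if_cong)
  qed
  show "(\<Sum>T\<in>Pow (set as). d1 (flipset T s')) = 0" if "w ~= tf i" "s' \<in> {s, flipset {y} s}" for s'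
   by (rule d1_sum[OF that])
 qed
 finally show ?thesis .
qed

lemmas run_gate_sum = run_gate[unfolded w_def]

end


lemma set_copies: "q \<in> set (copies v) \<longleftrightarrow> (\<exists>i<G. \<exists>k<K. \<exists>u.
  q = anc 1 i k v u \<and> u < cf i v * rp k \<or> q = anc 4 i k v u \<and> u < cf i v * rm k)"
 by (simp add: copies_def set_block Bex_def) blast

definition cp :: "nat => nat" where
 "cp = fans W copies wire"

lemma run_copy_layer: "run copy_layer J = (\<lambda>j. J (cp j))"
proof -
 have "map (to_xgate ang) copy_layer = map (\<lambda>v. XF (copies v) (wire v)) [0..<W]"
  by (simp add: copy_layer_def)
 moreover have "acts (map (\<lambda>v. XF (copies v) (wire v)) [0..<W]) cp"
  unfolding cp_def by (rule acts_fans) (unfold set_copies, auto simp: anc_eq wire_anc)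
 ultimately show ?thesis by (simp add: acts_def)
qed

lemma cp_cp: "cp (cp j) = j"
 unfolding cp_def by (rule fans_fans) (unfold set_copies, auto simp: wire_anc)

lemma run_copy_ket: "run copy_layer (ket s) = ket (cp s)"
 unfolding run_copy_layer ket_def using cp_cp by (auto simp: fun_eq_iff)

definition own :: "nat => nat => bool" where
 "own i q \<longleftrightarrow> q = tgt i \<or> (\<exists>t k v u. q = anc t i k v u)"

lemma own_anc: "own i (tgt i)" "own i (anc t i k v u)"
 by (auto simp: own_def)

lemma own_lists:
 "q \<in> set (P1 i k) ==> own i q" "q \<in> set (P2 i k) ==> own i q" "q \<in> set (C1 i k) ==> own i q"
 "q \<in> set (C2 i T) ==> own i q" "q \<in> set (D1 i T) ==> own i q" "q \<in> set (D2 i T) ==> own i q"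
 by (auto simp: P1_def P2_def C1_def C2_def D1_def D2_def set_block own_anc split: if_splits)

lemma stage_qubits:
 assumes "f \<in> set stages" "g \<in> set (f i)" "q \<in> set (gate_qubits g)"
 shows "own i q"
proof -
 have "own i q" if "g \<in> set (HYA i) \<union> set (HA i) \<union> set (FA i) \<union> set (R1 i) \<union> set (R2 i) \<union> set (FC i)"
  using that assms(3) by (auto simp: HYA_def HA_def FA_def R1_def R2_def FC_def A_def own_anc own_lists)
 moreover have "own i q" if "g \<in> set (HB i) \<union> set (FB i) \<union> set (FD i) \<union> set (FY i) \<union> set (RD i)"
  using that assms(3) by (auto simp: HB_def FB_def FD_def FY_def RD_def Bq_def own_anc own_lists)
 moreover have "f \<in> {HYA, FA, R1, HA, FC, HB, FB, FD, FY, RD, R2}"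
  using assms(1) by (auto simp: stages_def)
 ultimately show ?thesis using assms(2) by blast
qed

lemma own_disjoint: "i < G ==> j < G ==> own i q ==> own j q ==> i = j"
 unfolding own_def by (metis tgt_inj tgt_anc anc_eq)

definition satisfied :: "nat => nat => bool" where
 "satisfied s i \<longleftrightarrow> (\<Sum>v<W. cf i v * of_bool (bit s (wire v))) = tf i"

lemma run_gates:
 assumes clean: "!!t i k v u. \<not> bit s (anc t i k v u)" and "n <= G"
 shows "run (concat (map (\<lambda>i. concat (map (\<lambda>f. f i) stages)) [0..<n])) (ket (cp s))
   = ket (flipset (tgt ` {i. i < n \<and> satisfied s i}) (cp s))"
 using assms(2)
proof (induction n)
 case (Suc n)
 let ?Tg = "tgt ` {i. i < n \<and> satisfied s i}"
 let ?s = "flipset ?Tg (cp s)"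
 have fin: "finite (tgt ` {i. i < m \<and> satisfied s i})" for m by simp
 have x: "bit ?s (wire v) = bit s (wire v)" if "v < W" for v
 proof -
  have "wire v ~= tgt j" if "j < n" for j
   using tgt_wire[of j v] \<open>v < W\<close> that Suc.prems by auto
  then have "wire v \<notin> ?Tg" by blast
  then show ?thesis
   unfolding bit_flipset[OF fin] cp_def bit_fans set_copies by (auto simp: wire_anc)
 qed
 have "bit ?s (anc t n k v u) \<longleftrightarrow> k < K \<and> v < W \<and> bit s (wire v) \<and>
    (t = 1 \<and> u < cf n v * rp k \<or> t = 4 \<and> u < cf n v * rm k)" for t k v u
  unfolding bit_flipset[OF fin] cp_def bit_fans set_copies
  using Suc.prems by (auto simp: anc_eq tgt_anc[symmetric] clean)
 then have "run (concat (map (\<lambda>f. f n) stages)) (ket ?s)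
   = ket (if (\<Sum>v<W. cf n v * of_bool (bit s (wire v))) = tf n then flipset {tgt n} ?s else ?s)"
  using run_gate_sum[of n ?s "\<lambda>v. bit s (wire v)"] x Suc.prems by simp
 also have "(\<Sum>v<W. cf n v * of_bool (bit s (wire v))) = tf n \<longleftrightarrow> satisfied s n"
  by (simp add: satisfied_def)
 also have "(if satisfied s n then flipset {tgt n} ?s else ?s) = flipset (tgt ` {i. i < Suc n \<and> satisfied s i}) (cp s)"
 proof -
  have "tgt n ~= tgt i" if "i < n" for i using tgt_inj[of n i] that Suc.prems by auto
  then have notin: "tgt n \<notin> ?Tg" by blast
  have "tgt ` {i. i < Suc n \<and> satisfied s i} = (if satisfied s n then insert (tgt n) ?Tg else ?Tg)"
   by (auto simp: less_Suc_eq)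
  then show ?thesis using flipset_insert[OF fin notin] by simp
 qed
 finally show ?case using Suc by simp
qed simp

text \<open>Gates of the layer own disjoint qubits, so the stages may be regrouped into one gate
  after the other. No target is a wire that is read; hence the second copy layer sees unchanged
  wires and erases the copies.\<close>

theorem run_layers:
 assumes clean: "!!t i k v u. \<not> bit s (anc t i k v u)"
 shows "run (concat layers) (ket s) = ket (flipset (tgt ` {i. i < G \<and> satisfied s i}) s)"
proof -
 let ?X = "map (to_xgate ang)"
 let ?T = "tgt ` {i. i < G \<and> satisfied s i}"
 have stages_nth: "stages ! l \<in> set stages" if "l < length stages" for l using that by simp
 have mapn: "map (\<lambda>l. F (stages ! l)) [0..<length stages] = map F stages" for F :: "(nat => gate list) => 'b"
  by (rule nth_equalityI) auto
 have "run (concat (map (\<lambda>f. concat (map f [0..<G])) stages)) J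
   = run (concat (map (\<lambda>i. concat (map (\<lambda>f. f i) stages)) [0..<G])) J" for J
 proof -
  have e: "?X (concat (map (\<lambda>f. concat (map f [0..<G])) stages))
    = concat (map (\<lambda>l. concat (map (\<lambda>i. ?X ((stages ! l) i)) [0..<G])) [0..<length stages])"
   unfolding mapn[of "\<lambda>f. concat (map (\<lambda>i. ?X (f i)) [0..<G])"] by (simp add: map_concat o_def)
  have "xrun (concat (map (\<lambda>l. concat (map (\<lambda>i. ?X ((stages ! l) i)) [0..<G])) [0..<length stages])) J
    = xrun (concat (map (\<lambda>i. concat (map (\<lambda>l. ?X ((stages ! l) i)) [0..<length stages])) [0..<G])) J"
  proof (rule xrun_groups)
   fix l l' i j g h
   assume a: "l < length stages" "l' < length stages" "i < G" "j < G" "i ~= j"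
    "g \<in> set (?X ((stages ! l) i))" "h \<in> set (?X ((stages ! l') j))"
   have "own i q" if "q \<in> xqubits g" for q
   proof -
    obtain h' where "h' \<in> set ((stages ! l) i)" "g = to_xgate ang h'" using a(6) by auto
    then show ?thesis using stage_qubits[OF stages_nth[OF a(1)]] that by (simp add: xqubits_to_xgate)
   qed
   moreover have "own j q" if "q \<in> xqubits h" for q
   proof -
    obtain h' where "h' \<in> set ((stages ! l') j)" "h = to_xgate ang h'" using a(7) by auto
    then show ?thesis using stage_qubits[OF stages_nth[OF a(2)]] that by (simp add: xqubits_to_xgate)
   qed
   ultimately show "xqubits g \<inter> xqubits h = {}"
    using own_disjoint[OF a(3,4)] a(5) by blast
  qed
  moreover have "xrun (concat (map (\<lambda>i. concat (map (\<lambda>l. ?X ((stages ! l) i)) [0..<length stages])) [0..<G])) J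
    = run (concat (map (\<lambda>i. concat (map (\<lambda>f. f i) stages)) [0..<G])) J"
  proof -
   have "concat (map (\<lambda>l. ?X ((stages ! l) i)) [0..<length stages]) = ?X (concat (map (\<lambda>f. f i) stages))" for i
    unfolding mapn[of "\<lambda>f. ?X (f i)"] by (simp add: map_concat o_def)
   then show ?thesis by (simp add: map_concat o_def)
  qed
  ultimately show ?thesis by (simp only: e)
 qed
 then have "run (concat layers) (ket s) = run copy_layer (run (concat (map (\<lambda>i. concat (map (\<lambda>f. f i) stages)) [0..<G])) (run copy_layer (ket s)))"
  by (simp add: layers_def)
 also have "... = ket (cp (flipset ?T (cp s)))"
  unfolding run_copy_ket run_gates[OF clean order_refl] ..
 also have "... = ket (flipset ?T s)"
 proof (rule arg_cong[where f = ket], rule bit_eqI)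
  fix q
  have fin: "finite ?T" by simp
  have x: "bit (cp s) (wire v) = bit s (wire v)" for v
   unfolding cp_def bit_fans set_copies by (auto simp: wire_anc)
  have x': "bit (flipset ?T (cp s)) (wire v) = bit s (wire v)" if "v < W" for v
  proof -
   have "wire v ~= tgt i" if "i < G" for i using tgt_wire[of i v] \<open>v < W\<close> that by auto
   then have "wire v \<notin> ?T" by blast
   then show ?thesis unfolding bit_flipset[OF fin] x by simp
  qed
  have "bit (cp (flipset ?T (cp s))) q \<longleftrightarrow> bit (flipset ?T (cp s)) q ~= (\<exists>v<W. q \<in> set (copies v) \<and> bit s (wire v))"
   unfolding cp_def[abs_def] bit_fans[of W copies wire "flipset _ _"] using x' by (auto simp: cp_def)
  also have "bit (flipset ?T (cp s)) q = ((bit s q ~= (\<exists>v<W. q \<in> set (copies v) \<and> bit s (wire v))) ~= (q \<in> ?T))"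
   unfolding bit_flipset[OF fin] cp_def bit_fans ..
  finally show "bit (cp (flipset ?T (cp s))) q = bit (flipset ?T s) q"
   unfolding bit_flipset[OF fin] by blast
 qed
 finally show ?thesis .
qed

end


section \<open>Disjointness, width and accuracy of the layers\<close>

lemma distinct_concat_upt:
 assumes "!!i. i < n ==> distinct (f i)"
  and "!!i j q. i < n ==> j < n ==> q \<in> set (f i) ==> q \<in> set (f j) ==> i = j"
 shows "distinct (concat (map f [0..<n]))"
 using assms
proof (induction n)
 case (Suc n)
 have "distinct (concat (map f [0..<n]))"
  by (rule Suc.IH; use Suc.prems in "meson less_SucI")
 moreover have "set (concat (map f [0..<n])) \<inter> set (f n) = {}"
 proof -
  have "q \<notin> set (f n)" if "i < n" "q \<in> set (f i)" for i q
   using Suc.prems(2)[of i n q] that by auto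
  then show ?thesis by auto
 qed
 ultimately show ?case using Suc.prems(1) by simp
qed simp

definition layer_qubits :: "gate list => nat list" where
 "layer_qubits L = concat (map gate_qubits L)"

lemma layer_qubits_simps [simp]:
 "layer_qubits [] = []" "layer_qubits (g # L) = gate_qubits g @ layer_qubits L"
 "layer_qubits (L @ L') = layer_qubits L @ layer_qubits L'"
 "layer_qubits (concat Ls) = concat (map layer_qubits Ls)"
 "layer_qubits (map Rotation qs) = qs" "layer_qubits (map Hadamard qs) = qs"
 by (simp_all add: layer_qubits_def map_concat) (induction Ls; simp add: layer_qubits_def; fail | induction qs; simp)+

lemma layer_qubits_map: "layer_qubits (map f xs) = concat (map (\<lambda>x. gate_qubits (f x)) xs)"
 by (simp add: layer_qubits_def o_def)

context exact_layer_sem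
begin

lemma distinct_block: "distinct (block t i k v n)"
 by (auto simp: block_def distinct_map inj_on_def anc_eq)

lemma distinct_P: "distinct (P1 i k @ P2 i k @ [A i k])"
proof -
 have "distinct (concat (map (\<lambda>v. block t i k v (f v) @ block t' i k v (g v)) [0..<n]))" if "t ~= t'" for t t' f g n
  by (rule distinct_concat_upt) (use that in "auto simp: distinct_block set_block anc_eq")
 then show ?thesis
  unfolding P1_def P2_def by (auto simp: distinct_block set_block anc_eq A_def)
qed

lemma distinct_C1: "distinct (C1 i k @ [A i k])"
 unfolding C1_def by (auto simp: anc_eq A_def intro!: distinct_concat_upt)

lemma distinct_C2': "distinct (Bq i T # C2 i T)"
 unfolding C2_def by (auto simp: anc_eq Bq_def intro!: distinct_concat_upt split: if_splits)

lemma distinct_D: "distinct (D1 i T @ D2 i T @ [Bq i T])"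
 by (auto simp: D1_def D2_def distinct_block set_block anc_eq Bq_def)

lemma set_P1_own: "q \<in> set (P1 i k) ==> \<exists>t\<in>{1, 2, 3}. \<exists>v u. q = anc t i k v u"
 by (auto simp: P1_def set_block)

lemma set_P2_own: "q \<in> set (P2 i k) ==> \<exists>t\<in>{4, 5, 6}. \<exists>v u. q = anc t i k v u"
 by (auto simp: P2_def set_block)

lemma set_C1_own: "q \<in> set (C1 i k) ==> \<exists>T. q = anc 7 i k T 0"
 by (auto simp: C1_def split: if_splits)

lemma set_C2_own: "q \<in> set (C2 i T) ==> \<exists>k. q = anc 7 i k T 0"
 by (auto simp: C2_def split: if_splits)

lemma set_D_own: "q \<in> set (D1 i T) ==> \<exists>u. q = anc 9 i 0 T u" "q \<in> set (D2 i T) ==> \<exists>u. q = anc 10 i 0 T u"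
 by (auto simp: D1_def D2_def set_block)

lemma distinct_stage:
 assumes "f \<in> set stages"
 shows "distinct (layer_qubits (f i))"
proof -
 have HA: "layer_qubits (HA i) = map (A i) [0..<K]"
  by (simp add: HA_def layer_qubits_map concat_map_singleton)
 have dHA: "distinct (map (A i) [0..<K])"
  by (auto simp: distinct_map inj_on_def A_def anc_eq)
 have "distinct (layer_qubits (HYA i))"
  unfolding HYA_def using dHA by (auto simp: HA A_def tgt_anc)
 moreover have "distinct (layer_qubits (FA i))"
  unfolding FA_def layer_qubits_map gate_qubits.simps append_assoc
  by (rule distinct_concat_upt) (auto simp: distinct_P[simplified] A_def anc_eq dest!: set_P1_own set_P2_own)
 moreover have "distinct (layer_qubits (R1 i))" "distinct (layer_qubits (R2 i))"
 proof -
  have dP: "distinct (P1 i k)" "distinct (P2 i k)" for k using distinct_P[of i k] by auto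
  have "distinct (concat (map (P1 i) [0..<K]))"
   by (rule distinct_concat_upt) (auto simp: dP anc_eq dest!: set_P1_own)
  moreover have "distinct (concat (map (P2 i) [0..<K]))"
   by (rule distinct_concat_upt) (auto simp: dP anc_eq dest!: set_P2_own)
  ultimately show "distinct (layer_qubits (R1 i))" "distinct (layer_qubits (R2 i))"
   by (simp_all add: R1_def R2_def o_def)
 qed
 moreover have "distinct (layer_qubits (FC i))"
  unfolding FC_def layer_qubits_map gate_qubits.simps
  by (rule distinct_concat_upt) (auto simp: distinct_C1[simplified] A_def anc_eq dest!: set_C1_own)
 moreover have "distinct (layer_qubits (HB i))"
 proof -
  have "layer_qubits (HB i) = concat (map (\<lambda>T. Bq i T # C2 i T) [0..<2 ^ K])"
   by (simp add: HB_def o_def flip: list.map)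
  then show ?thesis
   by (simp only:, intro distinct_concat_upt distinct_C2') (auto simp: Bq_def anc_eq dest!: set_C2_own)
 qed
 moreover have "distinct (layer_qubits (FB i))"
  unfolding FB_def layer_qubits_map gate_qubits.simps
  by (rule distinct_concat_upt) (use distinct_C2' in "auto simp: Bq_def anc_eq dest!: set_C2_own")
 moreover have "distinct (layer_qubits (FD i))"
  unfolding FD_def layer_qubits_map gate_qubits.simps append_assoc
  by (rule distinct_concat_upt) (auto simp: distinct_D[simplified] Bq_def anc_eq dest!: set_D_own)
 moreover have "distinct (layer_qubits (FY i))"
 proof -
  have "distinct (concat (map (D2 i) [0..<2 ^ K]))"
   by (rule distinct_concat_upt) (use distinct_D in "auto simp: anc_eq dest!: set_D_own")
  then show ?thesis unfolding FY_def by (auto simp: tgt_anc dest!: set_D_own)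
 qed
 moreover have "distinct (layer_qubits (RD i))"
 proof -
  have "layer_qubits (RD i) = concat (map (\<lambda>T. D1 i T @ D2 i T) [0..<2 ^ K])"
   by (simp add: RD_def o_def flip: map_append)
  then show ?thesis
   by (simp only:, intro distinct_concat_upt) (use distinct_D in "auto simp: anc_eq dest!: set_D_own")
 qed
 moreover have "f \<in> {HYA, FA, R1, HA, FC, HB, FB, FD, FY, RD, R2}"
  using assms by (auto simp: stages_def)
 ultimately show ?thesis using HA dHA by auto
qed

lemma distinct_copies: "distinct (copies v)"
 unfolding copies_def
proof (rule distinct_concat_upt)
 show "distinct (concat (map (\<lambda>k. block 1 i k v (cf i v * rp k) @ block 4 i k v (cf i v * rm k)) [0..<K]))" for i
  by (rule distinct_concat_upt) (auto simp: distinct_block set_block anc_eq)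
qed (auto simp: set_block anc_eq)

lemma distinct_layers:
 assumes "L \<in> set layers"
 shows "distinct (layer_qubits L)"
proof -
 have "distinct (layer_qubits copy_layer)"
  unfolding copy_layer_def layer_qubits_map gate_qubits.simps
  by (rule distinct_concat_upt)
   (auto simp: distinct_copies set_copies wire_anc wire_anc[symmetric] anc_eq wire_inj)
 moreover have "distinct (layer_qubits (concat (map f [0..<G])))" if f: "f \<in> set stages" for f
 proof -
  have "layer_qubits (concat (map f [0..<G])) = concat (map (\<lambda>i. layer_qubits (f i)) [0..<G])"
   by (simp add: o_def)
  moreover have "distinct (concat (map (\<lambda>i. layer_qubits (f i)) [0..<G]))"
  proof (rule distinct_concat_upt)
   show "distinct (layer_qubits (f i))" for i using distinct_stage[OF f] .
   show "i = j" if a: "i < G" "j < G" "q \<in> set (layer_qubits (f i))" "q \<in> set (layer_qubits (f j))" for i j q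
   proof -
    obtain g h where "g \<in> set (f i)" "q \<in> set (gate_qubits g)" "h \<in> set (f j)" "q \<in> set (gate_qubits h)"
     using a(3,4) by (auto simp: layer_qubits_def)
    then show ?thesis using stage_qubits[OF f] own_disjoint[OF a(1,2)] by blast
   qed
  qed
  ultimately show ?thesis by simp
 qed
 ultimately show ?thesis using assms by (auto simp: layers_def)
qed


definition own_upto :: "nat => nat => bool" where
 "own_upto M q \<longleftrightarrow> (\<exists>i<G. q = tgt i) \<or> (\<exists>v<W. q = wire v) \<or>
   (\<exists>t\<le>10. \<exists>i\<le>M. \<exists>k\<le>M. \<exists>v\<le>M. \<exists>u\<le>M. q = anc t i k v u)"

lemma layers_own_upto:
 assumes M: "G <= M" "K <= M" "W <= M" "2 ^ K <= M"
  and r: "!!k. k < K ==> 2 ^ K * rp k <= M" "!!k. k < K ==> 2 ^ K * rm k <= M"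
   "!!k. k < K ==> 2 * 2 ^ K * rp k <= M" "!!k. k < K ==> 2 * 2 ^ K * rm k <= M"
  and L: "L \<in> set layers" "q \<in> set (layer_qubits L)"
 shows "own_upto M q"
proof -
 have anc: "own_upto M (anc t i k v u)" if "t <= 10" "i < G" "k < K \<or> k = 0" "v < W \<or> v < 2 ^ K \<or> v = 0" "u <= M" for t i k v u
  using that M unfolding own_upto_def by (intro disjI2 exI conjI refl) auto
 have cf_le: "cf i v <= 2 ^ K" if "i < G" "v < W" for i v
  using weight_bound[OF that(1)] member_le_sum[of v "{..<W}" "cf i"] that(2) by auto
 have cp: "u <= M" if "u < cf i v * rp k" "i < G" "v < W" "k < K" for u i v k
  using order_trans[OF mult_le_mono1[OF cf_le[OF that(2,3)], of "rp k"] r(1)[OF that(4)]] that(1) by linarith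
 have cm: "u <= M" if "u < cf i v * rm k" "i < G" "v < W" "k < K" for u i v k
  using order_trans[OF mult_le_mono1[OF cf_le[OF that(2,3)], of "rm k"] r(2)[OF that(4)]] that(1) by linarith
 have tp: "u <= M" if "u < 2 * tf i * rp k" "i < G" "k < K" for u i k
 proof -
  have "2 * tf i * rp k <= 2 * 2 ^ K * rp k"
   by (intro mult_le_mono1 mult_le_mono2) (use target_bound[OF that(2)] in simp)
  then show ?thesis using r(3)[OF that(3)] that(1) by linarith
 qed
 have tm: "u <= M" if "u < 2 * tf i * rm k" "i < G" "k < K" for u i k
 proof -
  have "2 * tf i * rm k <= 2 * 2 ^ K * rm k"
   by (intro mult_le_mono1 mult_le_mono2) (use target_bound[OF that(2)] in simp)
  then show ?thesis using r(4)[OF that(3)] that(1) by linarith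
 qed
 have rp1: "u <= M" if "u < rp (K - 1)" for u
 proof -
  have "rp (K - 1) <= 2 ^ K * rp (K - 1)" by simp
  then show ?thesis using r(1)[of "K - 1"] K_pos that by linarith
 qed
 have rm1: "u <= M" if "u < rm (K - 1)" for u
 proof -
  have "rm (K - 1) <= 2 ^ K * rm (K - 1)" by simp
  then show ?thesis using r(2)[of "K - 1"] K_pos that by linarith
 qed
 have P: "own_upto M q" if "q \<in> set (P1 i k) \<or> q \<in> set (P2 i k)" "i < G" "k < K" for q i k
  using that unfolding P1_def P2_def by (auto simp: set_block intro!: anc dest: cp cm tp tm)
 have C: "own_upto M q" if "q \<in> set (C1 i k)" "i < G" "k < K" for q i k
  using that unfolding C1_def by (auto intro!: anc split: if_splits)
 have C': "own_upto M q" if "q \<in> set (C2 i T)" "i < G" "T < 2 ^ K" for q i T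
  using that unfolding C2_def by (auto intro!: anc split: if_splits)
 have D: "own_upto M q" if "q \<in> set (D1 i T) \<or> q \<in> set (D2 i T)" "i < G" "T < 2 ^ K" for q i T
  using that unfolding D1_def D2_def by (auto simp: set_block intro!: anc dest: rp1[unfolded One_nat_def] rm1[unfolded One_nat_def])
 have A: "own_upto M (A i k)" if "i < G" "k < K" for i k
  using that unfolding A_def by (intro anc) auto
 have B: "own_upto M (Bq i T)" if "i < G" "T < 2 ^ K" for i T
  using that unfolding Bq_def by (intro anc) auto
 have Y: "own_upto M (tgt i)" if "i < G" for i using that by (auto simp: own_upto_def)
 have X: "own_upto M (wire v)" if "v < W" for v using that by (auto simp: own_upto_def)
 have stage: "own_upto M q" if "f \<in> set stages" "i < G" "q \<in> set (layer_qubits (f i))" for f i q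
 proof -
  have "f \<in> {HYA, FA, R1, HA, FC, HB, FB, FD, FY, RD, R2}"
   using that by (auto simp: stages_def)
  then show ?thesis
   using that(2,3)
   by (auto simp: HYA_def HA_def FA_def R1_def R2_def FC_def HB_def FB_def FD_def FY_def RD_def layer_qubits_map
     intro!: A B Y) (meson P C C' D)+
 qed
 have "own_upto M q" if "q \<in> set (layer_qubits copy_layer)"
  using that unfolding copy_layer_def layer_qubits_map
  by (auto simp: set_copies X intro!: anc dest: cp cm)
 with stage L show ?thesis by (auto simp: layers_def)
qed


definition rot_error :: "gate => real" where
 "rot_error g = (case g of Rotation q => cmod (cis rotation_angle - cis (ang q)) | _ => 0)"

definition total_error :: "gate list => real" where
 "total_error L = (\<Sum>g\<leftarrow>L. rot_error g)"

lemma total_error_simps [simp]: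
 "total_error [] = 0" "total_error (g # L) = rot_error g + total_error L"
 "total_error (L @ L') = total_error L + total_error L'"
 by (simp_all add: total_error_def)

lemma total_error_concat: "total_error (concat (map f [0..<n])) = (\<Sum>i<n. total_error (f i))"
 by (induction n) auto

lemma total_error_none: "(!!g. g \<in> set L ==> rot_error g = 0) ==> total_error L = 0"
 by (induction L) auto

lemma total_error_block:
 assumes "!!u. ang (anc t i k v u) = \<theta>" "real r * cmod (cis rotation_angle - cis \<theta>) <= \<delta>"
 shows "total_error (map Rotation (block t i k v (c * r))) <= real c * \<delta>"
proof -
 have "total_error (map Rotation (block t i k v n)) = real n * cmod (cis rotation_angle - cis \<theta>)" for n
  by (induction n) (auto simp: block_def rot_error_def assms(1) algebra_simps)
 then show ?thesis
  using mult_left_mono[OF assms(2), of "real c"] by (simp add: mult.assoc)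
qed

text \<open>\<open>\<delta>\<close> bounds the error of one bundle. For each gate, \<open>R1\<close>
  and \<open>R2\<close> contribute at most \<open>K * 4 * 2 ^ K\<close> bundles (two per unit of
  weight and two per unit of the target), and \<open>RD\<close> contributes
  \<open>2 * 2 ^ K\<close>; thus the factor 10 is 4 + 4 + 2.\<close>

lemma layers_error:
 assumes \<delta>: "0 <= \<delta>"
  and p: "!!k. k < K ==> real (rp k) * cmod (cis rotation_angle - cis (ap k)) <= \<delta>"
  and m: "!!k. k < K ==> real (rm k) * cmod (cis rotation_angle - cis (am k)) <= \<delta>"
 shows "total_error (concat layers) <= real G * real K * 2 ^ K * 10 * \<delta>"
proof -
 have blockp: "total_error (map Rotation (block t i l v (c * rp k))) <= real c * \<delta>"
  if "t \<in> {1, 3, 5} \<and> l = k \<or> t = 9 \<and> k = K - 1 \<and> l = 0" "k < K" for t i k l v c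
  by (rule total_error_block[OF _ p[OF that(2)]]) (use that ang in auto)
 have blockm: "total_error (map Rotation (block t i l v (c * rm k))) <= real c * \<delta>"
  if "t \<in> {2, 4, 6} \<and> l = k \<or> t = 10 \<and> k = K - 1 \<and> l = 0" "k < K" for t i k l v c
  by (rule total_error_block[OF _ m[OF that(2)]]) (use that ang in auto)
 have sum_cf: "(\<Sum>v<W. real (cf i v)) <= 2 ^ K" if "i < G" for i
 proof -
  have "real (\<Sum>v<W. cf i v) <= real (2 ^ K)"
   using weight_bound[OF that] by (simp only: of_nat_le_iff less_imp_le)
  then show ?thesis by simp
 qed
 have tf_le: "real (2 * tf i) <= 2 * 2 ^ K" if "i < G" for i
 proof -
  have "real (tf i) <= real (2 ^ K)" using target_bound[OF that] by (simp only: of_nat_le_iff less_imp_le)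
  then show ?thesis by simp
 qed
 have P1: "total_error (map Rotation (P1 i k)) <= 4 * 2 ^ K * \<delta>" if "i < G" "k < K" for i k
 proof -
  have "total_error (map Rotation (P1 i k)) <= (\<Sum>v<W. real (cf i v) * \<delta> + real (cf i v) * \<delta>) + real (2 * tf i) * \<delta>"
   unfolding P1_def map_append map_concat list.map_comp o_def total_error_simps total_error_concat
   by (intro add_mono sum_mono blockp blockm) (use that in auto)
  also have "... = (2 * (\<Sum>v<W. real (cf i v)) + real (2 * tf i)) * \<delta>"
   by (simp add: sum.distrib sum_distrib_left sum_distrib_right algebra_simps)
  also have "... <= (4 * 2 ^ K) * \<delta>"
   by (intro mult_right_mono \<delta>) (use sum_cf[OF that(1)] tf_le[OF that(1)] in linarith)
  finally show ?thesis by simp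
 qed
 have P2: "total_error (map Rotation (P2 i k)) <= 4 * 2 ^ K * \<delta>" if "i < G" "k < K" for i k
 proof -
  have "total_error (map Rotation (P2 i k)) <= (\<Sum>v<W. real (cf i v) * \<delta> + real (cf i v) * \<delta>) + real (2 * tf i) * \<delta>"
   unfolding P2_def map_append map_concat list.map_comp o_def total_error_simps total_error_concat
   by (intro add_mono sum_mono blockp blockm) (use that in auto)
  also have "... = (2 * (\<Sum>v<W. real (cf i v)) + real (2 * tf i)) * \<delta>"
   by (simp add: sum.distrib sum_distrib_left sum_distrib_right algebra_simps)
  also have "... <= (4 * 2 ^ K) * \<delta>"
   by (intro mult_right_mono \<delta>) (use sum_cf[OF that(1)] tf_le[OF that(1)] in linarith)
  finally show ?thesis by simp
 qed
 have R: "total_error (R1 i) <= real K * (4 * 2 ^ K * \<delta>)" "total_error (R2 i) <= real K * (4 * 2 ^ K * \<delta>)" if "i < G" for i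
  using sum_mono[of "{..<K}" "\<lambda>k. total_error (map Rotation (P1 i k))" "\<lambda>k. 4 * 2 ^ K * \<delta>"]
   sum_mono[of "{..<K}" "\<lambda>k. total_error (map Rotation (P2 i k))" "\<lambda>k. 4 * 2 ^ K * \<delta>"] P1[OF that] P2[OF that]
  by (auto simp: R1_def R2_def total_error_concat)
 have RD: "total_error (RD i) <= 2 ^ K * (2 * \<delta>)" for i
 proof -
  have K1: "K - 1 < K" using K_pos by simp
  have "total_error (RD i) <= (\<Sum>T<(2 ^ K :: nat). \<delta> + \<delta>)"
   unfolding RD_def map_append total_error_concat total_error_simps D1_def D2_def
   using blockp[where t = 9 and k = "K - 1" and l = 0 and i = i and c = 1] blockm[where t = 10 and k = "K - 1" and l = 0 and i = i and c = 1] K1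
   by (intro sum_mono add_mono) auto
  then show ?thesis by simp
 qed
 have zero: "total_error (f i) = 0" if "f \<in> {HYA, FA, HA, FC, HB, FB, FD, FY}" for f i
  by (rule total_error_none)
   (use that in "auto simp: rot_error_def HYA_def HA_def FA_def FC_def HB_def FB_def FD_def FY_def")
 have gate: "(\<Sum>f\<leftarrow>stages. total_error (f i)) <= real K * 2 ^ K * 10 * \<delta>" if i: "i < G" for i
 proof -
  have "(\<Sum>f\<leftarrow>stages. total_error (f i)) = total_error (R1 i) + total_error (RD i) + total_error (R2 i)"
   by (simp add: stages_def zero)
  also have "... <= real K * (4 * 2 ^ K * \<delta>) + 2 ^ K * (2 * \<delta>) + real K * (4 * 2 ^ K * \<delta>)"
   by (intro add_mono R[OF i] RD)
  also have "... <= real K * (4 * 2 ^ K * \<delta>) + real K * (2 ^ K * (2 * \<delta>)) + real K * (4 * 2 ^ K * \<delta>)"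
  proof -
   have "1 * (2 ^ K * (2 * \<delta>)) <= real K * (2 ^ K * (2 * \<delta>))"
    using K_pos \<delta> by (intro mult_right_mono) auto
   then show ?thesis by linarith
  qed
  finally show ?thesis by (simp add: algebra_simps)
 qed
 have "total_error (concat (map (\<lambda>f. concat (map f [0..<G])) fs)) = (\<Sum>i<G. \<Sum>f\<leftarrow>fs. total_error (f i))" for fs
  by (induction fs) (auto simp: total_error_concat sum.distrib)
 moreover have "total_error copy_layer = 0"
  by (rule total_error_none) (auto simp: copy_layer_def rot_error_def)
 ultimately have "total_error (concat layers) = (\<Sum>i<G. \<Sum>f\<leftarrow>stages. total_error (f i))"
  by (simp add: layers_def)
 also have "... <= (\<Sum>i<G. real K * 2 ^ K * 10 * \<delta>)"
  by (intro sum_mono gate) auto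
 finally show ?thesis by simp
qed

end


section \<open>Approximating rational angles by multiples of the basis angle\<close>

lemma cis_diff_le: "cmod (cis x - cis y) <= \<bar>x - y\<bar>"
proof -
 have "cis x - cis y = cis y * (cis (x - y) - 1)"
  by (simp add: right_diff_distrib cis_mult)
 then have "cmod (cis x - cis y) = cmod (cis (x - y) - 1)"
  by (simp add: norm_mult)
 also have "(cmod (cis t - 1))\<^sup>2 <= t\<^sup>2" for t
 proof -
  have "(cmod (cis t - 1))\<^sup>2 = (cos t)\<^sup>2 + (sin t)\<^sup>2 + 1 - 2 * cos t"
   unfolding cmod_power2 by (simp add: power2_eq_square algebra_simps)
  also have "... = 2 - 2 * cos t" using sin_cos_squared_add[of t] by linarith
  also have "... = 4 * (sin (t / 2))\<^sup>2"
   using cos_double_sin[of "t / 2"] by simp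
  also have "... <= 4 * (t / 2)\<^sup>2"
   using abs_sin_x_le_abs_x[of "t / 2"] by (simp add: abs_le_square_iff[symmetric])
  finally show ?thesis by (simp add: power_divide)
 qed
 then have "cmod (cis (x - y) - 1) <= \<bar>x - y\<bar>"
  by (simp add: abs_le_square_iff[symmetric])
 finally show ?thesis .
qed

text \<open>
 If \<open>p\<^sup>2 - 2 q\<^sup>2 = 1\<close>, then \<open>2 q\<close> rotations by \<open>sqrt 2 * pi\<close> make \<open>p\<close> turns less \<open>1 / (p + q * sqrt 2)\<close> of a turn.
\<close>

lemma pell_rotation:
 fixes p q num den :: nat
 assumes pell: "p\<^sup>2 = 2 * q\<^sup>2 + 1" and num: "0 < num" "num < den" "den <= 2 * p" and q: "0 < q"
 defines "r \<equiv> 2 * q * ((2 * p * num) div den)"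
 obtains a where "cis (real r * a) = cis (- (2 * pi * (real num / real den)))"
  and "real r * cmod (cis rotation_angle - cis a) <= 8 / real p"
proof -
 \<comment> \<open>Each batch of \<open>2 * q\<close> rotations falls short of full turns by
   \<open>\<epsilon>\<close> of a turn, and \<open>\<epsilon>\<close> is about
   \<open>1 / (2 * p)\<close>. So about \<open>2 * p * (num / den)\<close> batches fall short by
   \<open>num / den\<close> of a turn.\<close>
 define u where "u = (2 * p * num) div den"
 define \<epsilon> where "\<epsilon> = real p - real q * sqrt 2"
 have den: "0 < den" using num by simp
 have p0: "0 < p" using num by auto
 have eps: "\<epsilon> * (real p + real q * sqrt 2) = 1"
 proof -
  have "real (p\<^sup>2) = real (2 * q\<^sup>2 + 1)" using pell by simp
  then have "(real p)\<^sup>2 = 2 * (real q)\<^sup>2 + 1" by simp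
  moreover have "\<epsilon> * (real p + real q * sqrt 2) = (real p)\<^sup>2 - 2 * (real q)\<^sup>2"
   by (simp add: \<epsilon>_def algebra_simps power2_eq_square)
  ultimately show ?thesis by simp
 qed
 have s: "real p + real q * sqrt 2 > 0" using p0 by (simp add: add_pos_nonneg)
 have eps0: "\<epsilon> > 0" by (rule zero_less_mult_pos2[OF _ s]) (simp only: eps zero_less_one)
 have eps_le: "\<epsilon> <= 1 / real p"
 proof -
  have "\<epsilon> * real p <= \<epsilon> * (real p + real q * sqrt 2)" using eps0 by (intro mult_left_mono) auto
  then show ?thesis using eps p0 by (simp add: field_simps)
 qed
 \<comment> \<open>This makes the estimate of \<open>\<epsilon>\<close> precise: it is the inverse
   of \<open>p + q * sqrt 2\<close>, and this number is \<open>2 * p - \<epsilon>\<close>.\<close>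
 have two_p: "2 * real p * \<epsilon> = 1 + \<epsilon>\<^sup>2"
 proof -
  have "2 * real p = (real p + real q * sqrt 2) + \<epsilon>" by (simp add: \<epsilon>_def)
  then have "2 * real p * \<epsilon> = \<epsilon> * (real p + real q * sqrt 2) + \<epsilon> * \<epsilon>" by (simp add: algebra_simps)
  then show ?thesis using eps by (simp add: power2_eq_square)
 qed
 define z where "z = real num / real den"
 have z: "0 < z" "z < 1" using num by (auto simp: z_def)
 have u_le: "real u <= 2 * real p * z" and u_gt: "2 * real p * z < real u + 1"
 proof -
  have "u * den <= 2 * p * num" unfolding u_def by simp
  then have "real (u * den) <= real (2 * p * num)" by (simp only: of_nat_le_iff)
  then show "real u <= 2 * real p * z" using den by (simp add: z_def field_simps)
  have "2 * p * num < (u + 1) * den"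
   using dividend_less_div_times[OF den, of "2 * p * num"] by (simp add: u_def)
  then have "real (2 * p * num) < real ((u + 1) * den)" by (simp only: of_nat_less_iff)
  then show "2 * real p * z < real u + 1" using den by (simp add: z_def field_simps)
 qed
 have u0: "0 < u"
 proof -
  have "den * 1 <= 2 * p * num" using num by (metis One_nat_def Suc_leI mult_le_mono)
  then show ?thesis unfolding u_def using den by (simp add: div_greater_zero_iff)
 qed
 have err: "\<bar>real u * \<epsilon> - z\<bar> <= \<epsilon>"
 proof -
  have e1: "\<epsilon> <= 1" using eps_le p0 by (auto intro: order_trans simp: divide_le_eq)
  have "real u * \<epsilon> <= 2 * real p * z * \<epsilon>" using u_le eps0 by (intro mult_right_mono) auto
  also have "... = z + z * \<epsilon>\<^sup>2" using two_p by (metis mult.assoc mult.commute distrib_left mult_1_right)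
  also have "z * \<epsilon>\<^sup>2 <= 1 * \<epsilon>"
   using z eps0 e1 by (intro mult_mono) (auto simp: power2_eq_square mult_left_le)
  finally have 1: "real u * \<epsilon> <= z + \<epsilon>" by simp
  have "z <= 2 * real p * z * \<epsilon>"
   using two_p z by (metis (no_types, opaque_lifting) mult.assoc mult.commute le_add_same_cancel1 zero_le_power2 mult_le_cancel_left1 less_le_not_le)
  also have "... <= (real u + 1) * \<epsilon>" using u_gt eps0 by (intro mult_right_mono) auto
  finally have "z <= real u * \<epsilon> + \<epsilon>" by (simp add: algebra_simps)
  with 1 show ?thesis by (simp add: abs_le_iff)
 qed
 define d where "d = - (2 * pi * (real u * \<epsilon> - z))"
 have r: "r = 2 * q * u" by (simp add: r_def u_def)
 have r0: "real r > 0" using u0 q by (simp add: r)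
 have turn: "real r * rotation_angle = 2 * pi * of_int (int (u * p)) + (- (2 * pi * z) + d)"
  by (simp add: r rotation_angle_def d_def \<epsilon>_def algebra_simps)
 \<comment> \<open>The residual angle \<open>d\<close> is spread evenly over the \<open>r\<close>
   rotations. They become exact as a bundle, and using the basis angle instead costs
   \<open>\<bar>d\<bar>\<close> in total; \<open>\<pi> < 4\<close> then gives the constant
   8.\<close>
 define a where "a = rotation_angle - d / real r"
 have "cis (real r * a) = cis (2 * pi * of_int (int (u * p)) + - (2 * pi * z))"
  using turn r0 by (simp add: a_def right_diff_distrib)
 also have "... = cis (2 * pi * of_int (int (u * p))) * cis (- (2 * pi * z))"
  by (simp only: cis_mult)
 also have "cis (2 * pi * of_int (int (u * p))) = 1"
  by (rule cis_multiple_2pi) simp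
 finally have "cis (real r * a) = cis (- (2 * pi * (real num / real den)))"
  by (simp add: z_def)
 moreover have "real r * cmod (cis rotation_angle - cis a) <= 8 / real p"
 proof -
  have "cmod (cis rotation_angle - cis a) <= \<bar>d / real r\<bar>"
   using cis_diff_le[of rotation_angle a] by (simp add: a_def)
  then have "real r * cmod (cis rotation_angle - cis a) <= \<bar>d\<bar>"
   using r0 by (simp add: field_simps abs_divide)
  also have "... = 2 * pi * \<bar>real u * \<epsilon> - z\<bar>" by (simp add: d_def abs_mult)
  also have "... <= 8 * (1 / real p)"
   using err eps_le pi_less_4 pi_gt_zero by (intro mult_mono) auto
  finally show ?thesis by simp
 qed
 ultimately show ?thesis using that by blast
qed

section \<open>Uniformity of the circuits\<close>

text \<open>Powers of two with a free exponent are not polynomially bounded, but their truncations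
  are: doubling with a cap stays at the cap once it is reached.\<close>

lemma lsf_min_power2 [lsf_intros]:
 assumes "lsf b" "lsf c"
 shows "lsf (\<lambda>E. min (2 ^ b E) (c E))"
proof -
 have eq: "rec_nat (min 1 c) (\<lambda>i acc. min (2 * acc) c) n = min (2 ^ n) c" for n c :: nat
  by (induction n) (auto simp: min_def)
 have "lsf (\<lambda>E. rec_nat (min 1 (c E)) (\<lambda>i acc. min (2 * acc) (c E)) (b E))"
  by (rule lsf_iter[where s = "\<lambda>acc i E. 2 * acc"]) (intro lsf_intros assms)+
 then show ?thesis by (simp only: eq)
qed

text \<open>Capping the divisor \<open>2 ^ k\<close> at \<open>Suc x\<close> does not change the
  quotient of \<open>x\<close>, because any divisor above \<open>x\<close> yields 0.\<close>

lemma lsp_bit [lsf_intros]: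
 assumes "lsf a" "lsf b"
 shows "lsp (\<lambda>E. bit (a E) (b E))"
proof -
 have "x div min (2 ^ k) (Suc x) = x div 2 ^ k" for x k :: nat
  by (auto simp: min_def div_eq_0_iff)
 then have eq: "bit x k \<longleftrightarrow> \<not> 2 dvd (x div min (2 ^ k) (Suc x))" for x k :: nat
  by (simp add: bit_iff_odd)
 show ?thesis unfolding eq by (intro lsf_intros assms)
qed

lemma lsf_prod_encode [lsf_intros]: "lsf a ==> lsf b ==> lsf (\<lambda>E. prod_encode (a E, b E))"
 unfolding prod_encode_def triangle_def split_conv by (intro lsf_intros)

lemma prod_encode_mono: "a <= a' ==> b <= b' ==> prod_encode (a, b) <= prod_encode (a', b')"
 unfolding prod_encode_def triangle_def split_conv by (intro add_mono div_le_mono mult_le_mono) auto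

definition anc_at :: "nat => nat => nat => nat => nat => nat => nat" where
 "anc_at b t i k v u = b + 2 * prod_encode (t, prod_encode (i, prod_encode (k, prod_encode (v, u)))) + 1"

lemma anc_at_eq: "anc_at b t i k v u = anc_at b t' i' k' v' u' \<longleftrightarrow> t = t' \<and> i = i' \<and> k = k' \<and> v = v' \<and> u = u'"
 by (simp add: anc_at_def prod_encode_eq)

lemma anc_at_mono: "t <= t' ==> i <= i' ==> k <= k' ==> v <= v' ==> u <= u' ==> anc_at b t i k v u <= anc_at b t' i' k' v' u'"
 unfolding anc_at_def by (intro add_mono mult_le_mono2 prod_encode_mono order_refl)

lemma lsf_anc_at [lsf_intros]: "lsf b ==> lsf t ==> lsf i ==> lsf k ==> lsf v ==> lsf u ==>
  lsf (\<lambda>E. anc_at (b E) (t E) (i E) (k E) (v E) (u E))"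
 unfolding anc_at_def by (intro lsf_intros)


text \<open>The prefix \<open>bs\<close> is arbitrary because one list is printed in several ways:
  as the targets of a fan-out gate, or as one rotation or Hadamard gate for every element.\<close>

definition natlist :: "(env => nat list) => bool" where
 "natlist ys \<longleftrightarrow> (\<forall>bs. prn (\<lambda>E. concat (map (\<lambda>x. bs @ encode_nat x) (ys E))))"

lemma prn_encode_nat [prn_intros]: "lsf f ==> prn (\<lambda>E. encode_nat (f E))"
 unfolding encode_nat_def by (rule prn_num)

named_theorems list_intros

lemma natlist_append [list_intros]: "natlist xs ==> natlist ys ==> natlist (\<lambda>E. xs E @ ys E)"
 unfolding natlist_def by (auto intro: prn_intros)

lemma natlist_if [list_intros]: "lsp P ==> natlist xs ==> natlist (\<lambda>E. if P E then xs E else [])"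
 unfolding natlist_def if_distrib[of "map _"] if_distrib[of concat] list.map concat.simps
 by (intro allI prn_if) simp_all

lemma natlist_single [list_intros]: "lsf f ==> natlist (\<lambda>E. [f E])"
 unfolding natlist_def by (auto intro!: prn_intros)

lemma natlist_map [list_intros]:
 assumes "lsf n" "lsf (\<lambda>E. f (E 0) (\<lambda>k. E (Suc k)))"
 shows "natlist (\<lambda>E. map (\<lambda>i. f i E) [0..<n E])"
 unfolding natlist_def map_map o_def by (intro allI prn_concat assms prn_append prn_str prn_encode_nat)

lemma natlist_concat [list_intros]:
 assumes "lsf n" "natlist (\<lambda>E. f (E 0) (\<lambda>k. E (Suc k)))"
 shows "natlist (\<lambda>E. concat (map (\<lambda>i. f i E) [0..<n E]))"
proof -
 have eq: "concat (map g (concat (map h xs))) = concat (map (\<lambda>i. concat (map g (h i))) xs)" for g :: "nat => bool list" and h xs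
  by (induction xs) auto
 show ?thesis
  unfolding natlist_def eq by (intro allI prn_concat assms(1)) (use assms(2) in "simp add: natlist_def")
qed

definition glist :: "(env => gate list) => bool" where
 "glist L \<longleftrightarrow> prn (\<lambda>E. concat (map (\<lambda>g. True # encode_gate g) (L E)))"

lemma glist_append [list_intros]: "glist L ==> glist L' ==> glist (\<lambda>E. L E @ L' E)"
 unfolding glist_def by (auto intro: prn_intros)

lemma glist_concat [list_intros]:
 assumes "lsf n" "glist (\<lambda>E. f (E 0) (\<lambda>k. E (Suc k)))"
 shows "glist (\<lambda>E. concat (map (\<lambda>i. f i E) [0..<n E]))"
proof -
 have eq: "concat (map g (concat (map h xs))) = concat (map (\<lambda>i. concat (map g (h i))) xs)"
  for g :: "gate => bool list" and h and xs :: "nat list"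
  by (induction xs) auto
 show ?thesis
  unfolding glist_def eq by (intro prn_concat assms(1)) (use assms(2) in "simp add: glist_def")
qed

lemma glist_map [list_intros]:
 assumes "lsf n" "glist (\<lambda>E. [g (E 0) (\<lambda>k. E (Suc k))])"
 shows "glist (\<lambda>E. map (\<lambda>i. g i E) [0..<n E])"
 using glist_concat[of n "\<lambda>i E. [g i E]"] assms by (simp add: concat_map_singleton)

lemma glist_Cons: "glist (\<lambda>E. [g E]) ==> glist L ==> glist (\<lambda>E. g E # L E)"
 using glist_append[of "\<lambda>E. [g E]" L] by simp

lemma glist_gate [list_intros]:
 "lsf f ==> glist (\<lambda>E. [Hadamard (f E)])"
 "lsf f ==> lsf f' ==> glist (\<lambda>E. [Cnot (f E) (f' E)])"
 unfolding glist_def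
 using prn_append[OF prn_str[of "[True, False, False]"] prn_encode_nat[of f]]
  prn_append[OF prn_str[of "[True, True, False]"] prn_append[OF prn_encode_nat[of f] prn_encode_nat[of f']]]
 by simp_all

lemma glist_rot [list_intros]: "natlist ys ==> glist (\<lambda>E. map Rotation (ys E))"
proof -
 assume "natlist ys"
 then have "prn (\<lambda>E. concat (map (\<lambda>x. [True, False, True] @ encode_nat x) (ys E)))"
  unfolding natlist_def by blast
 then show ?thesis by (simp add: glist_def o_def)
qed

lemma glist_had [list_intros]: "natlist ys ==> glist (\<lambda>E. map Hadamard (ys E))"
proof -
 assume "natlist ys"
 then have "prn (\<lambda>E. concat (map (\<lambda>x. [True, False, False] @ encode_nat x) (ys E)))"
  unfolding natlist_def by blast
 then show ?thesis by (simp add: glist_def o_def)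
qed

lemma glist_fan [list_intros]:
 assumes "natlist ys" "lsf f"
 shows "glist (\<lambda>E. [Fanout (ys E) (f E)])"
proof -
 have "prn (\<lambda>E. concat (map (\<lambda>x. [True] @ encode_nat x) (ys E)))"
  using assms(1) unfolding natlist_def by blast
 then have "prn (\<lambda>E. [True, True, True] @ concat (map (\<lambda>x. [True] @ encode_nat x) (ys E)) @ [False] @ encode_nat (f E))"
  by (intro prn_intros assms(2))
 then show ?thesis by (simp add: glist_def encode_list_def)
qed

definition llist :: "(env => gate list list) => bool" where
 "llist Ls \<longleftrightarrow> prn (\<lambda>E. concat (map (\<lambda>L. True # encode_list encode_gate L) (Ls E)))"

lemma llist_Nil [list_intros]: "llist (\<lambda>E. [])"
 unfolding llist_def by (auto intro: prn_intros)

lemma llist_append [list_intros]: "llist L ==> llist L' ==> llist (\<lambda>E. L E @ L' E)"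
 unfolding llist_def by (auto intro: prn_intros)

lemma llist_Cons [list_intros]:
 assumes "glist L" "llist Ls"
 shows "llist (\<lambda>E. L E # Ls E)"
proof -
 have "prn (\<lambda>E. [True] @ concat (map (\<lambda>g. True # encode_gate g) (L E)) @ [False] @ concat (map (\<lambda>L. True # encode_list encode_gate L) (Ls E)))"
  using assms unfolding glist_def llist_def by (intro prn_intros)
 then show ?thesis by (simp add: llist_def encode_list_def)
qed

theorem uniform_family_llist:
 assumes "lsf N" "llist Ls"
  and "!!n m. C n m = Circuit (N (push n (push m (\<lambda>_. 0)))) (Ls (push n (push m (\<lambda>_. 0))))"
 shows "uniform_family C"
proof -
 have "prn (\<lambda>E. encode_nat (N E) @ concat (map (\<lambda>L. True # encode_list encode_gate L) (Ls E)) @ [False])"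
  using assms(1,2) unfolding llist_def by (intro prn_intros)
 then obtain p where p: "!!E. encode_nat (N E) @ concat (map (\<lambda>L. True # encode_list encode_gate L) (Ls E)) @ [False] = print p E"
  unfolding prn_def by metis
 have "encode_circuit (C n m) = print p (push n (push m (\<lambda>_. 0)))" for n m
  unfolding p[symmetric] by (simp add: assms(3) encode_circuit_def encode_list_def[of "encode_list encode_gate"])
 then show ?thesis
  unfolding uniform_family_def using printer_computable[of p] by metis
qed


text \<open>That \<open>2 ^ K\<close> is computable is a separate premise, since \<open>lsf\<close>
  is not closed under exponentiation; it holds here because \<open>K\<close> will be a
  logarithm.\<close>

lemma llist_layers:
 fixes G K W base :: "env => nat" and cf :: "env => nat => nat => nat" and tf wire tgt rp rm :: "env => nat => nat"
 assumes G: "lsf G" and K: "lsf K" and W: "lsf W" and base: "lsf base" and K2: "lsf (\<lambda>E. 2 ^ K E)"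
  and cf: "lsf (\<lambda>E. cf (\<lambda>k. E (Suc (Suc k))) (E 0) (E 1))"
  and tf: "lsf (\<lambda>E. tf (\<lambda>k. E (Suc k)) (E 0))" and wire: "lsf (\<lambda>E. wire (\<lambda>k. E (Suc k)) (E 0))"
  and tgt: "lsf (\<lambda>E. tgt (\<lambda>k. E (Suc k)) (E 0))" and rp: "lsf (\<lambda>E. rp (\<lambda>k. E (Suc k)) (E 0))"
  and rm: "lsf (\<lambda>E. rm (\<lambda>k. E (Suc k)) (E 0))"
 shows "llist (\<lambda>E. exact_layer.layers (G E) (K E) (W E) (cf E) (tf E) (wire E) (tgt E) (anc_at (base E)) (rp E) (rm E))"
proof -
 have env1: "lsf (\<lambda>E. f (e E) (a E))" if "lsf (\<lambda>E. f (\<lambda>k. E (Suc k)) (E 0))" "!!k. lsf (\<lambda>E. e E k)" "lsf a"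
  for f :: "env => nat => nat" and e :: "env => env" and a
 proof -
  have "lsf (\<lambda>E. push (a E) (e E) k)" for k by (cases k) (use that in auto)
  from lsf_subst[OF that(1), of "\<lambda>k E. push (a E) (e E) k", OF this] show ?thesis by simp
 qed
 have env2: "lsf (\<lambda>E. f (e E) (a E) (b E))" if "lsf (\<lambda>E. f (\<lambda>k. E (Suc (Suc k))) (E 0) (E 1))" "!!k. lsf (\<lambda>E. e E k)" "lsf a" "lsf b"
  for f :: "env => nat => nat => nat" and e :: "env => env" and a b
 proof -
  have "lsf (\<lambda>E. push (a E) (push (b E) (e E)) k)" for k
   by (cases k; cases "k - 1") (use that in auto)
  from lsf_subst[OF that(1), of "\<lambda>k E. push (a E) (push (b E) (e E)) k", OF this] show ?thesis by simp
 qed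
 note params = lsf_subst[OF G] lsf_subst[OF K] lsf_subst[OF W] lsf_subst[OF base] lsf_subst[OF K2]
  env2[OF cf] env1[OF tf] env1[OF wire] env1[OF tgt] env1[OF rp] env1[OF rm]
 show ?thesis
  unfolding exact_layer.layers_def exact_layer.stages_def list.map append.simps
   exact_layer.copy_layer_def exact_layer.copies_def exact_layer.HYA_def exact_layer.HA_def exact_layer.FA_def
   exact_layer.R1_def exact_layer.R2_def exact_layer.FC_def exact_layer.HB_def exact_layer.FB_def exact_layer.FD_def
   exact_layer.FY_def exact_layer.RD_def exact_layer.P1_def exact_layer.P2_def exact_layer.C1_def exact_layer.C2_def
   exact_layer.D1_def exact_layer.D2_def exact_layer.block_def exact_layer.A_def exact_layer.Bq_def
  by (intro list_intros glist_Cons lsf_intros params)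
qed

section \<open>Circuits for nets of exact threshold gates\<close>

lemma xrun_ket_fans:
 assumes "acts gs p" "!!j. p (p j) = j"
 shows "xrun gs (ket s) = ket (p s)"
proof -
 have "xrun gs (ket s) = (\<lambda>j. ket s (p j))" using assms(1) by (simp add: acts_def)
 also have "... = ket (p s)" using assms(2) by (auto simp: ket_def fun_eq_iff)
 finally show ?thesis .
qed

text \<open>Wires are numbered consecutively in blocks of length \<open>R\<close>: wire
  \<open>d * R + i\<close> is gate \<open>i\<close> of level \<open>d\<close>, and a gate may read
  all wires of all earlier levels.\<close>

fun net_value :: "(nat => nat => nat => nat) => (nat => nat => nat) => nat => nat => nat => nat => bool" where
 "net_value cw tw R X 0 v = (v < R \<and> bit X v)"
| "net_value cw tw R X (Suc d) v = (if Suc d * R <= v \<and> v < Suc d * R + R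
   then (\<Sum>u<Suc d * R. cw (Suc d) u (v - Suc d * R) * of_bool (net_value cw tw R X d u)) = tw (Suc d) (v - Suc d * R)
   else net_value cw tw R X d v)"

lemma net_value_out: "Suc d * R <= v ==> \<not> net_value cw tw R X d v"
 by (induction d) auto

lemma net_value_mono: "v < Suc d * R ==> d <= d' ==> net_value cw tw R X d' v = net_value cw tw R X d v"
proof (induction d')
 case (Suc d')
 show ?case
 proof (cases "d = Suc d'")
  case False
  then have "d <= d'" using Suc.prems by simp
  moreover have "v < Suc d' * R"
   using Suc.prems(1) mult_le_mono1[of "Suc d" "Suc d'" R] \<open>d <= d'\<close> by linarith
  ultimately show ?thesis using Suc by simp
 qed simp
qed simp

locale net_circuit =
 fixes a b D R K M :: nat and cw :: "nat => nat => nat => nat" and tw :: "nat => nat => nat" and ow :: "nat => nat"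
  and rp rm :: "nat => nat"
begin

text \<open>Wires have even and ancillas odd distance from the output register.\<close>

definition wire :: "nat => nat" where
 "wire v = (if v < a then v else a + b + 2 * v)"

definition base :: nat where
 "base = a + b"

definition el :: "nat => gate list list" where
 "el d = exact_layer.layers R K (d * R) (\<lambda>i u. cw d u i) (tw d) wire (\<lambda>i. wire (d * R + i)) (anc_at base) rp rm"

definition copy_out :: "gate list" where
 "copy_out = map (\<lambda>i. Cnot (wire (ow i)) (a + i)) [0..<b]"

definition circ_layers :: "gate list list" where
 "circ_layers = concat (map el [1..<D + 1]) @ [copy_out] @ concat (map el (rev [1..<D + 1]))"

text \<open>\<open>M\<close> bounds all ancilla coordinates and 10 is the largest ancilla type, so
  by monotonicity the first term covers the ancillas; the second one makes room for the
  wires.\<close>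

definition width :: nat where
 "width = anc_at base 10 M M M M + 2 * ((D + 1) * R) + 1"

definition circ :: circuit where
 "circ = Circuit width circ_layers"

end

locale net_circuit_sem = net_circuit +
 fixes ap am :: "nat => real"
 assumes a_le: "a <= R"
  and K_pos: "0 < K"
  and weight_bound: "!!d i. 1 <= d ==> d <= D ==> i < R ==> (\<Sum>u<d * R. cw d u i) < 2 ^ K"
  and target_bound: "!!d i. 1 <= d ==> d <= D ==> i < R ==> tw d i < 2 ^ K"
  and ow_less: "!!i. i < b ==> ow i < (D + 1) * R"
  and ow_inj: "!!i j. i < b ==> j < b ==> ow i = ow j ==> i = j"
  and angp: "!!k. k < K ==> cis (of_nat (rp k) * ap k) = cis (pi / 2 ^ Suc k)"
  and angm: "!!k. k < K ==> cis (of_nat (rm k) * am k) = cis (- (pi / 2 ^ Suc k))"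
  and M: "R <= M" "K <= M" "D * R <= M" "2 ^ K <= M"
  and rp_bound: "!!k. k < K ==> 2 * 2 ^ K * rp k <= M" and rm_bound: "!!k. k < K ==> 2 * 2 ^ K * rm k <= M"
begin

text \<open>The angle is recovered by decoding the qubit number. Odd ancilla types rotate
  positively, even ones negatively; types 9 and 10 have coordinate 0 in the place of
  \<open>k\<close> and always use the angle for \<open>K - 1\<close>.\<close>

definition ang :: "nat => real" where
 "ang q = (let (t, r) = prod_decode ((q - base - 1) div 2); k = fst (prod_decode (snd (prod_decode r))) in
   if t = 9 then ap (K - 1) else if t = 10 then am (K - 1) else if odd t then ap k else am k)"

lemma ang_anc:
 "ang (anc_at base t i k v u) =
   (if t = 9 then ap (K - 1) else if t = 10 then am (K - 1) else if odd t then ap k else am k)"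
 by (simp add: ang_def anc_at_def)

lemma wire_eq: "wire v = wire v' \<longleftrightarrow> v = v'"
 by (auto simp: wire_def)

lemma wire_anc: "wire v ~= anc_at base t i k v' u"
 unfolding wire_def anc_at_def base_def by (simp split: if_splits) presburger

lemma out_anc: "i < b ==> a + i ~= anc_at base t i' k v' u"
 by (auto simp: anc_at_def base_def)

lemma wire_out: "i < b ==> wire v ~= a + i"
 by (auto simp: wire_def)

lemma level_sem:
 assumes "1 <= d" "d <= D"
 shows "exact_layer_sem R K (d * R) (\<lambda>i u. cw d u i) (tw d) wire (\<lambda>i. wire (d * R + i)) (anc_at base) rp rm ap am ang"
proof (unfold_locales, goal_cases)
 case (1 t i k v u t' i' k' v' u')
 then show ?case by (rule anc_at_eq)
next
 case (2 v t i k v' u)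
 then show ?case by (rule wire_anc)
next
 case (3 j t i k v u)
 then show ?case by (rule wire_anc)
qed (use assms weight_bound target_bound K_pos angp angm in "auto simp: wire_eq ang_anc")

abbreviation run :: "gate list => state => state" where
 "run gs \<equiv> xrun (map (to_xgate ang) gs)"

definition filled :: "nat => nat => nat set => nat" where
 "filled X d Os = bits_nat (wire ` {v. v < (D + 1) * R \<and> net_value cw tw R X d v} \<union> (\<lambda>i. a + i) ` (Os \<inter> {..<b}))"

lemma bit_filled: "bit (filled X d Os) q \<longleftrightarrow>
  (\<exists>v<(D + 1) * R. q = wire v \<and> net_value cw tw R X d v) \<or> (\<exists>i\<in>Os. i < b \<and> q = a + i)"
 unfolding filled_def by (subst bit_bits_nat) auto

lemma bit_filled_wire: "v < (D + 1) * R ==> bit (filled X d Os) (wire v) = net_value cw tw R X d v"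
 using wire_out by (auto simp: bit_filled wire_eq)

text \<open>Gates add their values to their targets modulo 2, so the same layers that compute a
  level also erase it. Both directions are treated at once by letting \<open>e\<close> be the state
  before or after the level.\<close>

lemma run_level:
 assumes "d < D" "e = d \<or> e = Suc d"
 shows "run (concat (el (Suc d))) (ket (filled X e Os)) = ket (filled X (if e = d then Suc d else d) Os)"
proof -
 interpret L: exact_layer_sem R K "Suc d * R" "\<lambda>i u. cw (Suc d) u i" "tw (Suc d)" wire "\<lambda>i. wire (Suc d * R + i)"
  "anc_at base" rp rm ap am ang
  by (rule level_sem) (use assms in auto)
 have le: "Suc d * R + R <= (D + 1) * R"
  using assms(1) mult_le_mono1[of "Suc d + 1" "D + 1" R] by simp
 define sat' where "sat' i \<longleftrightarrow> (\<Sum>u<Suc d * R. cw (Suc d) u i * of_bool (net_value cw tw R X d u)) = tw (Suc d) i" for i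
 have clean: "\<not> bit (filled X e Os) (anc_at base t i k v u)" for t i k v u
  using wire_anc out_anc by (auto simp: bit_filled) (metis wire_anc out_anc)+
 have sat: "L.satisfied (filled X e Os) i \<longleftrightarrow> sat' i" for i
 proof -
  have "bit (filled X e Os) (wire u) = net_value cw tw R X d u" if "u < Suc d * R" for u
  proof -
   have "net_value cw tw R X e u = net_value cw tw R X d u"
    using assms(2) net_value_mono[OF that, of e] by auto
   then show ?thesis using that le by (subst bit_filled_wire) auto
  qed
  then show ?thesis unfolding L.satisfied_def sat'_def by simp
 qed
 let ?T = "(\<lambda>i. wire (Suc d * R + i)) ` {i. i < R \<and> sat' i}"
 let ?e = "if e = d then Suc d else d"
 have "flipset ?T (filled X e Os) = filled X ?e Os"
 proof (rule bit_eqI)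
  fix q
  have fin: "finite ?T" by simp
  show "bit (flipset ?T (filled X e Os)) q = bit (filled X ?e Os) q"
  proof (cases "\<exists>v<(D + 1) * R. q = wire v")
   case True
   then obtain v where v: "v < (D + 1) * R" "q = wire v" by auto
   have "q \<in> ?T \<longleftrightarrow> Suc d * R <= v \<and> v < Suc d * R + R \<and> sat' (v - Suc d * R)"
    using v(2) by (auto simp: wire_eq image_iff intro!: exI[of _ "v - Suc d * R"])
   moreover have "net_value cw tw R X (Suc d) v \<longleftrightarrow> net_value cw tw R X d v ~=
     (Suc d * R <= v \<and> v < Suc d * R + R \<and> sat' (v - Suc d * R))"
    using net_value_out[of d R v cw tw X] by (auto simp: sat'_def simp del: sum_mult_of_bool_eq)
   ultimately show ?thesis
    unfolding bit_flipset[OF fin] v(2) bit_filled_wire[OF v(1)]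
    using assms(2) v(2) by (auto simp del: net_value.simps)
  next
   case False
   have "q \<notin> ?T"
   proof
    assume "q \<in> ?T"
    then obtain i where "i < R" "q = wire (Suc d * R + i)" by auto
    moreover have "Suc d * R + i < (D + 1) * R" using le \<open>i < R\<close> by linarith
    ultimately show False using False by blast
   qed
   then show ?thesis
    unfolding bit_flipset[OF fin] bit_filled using False by auto
  qed
 qed
 then show ?thesis
  using L.run_layers[OF clean] unfolding el_def sat by simp
qed

lemma run_up: "d <= D ==> run (concat (concat (map el [1..<d + 1]))) (ket (filled X 0 Os)) = ket (filled X d Os)"
proof (induction d)
 case (Suc d)
 then show ?case using run_level[of d d X Os] by simp
qed simp

lemma run_down: "d <= D ==> run (concat (concat (map el (rev [1..<d + 1])))) (ket (filled X d Os)) = ket (filled X 0 Os)"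
proof (induction d)
 case (Suc d)
 then show ?case using run_level[of d "Suc d" X Os] by simp
qed simp

lemma run_copy_out:
 "run copy_out (ket (filled X D {})) = ket (filled X D {i. net_value cw tw R X D (ow i)})"
proof -
 let ?f = "fans b (\<lambda>i. [a + i]) (\<lambda>i. wire (ow i))"
 have "map (to_xgate ang) copy_out = map (\<lambda>i. XF [a + i] (wire (ow i))) [0..<b]"
  by (simp add: copy_out_def)
 moreover have "acts (map (\<lambda>i. XF [a + i] (wire (ow i))) [0..<b]) ?f"
  by (rule acts_fans) (auto simp: wire_out)
 moreover have "?f (?f j) = j" for j
  by (rule fans_fans) (auto simp: wire_out)
 ultimately have "run copy_out (ket (filled X D {})) = ket (?f (filled X D {}))"
  using xrun_ket_fans by metis
 also have "?f (filled X D {}) = filled X D {i. net_value cw tw R X D (ow i)}"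
 proof (rule bit_eqI)
  fix q
  have "(\<exists>i<b. q \<in> set [a + i] \<and> bit (filled X D {}) (wire (ow i))) \<longleftrightarrow> (\<exists>i<b. q = a + i \<and> net_value cw tw R X D (ow i))"
   using bit_filled_wire[OF ow_less] by auto
  then show "bit (?f (filled X D {})) q = bit (filled X D {i. net_value cw tw R X D (ow i)}) q"
   unfolding bit_fans using wire_out by (auto simp: bit_filled)
 qed
 finally show ?thesis .
qed

theorem run_circ:
 assumes X: "X < 2 ^ a" and f: "!!i. i < b ==> bit y i = net_value cw tw R X D (ow i)"
 shows "run (concat circ_layers) (ket X) = ket (Bit_Operations.xor X (push_bit a (take_bit b y)))"
proof -
 have bitX: "q < a" if "bit X q" for q using bit_imp_less[OF X that] .
 have eq: "filled X 0 Os = Bit_Operations.xor X (push_bit a (take_bit b y))"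
  if "!!i. i < b ==> i \<in> Os \<longleftrightarrow> bit y i" for Os
 proof (rule bit_eqI)
  fix q
  have "(\<exists>v<(D + 1) * R. q = wire v \<and> net_value cw tw R X 0 v) \<longleftrightarrow> bit X q"
  proof
   assume "bit X q"
   then show "\<exists>v<(D + 1) * R. q = wire v \<and> net_value cw tw R X 0 v"
    using bitX[of q] a_le by (intro exI[of _ q]) (auto simp: wire_def)
  next
   assume "\<exists>v<(D + 1) * R. q = wire v \<and> net_value cw tw R X 0 v"
   then show "bit X q" using bitX by (auto simp: wire_def)
  qed
  moreover have "(\<exists>i\<in>Os. i < b \<and> q = a + i) \<longleftrightarrow> a <= q \<and> q - a < b \<and> bit y (q - a)"
   using that by (auto intro!: bexI[of _ "q - a"])
  ultimately show "bit (filled X 0 Os) q = bit (Bit_Operations.xor X (push_bit a (take_bit b y))) q"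
   using bitX[of q] by (auto simp: bit_filled bit_xor_iff bit_push_bit_iff bit_take_bit_iff)
 qed
 have X0: "filled X 0 {} = X"
 proof (rule bit_eqI)
  fix q
  show "bit (filled X 0 {}) q = bit X q"
  proof
   assume "bit X q"
   then show "bit (filled X 0 {}) q"
    using bitX[of q] a_le by (auto simp: bit_filled wire_def intro!: exI[of _ q])
  next
   assume "bit (filled X 0 {}) q"
   then show "bit X q" using bitX by (auto simp: bit_filled wire_def)
  qed
 qed
 let ?Os = "{i. net_value cw tw R X D (ow i)}"
 have "run (concat circ_layers) (ket X)
   = run (concat (concat (map el (rev [1..<D + 1])))) (run copy_out (run (concat (concat (map el [1..<D + 1]))) (ket (filled X 0 {}))))"
  by (simp add: circ_layers_def X0)
 also have "... = ket (filled X 0 ?Os)"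
  unfolding run_up[OF order_refl] run_copy_out run_down[OF order_refl] ..
 also have "filled X 0 ?Os = Bit_Operations.xor X (push_bit a (take_bit b y))"
  by (rule eq) (use f in auto)
 finally show ?thesis .
qed


lemma level_layers: "L \<in> set (el d) ==> 1 <= d ==> d <= D ==>
  distinct (layer_qubits L) \<and> (\<forall>q\<in>set (layer_qubits L). q < width)"
proof -
 assume L: "L \<in> set (el d)" and d: "1 <= d" "d <= D"
 interpret L: exact_layer_sem R K "d * R" "\<lambda>i u. cw d u i" "tw d" wire "\<lambda>i. wire (d * R + i)"
  "anc_at base" rp rm ap am ang
  by (rule level_sem[OF d])
 have dR: "d * R <= D * R" using d by simp
 have dM: "d * R <= M" using dR M(3) by linarith
 have wire_less: "wire v < width" if "v < (D + 1) * R" for v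
  using that by (auto simp: wire_def width_def anc_at_def base_def)
 have anc_less: "anc_at base t i k v u < width" if "t <= 10" "i <= M" "k <= M" "v <= M" "u <= M" for t i k v u
  using anc_at_mono[OF that, of base] by (simp add: width_def)
 have "q < width" if q: "q \<in> set (layer_qubits L)" for q
 proof -
  have 1: "2 ^ K * rp k <= M" "2 ^ K * rm k <= M" if "k < K" for k
   using rp_bound[OF that] rm_bound[OF that] by linarith+
  have "L.own_upto M q"
   by (rule L.layers_own_upto[OF _ _ _ _ _ _ _ _ L[unfolded el_def] q])
    (use M(1,2,4) dM rp_bound rm_bound 1 in "auto")
  then show ?thesis
   unfolding L.own_upto_def
  proof (elim disjE exE conjE)
   fix i assume "i < R" "q = wire (d * R + i)"
   then show ?thesis using wire_less[of "d * R + i"] dR by simp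
  next
   fix v assume "v < d * R" "q = wire v"
   then show ?thesis using wire_less[of v] dR by simp
  qed (use anc_less in auto)
 qed
 then show ?thesis using L.distinct_layers L by (auto simp: el_def)
qed

lemma copy_out_layer: "distinct (layer_qubits copy_out) \<and> (\<forall>q\<in>set (layer_qubits copy_out). q < width)"
proof
 show "distinct (layer_qubits copy_out)"
  unfolding copy_out_def layer_qubits_map gate_qubits.simps
  by (rule distinct_concat_upt) (auto simp: wire_out wire_out[symmetric] wire_eq ow_inj)
 show "\<forall>q\<in>set (layer_qubits copy_out). q < width"
  using ow_less by (fastforce simp: copy_out_def layer_qubits_map wire_def width_def anc_at_def base_def)
qed

lemma circ_layer: "L \<in> set circ_layers ==> distinct (layer_qubits L) \<and> (\<forall>q\<in>set (layer_qubits L). q < width)"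
 using copy_out_layer level_layers[of L] by (auto simp: circ_layers_def)

lemma wf_circ: "wf_circuit circ"
 using circ_layer by (auto simp: wf_circuit_def circ_def layer_qubits_def)

lemma a_b_le_width: "a + b <= width"
 by (simp add: width_def anc_at_def base_def)

lemma length_el: "length (el d) = 25"
 by (simp add: el_def exact_layer.layers_def exact_layer.stages_def)

lemma depth_circ: "circuit_depth circ = 50 * D + 1"
proof -
 have "length (concat (map el xs)) = 25 * length xs" for xs
  by (induction xs) (auto simp: length_el)
 then show ?thesis by (simp add: circuit_depth_def circ_def circ_layers_def del: upt_Suc)
qed

text \<open>A layer uses every qubit at most once.\<close>

lemma size_circ: "circuit_size circ <= circuit_depth circ * width"
proof -
 have size: "sum_list (map gate_size (concat Ls)) <= length Ls * width"
  if "!!L. L \<in> set Ls ==> distinct (layer_qubits L) \<and> (\<forall>q\<in>set (layer_qubits L). q < width)" for Ls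
  using that
 proof (induction Ls)
  case (Cons L Ls)
  have "sum_list (map gate_size L) = length (layer_qubits L)"
   by (simp add: layer_qubits_def gate_size_def[abs_def] length_concat o_def)
  also have "... = card (set (layer_qubits L))"
   using Cons.prems[of L] by (simp add: distinct_card)
  also have "... <= card {..<width}"
   using Cons.prems[of L] by (intro card_mono) auto
  finally show ?case using Cons.IH Cons.prems by (fastforce intro: add_mono)
 qed simp
 show ?thesis
  using size[of circ_layers] circ_layer by (simp add: circuit_size_def circuit_depth_def circ_def)
qed

lemma similar: "list_all2 similar_gate (map (to_xgate f) gs) (map (to_xgate f') gs)"
proof -
 have "similar_gate (to_xgate f g) (to_xgate f' g)" for g
  by (cases g) (auto simp: similar_gate_def)
 then show ?thesis by (simp add: list_all2_conv_all_nth)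
qed

text \<open>Every level is run twice, upwards and downwards, which doubles the factor 10 of a single
  level; copying the output involves no rotation.\<close>

lemma circ_error:
 assumes \<delta>: "0 <= \<delta>"
  and p: "!!k. k < K ==> real (rp k) * cmod (cis rotation_angle - cis (ap k)) <= \<delta>"
  and m: "!!k. k < K ==> real (rm k) * cmod (cis rotation_angle - cis (am k)) <= \<delta>"
 shows "nrm width (\<lambda>i. xrun (map (to_xgate (\<lambda>_. rotation_angle)) (concat circ_layers)) \<psi> i - run (concat circ_layers) \<psi> i)
   <= 20 * real D * real R * real K * 2 ^ K * \<delta> * nrm width \<psi>"
proof -
 define err :: "gate => real" where
  "err g = (case g of Rotation q => cmod (cis rotation_angle - cis (ang q)) | _ => 0)" for g
 have level: "(\<Sum>g\<leftarrow>concat (el d). err g) <= real R * real K * 2 ^ K * 10 * \<delta>" if d: "1 <= d" "d <= D" for d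
 proof -
  interpret L: exact_layer_sem R K "d * R" "\<lambda>i u. cw d u i" "tw d" wire "\<lambda>i. wire (d * R + i)"
   "anc_at base" rp rm ap am ang
   by (rule level_sem[OF d])
  show ?thesis
   using L.layers_error[OF \<delta> p m] unfolding L.total_error_def L.rot_error_def[abs_def] err_def el_def by simp
 qed
 have levels: "(\<Sum>g\<leftarrow>concat (concat (map el xs)). err g) <= real (length xs) * (real R * real K * 2 ^ K * 10 * \<delta>)"
  if "set xs \<subseteq> {1..D}" for xs
  using that
 proof (induction xs)
  case (Cons x xs)
  then show ?case using level[of x] by (simp add: distrib_right)
 qed simp
 have out: "(\<Sum>g\<leftarrow>copy_out. err g) = 0"
  by (simp add: copy_out_def err_def o_def sum_list_0)
 have eq: "(\<Sum>(g, h)\<leftarrow>zip (map (to_xgate (\<lambda>_. rotation_angle)) gs) (map (to_xgate ang) gs). gate_error g h) = (\<Sum>g\<leftarrow>gs. err g)" for gs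
 proof (induction gs)
  case (Cons g gs)
  then show ?case by (cases g) (auto simp: err_def)
 qed simp
 have le: "(\<Sum>g\<leftarrow>concat circ_layers. err g) <= 20 * real D * real R * real K * 2 ^ K * \<delta>"
 proof -
  have *: "set [1..<D + 1] \<subseteq> {1..D}" "set (rev [1..<D + 1]) \<subseteq> {1..D}" by auto
  have "(\<Sum>g\<leftarrow>concat circ_layers. err g) = (\<Sum>g\<leftarrow>concat (concat (map el [1..<D + 1])). err g)
    + (\<Sum>g\<leftarrow>concat (concat (map el (rev [1..<D + 1]))). err g)"
   using out by (simp add: circ_layers_def del: upt_Suc)
  also have "... <= real D * (real R * real K * 2 ^ K * 10 * \<delta>) + real D * (real R * real K * 2 ^ K * 10 * \<delta>)"
   using \<delta> by (intro add_mono order_trans[OF levels] *) auto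
  finally show ?thesis by (simp add: ac_simps)
 qed
 have wf: "\<forall>h \<in> set (map (to_xgate ang) (concat circ_layers)). xwf width h"
 proof
  fix h assume "h \<in> set (map (to_xgate ang) (concat circ_layers))"
  then obtain L g where g: "L \<in> set circ_layers" "g \<in> set L" "h = to_xgate ang g" by auto
  have "set (gate_qubits g) \<subseteq> {..<width}"
   using circ_layer[OF g(1)] g(2) by (auto simp: layer_qubits_def)
  moreover have "distinct (gate_qubits g)"
   using circ_layer[OF g(1)] g(2) by (auto simp: layer_qubits_def distinct_concat_iff)
  ultimately show "xwf width h"
   unfolding xwf_def g(3) by (cases g) (auto simp: xqubits_to_xgate)
 qed
 show ?thesis
  by (rule order_trans[OF xrun_error[OF similar wf]], unfold eq, rule mult_right_mono[OF le nrm_nonneg])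
qed

end

section \<open>Constant-depth computable functions\<close>

lemma lsf_arg:
 assumes "lsf (\<lambda>E. f (E 0) (\<lambda>k. E (Suc k)))" "lsf a" "!!k. lsf (\<lambda>E. e E k)"
 shows "lsf (\<lambda>E. f (a E) (e E))"
proof -
 have "lsf (\<lambda>E. push (a E) (e E) k)" for k by (cases k) (use assms in auto)
 from lsf_subst[OF assms(1), of "\<lambda>k E. push (a E) (e E) k", OF this] show ?thesis by simp
qed

lemma lsf_push_env: "lsf a ==> (!!k. lsf (\<lambda>E. e E k)) ==> lsf (\<lambda>E. push (a E) (e E) k)"
 by (cases k) auto

lemma lsf_env: "lsf f ==> (!!k. lsf (\<lambda>E. e E k)) ==> lsf (\<lambda>E. f (e E))"
 using lsf_subst[of f "\<lambda>k E. e E k"] by simp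

text \<open>The inductive step is what one level of exact gates computes from one-hot wires: sums of
  arbitrary log-space functions, each of a single earlier value. Two sums are the minimum for
  bringing together two different functions; every other operation is derived from this
  rule.\<close>

inductive tcn :: "(env => nat => nat) => bool" where
 input: "lsf f ==> tcn (\<lambda>E X. of_bool (bit X (f E)))"
| comb: "tcn G ==> tcn H ==> lsf f ==> lsf g ==> lsf w ==> lsf w' ==>
  tcn (\<lambda>E X. (\<Sum>i<w E. f (push (G (push i E) X) (push i E))) + (\<Sum>i<w' E. g (push (H (push i E) X) (push i E))))"

lemma tcn_bound: "tcn F ==> \<exists>b. lsf b \<and> (\<forall>E X. F E X <= b E)"
proof (induction rule: tcn.induct)
 case (input f)
 show ?case by (intro exI[of _ "\<lambda>_. 1"] conjI lsf_intros) simp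
next
 case (comb G H f g w w')
 then obtain b c where b: "lsf b" "!!E X. G E X <= b E" and c: "lsf c" "!!E X. H E X <= c E" by auto
 have le: "(\<Sum>i<w E. f (push (G (push i E) X) (push i E))) <= (\<Sum>i<w E. \<Sum>v<Suc (b (push i E)). f (push v (push i E)))"
  if "!!E X. G E X <= b E" for w b and f :: "env => nat" and G :: "env => nat => nat" and E X
  using that by (intro sum_mono member_le_sum) (auto simp: le_imp_less_Suc)
 show ?case
 proof (intro exI conjI allI)
  show "lsf (\<lambda>E. (\<Sum>i<w E. \<Sum>v<Suc (b (push i E)). f (push v (push i E)))
    + (\<Sum>i<w' E. \<Sum>v<Suc (c (push i E)). g (push v (push i E))))"
   by (intro lsf_intros comb lsf_env[OF b(1)] lsf_env[OF c(1)] lsf_env[OF comb.hyps(3)] lsf_env[OF comb.hyps(4)] lsf_push_env)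
 qed (intro add_mono le b c)
qed

lemma tcn_subst: "tcn F ==> (!!k. lsf (J k)) ==> tcn (\<lambda>E X. F (\<lambda>k. J k E) X)"
proof (induction arbitrary: J rule: tcn.induct)
 case (input f)
 show ?case by (rule tcn.input[OF lsf_subst[OF input]])
next
 case (comb G H f g w w')
 let ?J = "\<lambda>k E. push (E 0) (\<lambda>k. J k (\<lambda>k. E (Suc k))) k"
 have J: "lsf (?J k)" for k
  by (intro lsf_push_env lsf_intros lsf_env[OF comb.prems])
 have J': "lsf (\<lambda>E. push (E 0) (\<lambda>k. ?J k (\<lambda>k. E (Suc k))) k)" for k
  by (intro lsf_push_env lsf_intros lsf_env[OF comb.prems])
 have "tcn (\<lambda>E X. (\<Sum>i<w (\<lambda>k. J k E). (\<lambda>E. f (\<lambda>k. push (E 0) (\<lambda>k. ?J k (\<lambda>k. E (Suc k))) k)) (push (G (\<lambda>k. ?J k (push i E)) X) (push i E)))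
  + (\<Sum>i<w' (\<lambda>k. J k E). (\<lambda>E. g (\<lambda>k. push (E 0) (\<lambda>k. ?J k (\<lambda>k. E (Suc k))) k)) (push (H (\<lambda>k. ?J k (push i E)) X) (push i E))))"
  by (intro tcn.comb comb.IH J lsf_env[OF comb.hyps(3) J'] lsf_env[OF comb.hyps(4) J'] lsf_env[OF comb.hyps(5) comb.prems] lsf_env[OF comb.hyps(6) comb.prems])
 then show ?case by simp
qed

text \<open>A position in a level codes a tuple: \<open>r\<close> indices of the surrounding sums
  (\<open>denv\<close>) followed by a candidate value (\<open>dval\<close>).
  \<open>with_dval\<close> exchanges the candidate.\<close>

primrec dval :: "nat => nat => nat" where
 "dval 0 j = j"
| "dval (Suc r) j = dval r (snd (prod_decode j))"

primrec denv :: "nat => nat => env => env" where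
 "denv 0 j z = z"
| "denv (Suc r) j z = push (fst (prod_decode j)) (denv r (snd (prod_decode j)) z)"

primrec with_dval :: "nat => nat => nat => nat" where
 "with_dval 0 v j = v"
| "with_dval (Suc r) v j = prod_encode (fst (prod_decode j), with_dval r v (snd (prod_decode j)))"

lemma dval_with_dval [simp]: "dval r (with_dval r v j) = v"
 by (induction r arbitrary: j) auto

lemma denv_with_dval [simp]: "denv r (with_dval r v j) z = denv r j z"
 by (induction r arbitrary: j) auto

text \<open>Decoding by search: both components of a pair are at most its code.\<close>

lemma lsf_fst_decode [lsf_intros]: "lsf a ==> lsf (\<lambda>E. fst (prod_decode (a E)))"
 and lsf_snd_decode [lsf_intros]: "lsf a ==> lsf (\<lambda>E. snd (prod_decode (a E)))"
proof -
 have *: "(\<Sum>x<Suc j. \<Sum>y<Suc j. (if prod_encode (x, y) = j then f x y else 0)) = (f (fst (prod_decode j)) (snd (prod_decode j)) :: nat)"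
  for j and f :: "nat => nat => nat"
 proof -
  let ?x = "fst (prod_decode j)" and ?y = "snd (prod_decode j)"
  have j: "prod_encode (x, y) = j \<longleftrightarrow> x = ?x \<and> y = ?y" for x y
   by (metis fst_conv prod_decode_inverse prod_encode_inverse snd_conv surjective_pairing)
  have le: "?x <= j" "?y <= j"
   using le_prod_encode_1[of ?x ?y] le_prod_encode_2[of ?y ?x] by simp_all
  have "(\<Sum>x<Suc j. \<Sum>y<Suc j. (if prod_encode (x, y) = j then f x y else 0))
    = (\<Sum>x<Suc j. if x = ?x then (\<Sum>y<Suc j. if y = ?y then f x y else 0) else 0)"
   unfolding j by (intro sum.cong) auto
  also have "... = f ?x ?y" using le by (simp add: sum.delta del: sum.lessThan_Suc)
  finally show ?thesis .
 qed
 show "lsf (\<lambda>E. fst (prod_decode (a E)))" if "lsf a"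
  by (rule lsf_comp[OF _ that], subst *[where f = "\<lambda>x y. x", symmetric]) (intro lsf_intros)
 show "lsf (\<lambda>E. snd (prod_decode (a E)))" if "lsf a"
  by (rule lsf_comp[OF _ that], subst *[where f = "\<lambda>x y. y", symmetric]) (intro lsf_intros)
qed

lemma lsf_dval [lsf_intros]: "lsf a ==> lsf (\<lambda>E. dval r (a E))"
 by (induction r arbitrary: a) (auto intro: lsf_intros)

lemma lsf_denv [lsf_intros]: "lsf a ==> (!!k. lsf (\<lambda>E. e E k)) ==> lsf (\<lambda>E. denv r (a E) (e E) k)"
proof (induction r arbitrary: a k)
 case (Suc r)
 show ?case unfolding denv.simps
  by (intro lsf_push_env lsf_fst_decode Suc.IH lsf_snd_decode Suc.prems)
qed simp

lemma lsf_with_dval [lsf_intros]: "lsf v ==> lsf a ==> lsf (\<lambda>E. with_dval r (v E) (a E))"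
 by (induction r arbitrary: a) (auto intro!: lsf_intros)


type_synonym level = "(env => nat) \<times> (env => nat => nat => nat => nat) \<times> (env => nat => nat)"

text \<open>The levels of a net are listed from the last to the first; level 0 consists of the input bits.\<close>

fun net_val :: "env => nat => level list => nat => nat => bool" where
 "net_val z X [] l j = (l = 0 \<and> bit X j)"
| "net_val z X ((B, c, t) # Ls) l j = (if l = Suc (length Ls)
   then (\<Sum>l'<Suc (length Ls). \<Sum>j'<B z. c z l' j' j * of_bool (net_val z X Ls l' j')) = t z j
   else net_val z X Ls l j)"

definition lsf_level :: "level => bool" where
 "lsf_level L \<longleftrightarrow> (case L of (B, c, t) => lsf B \<and>
   lsf (\<lambda>E. c (\<lambda>k. E (Suc (Suc (Suc k)))) (E 0) (E 1) (E 2)) \<and> lsf (\<lambda>E. t (\<lambda>k. E (Suc k)) (E 0)))"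

lemma net_val_append: "l <= length Ls ==> net_val z X (Ls' @ Ls) l j = net_val z X Ls l j"
 by (induction Ls') auto

text \<open>The wire at position \<open>j\<close> of a level representing \<open>F\<close> says that the value encoded in \<open>j\<close> is
 the value of \<open>F\<close> at the indices encoded in \<open>j\<close>.\<close>

definition represents :: "level list => nat => nat => (env => nat) => (env => nat => nat) => bool" where
 "represents Ls l r N F \<longleftrightarrow> (\<forall>z X j. j < N z --> net_val z X Ls l j = (F (denv r j z) X = dval r j))"

definition slot :: "nat => nat => nat => nat => nat" where
 "slot r j i v = prod_encode (i, with_dval r v j)"

lemma slot_decode [simp]: "fst (prod_decode (slot r j i v)) = i" "dval (Suc r) (slot r j i v) = v"
 "denv (Suc r) (slot r j i v) z = push i (denv r j z)"
 by (simp_all add: slot_def)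

text \<open>For every \<open>i\<close>, among the slots with the indices of \<open>j\<close> and
  varying candidate value exactly one wire is on, the one for the true value \<open>G i\<close>.
  Giving the slot of \<open>v\<close> the weight \<open>h v i\<close> therefore makes the linear
  form equal to the sum of \<open>h (G i) i\<close>.\<close>

lemma sum_slots:
 assumes "!!i v. i < w ==> v <= b i ==> slot r j i v < B"
  and "!!i v. i < w ==> slot r j i v < B ==> val (slot r j i v) = (G i = v)"
  and "!!i. i < w ==> G i <= b i"
 shows "(\<Sum>j'<B. (if fst (prod_decode j') < w \<and> j' = slot r j (fst (prod_decode j')) (dval (Suc r) j')
    then h (dval (Suc r) j') (fst (prod_decode j')) else 0) * of_bool (val j')) = (\<Sum>i<w. h (G i) i :: nat)"
proof -
 let ?s = "\<lambda>i. slot r j i (G i)"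
 let ?t = "\<lambda>j'. (if fst (prod_decode j') < w \<and> j' = slot r j (fst (prod_decode j')) (dval (Suc r) j')
    then h (dval (Suc r) j') (fst (prod_decode j')) else 0) * of_bool (val j')"
 have inj: "inj_on ?s {..<w}"
  by (rule inj_on_inverseI[of _ "\<lambda>j'. fst (prod_decode j')"]) simp
 have "(\<Sum>j'<B. ?t j') = (\<Sum>j'\<in>?s ` {..<w}. ?t j')"
 proof (rule sum.mono_neutral_right)
  show "?s ` {..<w} \<subseteq> {..<B}" using assms(1,3) by auto
  show "\<forall>j'\<in>{..<B} - ?s ` {..<w}. ?t j' = 0"
  proof
   fix j' assume j': "j' \<in> {..<B} - ?s ` {..<w}"
   show "?t j' = 0"
   proof (rule ccontr)
    assume "?t j' ~= 0"
    then have *: "fst (prod_decode j') < w" "j' = slot r j (fst (prod_decode j')) (dval (Suc r) j')" "val j'"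
     by (auto simp del: dval.simps split: if_splits)
    then have "G (fst (prod_decode j')) = dval (Suc r) j'"
     using assms(2)[of "fst (prod_decode j')" "dval (Suc r) j'"] j' by auto
    then have "j' = ?s (fst (prod_decode j'))" using *(2) by simp
    then show False using *(1) j' by blast
   qed
  qed
 qed simp
 also have "... = (\<Sum>i<w. ?t (?s i))" by (simp add: sum.reindex[OF inj] del: dval.simps)
 also have "... = (\<Sum>i<w. h (G i) i)"
  using assms by (intro sum.cong refl) (simp del: dval.simps)
 finally show ?thesis .
qed

lemma represents_input:
 assumes f: "lsf f" and N: "lsf N"
 shows "\<exists>L. lsf_level L \<and> represents (L # Ls) (Suc (length Ls)) r N (\<lambda>E X. of_bool (bit X (f E)))"
proof (intro exI conjI)
 let ?c = "\<lambda>z l j' j. of_bool (l = 0 \<and> j' = f (denv r j z)) :: nat"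
 let ?B = "\<lambda>z. Suc (\<Sum>j<N z. f (denv r j z))"
 let ?L = "(?B, ?c, \<lambda>z j. dval r j)"
 show "lsf_level ?L"
  unfolding lsf_level_def split_conv
  by (intro conjI lsf_intros N lsf_env[OF f])
 have val0: "net_val z X Ls 0 i = bit X i" for z X i
  using net_val_append[of 0 "[]" z X Ls i] by simp
 have "(\<Sum>l'<Suc (length Ls). \<Sum>j'<?B z. ?c z l' j' j * of_bool (net_val z X Ls l' j')) = of_bool (bit X (f (denv r j z)))"
  if "j < N z" for z X j
 proof -
  have le: "f (denv r j z) < ?B z"
   using member_le_sum[of j "{..<N z}" "\<lambda>j. f (denv r j z)"] that by (simp add: le_imp_less_Suc)
  have "(\<Sum>l'<Suc (length Ls). \<Sum>j'<?B z. ?c z l' j' j * of_bool (net_val z X Ls l' j'))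
    = (\<Sum>l'<Suc (length Ls). if l' = 0 then (\<Sum>j'<?B z. if j' = f (denv r j z) then of_bool (bit X j') else 0) else 0)"
  proof (rule sum.cong[OF refl])
   fix l'
   show "(\<Sum>j'<?B z. ?c z l' j' j * of_bool (net_val z X Ls l' j'))
    = (if l' = 0 then (\<Sum>j'<?B z. if j' = f (denv r j z) then of_bool (bit X j') else 0) else 0)"
   proof (cases "l' = 0")
    case True
    have "(\<Sum>j'<?B z. ?c z l' j' j * of_bool (net_val z X Ls l' j')) = (\<Sum>j'<?B z. if j' = f (denv r j z) then of_bool (bit X j') else 0)"
     by (rule sum.cong) (auto simp: True val0)
    then show ?thesis using True by simp
   qed (simp add: sum.neutral)
  qed
  also have "... = of_bool (bit X (f (denv r j z)))"
   using le by (simp add: sum.delta del: sum.lessThan_Suc)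
  finally show ?thesis .
 qed
 then show "represents (?L # Ls) (Suc (length Ls)) r N (\<lambda>E X. of_bool (bit X (f E)))"
  unfolding represents_def by simp
qed


definition comb_weight :: "nat => nat => (env => nat) => (env => nat) => env => nat => nat => nat => nat" where
 "comb_weight d r w f z l j' j = (if l = d \<and> fst (prod_decode j') < w (denv r j z) \<and> j' = slot r j (fst (prod_decode j')) (dval (Suc r) j')
   then f (push (dval (Suc r) j') (push (fst (prod_decode j')) (denv r j z))) else 0)"

definition slots_bound :: "nat => (env => nat) => (env => nat) => (env => nat) => env => nat" where
 "slots_bound r N w b z = (\<Sum>j<N z. \<Sum>i<w (denv r j z). \<Sum>v<Suc (b (push i (denv r j z))). Suc (slot r j i v))"

lemma slots_bound:
 assumes "j < N z" "i < w (denv r j z)" "v <= b (push i (denv r j z))"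
 shows "slot r j i v < slots_bound r N w b z"
proof -
 have "Suc (slot r j i v) <= (\<Sum>v<Suc (b (push i (denv r j z))). Suc (slot r j i v))"
  by (rule member_le_sum) (use assms in auto)
 also have "... <= (\<Sum>i<w (denv r j z). \<Sum>v<Suc (b (push i (denv r j z))). Suc (slot r j i v))"
  by (rule member_le_sum[of i _ "\<lambda>i. \<Sum>v<Suc (b (push i (denv r j z))). Suc (slot r j i v)"]) (use assms in auto)
 also have "... <= slots_bound r N w b z"
  unfolding slots_bound_def
  by (rule member_le_sum[of j _ "\<lambda>j. \<Sum>i<w (denv r j z). \<Sum>v<Suc (b (push i (denv r j z))). Suc (slot r j i v)"]) (use assms in auto)
 finally show ?thesis by simp
qed

lemma lsf_slot [lsf_intros]: "lsf a ==> lsf b ==> lsf c ==> lsf (\<lambda>E. slot r (a E) (b E) (c E))"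
 unfolding slot_def by (intro lsf_intros)

lemma lsf_slots_bound:
 assumes "lsf N" "lsf w" "lsf b"
 shows "lsf (slots_bound r N w b)"
 unfolding slots_bound_def[abs_def] by (intro lsf_intros assms lsf_env[OF assms(2)] lsf_env[OF assms(3)] lsf_push_env)

lemma lsf_comb_weight:
 assumes "lsf w" "lsf f"
 shows "lsf (\<lambda>E. comb_weight d r w f (\<lambda>k. E (Suc (Suc (Suc k)))) (E 0) (E 1) (E 2))"
 unfolding comb_weight_def by (intro lsf_intros lsf_env[OF assms(1)] lsf_env[OF assms(2)] lsf_push_env)

lemma sum_comb_weight:
 assumes rep: "represents Ls d (Suc r) (slots_bound r N w b) G" and b: "!!E X. G E X <= b E"
  and j: "j < N z" and B: "slots_bound r N w b z = B" and d: "d <= D"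
 shows "(\<Sum>l'<Suc D. \<Sum>j'<B. comb_weight d r w f z l' j' j * of_bool (net_val z X Ls l' j'))
    = (\<Sum>i<w (denv r j z). f (push (G (push i (denv r j z)) X) (push i (denv r j z))))"
proof -
 let ?e = "denv r j z"
 have "(\<Sum>l'<Suc D. \<Sum>j'<B. comb_weight d r w f z l' j' j * of_bool (net_val z X Ls l' j'))
   = (\<Sum>l'<Suc D. if l' = d then (\<Sum>j'<B. comb_weight d r w f z d j' j * of_bool (net_val z X Ls d j')) else 0)"
  by (rule sum.cong) (auto simp: comb_weight_def)
 also have "... = (\<Sum>j'<B. comb_weight d r w f z d j' j * of_bool (net_val z X Ls d j'))"
  using d by (simp add: sum.delta)
 also have "... = (\<Sum>j'<B. (if fst (prod_decode j') < w ?e \<and> j' = slot r j (fst (prod_decode j')) (dval (Suc r) j')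
    then f (push (dval (Suc r) j') (push (fst (prod_decode j')) ?e)) else 0) * of_bool (net_val z X Ls d j'))"
  by (simp add: comb_weight_def del: dval.simps)
 also have "... = (\<Sum>i<w ?e. f (push (G (push i ?e) X) (push i ?e)))"
 proof (rule sum_slots[where h = "\<lambda>v i. f (push v (push i ?e))" and b = "\<lambda>i. b (push i ?e)"])
  show "slot r j i v < B" if "i < w ?e" "v <= b (push i ?e)" for i v
   using slots_bound[of j N z i w r v b] j that B by simp
  show "net_val z X Ls d (slot r j i v) = (G (push i ?e) X = v)" if "slot r j i v < B" for i v
   using rep that unfolding represents_def B[symmetric] by (simp del: dval.simps denv.simps)
 qed (rule b)
 finally show ?thesis .
qed

lemma represents_comb:
 assumes G: "represents Ls d (Suc r) (slots_bound r N w b) G" "!!E X. G E X <= b E" "d <= length Ls"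
  and H: "represents Ls d' (Suc r) (slots_bound r N w' b') H" "!!E X. H E X <= b' E" "d' <= length Ls"
  and lsf: "lsf N" "lsf w" "lsf b" "lsf f" "lsf w'" "lsf b'" "lsf g"
 shows "\<exists>L. lsf_level L \<and> represents (L # Ls) (Suc (length Ls)) r N
   (\<lambda>E X. (\<Sum>i<w E. f (push (G (push i E) X) (push i E))) + (\<Sum>i<w' E. g (push (H (push i E) X) (push i E))))"
proof (intro exI conjI)
 let ?S = "slots_bound r N w b" and ?S' = "slots_bound r N w' b'"
 \<comment> \<open>The two earlier levels have different lengths but share one range of positions
   here. The guards discard positions at which nothing is known about the respective level.\<close>
 let ?c = "\<lambda>z l j' j. (if j' < ?S z then comb_weight d r w f z l j' j else 0) + (if j' < ?S' z then comb_weight d' r w' g z l j' j else 0)"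
 let ?B = "\<lambda>z. ?S z + ?S' z"
 let ?L = "(?B, ?c, \<lambda>z j. dval r j)"
 note S = lsf_slots_bound[OF lsf(1-3), of r] lsf_slots_bound[OF lsf(1,5,6), of r]
 show "lsf_level ?L"
  unfolding lsf_level_def split_conv
  by (intro conjI lsf_intros S lsf_env[OF S(1)] lsf_env[OF S(2)] lsf_comb_weight lsf)
 have restrict: "(\<Sum>j'<B. (if j' < S then x j' else 0) * y j') = (\<Sum>j'<S. x j' * y j')" if "S <= B" for B S and x y :: "nat => nat"
 proof -
  have "(\<Sum>j'<B. (if j' < S then x j' else 0) * y j') = (\<Sum>j'<S. (if j' < S then x j' else 0) * y j')"
   by (rule sum.mono_neutral_right) (use that in auto)
  then show ?thesis by simp
 qed
 have "(\<Sum>l'<Suc (length Ls). \<Sum>j'<?B z. ?c z l' j' j * of_bool (net_val z X Ls l' j'))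
   = (\<Sum>i<w (denv r j z). f (push (G (push i (denv r j z)) X) (push i (denv r j z))))
   + (\<Sum>i<w' (denv r j z). g (push (H (push i (denv r j z)) X) (push i (denv r j z))))"
  if j: "j < N z" for z X j
  unfolding sum_comb_weight[of Ls d r N w b G j z, OF G(1,2) j refl G(3), symmetric]
   sum_comb_weight[of Ls d' r N w' b' H j z, OF H(1,2) j refl H(3), symmetric]
  by (simp only: add_mult_distrib sum.distrib restrict le_add1 le_add2)
 then show "represents (?L # Ls) (Suc (length Ls)) r N
   (\<lambda>E X. (\<Sum>i<w E. f (push (G (push i E) X) (push i E))) + (\<Sum>i<w' E. g (push (H (push i E) X) (push i E))))"
  unfolding represents_def by simp
qed

lemma represents_append: "represents Ls l r N F ==> l <= length Ls ==> represents (Ls' @ Ls) l r N F"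
 by (simp add: represents_def net_val_append)

text \<open>The statement allows levels \<open>Ls\<close> to be present already, so that the nets of
  the two arguments can be stacked; \<open>r\<close> and \<open>N\<close> are free because arguments
  need one more index and many more positions.\<close>

theorem tcn_net:
 assumes "tcn F" "lsf N" "\<forall>L\<in>set Ls. lsf_level L"
 shows "\<exists>Ls'. (\<forall>L\<in>set (Ls' @ Ls). lsf_level L) \<and> represents (Ls' @ Ls) (length (Ls' @ Ls)) r N F"
 using assms
proof (induction arbitrary: r N Ls rule: tcn.induct)
 case (input f)
 then obtain L where "lsf_level L" "represents (L # Ls) (Suc (length Ls)) r N (\<lambda>E X. of_bool (bit X (f E)))"
  using represents_input by blast
 then show ?case using input by (intro exI[of _ "[L]"]) simp
next
 case (comb G H f g w w')
 obtain b where b: "lsf b" "!!E X. G E X <= b E" using tcn_bound[OF comb.hyps(1)] by auto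
 obtain b' where b': "lsf b'" "!!E X. H E X <= b' E" using tcn_bound[OF comb.hyps(2)] by auto
 obtain Ls1 where 1: "\<forall>L\<in>set (Ls1 @ Ls). lsf_level L"
   "represents (Ls1 @ Ls) (length (Ls1 @ Ls)) (Suc r) (slots_bound r N w b) G"
  using comb.IH(1)[OF lsf_slots_bound[OF comb.prems(1) comb.hyps(5) b(1)] comb.prems(2)] by blast
 obtain Ls2 where 2: "\<forall>L\<in>set (Ls2 @ Ls1 @ Ls). lsf_level L"
   "represents (Ls2 @ Ls1 @ Ls) (length (Ls2 @ Ls1 @ Ls)) (Suc r) (slots_bound r N w' b') H"
  using comb.IH(2)[OF lsf_slots_bound[OF comb.prems(1) comb.hyps(6) b'(1)] 1(1)] by blast
 have "represents (Ls2 @ Ls1 @ Ls) (length (Ls1 @ Ls)) (Suc r) (slots_bound r N w b) G"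
  by (rule represents_append[OF 1(2)]) simp
 from represents_comb[OF this b(2) _ 2(2) b'(2) order_refl comb.prems(1) comb.hyps(5) b(1) comb.hyps(3,6) b'(1) comb.hyps(4)]
 obtain L where "lsf_level L" "represents (L # Ls2 @ Ls1 @ Ls) (Suc (length (Ls2 @ Ls1 @ Ls))) r N
   (\<lambda>E X. (\<Sum>i<w E. f (push (G (push i E) X) (push i E))) + (\<Sum>i<w' E. g (push (H (push i E) X) (push i E))))"
  by auto
 then show ?case using 2(1) by (intro exI[of _ "L # Ls2 @ Ls1"]) simp
qed


section \<open>Bounded search, logarithms and Pell's equation\<close>

lemma lsf_Least:
 assumes "lsp (\<lambda>s. P (s 0) (\<lambda>k. s (Suc k)))" "lsf c" "!!s. \<exists>x\<le>c s. P x s"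
 shows "lsf (\<lambda>s. LEAST x. P x s)"
proof -
 have eq: "(LEAST x. P x s) = (\<Sum>x<Suc (c s). if P x s \<and> (\<forall>y<x. \<not> P y s) then x else 0)" for s
 proof -
  obtain x where x: "x <= c s" "P x s" using assms(3) by auto
  let ?l = "LEAST x. P x s"
  have l: "P ?l s" "?l <= c s" using x LeastI[of "\<lambda>x. P x s" x] Least_le[of "\<lambda>x. P x s" x] by auto
  have "P x s \<and> (\<forall>y<x. \<not> P y s) \<longleftrightarrow> x = ?l" for x
   using l(1) not_less_Least[of _ "\<lambda>x. P x s"] by (metis linorder_neqE_nat)
  then show ?thesis using l(2) by (simp add: sum.delta le_imp_less_Suc del: sum.lessThan_Suc)
 qed
 have "lsp (\<lambda>s. P (s 0) (\<lambda>k. s (Suc (Suc k))))"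
  using lsf_env[OF assms(1)[unfolded lsp_def], of "\<lambda>s. push (s 0) (\<lambda>k. s (Suc (Suc k)))", OF lsf_push_env[OF lsf_var lsf_var]]
  unfolding lsp_def by simp
 then show ?thesis unfolding eq by (intro lsf_intros assms)
qed

definition clog :: "nat => nat" where
 "clog W = (LEAST k. W <= 2 ^ k)"

lemma le_power_clog: "W <= 2 ^ clog W"
 unfolding clog_def by (rule LeastI[of _ W]) (simp add: less_imp_le)

lemma clog_le: "W <= 2 ^ k ==> clog W <= k"
 unfolding clog_def by (rule Least_le)

lemma power_less_clog: "k < clog W ==> 2 ^ k < W"
 unfolding clog_def using not_less_Least not_le by blast

lemma power_clog_le: "1 <= W ==> 2 ^ clog W <= 2 * W"
 using power_less_clog[of "clog W - 1" W] by (cases "clog W") auto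

lemma clog_pos: "2 <= W ==> 0 < clog W"
 using le_power_clog[of W] by (cases "clog W") auto

lemma lsf_clog [lsf_intros]: "lsf a ==> lsf (\<lambda>s. clog (a s))"
proof -
 assume a: "lsf a"
 have eq: "W <= 2 ^ k \<longleftrightarrow> W <= min (2 ^ k) W" for W k :: nat by auto
 show ?thesis
  unfolding clog_def
 proof (rule lsf_Least[of "\<lambda>k s. a s <= 2 ^ k" a])
  show "lsp (\<lambda>s. a (\<lambda>k. s (Suc k)) <= 2 ^ s 0)"
   unfolding eq by (intro lsf_intros lsf_weaken[OF a])
  show "\<exists>x\<le>a s. a s <= 2 ^ x" for s by (rule exI[of _ "a s"]) (simp add: less_imp_le)
 qed (rule a)
qed

text \<open>Rounding up to a power of two at most doubles, so a cap of \<open>2 * W + 1\<close>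
  leaves the power unchanged.\<close>

lemma lsf_power_clog [lsf_intros]: "lsf a ==> lsf (\<lambda>s. 2 ^ clog (a s))"
proof -
 assume a: "lsf a"
 have "2 ^ clog W = min (2 ^ clog W) (2 * W + 1)" for W
  using power_clog_le[of W] by (cases "W = 0") (auto simp: clog_def Least_eq_0)
 then show ?thesis by (subst \<open>!!W. 2 ^ clog W = _\<close>) (intro lsf_intros a)
qed

definition pell :: "nat => nat" where
 "pell B = (LEAST x. B <= x \<and> 1 < x \<and> (\<exists>q<x. x ^ 2 = 2 * q ^ 2 + 1))"

definition pell_root :: "nat => nat" where
 "pell_root x = (LEAST q. x ^ 2 <= 2 * q ^ 2 + 1)"

text \<open>Starting from (3, 2), multiplication by the unit \<open>3 + 2 * sqrt 2\<close> maps a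
  solution (x, q) to (3x + 4q, 2x + 3q). As q < x, one step multiplies x by less than 7, so
  solutions are dense enough for a polynomially bounded search.\<close>

lemma pell_exists: "\<exists>x\<le>7 * B + 3. B <= x \<and> 1 < x \<and> (\<exists>q<x. x ^ 2 = 2 * q ^ 2 + (1::nat))"
proof (induction B)
 case 0
 show ?case by (intro exI[of _ 3] conjI exI[of _ 2]) auto
next
 case (Suc B)
 then obtain x q where x: "x <= 7 * B + 3" "B <= x" "1 < x" "q < x" "x ^ 2 = 2 * q ^ 2 + (1::nat)" by auto
 show ?case
 proof (cases "Suc B <= x")
  case True
  then show ?thesis using x by (intro exI[of _ x]) auto
 next
  case False
  then have "x = B" using x by simp
  have "(3 * x + 4 * q) ^ 2 = 2 * (2 * x + 3 * q) ^ 2 + 1"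
   using x(5) by (simp add: power2_eq_square algebra_simps)
  moreover have "2 * x + 3 * q < 3 * x + 4 * q" using x by simp
  ultimately have "\<exists>q'<3 * x + 4 * q. (3 * x + 4 * q) ^ 2 = 2 * q' ^ 2 + 1" by blast
  moreover have "3 * x + 4 * q <= 7 * Suc B + 3" "Suc B <= 3 * x + 4 * q" "1 < 3 * x + 4 * q"
   using x \<open>x = B\<close> by auto
  ultimately show ?thesis by blast
 qed
qed

lemma pell:
 "B <= pell B" "1 < pell B" "(pell B) ^ 2 = 2 * (pell_root (pell B)) ^ 2 + 1" "0 < pell_root (pell B)"
proof -
 let ?P = "\<lambda>x. B <= x \<and> 1 < x \<and> (\<exists>q<x. x ^ 2 = 2 * q ^ 2 + (1::nat))"
 have "\<exists>x. ?P x" using pell_exists[of B] by blast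
 then have P: "?P (pell B)" unfolding pell_def by (rule LeastI_ex)
 then obtain q where q: "(pell B) ^ 2 = 2 * q ^ 2 + 1" by auto
 have root: "pell_root (pell B) = q"
  unfolding pell_root_def q by (rule Least_equality) (auto simp: power2_nat_le_eq_le)
 then show "(pell B) ^ 2 = 2 * (pell_root (pell B)) ^ 2 + 1" using q by simp
 show "B <= pell B" "1 < pell B" using P by blast+
 have "q ~= 0"
 proof
  assume "q = 0"
  then have "pell B ^ 2 = 1" using q by simp
  then show False using \<open>1 < pell B\<close> by (simp add: power2_eq_square)
 qed
 then show "0 < pell_root (pell B)" using root by simp
qed

lemma lsf_pell [lsf_intros]:
 assumes "lsf a"
 shows "lsf (\<lambda>s. pell (a s))"
 unfolding pell_def power2_eq_square
proof (rule lsf_Least[of "\<lambda>x s. a s <= x \<and> 1 < x \<and> (\<exists>q<x. x * x = 2 * (q * q) + 1)"])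
 show "lsp (\<lambda>s. a (\<lambda>k. s (Suc k)) <= s 0 \<and> 1 < s 0 \<and> (\<exists>q<s 0. s 0 * s 0 = 2 * (q * q) + 1))"
  by (intro lsf_intros lsf_weaken[OF assms])
 show "lsf (\<lambda>s. 7 * a s + 3)" by (intro lsf_intros assms)
 show "\<exists>x\<le>7 * a s + 3. a s <= x \<and> 1 < x \<and> (\<exists>q<x. x * x = 2 * (q * q) + 1)" for s
  using pell_exists[of "a s"] by (simp only: power2_eq_square)
qed

lemma lsf_pell_root [lsf_intros]:
 assumes "lsf a"
 shows "lsf (\<lambda>s. pell_root (a s))"
 unfolding pell_root_def power2_eq_square
proof (rule lsf_Least[of "\<lambda>q s. a s * a s <= 2 * (q * q) + 1", OF _ assms])
 show "lsp (\<lambda>s. a (\<lambda>k. s (Suc k)) * a (\<lambda>k. s (Suc k)) <= 2 * (s 0 * s 0) + 1)"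
  by (intro lsf_intros lsf_weaken[OF assms])
 have "x * x <= 2 * (x * x) + 1" for x :: nat by simp
 then show "\<exists>x\<le>a s. a s * a s <= 2 * (x * x) + 1" for s by blast
qed


section \<open>Parameters and correctness of the circuit for a net\<close>

fun net_weight :: "level list => env => nat => nat => nat => nat => nat" where
 "net_weight [] E R d u i = 0"
| "net_weight ((B, c, t) # Ls) E R d u i = (if d = Suc (length Ls)
   then if u mod R < B E then c E (u div R) (u mod R) i else 0
   else net_weight Ls E R d u i)"

fun net_target :: "level list => env => nat => nat => nat" where
 "net_target [] E d i = 0"
| "net_target ((B, c, t) # Ls) E d i = (if d = Suc (length Ls) then t E i else net_target Ls E d i)"

lemma net_value_cong:
 "(!!d' u i. d' <= d ==> cw d' u i = cw' d' u i) ==> (!!d' i. d' <= d ==> tw d' i = tw' d' i)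
  ==> net_value cw tw R X d v = net_value cw' tw' R X d v"
 by (induction d arbitrary: v) (auto simp del: sum_mult_of_bool_eq)

lemma div_mod_block:
 fixes u d R :: nat
 assumes "d * R <= u" "u < d * R + R"
 shows "u div R = d" "u mod R = u - d * R"
proof -
 obtain j where "u = d * R + j" using assms(1) le_Suc_ex by blast
 then show "u div R = d" "u mod R = u - d * R" using assms(2) by auto
qed

lemma sum_div_mod:
 fixes d R :: nat
 shows "0 < R ==> (\<Sum>u<d * R. g (u div R) (u mod R)) = (\<Sum>l<d. \<Sum>j<R. g l j :: nat)"
proof (induction d)
 case (Suc d)
 have "(\<Sum>u<Suc d * R. g (u div R) (u mod R)) = (\<Sum>u<d * R. g (u div R) (u mod R)) + (\<Sum>u\<in>{d * R..<Suc d * R}. g (u div R) (u mod R))"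
  using sum.atLeastLessThan_concat[of 0 "d * R" "Suc d * R" "\<lambda>u. g (u div R) (u mod R)"]
  by (simp add: atLeast0LessThan)
 also have "(\<Sum>u\<in>{d * R..<Suc d * R}. g (u div R) (u mod R)) = (\<Sum>j<R. g d j)"
  by (rule sum.reindex_bij_witness[of _ "\<lambda>j. d * R + j" "\<lambda>u. u - d * R"])
   (use Suc.prems in "auto simp: div_mod_block")
 finally show ?case using Suc by simp
qed simp

lemma net_value_net_val:
 assumes "0 < R" "!!B c t. (B, c, t) \<in> set Ls ==> B E <= R"
 shows "net_value (net_weight Ls E R) (net_target Ls E) R X (length Ls) v \<longleftrightarrow>
   v < Suc (length Ls) * R \<and> net_val E X Ls (v div R) (v mod R)"
 using assms(2)
proof (induction Ls arbitrary: v)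
 case Nil
 then show ?case by auto
next
 case (Cons L Ls)
 obtain B c t where L: "L = (B, c, t)" by (cases L)
 have B: "B E <= R" using Cons.prems[of B c t] L by simp
 let ?d = "length Ls"
 let ?cw = "net_weight (L # Ls) E R" and ?tw = "net_target (L # Ls) E"
 have old: "net_value ?cw ?tw R X ?d v \<longleftrightarrow> v < Suc ?d * R \<and> net_val E X Ls (v div R) (v mod R)" for v
 proof -
  have "net_value ?cw ?tw R X ?d v = net_value (net_weight Ls E R) (net_target Ls E) R X ?d v"
   by (rule net_value_cong) (auto simp: L)
  also have "... \<longleftrightarrow> v < Suc ?d * R \<and> net_val E X Ls (v div R) (v mod R)"
   by (rule Cons.IH, rule Cons.prems) auto
  finally show ?thesis .
 qed
 show ?case
 proof (cases "Suc ?d * R <= v \<and> v < Suc ?d * R + R")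
  case True
  then have v: "v div R = Suc ?d" "v mod R = v - Suc ?d * R"
   using div_mod_block[of "Suc ?d" R v] by auto
  let ?i = "v - Suc ?d * R"
  have "(\<Sum>u<Suc ?d * R. ?cw (Suc ?d) u ?i * of_bool (net_value ?cw ?tw R X ?d u))
    = (\<Sum>u<Suc ?d * R. (if u mod R < B E then c E (u div R) (u mod R) ?i else 0) * of_bool (net_val E X Ls (u div R) (u mod R)))"
   unfolding old by (intro sum.cong) (auto simp: L)
  also have "... = (\<Sum>l<Suc ?d. \<Sum>j<R. (if j < B E then c E l j ?i else 0) * of_bool (net_val E X Ls l j))"
   by (rule sum_div_mod[OF assms(1), where g = "\<lambda>l j. (if j < B E then c E l j ?i else 0) * of_bool (net_val E X Ls l j)"])
  also have "... = (\<Sum>l<Suc ?d. \<Sum>j<B E. c E l j ?i * of_bool (net_val E X Ls l j))"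
  proof (rule sum.cong[OF refl])
   fix l
   have "(\<Sum>j<R. (if j < B E then c E l j ?i else 0) * (of_bool (net_val E X Ls l j) :: nat))
     = (\<Sum>j<B E. (if j < B E then c E l j ?i else 0) * of_bool (net_val E X Ls l j))"
    by (rule sum.mono_neutral_right) (use B in auto)
   then show "(\<Sum>j<R. (if j < B E then c E l j ?i else 0) * of_bool (net_val E X Ls l j)) = (\<Sum>j<B E. c E l j ?i * of_bool (net_val E X Ls l j))"
    by simp
  qed
  finally have sum: "(\<Sum>u<Suc ?d * R. ?cw (Suc ?d) u ?i * of_bool (net_value ?cw ?tw R X ?d u))
    = (\<Sum>l<Suc ?d. \<Sum>j<B E. c E l j ?i * of_bool (net_val E X Ls l j))" .
  have "net_value ?cw ?tw R X (Suc ?d) v \<longleftrightarrow> (\<Sum>l<Suc ?d. \<Sum>j<B E. c E l j ?i * of_bool (net_val E X Ls l j)) = ?tw (Suc ?d) ?i"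
   unfolding sum[symmetric] using True by (simp only: net_value.simps if_True simp_thms)
  moreover have "?tw (Suc ?d) ?i = t E ?i" by (simp add: L)
  moreover have "net_val E X (L # Ls) (v div R) (v mod R) \<longleftrightarrow> (\<Sum>l<Suc ?d. \<Sum>j<B E. c E l j ?i * of_bool (net_val E X Ls l j)) = t E ?i"
   unfolding v L by (simp only: net_val.simps refl if_True)
  moreover have "v < Suc (Suc ?d) * R" using True by simp
  ultimately show ?thesis by simp
 next
  case False
  then have "net_value ?cw ?tw R X (Suc ?d) v = net_value ?cw ?tw R X ?d v" by auto
  moreover have "v < Suc ?d * R ==> v div R < Suc ?d"
   using assms(1) by (simp add: div_less_iff_less_mult del: mult_Suc)
  moreover have "v < Suc (Suc ?d) * R \<longleftrightarrow> v < Suc ?d * R" using False by auto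
  moreover have "net_val E X (L # Ls) l j = net_val E X Ls l j" if "l < Suc ?d" for l j
   using that by (simp add: L)
  ultimately show ?thesis unfolding length_Cons old by blast
 qed
qed


context
 fixes Ls :: "level list" and a b :: "env => nat" and e :: nat
 assumes Ls: "\<forall>L\<in>set Ls. lsf_level L" and a: "lsf a" and b: "lsf b"
begin

definition net_R :: "env => nat" where
 "net_R E = Suc ((\<Sum>L\<leftarrow>Ls. fst L E) + prod_encode (b E, 1) + a E)"

text \<open>A crude number above every total weight plus target, so that its binary logarithm can
  serve as the number of phases of all gates; the summand 2 makes that logarithm positive.\<close>

definition net_total :: "env => nat" where
 "net_total E = (\<Sum>d<Suc (length Ls). \<Sum>i<net_R E.
   (\<Sum>u<Suc (length Ls) * net_R E. net_weight Ls E (net_R E) d u i) + net_target Ls E d i) + 2"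

definition net_K :: "env => nat" where
 "net_K E = clog (net_total E)"

text \<open>The factor 160 is 20 (levels run twice, 10 bundles each) times 8 (bundle error
  \<open>8 / p\<close>); together with the power of the sizes it brings the total error below the
  requested one. The last summand ensures that \<open>2 ^ (k + 2) <= 2 * net_p E\<close> for all
  phases \<open>k\<close>.\<close>

definition net_p :: "env => nat" where
 "net_p E = pell (160 * length Ls * net_R E * net_K E * 2 ^ clog (net_total E) * (E 0 + E 1) ^ e + 2 ^ clog (net_total E))"

text \<open>Pell rotations realise negative angles only. With \<open>z = 2 ^ (k + 2)\<close>, the
  positive angle \<open>\<pi> / 2 ^ (k + 1)\<close> is one z-th of a turn and thus equivalent to
  minus \<open>(z - 1) / z\<close> of a turn, whereas \<open>net_rm\<close> uses minus
  \<open>1 / z\<close>. The minimum equals the power for all relevant \<open>k\<close> and keeps the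
  function in \<open>lsf\<close>.\<close>

definition net_rp :: "env => nat => nat" where
 "net_rp E k = (let z = min (2 ^ (k + 2)) (2 * 2 ^ clog (net_total E)) in 2 * pell_root (net_p E) * ((2 * net_p E * (z - 1)) div z))"

definition net_rm :: "env => nat => nat" where
 "net_rm E k = (let z = min (2 ^ (k + 2)) (2 * 2 ^ clog (net_total E)) in 2 * pell_root (net_p E) * ((2 * net_p E * 1) div z))"

definition net_M :: "env => nat" where
 "net_M E = net_R E + net_K E + length Ls * net_R E + 2 ^ clog (net_total E)
   + (\<Sum>k<net_K E. 2 * 2 ^ clog (net_total E) * (net_rp E k + net_rm E k))"

text \<open>In the last level, position \<open>prod_encode (i, 1)\<close> asks whether the function
  has value 1 at index \<open>i\<close>; this is output bit \<open>i\<close>.\<close>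

definition net_out :: "env => nat => nat" where
 "net_out E i = length Ls * net_R E + prod_encode (i, 1)"

lemma lsf_net_weight:
 assumes "!!k. lsf (\<lambda>s. g s k)" "lsf R" "lsf d" "lsf u" "lsf i"
 shows "lsf (\<lambda>s. net_weight Ls (g s) (R s) (d s) (u s) (i s))"
 using Ls
proof (induction Ls)
 case (Cons L Ls)
 obtain B c t where L: "L = (B, c, t)" by (cases L)
 have B: "lsf B" and c: "lsf (\<lambda>s. c (\<lambda>k. s (Suc (Suc (Suc k)))) (s 0) (s 1) (s 2))"
  using Cons.prems by (auto simp: L lsf_level_def)
 have c': "lsf (\<lambda>s. c (g s) (x s) (y s) (z s))" if "lsf x" "lsf y" "lsf z" for x y z
  using lsf_env[OF c, of "\<lambda>s. push (x s) (push (y s) (push (z s) (g s)))",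
    OF lsf_push_env[OF that(1) lsf_push_env[OF that(2) lsf_push_env[OF that(3) assms(1)]]]]
  by simp
 show ?case
  unfolding L net_weight.simps
  by (intro lsf_intros assms lsf_env[OF B assms(1)] c' Cons.IH) (use Cons.prems in auto)
qed (auto intro: lsf_intros)

lemma lsf_net_target:
 assumes "!!k. lsf (\<lambda>s. g s k)" "lsf d" "lsf i"
 shows "lsf (\<lambda>s. net_target Ls (g s) (d s) (i s))"
 using Ls
proof (induction Ls)
 case (Cons L Ls)
 obtain B c t where L: "L = (B, c, t)" by (cases L)
 have t: "lsf (\<lambda>s. t (\<lambda>k. s (Suc k)) (s 0))"
  using Cons.prems by (auto simp: L lsf_level_def)
 show ?case
  unfolding L net_target.simps
  by (intro lsf_intros assms lsf_arg[OF t] Cons.IH) (use Cons.prems in auto)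
qed (auto intro: lsf_intros)

lemma lsf_net_R: "lsf net_R"
proof -
 have "lsf (\<lambda>E. \<Sum>L\<leftarrow>Ls. fst L E)" using Ls
  by (induction Ls) (auto intro!: lsf_intros simp: lsf_level_def split: prod.splits)
 then show ?thesis unfolding net_R_def[abs_def] by (intro lsf_intros a b)
qed

lemma lsf_net_total: "lsf net_total"
 unfolding net_total_def[abs_def]
 by (intro lsf_intros lsf_net_R lsf_net_weight lsf_net_target lsf_env[OF lsf_net_R])

lemma lsf_net_K: "lsf net_K"
 unfolding net_K_def[abs_def] by (intro lsf_intros lsf_net_total)

lemma lsf_net_p: "lsf net_p"
 unfolding net_p_def[abs_def] by (intro lsf_intros lsf_const_power lsf_net_total lsf_net_K lsf_net_R)

lemma lsf_net_rp: "lsf (\<lambda>s. net_rp (\<lambda>k. s (Suc k)) (s 0))"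
 unfolding net_rp_def Let_def by (intro lsf_intros lsf_weaken[OF lsf_net_total] lsf_weaken[OF lsf_net_p])

lemma lsf_net_rm: "lsf (\<lambda>s. net_rm (\<lambda>k. s (Suc k)) (s 0))"
 unfolding net_rm_def Let_def by (intro lsf_intros lsf_weaken[OF lsf_net_total] lsf_weaken[OF lsf_net_p])

lemma lsf_net_M: "lsf net_M"
 unfolding net_M_def[abs_def]
 by (intro lsf_intros lsf_net_total lsf_net_K lsf_net_R lsf_net_rp lsf_net_rm lsf_weaken[OF lsf_net_total])

lemma lsf_net_out: "lsf (\<lambda>s. net_out (\<lambda>k. s (Suc k)) (s 0))"
 unfolding net_out_def by (intro lsf_intros lsf_weaken[OF lsf_net_R])

abbreviation net_W :: "env => nat" where
 "net_W E \<equiv> net_circuit.width (a E) (b E) (length Ls) (net_R E) (net_M E)"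

abbreviation net_layers :: "env => gate list list" where
 "net_layers E \<equiv> net_circuit.circ_layers (a E) (b E) (length Ls) (net_R E) (net_K E)
   (net_weight Ls E (net_R E)) (net_target Ls E) (net_out E) (net_rp E) (net_rm E)"

lemma lsf_wire: "lsf (\<lambda>s. g s) ==> lsf c ==> lsf d ==> lsf (\<lambda>s. net_circuit.wire (c s) (d s) (g s))"
 unfolding net_circuit.wire_def by (intro lsf_intros)

lemma llist_el:
 "llist (\<lambda>E. net_circuit.el (a E) (b E) (net_R E) (net_K E) (net_weight Ls E (net_R E)) (net_target Ls E) (net_rp E) (net_rm E) d)"
 unfolding net_circuit.el_def
proof (rule llist_layers)
 show "lsf (\<lambda>s. 2 ^ net_K s)" unfolding net_K_def by (intro lsf_intros lsf_net_total)
 show "lsf (\<lambda>s. net_circuit.base (a s) (b s))" unfolding net_circuit.base_def by (intro lsf_intros a b)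
qed (intro lsf_intros lsf_net_R lsf_net_K lsf_net_rp lsf_net_rm lsf_wire lsf_weaken[OF a] lsf_weaken[OF b] lsf_weaken[OF lsf_net_R]
  lsf_net_weight lsf_net_target lsf_env[OF lsf_net_R])+

lemma lsf_net_W: "lsf net_W"
 unfolding net_circuit.width_def net_circuit.base_def by (intro lsf_intros a b lsf_net_R lsf_net_M)

lemma llist_net_layers: "llist net_layers"
proof -
 let ?el = "\<lambda>E. net_circuit.el (a E) (b E) (net_R E) (net_K E) (net_weight Ls E (net_R E)) (net_target Ls E) (net_rp E) (net_rm E)"
 have levels: "llist (\<lambda>E. concat (map (?el E) ds))" for ds
  by (induction ds) (auto intro: list_intros llist_el)
 have copy: "llist (\<lambda>E. [net_circuit.copy_out (a E) (b E) (net_out E)])"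
  unfolding net_circuit.copy_out_def
  by (intro list_intros b lsf_intros lsf_wire lsf_weaken[OF a] lsf_weaken[OF b] lsf_net_out)
 show ?thesis
  unfolding net_circuit.circ_layers_def by (intro llist_append levels copy)
qed

lemma net_uniform: "uniform_family (\<lambda>n m. Circuit (net_W (push n (push m (\<lambda>_. 0)))) (net_layers (push n (push m (\<lambda>_. 0)))))"
 by (rule uniform_family_llist[OF lsf_net_W llist_net_layers]) simp

lemma net_rotations:
 assumes "k < net_K E"
 obtains ap am where
  "cis (real (net_rp E k) * ap) = cis (pi / 2 ^ Suc k)" "cis (real (net_rm E k) * am) = cis (- (pi / 2 ^ Suc k))"
  "real (net_rp E k) * cmod (cis rotation_angle - cis ap) <= 8 / real (net_p E)"
  "real (net_rm E k) * cmod (cis rotation_angle - cis am) <= 8 / real (net_p E)"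
proof -
 let ?p = "net_p E" and ?q = "pell_root (net_p E)" and ?z = "2 ^ (k + 2) :: nat"
 have pow: "?z <= 2 * 2 ^ clog (net_total E)"
  using power_increasing[of "k + 2" "Suc (clog (net_total E))" "2 :: nat"] assms by (simp add: net_K_def)
 then have z: "min ?z (2 * 2 ^ clog (net_total E)) = ?z" by simp
 have pz: "?z <= 2 * ?p"
  using pow pell(1) unfolding net_p_def by (meson add_leD2 mult_le_mono2 order_trans)
 have root: "?p\<^sup>2 = 2 * ?q\<^sup>2 + 1" "0 < ?q" unfolding net_p_def by (rule pell)+
 have "(1::nat) <= 2 ^ k" "?z = 4 * 2 ^ k" by simp_all
 then have z3: "0 < ?z - 1" "?z - 1 < ?z" by linarith+
 obtain ap where ap: "cis (real (net_rp E k) * ap) = cis (- (2 * pi * (real (?z - 1) / real ?z)))"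
   "real (net_rp E k) * cmod (cis rotation_angle - cis ap) <= 8 / real ?p"
  using pell_rotation[OF root(1) z3 pz root(2)] unfolding net_rp_def z Let_def by blast
 obtain am where am: "cis (real (net_rm E k) * am) = cis (- (2 * pi * (real 1 / real ?z)))"
   "real (net_rm E k) * cmod (cis rotation_angle - cis am) <= 8 / real ?p"
  using pell_rotation[OF root(1) _ _ pz root(2), of 1] z3 unfolding net_rm_def z Let_def by (metis less_numeral_extra(1) zero_less_diff)
 have "- (2 * pi * (real (?z - 1) / real ?z)) = pi / 2 ^ Suc k - 2 * pi"
  using z3 by (simp add: of_nat_diff field_simps)
 then have "cis (real (net_rp E k) * ap) = cis (pi / 2 ^ Suc k)"
  unfolding ap(1) by (simp flip: cis_divide)
 moreover have "- (2 * pi * (real 1 / real ?z)) = - (pi / 2 ^ Suc k)" by (simp add: field_simps)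
 ultimately show ?thesis using that ap(2) am by metis
qed

lemma net_sem:
 obtains ap am where "net_circuit_sem (a E) (b E) (length Ls) (net_R E) (net_K E) (net_M E)
   (net_weight Ls E (net_R E)) (net_target Ls E) (net_out E) (net_rp E) (net_rm E) ap am"
  and "!!k. k < net_K E ==> real (net_rp E k) * cmod (cis rotation_angle - cis (ap k)) <= 8 / real (net_p E)"
  and "!!k. k < net_K E ==> real (net_rm E k) * cmod (cis rotation_angle - cis (am k)) <= 8 / real (net_p E)"
proof -
 have "\<forall>k. \<exists>ap am. k < net_K E -->
  cis (real (net_rp E k) * ap) = cis (pi / 2 ^ Suc k) \<and> cis (real (net_rm E k) * am) = cis (- (pi / 2 ^ Suc k)) \<and>
  real (net_rp E k) * cmod (cis rotation_angle - cis ap) <= 8 / real (net_p E) \<and>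
  real (net_rm E k) * cmod (cis rotation_angle - cis am) <= 8 / real (net_p E)"
  using net_rotations by metis
 then obtain ap am where ang: "!!k. k < net_K E ==>
  cis (real (net_rp E k) * ap k) = cis (pi / 2 ^ Suc k) \<and> cis (real (net_rm E k) * am k) = cis (- (pi / 2 ^ Suc k)) \<and>
  real (net_rp E k) * cmod (cis rotation_angle - cis (ap k)) <= 8 / real (net_p E) \<and>
  real (net_rm E k) * cmod (cis rotation_angle - cis (am k)) <= 8 / real (net_p E)" by metis
 let ?D = "length Ls" and ?R = "net_R E"
 have total: "(\<Sum>u<Suc ?D * ?R. net_weight Ls E ?R d u i) + net_target Ls E d i < 2 ^ net_K E" if "d <= ?D" "i < ?R" for d i
 proof -
  have "(\<Sum>u<Suc ?D * ?R. net_weight Ls E ?R d u i) + net_target Ls E d i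
    <= (\<Sum>i<?R. (\<Sum>u<Suc ?D * ?R. net_weight Ls E ?R d u i) + net_target Ls E d i)"
   by (rule member_le_sum[of i _ "\<lambda>i. (\<Sum>u<Suc ?D * ?R. net_weight Ls E ?R d u i) + net_target Ls E d i"]) (use that in auto)
  also have "... <= (\<Sum>d<Suc ?D. \<Sum>i<?R. (\<Sum>u<Suc ?D * ?R. net_weight Ls E ?R d u i) + net_target Ls E d i)"
   by (rule member_le_sum[of d _ "\<lambda>d. \<Sum>i<?R. (\<Sum>u<Suc ?D * ?R. net_weight Ls E ?R d u i) + net_target Ls E d i"]) (use that in auto)
  also have "... < net_total E" by (simp add: net_total_def)
  also have "... <= 2 ^ net_K E" by (simp add: net_K_def le_power_clog)
  finally show ?thesis .
 qed
 have rot_le: "2 * 2 ^ net_K E * (net_rp E k + net_rm E k) <= net_M E" if "k < net_K E" for k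
  using member_le_sum[of k "{..<net_K E}" "\<lambda>k. 2 * 2 ^ clog (net_total E) * (net_rp E k + net_rm E k)"] that
  by (simp add: net_M_def net_K_def)
 have "net_circuit_sem (a E) (b E) ?D ?R (net_K E) (net_M E)
   (net_weight Ls E ?R) (net_target Ls E) (net_out E) (net_rp E) (net_rm E) ap am"
 proof (unfold_locales, goal_cases)
  case 1
  show ?case by (simp add: net_R_def)
 next
  case 2
  show ?case unfolding net_K_def by (rule clog_pos) (simp add: net_total_def)
 next
  case (3 d i)
  have "(\<Sum>u<d * ?R. net_weight Ls E ?R d u i) <= (\<Sum>u<Suc ?D * ?R. net_weight Ls E ?R d u i)"
   by (rule sum_mono2) (use 3 in \<open>auto intro: order_less_le_trans[OF _ mult_le_mono1[of d "Suc ?D"]] simp del: mult_Suc\<close>)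
  then show ?case using total[of d i] 3 by linarith
 next
  case (4 d i)
  then show ?case using total[of d i] by linarith
 next
  case (5 i)
  then have "prod_encode (i, 1) <= prod_encode (b E, 1)" by (intro prod_encode_mono) auto
  then show ?case by (simp add: net_out_def net_R_def)
 next
  case (6 i j)
  then show ?case by (simp add: net_out_def prod_encode_eq)
 next
  case (13 k)
  then show ?case using rot_le[of k] by (simp add: distrib_left)
 next
  case (14 k)
  then show ?case using rot_le[of k] by (simp add: distrib_left)
 qed (use ang in "auto simp: net_M_def net_K_def")
 then show ?thesis using that ang by blast
qed

lemma net_correct:
 assumes rep: "represents Ls (length Ls) 1 (\<lambda>E. Suc (prod_encode (b E, 1))) F" and E: "0 < E 0"
 shows "wf_circuit (Circuit (net_W E) (net_layers E))" "a E + b E <= net_W E"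
  "circuit_size (Circuit (net_W E) (net_layers E)) <= (50 * length Ls + 1) * net_W E"
  "length (net_layers E) = 50 * length Ls + 1"
  "\<exists>ideal. (\<forall>X y. X < 2 ^ a E --> (\<forall>i<b E. bit y i = (F (push i E) X = 1)) -->
     xrun ideal (ket X) = ket (Bit_Operations.xor X (push_bit (a E) (take_bit (b E) y)))) \<and>
    (\<forall>w. nrm (net_W E) (\<lambda>i. xrun (map (to_xgate (\<lambda>_. rotation_angle)) (concat (net_layers E))) w i - xrun ideal w i)
     <= 1 / real (E 0 + E 1) ^ e * nrm (net_W E) w)"
proof -
 let ?R = "net_R E" and ?K = "net_K E" and ?D = "length Ls"
 obtain ap am where "net_circuit_sem (a E) (b E) ?D ?R ?K (net_M E)
   (net_weight Ls E ?R) (net_target Ls E) (net_out E) (net_rp E) (net_rm E) ap am"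
  and p: "!!k. k < ?K ==> real (net_rp E k) * cmod (cis rotation_angle - cis (ap k)) <= 8 / real (net_p E)"
  and m: "!!k. k < ?K ==> real (net_rm E k) * cmod (cis rotation_angle - cis (am k)) <= 8 / real (net_p E)"
  by (rule net_sem[of E]) blast
 then interpret S: net_circuit_sem "a E" "b E" ?D ?R ?K "net_M E"
  "net_weight Ls E ?R" "net_target Ls E" "net_out E" "net_rp E" "net_rm E" ap am
  by simp
 show "wf_circuit (Circuit (net_W E) (net_layers E))" using S.wf_circ by (simp add: S.circ_def)
 show "a E + b E <= net_W E" by (rule S.a_b_le_width)
 show "length (net_layers E) = 50 * ?D + 1"
  using S.depth_circ by (simp add: circuit_depth_def S.circ_def)
 show "circuit_size (Circuit (net_W E) (net_layers E)) <= (50 * ?D + 1) * net_W E"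
  using S.size_circ unfolding S.depth_circ by (simp add: S.circ_def)
 have out: "net_value (net_weight Ls E ?R) (net_target Ls E) ?R X ?D (net_out E i) = (F (push i E) X = 1)"
  if "i < b E" for X i
 proof -
  have le: "prod_encode (i, 1) <= prod_encode (b E, 1)" using that by (intro prod_encode_mono) auto
  then have less: "prod_encode (i, 1) < ?R" by (simp add: net_R_def)
  have B: "B E <= ?R" if "(B, c, t) \<in> set Ls" for B c t
  proof -
   have "fst (B, c, t) E <= (\<Sum>L\<leftarrow>Ls. fst L E)" using that by (intro member_le_sum_list) (force, simp)
   then show ?thesis by (simp add: net_R_def)
  qed
  have "net_out E i div ?R = ?D" "net_out E i mod ?R = prod_encode (i, 1)" "net_out E i < Suc ?D * ?R"
   using less by (simp_all add: net_out_def)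
  then have "net_value (net_weight Ls E ?R) (net_target Ls E) ?R X ?D (net_out E i) = net_val E X Ls ?D (prod_encode (i, 1))"
   using net_value_net_val[of ?R Ls E X "net_out E i"] B less by simp
  also have "... = (F (push i E) X = 1)"
   using rep le unfolding represents_def by (simp add: le_imp_less_Suc)
  finally show ?thesis .
 qed
 show "\<exists>ideal. (\<forall>X y. X < 2 ^ a E --> (\<forall>i<b E. bit y i = (F (push i E) X = 1)) -->
     xrun ideal (ket X) = ket (Bit_Operations.xor X (push_bit (a E) (take_bit (b E) y)))) \<and>
    (\<forall>w. nrm (net_W E) (\<lambda>i. xrun (map (to_xgate (\<lambda>_. rotation_angle)) (concat (net_layers E))) w i - xrun ideal w i)
     <= 1 / real (E 0 + E 1) ^ e * nrm (net_W E) w)"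
 proof (intro exI conjI allI impI)
  fix X y :: nat assume "X < 2 ^ a E" "\<forall>i<b E. bit y i = (F (push i E) X = 1)"
  then show "S.run (concat (net_layers E)) (ket X) = ket (Bit_Operations.xor X (push_bit (a E) (take_bit (b E) y)))"
   by (intro S.run_circ) (auto simp: out)
 next
  fix w
  let ?c = "160 * ?D * ?R * ?K * 2 ^ ?K" and ?n = "(E 0 + E 1) ^ e"
  have n: "0 < real ?n" using E by simp
  have "?c * ?n <= net_p E"
   unfolding net_p_def net_K_def by (rule order_trans[OF _ pell(1)]) simp
  then have "real (?c * ?n) <= real (net_p E)" by (rule of_nat_mono)
  then have le: "real ?c * real ?n <= real (net_p E)" by simp
  have "1 < net_p E" unfolding net_p_def by (rule pell(2))
  then have p0: "0 < real (net_p E)" by simp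
  have "20 * real ?D * real ?R * real ?K * 2 ^ ?K * (8 / real (net_p E)) = real ?c / real (net_p E)"
   by simp
  also have "... <= 1 / real ?n"
   using le n p0 by (simp add: field_simps)
  finally have "20 * real ?D * real ?R * real ?K * 2 ^ ?K * (8 / real (net_p E)) <= 1 / real (E 0 + E 1) ^ e" by simp
  then show "nrm (net_W E) (\<lambda>i. xrun (map (to_xgate (\<lambda>_. rotation_angle)) (concat (net_layers E))) w i - S.run (concat (net_layers E)) w i)
     <= 1 / real (E 0 + E 1) ^ e * nrm (net_W E) w"
   by (intro order_trans[OF S.circ_error[OF _ p m]] mult_right_mono nrm_nonneg) auto
 qed
qed

end

text \<open>The ideal gate list mediates between two requirements: it is exactly right on basis
  states, and the actual circuit is close to it on all vectors, hence on superpositions too.\<close>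

definition implements :: "circuit => nat => nat => (nat => nat => bool) => real => bool" where
 "implements C a b P \<epsilon> \<longleftrightarrow> wf_circuit C \<and> a + b <= circuit_width C \<and>
   (\<exists>ideal. (\<forall>X y. X < 2 ^ a --> (\<forall>i<b. bit y i = P i X) -->
     xrun ideal (ket X) = ket (Bit_Operations.xor X (push_bit a (take_bit b y)))) \<and>
    (\<forall>w. nrm (circuit_width C) (\<lambda>i. xrun (map (to_xgate (\<lambda>_. rotation_angle)) (concat (circuit_layers C))) w i - xrun ideal w i)
     <= \<epsilon> * nrm (circuit_width C) w))"

theorem tcn_circuits:
 assumes F: "tcn F" and a: "lsf a" and b: "lsf b"
 shows "\<exists>C. uniform_family C \<and> (\<exists>d. \<forall>n>0. \<forall>m>0. circuit_depth (C n m) <= d) \<and>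
  (\<exists>c. \<forall>n>0. \<forall>m>0. circuit_size (C n m) <= c * (n + m) ^ c) \<and>
  (\<forall>n>0. \<forall>m>0. implements (C n m) (a (push n (push m (\<lambda>_. 0)))) (b (push n (push m (\<lambda>_. 0))))
    (\<lambda>i X. F (push i (push n (push m (\<lambda>_. 0)))) X = 1) (1 / real (n + m) ^ e))"
proof -
 let ?E = "\<lambda>n m. push n (push m (\<lambda>_. 0))"
 have "lsf (\<lambda>E. Suc (prod_encode (b E, 1)))" by (intro lsf_intros b)
 from tcn_net[OF F this, of "[]" 1] obtain Ls where Ls: "\<forall>L\<in>set Ls. lsf_level L"
   "represents Ls (length Ls) 1 (\<lambda>E. Suc (prod_encode (b E, 1))) F"
  by auto
 let ?W = "\<lambda>E. net_circuit.width (a E) (b E) (length Ls) (net_R Ls a b E) (net_M Ls a b e E)"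
 let ?L = "\<lambda>E. net_circuit.circ_layers (a E) (b E) (length Ls) (net_R Ls a b E) (net_K Ls a b E)
   (net_weight Ls E (net_R Ls a b E)) (net_target Ls E) (net_out Ls a b E) (net_rp Ls a b e E) (net_rm Ls a b e E)"
 let ?C = "\<lambda>n m. Circuit (?W (?E n m)) (?L (?E n m))"
 note correct = net_correct[OF Ls(1) a b Ls(2)]
 obtain k c where W: "!!E. ?W E <= poly_bound k c E"
  using lsf_poly_boundE[OF lsf_net_W[OF Ls(1) a b]] by metis
 have W': "?W (?E n m) <= 3 ^ c * (n + m) ^ c" if "0 < n" for n m
 proof -
  have "(\<Sum>i<k. ?E n m i) <= (\<Sum>i<Suc (Suc k). ?E n m i)" by (rule sum_mono2) auto
  also have "... = n + m" by (simp add: sum.lessThan_Suc_shift del: sum.lessThan_Suc)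
  finally have "poly_bound k c (?E n m) <= (3 * (n + m)) ^ c"
   unfolding poly_bound_def using that by (intro power_mono) auto
  then show ?thesis using W[of "?E n m"] unfolding power_mult_distrib by linarith
 qed
 let ?d = "50 * length Ls + 1"
 show ?thesis
 proof (intro exI[of _ ?C] conjI allI impI)
  show "uniform_family ?C" by (rule net_uniform[OF Ls(1) a b])
  show "\<exists>d. \<forall>n>0. \<forall>m>0. circuit_depth (?C n m) <= d"
   using correct(4) by (intro exI[of _ ?d]) (simp add: circuit_depth_def)
  show "\<exists>c. \<forall>n>0. \<forall>m>0. circuit_size (?C n m) <= c * (n + m) ^ c"
  proof (intro exI allI impI)
   fix n m :: nat assume nm: "0 < n" "0 < m"
   have "circuit_size (?C n m) <= ?d * ?W (?E n m)" by (rule correct(3)) (use nm in simp)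
   also have "... <= ?d * (3 ^ c * (n + m) ^ c)" using W'[OF nm(1)] by (rule mult_le_mono2)
   also have "... <= (?d * 3 ^ c + c) * (n + m) ^ (?d * 3 ^ c + c)"
    unfolding mult.assoc[symmetric] by (rule mult_le_mono) (use nm in "auto intro!: power_increasing")
   finally show "circuit_size (?C n m) <= (?d * 3 ^ c + c) * (n + m) ^ (?d * 3 ^ c + c)" .
  qed
  fix n m :: nat assume nm: "0 < n" "0 < m"
  then have E: "0 < ?E n m 0" by simp
  show "implements (?C n m) (a (?E n m)) (b (?E n m)) (\<lambda>i X. F (push i (?E n m)) X = 1) (1 / real (n + m) ^ e)"
   unfolding implements_def circuit.sel
   using correct(1,2,5)[where E = "?E n m" and e = e, OF E] by simp
 qed
qed

section \<open>From amplitude functions to matrices\<close>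

lemma nat_bit_eq_iff: "(i::nat) = j \<longleftrightarrow> (\<forall>q. bit i q = bit j q)"
 by (simp add: bit_eq_iff)

lemma bit_restrict_index: "bit (restrict_index qs i) l \<longleftrightarrow> l < length qs \<and> bit i (qs ! l)"
 by (auto simp: restrict_index_def bit_horner_sum_bit_iff)

lemma restrict_index_less: "restrict_index qs i < 2 ^ length qs"
 by (auto simp: less_exp_bits bit_restrict_index)

lemma act_on_vec:
 "act_on N qs G *\<^sub>v vec (2 ^ N) u = vec (2 ^ N) (\<lambda>i. \<Sum>j<2 ^ N.
   if \<forall>q<N. q \<notin> set qs --> bit i q = bit j q then G $$ (restrict_index qs i, restrict_index qs j) * u j else 0)"
 by (intro eq_vecI) (auto simp: act_on_def scalar_prod_def lessThan_atLeast0 intro!: sum.cong)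

lemma agree_off_iff:
 fixes i j :: nat
 assumes "i < 2 ^ N" "j < 2 ^ N" "set qs \<subseteq> {..<N}"
 shows "(\<forall>q<N. q \<notin> set qs --> bit i q = bit j q) \<longleftrightarrow> (\<forall>q. q \<notin> set qs --> bit i q = bit j q)"
proof -
 have "bit i q = bit j q" if "\<not> q < N" for q
  using assms(1,2) that by (auto simp: less_exp_bits)
 then show ?thesis by blast
qed

text \<open>A permutation matrix acts on amplitudes by the inverse permutation, and
  \<open>fan\<close> is its own inverse. The abstract \<open>F\<close> covers the controlled-not and
  the fan-out gate, whose local digit orders differ.\<close>

lemma act_on_fan:
 assumes "set qs = insert x (set ys)" "set qs \<subseteq> {..<N}" "x \<notin> set ys"
  and G: "!!i j. i < 2 ^ length qs ==> j < 2 ^ length qs ==> G $$ (i, j) = of_bool (i = F j)"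
  and F: "!!j l. bit (F (restrict_index qs j)) l \<longleftrightarrow> l < length qs \<and> bit j (qs ! l) ~= (bit j x \<and> qs ! l \<in> set ys)"
 shows "act_on N qs G *\<^sub>v vec (2 ^ N) u = vec (2 ^ N) (\<lambda>i. u (fan ys x i))"
proof -
 have "(\<Sum>j<2 ^ N. if \<forall>q<N. q \<notin> set qs --> bit i q = bit j q
      then G $$ (restrict_index qs i, restrict_index qs j) * u j else 0) = u (fan ys x i)"
  if i: "i < 2 ^ N" for i
 proof -
  have *: "(if \<forall>q<N. q \<notin> set qs --> bit i q = bit j q
      then G $$ (restrict_index qs i, restrict_index qs j) * u j else 0) = (if j = fan ys x i then u j else 0)"
   if j: "j < 2 ^ N" for j
  proof -
   have "restrict_index qs i = F (restrict_index qs j) \<longleftrightarrow>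
     (\<forall>l<length qs. bit i (qs ! l) = (bit j (qs ! l) ~= (bit j x \<and> qs ! l \<in> set ys)))"
    unfolding nat_bit_eq_iff bit_restrict_index F by blast
   also have "... \<longleftrightarrow> (\<forall>q\<in>set qs. bit i q = bit (fan ys x j) q)"
    unfolding bit_fan by (auto simp: all_set_conv_all_nth)
   finally have 1: "restrict_index qs i = F (restrict_index qs j) \<longleftrightarrow> (\<forall>q\<in>set qs. bit i q = bit (fan ys x j) q)" .
   have "bit (fan ys x j) q = bit j q" if "q \<notin> set qs" for q
    using assms(1) that by (simp add: bit_fan)
   then have "(\<forall>q<N. q \<notin> set qs --> bit i q = bit j q) \<and> restrict_index qs i = F (restrict_index qs j) \<longleftrightarrow>
     (\<forall>q. bit i q = bit (fan ys x j) q)"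
    unfolding agree_off_iff[OF i j assms(2)] 1 by blast
   also have "... \<longleftrightarrow> j = fan ys x i"
   proof
    assume "\<forall>q. bit i q = bit (fan ys x j) q"
    then have "i = fan ys x j" by (simp add: bit_eq_iff)
    then show "j = fan ys x i" using fan_fan[OF assms(3)] by simp
   next
    assume "j = fan ys x i"
    then show "\<forall>q. bit i q = bit (fan ys x j) q" using fan_fan[OF assms(3)] by simp
   qed
   finally show ?thesis unfolding G[OF restrict_index_less restrict_index_less] by auto
  qed
  have "fan ys x i < 2 ^ N"
   using i assms(1,2) by (auto simp: less_exp_bits bit_fan)
  then show ?thesis by (simp add: * sum.delta)
 qed
 then show ?thesis unfolding act_on_vec by (intro eq_vecI) auto
qed

lemma act_on_single:
 assumes "q < N"
  and G: "!!b c. G $$ (of_bool b, of_bool c) = g b c"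
 shows "act_on N [q] G *\<^sub>v vec (2 ^ N) u = vec (2 ^ N) (\<lambda>i. g (bit i q) (bit i q) * u i + g (bit i q) (\<not> bit i q) * u (flipset {q} i))"
proof -
 have "(\<Sum>j<2 ^ N. if \<forall>q'<N. q' \<notin> set [q] --> bit i q' = bit j q'
      then G $$ (restrict_index [q] i, restrict_index [q] j) * u j else 0)
   = g (bit i q) (bit i q) * u i + g (bit i q) (\<not> bit i q) * u (flipset {q} i)"
  if i: "i < 2 ^ N" for i
 proof -
  have fl: "flipset {q} i < 2 ^ N" "flipset {q} i ~= i"
   using assms(1) i by (auto simp: flipset_less) (metis bit_flipset finite.emptyI finite_insert singletonI)
  have *: "(\<forall>q'<N. q' \<notin> set [q] --> bit i q' = bit j q') \<longleftrightarrow> j = i \<or> j = flipset {q} i" if j: "j < 2 ^ N" for j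
  proof -
   have "set [q] \<subseteq> {..<N}" using assms(1) by simp
   note agree_off_iff[OF i j this]
   moreover have "(\<forall>q'. q' \<notin> set [q] --> bit i q' = bit j q') \<longleftrightarrow> j = i \<or> j = flipset {q} i"
   proof
    assume *: "\<forall>q'. q' \<notin> set [q] --> bit i q' = bit j q'"
    show "j = i \<or> j = flipset {q} i"
    proof (cases "bit j q = bit i q")
     case True
     then have "j = i" using * by (intro bit_eqI) (metis empty_iff empty_set set_ConsD)
     then show ?thesis ..
    next
     case False
     then have "j = flipset {q} i" using * by (intro bit_eqI) (auto simp: bit_flipset)
     then show ?thesis ..
    qed
   qed (auto simp: bit_flipset)
   ultimately show ?thesis by simp
  qed
  have r: "restrict_index [q] j = of_bool (bit j q)" for j
   by (simp add: restrict_index_def)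
  have "(\<Sum>j<2 ^ N. if \<forall>q'<N. q' \<notin> set [q] --> bit i q' = bit j q'
      then G $$ (restrict_index [q] i, restrict_index [q] j) * u j else 0)
    = (\<Sum>j<2 ^ N. if j \<in> {i, flipset {q} i} then g (bit i q) (bit j q) * u j else 0)"
   by (intro sum.cong refl) (simp only: lessThan_iff * r G, simp)
  also have "... = (\<Sum>j\<in>{..<2 ^ N} \<inter> {i, flipset {q} i}. g (bit i q) (bit j q) * u j)"
   by (simp add: sum.inter_restrict)
  also have "{..<2 ^ N} \<inter> {i, flipset {q} i} = {i, flipset {q} i}" using i fl by auto
  finally show ?thesis using fl by (simp add: bit_flipset)
 qed
 then show ?thesis unfolding act_on_vec by (intro eq_vecI) auto
qed

abbreviation actual :: "gate => xgate" where
 "actual \<equiv> to_xgate (\<lambda>_. rotation_angle)"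

lemma act_on_gate:
 assumes "set (gate_qubits g) \<subseteq> {..<N}" "distinct (gate_qubits g)"
 shows "act_on N (gate_qubits g) (gate_matrix g) *\<^sub>v vec (2 ^ N) u = vec (2 ^ N) (xact (actual g) u)"
proof (cases g)
 case (Hadamard q)
 then show ?thesis
  using assms act_on_single[of q N "gate_matrix g" "\<lambda>b c. if b \<and> c then - isq2 else isq2" u]
  by (auto simp: isq2_def algebra_simps intro!: eq_vecI)
next
 case (Rotation q)
 then show ?thesis
  using assms act_on_single[of q N "gate_matrix g" "\<lambda>b c. if b = c then if c then cis rotation_angle else 1 else 0" u]
  by (auto intro!: eq_vecI)
next
 case (Cnot c t)
 have "bit (if bit (restrict_index [c, t] j) 0 then flip_bit 1 (restrict_index [c, t] j) else restrict_index [c, t] j) l \<longleftrightarrow>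
   l < length [c, t] \<and> bit j ([c, t] ! l) ~= (bit j c \<and> [c, t] ! l \<in> set [t])" for j l
  using assms(2) Cnot by (auto simp: bit_flip_bit_iff bit_restrict_index less_Suc_eq)
 then show ?thesis
  using assms act_on_fan[of "[c, t]" c "[t]" N "gate_matrix g" "\<lambda>j. if bit j 0 then flip_bit 1 j else j" u] Cnot
  by simp
next
 case (Fanout ys x)
 let ?k = "length ys"
 have "bit (if bit (restrict_index (ys @ [x]) j) ?k then Bit_Operations.xor (restrict_index (ys @ [x]) j) (mask ?k)
    else restrict_index (ys @ [x]) j) l \<longleftrightarrow>
   l < length (ys @ [x]) \<and> bit j ((ys @ [x]) ! l) ~= (bit j x \<and> (ys @ [x]) ! l \<in> set ys)" for j l
  using assms(2) Fanout by (auto simp: bit_xor_iff bit_mask_iff bit_restrict_index nth_append less_Suc_eq)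
 then show ?thesis
  using assms act_on_fan[of "ys @ [x]" x ys N "gate_matrix g"
    "\<lambda>j. if bit j ?k then Bit_Operations.xor j (mask ?k) else j" u] Fanout
  by (simp add: Let_def)
qed

lemma foldl_mat_vec:
 assumes "!!x. x \<in> set xs ==> F x \<in> carrier_mat n n" "A \<in> carrier_mat n n" "v \<in> carrier_vec n"
 shows "foldl (\<lambda>A x. F x * A) A xs *\<^sub>v v = fold (\<lambda>x v. F x *\<^sub>v v) xs (A *\<^sub>v v)
  \<and> foldl (\<lambda>A x. F x * A) A xs \<in> carrier_mat n n"
 using assms(1,2)
proof (induction xs arbitrary: A)
 case (Cons x xs)
 have Fx: "F x \<in> carrier_mat n n" using Cons.prems(1) by simp
 then have "F x * A \<in> carrier_mat n n" using Cons.prems(2) by simp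
 moreover have "(F x * A) *\<^sub>v v = F x *\<^sub>v (A *\<^sub>v v)"
  using Fx Cons.prems(2) assms(3) by (rule assoc_mult_mat_vec)
 ultimately show ?case using Cons by simp
qed simp

lemma act_on_carrier: "act_on N qs G \<in> carrier_mat (2 ^ N) (2 ^ N)"
 by (simp add: act_on_def)

lemma layer_matrix_carrier: "layer_matrix N L \<in> carrier_mat (2 ^ N) (2 ^ N)"
 unfolding layer_matrix_def
 using foldl_mat_vec[where xs = L and A = "1\<^sub>m (2 ^ N)" and v = "0\<^sub>v (2 ^ N)", OF act_on_carrier]
 by auto

lemma layer_matrix_vec:
 assumes "!!g. g \<in> set L ==> set (gate_qubits g) \<subseteq> {..<N} \<and> distinct (gate_qubits g)"
 shows "layer_matrix N L *\<^sub>v vec (2 ^ N) u = vec (2 ^ N) (xrun (map actual L) u)"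
proof -
 have "layer_matrix N L *\<^sub>v vec (2 ^ N) u
   = fold (\<lambda>g v. act_on N (gate_qubits g) (gate_matrix g) *\<^sub>v v) L (vec (2 ^ N) u)"
  unfolding layer_matrix_def by (subst foldl_mat_vec[THEN conjunct1, OF act_on_carrier]) auto
 also have "... = vec (2 ^ N) (xrun (map actual L) u)"
  using assms
 proof (induction L arbitrary: u)
  case (Cons g L)
  then show ?case by (simp add: act_on_gate)
 qed simp
 finally show ?thesis .
qed

lemma circuit_matrix_vec:
 assumes "wf_circuit C"
 shows "circuit_matrix C *\<^sub>v vec (2 ^ circuit_width C) u
  = vec (2 ^ circuit_width C) (xrun (map actual (concat (circuit_layers C))) u)"
proof -
 let ?N = "circuit_width C"
 have wf: "set (gate_qubits g) \<subseteq> {..<?N} \<and> distinct (gate_qubits g)" if "L \<in> set (circuit_layers C)" "g \<in> set L" for g L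
  using assms that by (auto simp: wf_circuit_def distinct_concat_iff)
 have "circuit_matrix C *\<^sub>v vec (2 ^ ?N) u = fold (\<lambda>L v. layer_matrix ?N L *\<^sub>v v) (circuit_layers C) (vec (2 ^ ?N) u)"
  unfolding circuit_matrix_def by (subst foldl_mat_vec[THEN conjunct1, OF layer_matrix_carrier]) auto
 also have "... = vec (2 ^ ?N) (xrun (map actual (concat (circuit_layers C))) u)"
 proof -
  have "fold (\<lambda>L v. layer_matrix ?N L *\<^sub>v v) Ls (vec (2 ^ ?N) u) = vec (2 ^ ?N) (xrun (map actual (concat Ls)) u)"
   if "set Ls \<subseteq> set (circuit_layers C)" for Ls
   using that
  proof (induction Ls arbitrary: u)
   case (Cons L Ls)
   then show ?case using layer_matrix_vec[of L ?N] wf[of L] by simp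
  qed simp
  then show ?thesis by simp
 qed
 finally show ?thesis .
qed

lemma vec_norm2_vec: "vec_norm2 (vec (2 ^ N) u) = nrm N u"
proof -
 have "vec (2 ^ N) u \<bullet>c vec (2 ^ N) u = (\<Sum>i<2 ^ N. u i * cnj (u i))"
  by (simp add: scalar_prod_def lessThan_atLeast0)
 also have "Re ... = (\<Sum>i<2 ^ N. (cmod (u i))\<^sup>2)"
  by (simp add: complex_mult_cnj cmod_power2)
 finally show ?thesis by (simp add: vec_norm2_def nrm_def L2_set_def)
qed

theorem approximates_fun_operator:
 fixes ideal :: "xgate list"
 assumes wf: "wf_circuit C" and w: "a + b <= circuit_width C"
  and ideal: "!!X. X < 2 ^ a ==> X \<in> Dom ==>
   xrun ideal (ket X) = ket (Bit_Operations.xor X (push_bit a (take_bit b (f X))))"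
  and err: "!!u. nrm (circuit_width C) (\<lambda>i. xrun (map actual (concat (circuit_layers C))) u i - xrun ideal u i)
   <= \<epsilon> * nrm (circuit_width C) u"
 shows "approximates C (fun_operator a b Dom f) \<epsilon>"
 unfolding approximates_def
proof (intro conjI ballI impI)
 let ?U = "fun_operator a b Dom f" and ?N = "circuit_width C"
 let ?F = "\<lambda>j. Bit_Operations.xor j (push_bit a (take_bit b (f (take_bit a j))))"
 show "wf_circuit C" "op_qubits ?U <= ?N" using wf w by (simp_all add: fun_operator_def)
 fix v :: "complex vec"
 assume v: "v \<in> carrier_vec (2 ^ op_qubits ?U)" and dom: "\<forall>i<2 ^ op_qubits ?U. i \<notin> op_dom ?U --> v $ i = 0"
 define u where "u i = (if i < 2 ^ (a + b) then v $ i else 0)" for i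
 let ?S = "{x. x < 2 ^ a \<and> x \<in> Dom}"
 have le: "(2::nat) ^ (a + b) <= 2 ^ ?N" using w by (intro power_increasing) auto
 have le': "(2::nat) ^ a <= 2 ^ (a + b)" by (intro power_increasing) auto
 have uz: "u i = 0" if "i \<notin> ?S" for i
  using dom that by (auto simp: u_def fun_operator_def)
 \<comment> \<open>Indices below \<open>2 ^ a\<close> are those whose output digits are all zero, so
   no separate condition on the output register appears in \<open>?S\<close>.\<close>
 have dec: "u = (\<lambda>i. \<Sum>x\<in>?S. u x * ket x i)"
 proof
  fix i
  have "(\<Sum>x\<in>?S. u x * ket x i) = (\<Sum>x\<in>?S. if x = i then u x else 0)"
   by (intro sum.cong) (auto simp: ket_def)
  then show "u i = (\<Sum>x\<in>?S. u x * ket x i)" using uz[of i] by (simp add: sum.delta)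
 qed
 have "xrun ideal u = xrun ideal (\<lambda>i. \<Sum>x\<in>?S. u x * ket x i)"
  using dec by (rule arg_cong)
 also have "... = (\<lambda>i. \<Sum>x\<in>?S. u x * ket (?F x) i)"
  by (subst xrun_sum) (auto simp: xrun_scale ideal take_bit_nat_eq_self intro!: sum.cong)
 also have "... = (\<lambda>i. \<Sum>x\<in>?S. u x * of_bool (i = ?F x))" by (simp add: ket_def)
 finally have run: "xrun ideal u = ..." .
 have F_less: "?F j < 2 ^ (a + b)" if "j < 2 ^ (a + b)" for j
  using that by (auto simp: less_exp_bits bit_xor_iff bit_push_bit_iff bit_take_bit_iff)
 have "op_matrix ?U *\<^sub>v v = vec (2 ^ (a + b)) (\<lambda>i. \<Sum>x\<in>?S. u x * of_bool (i = ?F x))"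
 proof (intro eq_vecI)
  fix i assume i: "i < dim_vec (vec (2 ^ (a + b)) (\<lambda>i. \<Sum>x\<in>?S. u x * of_bool (i = ?F x)))"
  have "(op_matrix ?U *\<^sub>v v) $ i = (\<Sum>j<2 ^ (a + b). of_bool (i = ?F j) * v $ j)"
   using i v by (simp add: fun_operator_def scalar_prod_def lessThan_atLeast0)
  also have "... = (\<Sum>j<2 ^ (a + b). u j * of_bool (i = ?F j))"
   by (intro sum.cong) (auto simp: u_def)
  also have "... = (\<Sum>x\<in>?S. u x * of_bool (i = ?F x))"
   by (rule sum.mono_neutral_right) (use uz in "auto intro: order_less_le_trans[OF _ le']")
  finally show "(op_matrix ?U *\<^sub>v v) $ i = vec (2 ^ (a + b)) (\<lambda>i. \<Sum>x\<in>?S. u x * of_bool (i = ?F x)) $ i"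
   using i by simp
 qed (simp add: fun_operator_def)
 then have 1: "with_ancillas ?N (op_qubits ?U) (op_matrix ?U *\<^sub>v v) = vec (2 ^ ?N) (xrun ideal u)"
  unfolding run with_ancillas_def
  by (intro eq_vecI) (auto simp: fun_operator_def intro!: sum.neutral sum.cong dest!: F_less order_less_le_trans[OF _ le'])
 have 2: "with_ancillas ?N (op_qubits ?U) v = vec (2 ^ ?N) u"
  by (intro eq_vecI) (auto simp: with_ancillas_def u_def fun_operator_def)
 have 3: "vec_norm2 v = nrm ?N u"
 proof -
  have "v = vec (2 ^ (a + b)) u" using v by (intro eq_vecI) (auto simp: u_def fun_operator_def)
  then have "vec_norm2 v = nrm (a + b) u" by (metis vec_norm2_vec)
  also have "... = nrm ?N u"
   unfolding nrm_def L2_set_def by (intro arg_cong[where f = sqrt] sum.mono_neutral_left) (use le in "auto simp: u_def")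
  finally show ?thesis .
 qed
 have minus: "vec n \<phi> - vec n \<chi> = vec n (\<lambda>i. \<phi> i - \<chi> i)" for n and \<phi> \<chi> :: "nat => complex"
  by (intro eq_vecI) auto
 show "vec_norm2 (circuit_matrix C *\<^sub>v with_ancillas ?N (op_qubits ?U) v
   - with_ancillas ?N (op_qubits ?U) (op_matrix ?U *\<^sub>v v)) <= \<epsilon> * vec_norm2 v"
  unfolding 1 2 3 circuit_matrix_vec[OF wf] minus vec_norm2_vec by (rule err)
qed


lemma implements_approximates:
 assumes "implements C a b P \<epsilon>" "!!X i. X < 2 ^ a ==> X \<in> Dom ==> i < b ==> bit (f X) i = P i X"
 shows "approximates C (fun_operator a b Dom f) \<epsilon>"
proof -
 obtain ideal where wf: "wf_circuit C" "a + b <= circuit_width C"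
  and ideal: "\<forall>X y. X < 2 ^ a --> (\<forall>i<b. bit y i = P i X) -->
     xrun ideal (ket X) = ket (Bit_Operations.xor X (push_bit a (take_bit b y)))"
  and err: "\<forall>\<psi>. nrm (circuit_width C) (\<lambda>i. xrun (map (to_xgate (\<lambda>_. rotation_angle)) (concat (circuit_layers C))) \<psi> i - xrun ideal \<psi> i)
     <= \<epsilon> * nrm (circuit_width C) \<psi>"
  using assms(1) unfolding implements_def by (elim exE conjE)
 show ?thesis
  by (rule approximates_fun_operator[OF wf _ err[rule_format]]) (rule ideal[rule_format], assumption, rule assms(2))
qed

theorem BQNC0f_fun_operator:
 assumes F: "tcn F" "lsf a" "lsf b"
  and U: "!!n m. 0 < n ==> 0 < m ==> U n m = fun_operator (a (push n (push m (\<lambda>_. 0)))) (b (push n (push m (\<lambda>_. 0)))) (Dom n m) (f n m)"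
  and f: "!!n m X i. 0 < n ==> 0 < m ==> X < 2 ^ a (push n (push m (\<lambda>_. 0))) ==> X \<in> Dom n m ==>
   i < b (push n (push m (\<lambda>_. 0))) ==> bit (f n m X) i = (F (push i (push n (push m (\<lambda>_. 0)))) X = 1)"
 shows "U \<in> BQNC0f"
 unfolding BQNC0f_def mem_Collect_eq
proof
 fix e
 have "approximates (C n m) (U n m) (1 / real (n + m) ^ e)"
  if "0 < n" "0 < m" "implements (C n m) (a (push n (push m (\<lambda>_. 0)))) (b (push n (push m (\<lambda>_. 0))))
    (\<lambda>i X. F (push i (push n (push m (\<lambda>_. 0)))) X = 1) (1 / real (n + m) ^ e)" for n m C
  using implements_approximates[OF that(3), of "Dom n m" "f n m"] f[OF that(1,2)] U[OF that(1,2)] by simp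
 then show "\<exists>C. uniform_family C \<and> (\<exists>d. \<forall>n>0. \<forall>m>0. circuit_depth (C n m) <= d) \<and>
   (\<exists>c. \<forall>n>0. \<forall>m>0. circuit_size (C n m) <= c * (n + m) ^ c) \<and>
   (\<forall>n>0. \<forall>m>0. approximates (C n m) (U n m) (1 / real (n + m) ^ e))"
  using tcn_circuits[OF F, of e] by (elim ex_forward conj_forward all_forward) (assumption | blast)+
qed

section \<open>Arithmetic in constant depth\<close>

named_theorems tcn_intros

lemma tcn_env: "tcn F ==> (!!k. lsf (\<lambda>s. e s k)) ==> tcn (\<lambda>s. F (e s))"
 using tcn_subst[of F "\<lambda>k s. e s k"] by simp

lemma tcn_sum [tcn_intros]:
 assumes "lsf w" "tcn (\<lambda>s. g (s 0) (\<lambda>k. s (Suc k)))"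
 shows "tcn (\<lambda>s X. \<Sum>i<w s. g i s X)"
 using tcn.comb[OF assms(2,2) lsf_var[of 0] lsf_var[of 0] assms(1) lsf_const[of 0]] by simp

lemma tcn_app1:
 assumes "lsf (\<lambda>s. f (s 0) (\<lambda>k. s (Suc k)))" "tcn G"
 shows "tcn (\<lambda>s X. f (G s X) s)"
proof -
 have "tcn (\<lambda>s. G (\<lambda>k. s (Suc k)))" by (rule tcn_env[OF assms(2) lsf_var])
 moreover have "lsf (\<lambda>s. f (s 0) (\<lambda>k. s (Suc (Suc k))))"
  by (rule lsf_arg[OF assms(1)]) (rule lsf_var)+
 ultimately show ?thesis
  using tcn.comb[of "\<lambda>s. G (\<lambda>k. s (Suc k))" "\<lambda>s. G (\<lambda>k. s (Suc k))" "\<lambda>s. f (s 0) (\<lambda>k. s (Suc (Suc k)))"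
    "\<lambda>s. s 0" "\<lambda>_. 1" "\<lambda>_. 0"] lsf_var[of 0] lsf_const[of 0] lsf_const[of 1] by simp
qed

lemma tcn_lsf: "lsf f ==> tcn (\<lambda>s X. f s)"
 using tcn_app1[of "\<lambda>_. f" "\<lambda>s X. of_bool (bit X 0)"] lsf_weaken[of f] tcn.input[OF lsf_const[of 0]] by simp

lemma tcn_add [tcn_intros]:
 assumes "tcn G" "tcn H"
 shows "tcn (\<lambda>s X. G s X + H s X)"
 using tcn.comb[of "\<lambda>s. G (\<lambda>k. s (Suc k))" "\<lambda>s. H (\<lambda>k. s (Suc k))" "\<lambda>s. s 0" "\<lambda>s. s 0" "\<lambda>_. 1" "\<lambda>_. 1"]
  tcn_env[OF assms(1) lsf_var] tcn_env[OF assms(2) lsf_var] lsf_var[of 0] lsf_const[of 1] by simp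

text \<open>The defining rule applies functions of one value only. Two bounded values are therefore
  packed into the single number \<open>G + H * Suc b\<close> and separated again by remainder and
  quotient inside a log-space function.\<close>

lemma tcn_app2:
 assumes f: "lsf (\<lambda>s. f (s 0) (s (Suc 0)) (\<lambda>k. s (Suc (Suc k))))" and "tcn G" "tcn H"
 shows "tcn (\<lambda>s X. f (G s X) (H s X) s)"
proof -
 obtain b where b: "lsf b" "!!s X. G s X <= b s" using tcn_bound[OF assms(2)] by auto
 have f': "lsf (\<lambda>s. f (u s) (v s) (\<lambda>k. s (Suc k)))" if "lsf u" "lsf v" for u v
  using lsf_env[OF f, of "\<lambda>s. push (u s) (push (v s) (\<lambda>k. s (Suc k)))", OF lsf_push_env[OF that(1) lsf_push_env[OF that(2) lsf_var]]]
  by simp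
 have "tcn (\<lambda>s X. H s X * Suc (b s))"
  by (rule tcn_app1[OF _ assms(3)]) (intro lsf_intros lsf_weaken[OF b(1)])
 then have "tcn (\<lambda>s X. G s X + H s X * Suc (b s))" by (intro tcn_intros assms)
 from tcn_app1[OF _ this, of "\<lambda>v s. f (v mod Suc (b s)) (v div Suc (b s)) s"]
 have "tcn (\<lambda>s X. f ((G s X + H s X * Suc (b s)) mod Suc (b s)) ((G s X + H s X * Suc (b s)) div Suc (b s)) s)"
  using f' lsf_weaken[OF b(1)] by (simp add: lsf_intros del: mult_Suc mult_Suc_right)
 moreover have "(x + y * Suc c) mod Suc c = x" "(x + y * Suc c) div Suc c = y" if "x <= c" for x y c :: nat
  using that by (simp_all del: mult_Suc_right add: le_imp_less_Suc)
 ultimately show ?thesis by (simp only: b(2))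
qed

definition tcp :: "(env => nat => bool) => bool" where
 "tcp P \<longleftrightarrow> tcn (\<lambda>s X. of_bool (P s X))"

lemma tcn_ops [tcn_intros]:
 assumes "tcn G" "tcn H"
 shows "tcn (\<lambda>s X. G s X * H s X)" "tcn (\<lambda>s X. G s X - H s X)" "tcn (\<lambda>s X. G s X div H s X)"
  "tcn (\<lambda>s X. G s X mod H s X)"
  "tcp (\<lambda>s X. G s X = H s X)" "tcp (\<lambda>s X. G s X <= H s X)" "tcp (\<lambda>s X. G s X < H s X)"
  "tcp (\<lambda>s X. bit (G s X) (H s X))"
 unfolding tcp_def by (rule tcn_app2[OF _ assms], intro lsf_intros)+

lemma tcn_Suc [tcn_intros]: "tcn G ==> tcn (\<lambda>s X. Suc (G s X))"
 by (rule tcn_app1) (intro lsf_intros)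

lemma tcn_of_bool [tcn_intros]: "tcp P ==> tcn (\<lambda>s X. of_bool (P s X))"
 by (simp add: tcp_def)

lemma tcp_input [tcn_intros]: "lsf f ==> tcp (\<lambda>s X. bit X (f s))"
 unfolding tcp_def by (rule tcn.input)

lemma tcp_lsp: "lsp P ==> tcp (\<lambda>s X. P s)"
 unfolding tcp_def lsp_def by (rule tcn_lsf)

lemma tcp_not [tcn_intros]: "tcp P ==> tcp (\<lambda>s X. \<not> P s X)"
proof -
 assume P: "tcp P"
 have eq: "of_bool (\<not> p) = (1 - of_bool p :: nat)" for p by simp
 show ?thesis unfolding tcp_def eq by (intro tcn_intros P tcn_lsf lsf_const)
qed

lemma tcp_conj [tcn_intros]: "tcp P ==> tcp Q ==> tcp (\<lambda>s X. P s X \<and> Q s X)"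
 using tcn_ops(1)[of "\<lambda>s X. of_bool (P s X)" "\<lambda>s X. of_bool (Q s X)"] by (simp add: tcp_def of_bool_conj)

lemma tcp_disj [tcn_intros]: "tcp P ==> tcp Q ==> tcp (\<lambda>s X. P s X \<or> Q s X)"
 using tcp_not[OF tcp_conj[OF tcp_not tcp_not], of P Q] by simp

lemma tcp_imp [tcn_intros]: "tcp P ==> tcp Q ==> tcp (\<lambda>s X. P s X --> Q s X)"
 using tcp_disj[OF tcp_not, of P Q] unfolding imp_conv_disj .

lemma tcp_iff [tcn_intros]: "tcp P ==> tcp Q ==> tcp (\<lambda>s X. P s X = Q s X)"
 using tcp_conj[OF tcp_imp tcp_imp, of P Q Q P] by (simp add: iff_conv_conj_imp)

lemma tcn_if [tcn_intros]: "tcp P ==> tcn G ==> tcn H ==> tcn (\<lambda>s X. if P s X then G s X else H s X)"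
proof -
 assume P: "tcp P" "tcn G" "tcn H"
 then have "tcn (\<lambda>s X. of_bool (P s X) * G s X + of_bool (\<not> P s X) * H s X)"
  by (intro tcn_intros)
 moreover have "(\<lambda>s X. of_bool (P s X) * G s X + of_bool (\<not> P s X) * H s X) = (\<lambda>s X. if P s X then G s X else H s X)"
  by (auto simp: fun_eq_iff)
 ultimately show ?thesis by simp
qed

lemma tcp_if [tcn_intros]: "tcp P ==> tcp Q ==> tcp R ==> tcp (\<lambda>s X. if P s X then Q s X else R s X)"
 using tcn_if[of P "\<lambda>s X. of_bool (Q s X)" "\<lambda>s X. of_bool (R s X)"] by (simp add: tcp_def if_distrib[of of_bool] cong: if_cong)

lemma tcp_ex [tcn_intros]:
 assumes "lsf w" "tcp (\<lambda>s. P (s 0) (\<lambda>k. s (Suc k)))"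
 shows "tcp (\<lambda>s X. \<exists>i<w s. P i s X)"
proof -
 have "tcp (\<lambda>s X. \<not> (\<Sum>i<w s. of_bool (P i s X)) = (0::nat))"
  by (intro tcn_intros assms tcn_lsf lsf_intros)
 moreover have "(\<not> (\<Sum>i<w s. of_bool (P i s X)) = (0::nat)) = (\<exists>i<w s. P i s X)" for s X
  by auto
 ultimately show ?thesis by simp
qed

lemma tcp_all [tcn_intros]:
 assumes "lsf w" "tcp (\<lambda>s. P (s 0) (\<lambda>k. s (Suc k)))"
 shows "tcp (\<lambda>s X. \<forall>i<w s. P i s X)"
proof -
 have "tcp (\<lambda>s X. \<not> (\<exists>i<w s. \<not> P i s X))"
  by (intro tcn_intros assms)
 then show ?thesis by simp
qed

text \<open>Index variables range over numbers independent of the input. To use a computed value as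
  an index, all candidates \<open>i\<close> are tried, and the sum keeps the one that equals the
  value.\<close>

lemma tcn_let:
 assumes g: "tcn (\<lambda>s. g (s 0) (\<lambda>k. s (Suc k)))" and H: "tcn H"
 shows "tcn (\<lambda>s X. g (H s X) s X)"
proof -
 obtain b where b: "lsf b" "!!s X. H s X <= b s" using tcn_bound[OF H] by auto
 have "tcn (\<lambda>s X. \<Sum>i<Suc (b s). if i = H s X then g i s X else 0)"
  by (intro tcn_intros lsf_intros b g tcn_lsf tcn_env[OF H])
 moreover have "(\<Sum>i<Suc (b s). if i = H s X then g i s X else 0) = g (H s X) s X" for s X
  using b(2)[of s X] by (simp add: sum.delta le_imp_less_Suc del: sum.lessThan_Suc)
 ultimately show ?thesis by simp
qed

text \<open>Such a number may be exponentially large and so cannot be a \<open>tcn\<close> value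
  itself; variable 0 is the bit position, and the number of bits is bounded in terms of the
  sizes.\<close>

definition tcb :: "(env => nat => nat) => bool" where
 "tcb F \<longleftrightarrow> tcp (\<lambda>s X. bit (F (\<lambda>k. s (Suc k)) X) (s 0)) \<and> (\<exists>w. lsf w \<and> (\<forall>s X. F s X < 2 ^ w s))"

lemma tcbI: "tcp (\<lambda>s X. bit (F (\<lambda>k. s (Suc k)) X) (s 0)) ==> lsf w ==> (!!s X. F s X < 2 ^ w s) ==> tcb F"
 by (auto simp: tcb_def)

lemma tcp_bit [tcn_intros]:
 assumes "tcb F" "tcn p"
 shows "tcp (\<lambda>s X. bit (F s X) (p s X))"
 using tcn_let[of "\<lambda>i s X. of_bool (bit (F s X) i)" p] assms by (simp add: tcp_def tcb_def)

lemma tcb_bound: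
 assumes "tcb F"
 obtains w where "lsf w" "!!s X. F s X < 2 ^ w s"
proof -
 from assms have "\<exists>w. lsf w \<and> (\<forall>s X. F s X < 2 ^ w s)" by (simp add: tcb_def)
 then obtain w where "lsf w" "\<forall>s X. F s X < 2 ^ w s" by (elim exE conjE)
 then show ?thesis by (intro that) auto
qed

lemma tcb_env:
 assumes "tcb F" "!!k. lsf (\<lambda>s. e s k)"
 shows "tcb (\<lambda>s. F (e s))"
proof -
 obtain w where w: "lsf w" "!!s X. F s X < 2 ^ w s" using tcb_bound[OF assms(1)] by blast
 have "tcn (\<lambda>s X. of_bool (bit (F (\<lambda>k. s (Suc k)) X) (s 0)))" using assms(1) by (simp add: tcb_def tcp_def)
 from tcn_env[OF this, of "\<lambda>s. push (s 0) (e (\<lambda>k. s (Suc k)))", OF lsf_push_env[OF lsf_var lsf_weaken[OF assms(2)]]]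
 show ?thesis by (intro tcbI[OF _ lsf_env[OF w(1) assms(2)] w(2)]) (simp add: tcp_def)
qed

lemma tcb_tcn: assumes "tcn F" shows "tcb F"
proof -
 obtain b where b: "lsf b" "!!s X. F s X <= b s" using tcn_bound[OF assms] by auto
 show ?thesis
 proof (rule tcbI[OF _ b(1)])
  show "tcp (\<lambda>s X. bit (F (\<lambda>k. s (Suc k)) X) (s 0))"
   by (intro tcn_intros tcn_env[OF assms] lsf_intros tcn_lsf)
  show "F s X < 2 ^ b s" for s X
   using b(2)[of s X] less_exp[of "b s"] by (rule order_le_less_trans)
 qed
qed


section \<open>Numbers given by their bits, and their sums\<close>

lemma bits_nat_sum:
 fixes x :: nat
 assumes "x < 2 ^ w"
 shows "x = (\<Sum>i<w. of_bool (bit x i) * 2 ^ i)"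
proof -
 have "x = bits_nat {i. i < w \<and> bit x i}"
  using assms by (intro bit_eqI) (auto simp: bit_bits_nat less_exp_bits)
 also have "... = (\<Sum>i<w. of_bool (bit x i) * 2 ^ i)"
  unfolding bits_nat_def by (rule sum.mono_neutral_cong_left) auto
 finally show ?thesis .
qed

lemma bits_nat_less: "A \<subseteq> {..<w} ==> bits_nat A < 2 ^ w"
 by (auto simp: less_exp_bits bit_bits_nat finite_subset[of A "{..<w}"])

lemma tcb_of_bits:
 assumes "tcp (\<lambda>E. P (E 0) (\<lambda>k. E (Suc k)))" "lsf w"
 shows "tcb (\<lambda>E X. bits_nat {i. i < w E \<and> P i E X})"
proof (rule tcbI[OF _ assms(2)])
 show "tcp (\<lambda>E X. bit (bits_nat {i. i < w (\<lambda>k. E (Suc k)) \<and> P i (\<lambda>k. E (Suc k)) X}) (E 0))"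
  by (simp add: bit_bits_nat) (intro tcn_intros tcn_lsf lsf_intros assms(1) lsf_weaken[OF assms(2)])
qed (auto intro: bits_nat_less)

lemma tcb_bitwise:
 assumes "tcp (\<lambda>E X. P (E 0) (\<lambda>k. E (Suc k)) X)" "lsf w" "!!E X. F E X < 2 ^ w E"
  and "!!E X i. bit (F E X) i = P i E X"
 shows "tcb F"
 by (rule tcbI[OF _ assms(2,3)]) (simp add: assms(1,4))

lemma tcb_shift: "tcb F ==> tcb (\<lambda>E. F (\<lambda>k. E (Suc k)))"
 by (rule tcb_env[OF _ lsf_var])

lemma tcn_shift: "tcn F ==> tcn (\<lambda>E. F (\<lambda>k. E (Suc k)))"
 by (rule tcn_env[OF _ lsf_var])

lemma tcp_shift: "tcp F ==> tcp (\<lambda>E. F (\<lambda>k. E (Suc k)))"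
 unfolding tcp_def by (rule tcn_shift)

named_theorems tcb_intros

lemma tcb_take_bit [tcb_intros]:
 assumes F: "tcb F" and N: "tcn N"
 shows "tcb (\<lambda>E X. take_bit (N E X) (F E X))"
proof -
 obtain w where w: "lsf w" "!!E X. F E X < 2 ^ w E" using tcb_bound[OF F] by blast
 show ?thesis
 proof (rule tcb_bitwise[OF _ w(1), where P = "\<lambda>i E X. i < N E X \<and> bit (F E X) i"])
  show "tcp (\<lambda>E X. E 0 < N (\<lambda>k. E (Suc k)) X \<and> bit (F (\<lambda>k. E (Suc k)) X) (E 0))"
   by (intro tcn_intros tcn_lsf lsf_intros tcn_shift[OF N] tcb_shift[OF F])
  show "take_bit (N E X) (F E X) < 2 ^ w E" for E X
   using w(2)[of E X] take_bit_nat_less_eq_self by (rule order_le_less_trans[rotated])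
 qed (simp add: bit_take_bit_iff)
qed

lemma tcb_drop_bit [tcb_intros]:
 assumes F: "tcb F" and N: "tcn N"
 shows "tcb (\<lambda>E X. drop_bit (N E X) (F E X))"
proof -
 obtain w where w: "lsf w" "!!E X. F E X < 2 ^ w E" using tcb_bound[OF F] by blast
 show ?thesis
 proof (rule tcb_bitwise[OF _ w(1), where P = "\<lambda>i E X. bit (F E X) (N E X + i)"])
  show "tcp (\<lambda>E X. bit (F (\<lambda>k. E (Suc k)) X) (N (\<lambda>k. E (Suc k)) X + E 0))"
   by (intro tcn_intros tcn_lsf lsf_intros tcn_shift[OF N] tcb_shift[OF F])
  show "drop_bit (N E X) (F E X) < 2 ^ w E" for E X
   using w(2)[of E X] by (rule order_le_less_trans[rotated]) (simp add: drop_bit_eq_div)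
 qed (simp add: bit_drop_bit_eq)
qed

lemma tcb_push_bit [tcb_intros]:
 assumes F: "tcb F" and N: "tcn N"
 shows "tcb (\<lambda>E X. push_bit (N E X) (F E X))"
proof -
 obtain w where w: "lsf w" "!!E X. F E X < 2 ^ w E" using tcb_bound[OF F] by blast
 obtain b where b: "lsf b" "!!E X. N E X <= b E" using tcn_bound[OF N] by auto
 have less: "push_bit (N E X) (F E X) < 2 ^ (w E + b E)" for E X
 proof -
  have "F E X * 2 ^ N E X < 2 ^ w E * 2 ^ N E X" using w(2) by simp
  also have "... <= 2 ^ w E * 2 ^ b E" using b(2) by (intro mult_le_mono power_increasing) auto
  finally show ?thesis by (simp add: push_bit_eq_mult power_add)
 qed
 show ?thesis
 proof (rule tcb_bitwise[OF _ _ less, where P = "\<lambda>i E X. N E X <= i \<and> bit (F E X) (i - N E X)"])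
  show "tcp (\<lambda>E X. N (\<lambda>k. E (Suc k)) X <= E 0 \<and> bit (F (\<lambda>k. E (Suc k)) X) (E 0 - N (\<lambda>k. E (Suc k)) X))"
   by (intro tcn_intros tcn_lsf lsf_intros tcn_shift[OF N] tcb_shift[OF F])
  show "lsf (\<lambda>E. w E + b E)" by (intro lsf_intros w b)
 qed (simp add: bit_push_bit_iff)
qed

lemma tcb_if [tcb_intros]:
 assumes P: "tcp P" and F: "tcb F" and G: "tcb G"
 shows "tcb (\<lambda>E X. if P E X then F E X else G E X)"
proof -
 obtain w where w: "lsf w" "!!E X. F E X < 2 ^ w E" using tcb_bound[OF F] by blast
 obtain v where v: "lsf v" "!!E X. G E X < 2 ^ v E" using tcb_bound[OF G] by blast
 show ?thesis
 proof (rule tcb_bitwise[where w = "\<lambda>E. w E + v E" and P = "\<lambda>i E X. if P E X then bit (F E X) i else bit (G E X) i"])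
  show "tcp (\<lambda>E X. if P (\<lambda>k. E (Suc k)) X then bit (F (\<lambda>k. E (Suc k)) X) (E 0) else bit (G (\<lambda>k. E (Suc k)) X) (E 0))"
   by (intro tcn_intros tcn_lsf lsf_intros tcp_shift[OF P] tcb_shift[OF F] tcb_shift[OF G])
  have "F E X < 2 ^ (w E + v E)" "G E X < 2 ^ (w E + v E)" for E X
   by (rule order_less_le_trans[OF w(2)] order_less_le_trans[OF v(2)], intro power_increasing, simp, simp)+
  then show "(if P E X then F E X else G E X) < 2 ^ (w E + v E)" for E X by simp
  show "lsf (\<lambda>E. w E + v E)" by (intro lsf_intros w v)
 qed simp
qed


text \<open>Carry lookahead in base \<open>B\<close>: a carry is generated at a position
  \<open>u\<close> with digit at least \<open>B\<close> and propagated by digits at least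
  \<open>B - 1\<close>. The bound \<open>2 * B - 2\<close> on digits makes digit plus carry less
  than \<open>2 * B\<close>, so no carry exceeds 1.\<close>

lemma digit_carry:
 fixes e :: "nat => nat" and B :: nat
 assumes B: "0 < B" and e: "!!t. e t <= 2 * B - 2"
 defines "C \<equiv> \<lambda>t. (\<Sum>u<t. e u * B ^ u) div B ^ t"
 shows "C t = of_bool (\<exists>u<t. B <= e u \<and> (\<forall>v<t. u < v --> B - 1 <= e v))"
proof (induction t)
 case 0
 show ?case by (simp add: C_def)
next
 case (Suc t)
 have "C (Suc t) = ((\<Sum>u<t. e u * B ^ u) + e t * B ^ t) div B ^ t div B"
  unfolding C_def by (simp add: div_mult2_eq mult.commute[of B])
 also have "... = (C t + e t) div B"
  unfolding C_def using B by (simp add: add.commute)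
 finally have C: "C (Suc t) = (C t + e t) div B" .
 let ?P = "\<lambda>t. \<exists>u<t. B <= e u \<and> (\<forall>v<t. u < v --> B - 1 <= e v)"
 have step: "?P (Suc t) \<longleftrightarrow> B <= e t \<or> (?P t \<and> B - 1 <= e t)"
  by (auto simp: less_Suc_eq)
 have "C (Suc t) = of_bool (B <= C t + e t)"
 proof -
  have "C t + e t < 2 * B" using e[of t] B Suc.IH by (auto split: if_splits simp: of_bool_def)
  then show ?thesis unfolding C using B by (cases "B <= C t + e t") (auto intro: div_nat_eqI)
 qed
 also have "B <= C t + e t \<longleftrightarrow> ?P (Suc t)"
 proof -
  have "B <= of_bool p + x \<longleftrightarrow> B <= x \<or> (p \<and> B - 1 <= x)" for p and x :: nat
   using B by (cases p) auto
  then show ?thesis unfolding step Suc.IH .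
 qed
 finally show ?case .
qed

lemma digit_sum:
 fixes e :: "nat => nat" and B :: nat
 assumes "0 < B" "t < Z"
 shows "(\<Sum>u<Z. e u * B ^ u) div B ^ t mod B = ((\<Sum>u<t. e u * B ^ u) div B ^ t + e t) mod B"
proof -
 have "(\<Sum>u<Z. e u * B ^ u) = (\<Sum>u<t. e u * B ^ u) + (\<Sum>u=t..<Z. e u * B ^ u)"
  using assms(2) by (metis atLeast0LessThan sum.atLeastLessThan_concat le0 less_imp_le)
 also have "(\<Sum>u=t..<Z. e u * B ^ u) = e t * B ^ t + (\<Sum>u=Suc t..<Z. e u * B ^ u)"
  using assms(2) by (rule sum.atLeast_Suc_lessThan)
 also have "(\<Sum>u=Suc t..<Z. e u * B ^ u) = B ^ t * (B * (\<Sum>u=Suc t..<Z. e u * B ^ (u - Suc t)))"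
  unfolding sum_distrib_left
 proof (rule sum.cong[OF refl])
  fix u assume "u \<in> {Suc t..<Z}"
  then have "B ^ u = B ^ t * (B * B ^ (u - Suc t))"
   by (simp flip: power_Suc power_add)
  then show "e u * B ^ u = B ^ t * (B * (e u * B ^ (u - Suc t)))" by simp
 qed
 finally have "(\<Sum>u<Z. e u * B ^ u) = (\<Sum>u<t. e u * B ^ u) + B ^ t * (e t + B * (\<Sum>u=Suc t..<Z. e u * B ^ (u - Suc t)))"
  by (simp add: algebra_simps)
 then have "(\<Sum>u<Z. e u * B ^ u) div B ^ t = (\<Sum>u<t. e u * B ^ u) div B ^ t + e t + B * (\<Sum>u=Suc t..<Z. e u * B ^ (u - Suc t))"
  using assms(1) by simp
 then show ?thesis by simp
qed

definition block :: "(nat => nat) => nat => nat => nat" where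
 "block c s t = (\<Sum>r<s. c (t * s + r) * 2 ^ r)"

text \<open>With column sums below \<open>2 ^ s\<close>, a block of \<open>s\<close> columns has
  value below \<open>2 ^ (2 * s)\<close>. Its upper half moves to the next block, so each digit in
  base \<open>2 ^ s\<close> becomes the sum of just two numbers below \<open>2 ^ s\<close>, as in an
  ordinary addition.\<close>

definition digit :: "(nat => nat) => nat => nat => nat" where
 "digit c s t = block c s t mod 2 ^ s + (if t = 0 then 0 else block c s (t - 1) div 2 ^ s)"

lemma bit_columns:
 assumes s: "0 < s" and c: "!!j. c j < 2 ^ s" and L: "!!j. L <= j ==> c j = 0"
 shows "bit (\<Sum>j<L. c j * 2 ^ j) k = bit (digit c s (k div s) +
   of_bool (\<exists>u<k div s. 2 ^ s <= digit c s u \<and> (\<forall>v<k div s. u < v --> 2 ^ s - 1 <= digit c s v))) (k mod s)"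
proof -
 let ?B = "2 ^ s :: nat" and ?t = "k div s"
 have c_le: "c j <= ?B - 1" for j using c[of j] by linarith
 have block_less: "block c s t < ?B * ?B" for t
 proof -
  have "block c s t <= (\<Sum>r<s. (?B - 1) * 2 ^ r)"
   unfolding block_def by (intro sum_mono mult_le_mono1 c_le)
  also have "... = (?B - 1) * (?B - 1)"
   by (simp add: sum_power2 lessThan_atLeast0 flip: sum_distrib_left)
  also have "... < ?B * ?B" by (rule mult_strict_mono) auto
  finally show ?thesis .
 qed
 have e_le: "digit c s t <= 2 * ?B - 2" for t
 proof -
  have 1: "block c s t mod ?B < ?B" by simp
  have 2: "block c s (t - 1) div ?B < ?B" using block_less by (simp add: div_less_iff_less_mult)
  have "block c s t mod ?B <= ?B - 1" "block c s (t - 1) div ?B <= ?B - 1" using 1 2 by linarith+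
  moreover have "a <= b - 1 ==> c <= b - 1 ==> a + (if t = 0 then 0 else c) <= 2 * b - 2" for a b c :: nat
   by (cases "t = 0") auto
  ultimately show ?thesis unfolding digit_def by blast
 qed
 have block0: "block c s t = 0" if "L <= t" for t
 proof -
  have "t * 1 <= t * s" using s by (intro mult_le_mono2) simp
  then have "L <= t * s + r" for r using that by linarith
  then show ?thesis by (simp add: block_def L)
 qed
 define Z where "Z = L + ?t + 1"
 have "(\<Sum>j<L. c j * 2 ^ j) = (\<Sum>j<Z * s. c j * 2 ^ j)"
 proof (rule sum.mono_neutral_left)
  have "Z <= Z * s" using s by simp
  then show "{..<L} \<subseteq> {..<Z * s}" by (auto simp: Z_def)
 qed (use L in auto)
 also have "... = (\<Sum>t<Z. block c s t * ?B ^ t)"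
 proof -
  have "(\<Sum>j<T * s. c j * 2 ^ j) = (\<Sum>t<T. block c s t * ?B ^ t)" for T
  proof -
   have "(\<Sum>j<T * s. c j * 2 ^ j) = (\<Sum>t<T. \<Sum>r<s. c (t * s + r) * 2 ^ (t * s + r))"
    using sum_div_mod[OF s, of "\<lambda>t r. c (t * s + r) * 2 ^ (t * s + r)" T] by simp
   moreover have "c (t * s + r) * 2 ^ (t * s + r) = c (t * s + r) * 2 ^ r * ?B ^ t" for t r
    by (simp add: power_add power_mult mult.commute[of t s])
   ultimately show ?thesis by (simp only: block_def sum_distrib_right)
  qed
  then show ?thesis .
 qed
 also have "... = (\<Sum>t<Z. digit c s t * ?B ^ t)"
 proof -
  have "(\<Sum>t<T. block c s t * ?B ^ t) = (\<Sum>t<T. digit c s t * ?B ^ t) + (if T = 0 then 0 else block c s (T - 1) div ?B * ?B ^ T)" for T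
  proof (induction T)
   case (Suc T)
   have "block c s T * ?B ^ T = block c s T mod ?B * ?B ^ T + block c s T div ?B * ?B ^ Suc T"
   proof -
    have "(x div b * b + x mod b) * z = x mod b * z + x div b * (b * z)" for x b z :: nat
     by (simp only: algebra_simps)
    then show ?thesis by (simp only: div_mult_mod_eq power_Suc)
   qed
   then show ?case using Suc by (cases T) (simp_all add: digit_def algebra_simps)
  qed simp
  from this[of Z] show ?thesis by (simp add: block0 Z_def)
 qed
 finally have S: "(\<Sum>j<L. c j * 2 ^ j) = (\<Sum>t<Z. digit c s t * ?B ^ t)" .
 have "bit (\<Sum>j<L. c j * 2 ^ j) k = bit ((\<Sum>j<L. c j * 2 ^ j) div ?B ^ ?t mod ?B) (k mod s)"
 proof -
  have "(x div ?B ^ ?t mod ?B) = take_bit s (drop_bit (s * ?t) x)" for x :: nat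
   by (simp add: take_bit_eq_mod drop_bit_eq_div power_mult)
  then show ?thesis using s by (simp add: bit_take_bit_iff bit_drop_bit_eq)
 qed
 also have "... = bit (((\<Sum>u<?t. digit c s u * ?B ^ u) div ?B ^ ?t + digit c s ?t) mod ?B) (k mod s)"
  unfolding S by (subst digit_sum) (auto simp: Z_def)
 also have "... = bit ((\<Sum>u<?t. digit c s u * ?B ^ u) div ?B ^ ?t + digit c s ?t) (k mod s)"
  using s by (simp add: bit_take_bit_iff flip: take_bit_eq_mod)
 finally show ?thesis using digit_carry[where e = "digit c s" and B = ?B and t = ?t, OF _ e_le] by (simp add: add.commute)
qed


text \<open>The block length is logarithmic in a bound for the column sums. Hence
  \<open>2 ^ s\<close>, the blocks and the digits are polynomially bounded \<open>tcn\<close>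
  values, and the carry is a bounded quantification over them.\<close>

lemma tcb_columns:
 assumes c: "tcn (\<lambda>E. c (E 0) (\<lambda>k. E (Suc k)))" and L: "lsf L"
 shows "tcb (\<lambda>E X. \<Sum>j<L E. c j E X * 2 ^ j)"
proof -
 obtain b where b: "lsf b" "!!E X. c (E 0) (\<lambda>k. E (Suc k)) X <= b E" using tcn_bound[OF c] by auto
 \<comment> \<open>The summand 2 makes the block length \<open>clog (W E)\<close> positive, as
   division into blocks requires.\<close>
 define W where "W E = (\<Sum>j<L E. b (push j E)) + 2" for E
 define c' where "c' E X j = (if j < L E then c j E X else 0)" for E X j
 have W: "lsf W" unfolding W_def[abs_def] by (intro lsf_intros L lsf_env[OF b(1)] lsf_push_env)
 have c'_less: "c' E X j < 2 ^ clog (W E)" for E X j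
 proof -
  have "c' E X j < W E"
  proof (cases "j < L E")
   case True
   have "c j E X <= b (push j E)" using b(2)[of "push j E"] by simp
   also have "... <= (\<Sum>j<L E. b (push j E))"
    by (rule member_le_sum[of j "{..<L E}" "\<lambda>j. b (push j E)"]) (use True in auto)
   finally show ?thesis using True by (simp add: c'_def W_def)
  qed (simp add: c'_def W_def)
  also have "... <= 2 ^ clog (W E)" by (rule le_power_clog)
  finally show ?thesis .
 qed
 have pos: "0 < clog (W E)" for E by (rule clog_pos) (simp add: W_def)
 have sum: "(\<Sum>j<L E. c j E X * 2 ^ j) = (\<Sum>j<L E. c' E X j * 2 ^ j)" for E X
  by (simp add: c'_def)
 have c'_tcn: "tcn (\<lambda>E X. c' (e E) X (j E))" if "!!k. lsf (\<lambda>E. e E k)" "lsf j" for e j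
  unfolding c'_def using tcn_env[OF c, of "\<lambda>E. push (j E) (e E)", OF lsf_push_env[OF that(2,1)]]
  by (simp, intro tcn_intros tcp_lsp tcn_lsf lsf_intros that lsf_env[OF L]) simp
 have pow: "(2::nat) ^ r = min (2 ^ r) (2 ^ s)" if "r < s" for r s :: nat
  using that by (simp add: min_def)
 have block_eq: "block (c' E X) s t = (\<Sum>r<s. c' E X (t * s + r) * min (2 ^ r) (2 ^ s))" for E X s t
  unfolding block_def by (intro sum.cong refl) (use pow in auto)
 have block_tcn: "tcn (\<lambda>E X. block (c' (e E) X) (clog (W (e E))) (t E))" if "!!k. lsf (\<lambda>E. e E k)" "lsf t" for e t
  unfolding block_eq
  by (intro tcn_intros tcn_lsf lsf_intros c'_tcn that lsf_env[OF W] lsf_weaken[OF that(1)] lsf_weaken[OF that(2)])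
 have digit_tcn: "tcn (\<lambda>E X. digit (c' (e E) X) (clog (W (e E))) (t E))" if "!!k. lsf (\<lambda>E. e E k)" "lsf t" for e t
  unfolding digit_def
  by (intro tcn_intros tcp_lsp tcn_lsf lsf_intros block_tcn that lsf_env[OF W])
 show ?thesis
 proof (rule tcb_bitwise)
  show "(\<Sum>j<L E. c j E X * 2 ^ j) < 2 ^ (clog (W E) + L E)" for E X
  proof -
   have "(\<Sum>j<L E. c' E X j * 2 ^ j) <= (\<Sum>j<L E. 2 ^ clog (W E) * 2 ^ j)"
    by (intro sum_mono mult_le_mono1 less_imp_le c'_less)
   also have "... = 2 ^ clog (W E) * (2 ^ L E - 1)"
    by (simp add: sum_power2 lessThan_atLeast0 flip: sum_distrib_left)
   also have "... < 2 ^ (clog (W E) + L E)" by (simp add: power_add)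
   finally show ?thesis unfolding sum .
  qed
  show "lsf (\<lambda>E. clog (W E) + L E)" by (intro lsf_intros W L)
  show "bit (\<Sum>j<L E. c j E X * 2 ^ j) k = bit (digit (c' E X) (clog (W E)) (k div clog (W E)) +
   of_bool (\<exists>u<k div clog (W E). 2 ^ clog (W E) <= digit (c' E X) (clog (W E)) u \<and>
     (\<forall>v<k div clog (W E). u < v --> 2 ^ clog (W E) - 1 <= digit (c' E X) (clog (W E)) v))) (k mod clog (W E))" for E X k
   unfolding sum by (rule bit_columns[OF pos c'_less]) (simp add: c'_def)
  show "tcp (\<lambda>E X. bit (digit (c' (\<lambda>k. E (Suc k)) X) (clog (W (\<lambda>k. E (Suc k)))) (E 0 div clog (W (\<lambda>k. E (Suc k)))) +
   of_bool (\<exists>u<E 0 div clog (W (\<lambda>k. E (Suc k))). 2 ^ clog (W (\<lambda>k. E (Suc k))) <= digit (c' (\<lambda>k. E (Suc k)) X) (clog (W (\<lambda>k. E (Suc k)))) u \<and>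
     (\<forall>v<E 0 div clog (W (\<lambda>k. E (Suc k))). u < v --> 2 ^ clog (W (\<lambda>k. E (Suc k))) - 1 <= digit (c' (\<lambda>k. E (Suc k)) X) (clog (W (\<lambda>k. E (Suc k)))) v))) (E 0 mod clog (W (\<lambda>k. E (Suc k)))))"
   by (intro tcn_intros tcn_lsf tcp_lsp lsf_intros digit_tcn lsf_env[OF W])
 qed
qed

lemma tcb_sum [tcb_intros]:
 assumes w: "lsf w" and g: "tcb (\<lambda>E. g (E 0) (\<lambda>k. E (Suc k)))"
 shows "tcb (\<lambda>E X. \<Sum>i<w E. g i E X)"
proof -
 obtain v where v: "lsf v" "!!E X. g (E 0) (\<lambda>k. E (Suc k)) X < 2 ^ v E" using tcb_bound[OF g] by blast
 define L where "L E = (\<Sum>i<w E. v (push i E))" for E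
 have less: "g i E X < 2 ^ L E" if "i < w E" for i E X
 proof -
  have "v (push i E) <= L E"
   unfolding L_def by (rule member_le_sum[of i "{..<w E}" "\<lambda>i. v (push i E)"]) (use that in auto)
  then show ?thesis
   using v(2)[of "push i E" X] by (auto intro: order_less_le_trans power_increasing)
 qed
 have eq: "(\<Sum>i<w E. g i E X) = (\<Sum>j<L E. (\<Sum>i<w E. of_bool (bit (g i E X) j)) * 2 ^ j)" for E X
 proof -
  have "(\<Sum>i<w E. g i E X) = (\<Sum>i<w E. \<Sum>j<L E. of_bool (bit (g i E X) j) * 2 ^ j)"
   by (intro sum.cong refl bits_nat_sum less) simp
  also have "... = (\<Sum>j<L E. (\<Sum>i<w E. of_bool (bit (g i E X) j)) * 2 ^ j)"
   unfolding sum_distrib_right by (rule sum.swap)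
  finally show ?thesis .
 qed
 have L: "lsf L" unfolding L_def[abs_def] by (intro lsf_intros w lsf_env[OF v(1)] lsf_push_env)
 have g': "tcb (\<lambda>E. g (E 0) (\<lambda>k. E (Suc (Suc k))))"
  using tcb_env[OF g, of "\<lambda>E. push (E 0) (\<lambda>k. E (Suc (Suc k)))", OF lsf_push_env[OF lsf_var lsf_var]] by simp
 show ?thesis
  unfolding eq by (intro tcb_columns L tcn_intros lsf_weaken[OF w] g' tcn_lsf lsf_intros)
qed

lemma tcb_add [tcb_intros]:
 assumes F: "tcb F" and G: "tcb G"
 shows "tcb (\<lambda>E X. F E X + G E X)"
proof -
 have "tcb (\<lambda>E X. \<Sum>i<(2::nat). if i = 0 then F E X else G E X)"
  by (intro tcb_intros lsf_intros tcp_lsp tcb_shift[OF F] tcb_shift[OF G])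
 then show ?thesis by (simp add: numeral_2_eq_2)
qed

lemma tcb_mult [tcb_intros]:
 assumes F: "tcb F" and G: "tcb G"
 shows "tcb (\<lambda>E X. F E X * G E X)"
proof -
 obtain w where w: "lsf w" "!!E X. F E X < 2 ^ w E" using tcb_bound[OF F] by blast
 have "F E X * G E X = (\<Sum>i<w E. if bit (F E X) i then push_bit i (G E X) else 0)" for E X
 proof -
  have "F E X * G E X = (\<Sum>i<w E. of_bool (bit (F E X) i) * 2 ^ i * G E X)"
   using bits_nat_sum[OF w(2), of E X] by (metis sum_distrib_right)
  also have "... = (\<Sum>i<w E. if bit (F E X) i then push_bit i (G E X) else 0)"
   by (rule sum.cong) (auto simp: push_bit_eq_mult)
  finally show ?thesis .
 qed
 moreover have "tcb (\<lambda>E X. \<Sum>i<w E. if bit (F E X) i then push_bit i (G E X) else 0)"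
  by (intro tcb_intros tcn_intros lsf_intros w tcb_shift[OF F] tcb_shift[OF G] tcn_lsf tcb_tcn)
 ultimately show ?thesis by simp
qed

text \<open>The powers of two are reduced modulo \<open>p\<close> in log space. The sum of the
  selected remainders is then polynomially bounded, and its remainder is an operation on small
  numbers.\<close>

lemma tcn_mod [tcn_intros]:
 assumes F: "tcb F" and p: "lsf p" "!!E. 0 < p E"
 shows "tcn (\<lambda>E X. F E X mod p E)"
proof -
 obtain w where w: "lsf w" "!!E X. F E X < 2 ^ w E" using tcb_bound[OF F] by blast
 have "F E X mod p E = (\<Sum>i<w E. of_bool (bit (F E X) i) * (2 ^ i mod p E)) mod p E" for E X
 proof -
  have "F E X mod p E = (\<Sum>i<w E. of_bool (bit (F E X) i) * 2 ^ i) mod p E"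
   using bits_nat_sum[OF w(2), of E X] by metis
  also have "... = (\<Sum>i<w E. of_bool (bit (F E X) i) * (2 ^ i mod p E)) mod p E"
   by (subst (1 2) mod_sum_eq[symmetric]) (simp add: mod_mult_right_eq)
  finally show ?thesis .
 qed
 moreover have "tcn (\<lambda>E X. (\<Sum>i<w E. of_bool (bit (F E X) i) * (2 ^ i mod p E)) mod p E)"
  by (intro tcn_intros tcn_lsf lsf_intros lsf_power_mod w p tcb_shift[OF F] lsf_weaken[OF p(1)])
 ultimately show ?thesis by simp
qed

text \<open>Two's complement subtraction: adding the bitwise complement of \<open>G\<close> and 1
  gives the difference plus \<open>2 ^ w E\<close>, which is cut off.\<close>

lemma tcb_diff:
 assumes F: "tcb F" and G: "tcb G" and le: "!!E X. G E X <= F E X"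
 shows "tcb (\<lambda>E X. F E X - G E X)"
proof -
 obtain w where w: "lsf w" "!!E X. F E X < 2 ^ w E" using tcb_bound[OF F] by blast
 let ?H = "\<lambda>E X. bits_nat {i. i < w E \<and> \<not> bit (G E X) i}"
 have compl: "?H E X + G E X + 1 = 2 ^ w E" for E X
 proof -
  have G_less: "G E X < 2 ^ w E" using w(2) le by (meson order_le_less_trans)
  have H: "?H E X = (\<Sum>i<w E. of_bool (\<not> bit (G E X) i) * 2 ^ i)"
   unfolding bits_nat_def by (rule sum.mono_neutral_cong_left) auto
  have "?H E X + G E X = (\<Sum>i<w E. of_bool (\<not> bit (G E X) i) * 2 ^ i) + (\<Sum>i<w E. of_bool (bit (G E X) i) * 2 ^ i)"
   unfolding H using bits_nat_sum[OF G_less] by metis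
  also have "... = (\<Sum>i<w E. 2 ^ i)"
   unfolding sum.distrib[symmetric] by (rule sum.cong) auto
  finally show ?thesis by (simp add: sum_power2 lessThan_atLeast0)
 qed
 have "F E X - G E X = take_bit (w E) (F E X + ?H E X + 1)" for E X
 proof -
  have "F E X + ?H E X + 1 = (F E X - G E X) + 2 ^ w E"
   using compl[of E X] le[of E X] by linarith
  then show ?thesis using w(2)[of E X] by (simp add: take_bit_eq_mod)
 qed
 moreover have "tcb (\<lambda>E X. take_bit (w E) (F E X + ?H E X + 1))"
  by (intro tcb_intros tcb_of_bits tcn_intros F tcb_shift[OF G] tcn_lsf lsf_intros w tcb_tcn)
 ultimately show ?thesis by simp
qed

section \<open>Chinese remaindering and binary digits\<close>

text \<open>The recursion of the Leibniz harmonic triangle.\<close>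

lemma leibniz_dvd:
 assumes Q: "!!k. 1 <= k ==> k <= N ==> k dvd Q" and m: "1 <= m" "m <= n" "n <= N"
 shows "m * (n choose m) dvd Q"
proof -
 have "real Q / (real m * real (n choose m)) \<in> \<int>"
  using m
 proof (induction "n - m" arbitrary: n m)
  case 0
  then have "n = m" by simp
  then obtain c where "Q = m * c" using Q[of m] 0 by (auto elim: dvdE)
  then show ?case using \<open>n = m\<close> 0 by simp
 next
  case (Suc d)
  let ?c = "real ((n - 1) choose m)"
  have mn: "m < n" "0 < m" using Suc by simp_all
  have "(n - 1) choose m ~= 0" using mn by (simp add: binomial_eq_0_iff)
  then have c: "?c ~= 0" by simp
  have "real ((n - m) * (n choose m)) = real (n * ((n - 1) choose m))"
   by (simp only: binomial_absorb_comp)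
  then have 1: "real (n choose m) = real n * ?c / real (n - m)"
   using mn by (simp add: field_simps)
  have "real (Suc m * (n choose Suc m)) = real (n * ((n - 1) choose m))"
   by (simp only: binomial_absorption)
  then have 2: "real (Suc m) * real (n choose Suc m) = real n * ?c" by (simp only: of_nat_mult)
  have "real Q / (real m * real (n choose m)) = real Q / (real m * ?c) - real Q / (real (Suc m) * real (n choose Suc m))"
   unfolding 1 2 using c mn by (simp add: field_simps of_nat_diff)
  moreover have "real Q / (real m * ?c) \<in> \<int>"
   by (rule Suc(1)) (use Suc in simp_all)
  moreover have "real Q / (real (Suc m) * real (n choose Suc m)) \<in> \<int>"
   by (rule Suc(1)) (use Suc in simp_all)
  ultimately show ?case by simp
 qed
 then obtain z where z: "real Q / (real m * real (n choose m)) = of_int z" by (elim Ints_cases)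
 have pos: "0 < m * (n choose m)" using m by simp
 then have "real Q = of_int z * real (m * (n choose m))"
  using z by (simp add: field_simps)
 then have "real_of_int (int Q) = real_of_int (z * int (m * (n choose m)))" by simp
 then have "int Q = z * int (m * (n choose m))" by linarith
 then have "int (m * (n choose m)) dvd int Q" by simp
 then show ?thesis by (simp only: int_dvd_int_iff)
qed

text \<open>The least common multiple of 1, ..., N contains each prime in its highest power not
  exceeding N; this makes at most one factor N per prime.\<close>

lemma common_multiple:
 fixes N :: nat
 assumes N: "1 <= N"
 obtains Q where "0 < Q" "!!k. 1 <= k ==> k <= N ==> k dvd Q" "Q <= N ^ card {p. prime p \<and> p <= N}"
proof -
 let ?P = "{p. prime p \<and> p <= N}"
 define f where "f p = (GREATEST k. p ^ k <= N)" for p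
 have fin: "finite ?P" by simp
 have bound: "k <= N" if "prime p" "p ^ k <= N" for p k
 proof -
  have "k < 2 ^ k" by simp
  also have "... <= p ^ k" using that(1) by (intro power_mono prime_ge_2_nat) auto
  finally show ?thesis using that(2) by simp
 qed
 have f: "p ^ f p <= N" if "prime p" for p
  unfolding f_def by (rule GreatestI_nat[of "\<lambda>k. p ^ k <= N" 0 N]) (use bound that N in auto)
 have f_max: "k <= f p" if "prime p" "p ^ k <= N" for p k
  unfolding f_def by (rule Greatest_le_nat[of "\<lambda>k. p ^ k <= N" k N]) (use bound that in auto)
 let ?Q = "\<Prod>p\<in>?P. p ^ f p"
 show ?thesis
 proof (rule that[of ?Q])
  show "0 < ?Q" by (rule prod_pos) (auto simp: prime_gt_0_nat)
  have "?Q <= (\<Prod>p\<in>?P. N)" by (rule prod_mono) (use f in auto)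
  then show "?Q <= N ^ card ?P" by simp
  fix k assume k: "1 <= k" "k <= N"
  have pf: "p \<in> ?P \<and> multiplicity p k <= f p" if "p \<in> prime_factors k" for p
  proof -
   have "p ^ multiplicity p k dvd k" by (rule multiplicity_dvd)
   then have "p ^ multiplicity p k <= k" using k(1) by (intro dvd_imp_le) auto
   then have "p ^ multiplicity p k <= N" using k(2) by linarith
   moreover have "p <= N" "prime p" using that k by (auto dest: dvd_imp_le simp: in_prime_factors_iff)
   ultimately show ?thesis using f_max by simp
  qed
  have "k = (\<Prod>p\<in>prime_factors k. p ^ multiplicity p k)"
   using k by (simp add: prime_factorization_nat)
  also have "... dvd (\<Prod>p\<in>prime_factors k. p ^ f p)"
   by (rule prod_dvd_prod) (use pf in "auto intro: le_imp_power_dvd")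
  also have "... dvd ?Q" by (rule prod_dvd_prod_subset) (use pf in auto)
  finally show "k dvd ?Q" .
 qed
qed

text \<open>A Chebyshev type bound: \<open>n * (2 * n choose n)\<close> divides a common multiple of
  1, ..., 2n, which is small if primes are rare, while central binomial coefficients are at least
  \<open>4 ^ n / (2 * n)\<close>.\<close>

lemma power2_le_prime_power: "0 < n ==> 2 ^ n <= (2 * n) ^ card {p. prime p \<and> p <= 2 * n}"
proof -
 assume n: "0 < n"
 obtain Q where Q: "0 < Q" "!!k. 1 <= k ==> k <= 2 * n ==> k dvd Q" "Q <= (2 * n) ^ card {p. prime p \<and> p <= 2 * n}"
  using common_multiple[of "2 * n"] n by auto
 have "n * (2 * n choose n) dvd Q" by (rule leibniz_dvd[where N = "2 * n"]) (use Q(2) n in auto)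
 then have le: "n * (2 * n choose n) <= Q" using Q(1) by (rule dvd_imp_le)
 have "4 ^ n / (2 * real n) <= real (2 * n choose n)" using n by (rule central_binomial_lower_bound)
 then have "4 ^ n <= 2 * real (n * (2 * n choose n))" using n by (simp add: field_simps)
 then have "real (4 ^ n) <= real (2 * (n * (2 * n choose n)))" by simp
 then have "4 ^ n <= 2 * (n * (2 * n choose n))" by (simp only: of_nat_le_iff)
 moreover have "2 * 2 ^ n <= (4 :: nat) ^ n"
 proof -
  have "(4::nat) ^ n = 2 ^ n * 2 ^ n" by (simp flip: power_mult_distrib)
  moreover have "(2::nat) <= 2 ^ n" using power_increasing[of 1 n "2 :: nat"] n by simp
  ultimately show ?thesis by simp
 qed
 ultimately show ?thesis using le Q(3) by linarith
qed

definition prime_limit :: "nat => nat" where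
 "prime_limit m = 16 * (m + 2) ^ 2 + 1"

text \<open>With \<open>n = 8 * (m + 2) ^ 2\<close> and at most \<open>m\<close> primes up to
  \<open>2 * n\<close> (the prime 2 included), the previous bound would give
  \<open>n <= (2 * m + 8) * m\<close>, which is false. A quadratic limit is generous but sufficient,
  since the search has to be polynomial only.\<close>

lemma many_primes: "m <= card {p. prime p \<and> p ~= 2 \<and> p < prime_limit m}"
proof (rule ccontr)
 let ?n = "8 * (m + 2) ^ 2" and ?P = "{p. prime p \<and> p ~= 2 \<and> p < prime_limit m}"
 assume "\<not> m <= card ?P"
 then have card: "card ?P < m" by simp
 have eq: "{p. prime p \<and> p <= 2 * ?n} \<subseteq> insert 2 ?P"
  by (auto simp: prime_limit_def)
 have fin: "finite ?P" by (rule finite_subset[of _ "{..<prime_limit m}"]) auto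
 have "card {p. prime p \<and> p <= 2 * ?n} <= card (insert 2 ?P)"
  by (rule card_mono) (use eq fin in auto)
 also have "... <= m" using card fin by (simp add: card_insert_if)
 finally have card_le: "card {p. prime p \<and> p <= 2 * ?n} <= m" .
 have "2 ^ ?n <= (2 * ?n) ^ card {p. prime p \<and> p <= 2 * ?n}" by (rule power2_le_prime_power) simp
 also have "... <= (2 * ?n) ^ m" by (rule power_increasing[OF card_le]) simp
 also have "2 * ?n <= 2 ^ (4 + 2 * (m + 2))"
 proof -
  have "m + 2 <= 2 ^ (m + 2)" by (rule less_imp_le[OF less_exp])
  then have "(m + 2) ^ 2 <= (2 ^ (m + 2)) ^ 2" by (rule power_mono) simp
  also have "... = 2 ^ (2 * (m + 2))" by (metis power_mult mult.commute)
  finally show ?thesis by (simp add: power_add)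
 qed
 then have "(2 * ?n) ^ m <= (2 ^ (4 + 2 * (m + 2))) ^ m" by (rule power_mono) simp
 also have "... = 2 ^ ((4 + 2 * (m + 2)) * m)" by (simp only: power_mult)
 finally have "(2::nat) ^ ?n <= 2 ^ ((4 + 2 * (m + 2)) * m)" .
 then have "?n <= (4 + 2 * (m + 2)) * m" by (simp only: power_increasing_iff)
 then show False by (simp add: power2_eq_square algebra_simps)
qed

lemma prod_primes_dvd:
 fixes x :: int
 assumes "finite P" "!!p. p \<in> P ==> prime p \<and> int p dvd x"
 shows "int (\<Prod>P) dvd x"
 using assms
proof (induction P rule: finite_induct)
 case (insert p P)
 have "coprime (int p) (int (\<Prod>P))"
  unfolding coprime_int_iff
  by (rule prod_coprime_right) (use insert in "auto intro: primes_coprime")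
 then show ?case using insert by (simp add: divides_mult)
qed simp

lemma prod_one_plus_le:
 fixes x :: "nat => real"
 assumes "!!i. i < T ==> 0 <= x i" "(\<Sum>i<T. x i) <= 1 / 2"
 shows "(\<Prod>i<T. 1 + x i) <= 1 + 2 * (\<Sum>i<T. x i)"
 using assms
proof (induction T)
 case (Suc T)
 let ?s = "\<Sum>i<T. x i"
 have s: "?s <= 1 / 2" "0 <= x T" using Suc.prems by (auto intro: order_trans[rotated])
 have "(\<Prod>i<Suc T. 1 + x i) <= (1 + 2 * ?s) * (1 + x T)"
  using Suc s by (simp add: mult_right_mono)
 also have "... = 1 + 2 * ?s + x T + 2 * ?s * x T" by (simp add: algebra_simps)
 also have "2 * ?s * x T <= 1 * x T" using s by (intro mult_right_mono) auto
 finally show ?case by simp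
qed simp

text \<open>
 The moduli are grouped such that \<open>E / M\<close> is \<open>2 ^ - T\<close> up to a tiny relative error.  The fractional
 part of \<open>X * E / M\<close>, which the Chinese remainder theorem expresses by the residues, then has the
 binary expansion of \<open>X\<close> as its leading digits.
\<close>

theorem crr_binary:
 fixes P :: "nat set" and grp :: "nat => nat" and y :: "nat => nat" and X T s :: nat
 defines "A \<equiv> \<lambda>g. \<Prod>{p\<in>P. grp p = g}"
 assumes P: "finite P" "!!p. p \<in> P ==> prime p \<and> p ~= 2 \<and> grp p < T"
  and A: "!!g. g < T ==> 8 * T * 2 ^ T <= A g"
  and X: "X < 2 ^ T" and s: "4 * \<Sum>P <= 2 ^ s" "0 < s"
  and y: "!!p. p \<in> P ==> y p < p"
   "!!p. p \<in> P ==> [y p * \<Prod>(P - {p}) * 2 ^ T = X * (\<Prod>g<T. A g + 1)] (mod p)"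
 shows "X = ((\<Sum>p\<in>P. y p * (2 ^ (T + s) div p)) + 2 ^ (s - 1)) mod 2 ^ (T + s) div 2 ^ s"
proof -
 define M where "M = \<Prod>P"
 \<comment> \<open>All \<open>A g\<close> are odd, so the halves are integers and
   \<open>E / M\<close> is \<open>2 ^ - T\<close> times the product of \<open>1 + 1 / A g\<close>;
   the size of the \<open>A g\<close> keeps this product below
   \<open>1 + 1 / (4 * 2 ^ T)\<close>.\<close>
 define E where "E = (\<Prod>g<T. (A g + 1) div 2)"
 have M: "M = (\<Prod>g<T. A g)"
 proof -
  have "grp ` P \<subseteq> {..<T}" using P(2) by blast
  then show ?thesis unfolding M_def A_def using prod.group[of P "{..<T}" grp "\<lambda>p. p"] P(1) by simp
 qed
 have pos: "0 < p" if "p \<in> P" for p using P(2)[OF that] by (simp add: prime_gt_0_nat)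
 have M0: "0 < M" unfolding M_def using pos by (auto intro: prod_pos)
 have A0: "0 < A g" for g unfolding A_def using pos by (auto intro: prod_pos)
 have odd_p: "odd p" if "p \<in> P" for p
  using P(2)[OF that] primes_dvd_imp_eq[of 2 p] two_is_prime_nat by blast
 have odd: "odd (A g)" for g
 proof -
  from odd_p have "\<not> 2 dvd \<Prod>{p\<in>P. grp p = g}"
   using P(1) by (subst prime_dvd_prod_iff) auto
  then show ?thesis by (simp add: A_def)
 qed
 have E: "2 ^ T * E = (\<Prod>g<T. A g + 1)"
 proof -
  have "(\<Prod>g<T. A g + 1) = (\<Prod>g<T. 2 * ((A g + 1) div 2))" using odd by (intro prod.cong) auto
  then show ?thesis by (simp add: E_def prod.distrib)
 qed
 have Mp: "M = p * \<Prod>(P - {p})" if "p \<in> P" for p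
  unfolding M_def using that P(1) by (simp add: prod.remove)
 \<comment> \<open>Modulo each \<open>p\<close> only the summand of \<open>p\<close> survives, and
   the assumption on \<open>y p\<close> matches it with \<open>X * E\<close> after cancelling the
   unit \<open>2 ^ T\<close>.\<close>
 have "int M dvd int (X * E) - (\<Sum>p\<in>P. int (y p * \<Prod>(P - {p})))"
  unfolding M_def
 proof (rule prod_primes_dvd[OF P(1)])
  fix p assume p: "p \<in> P"
  have "int p dvd int (\<Prod>(P - {q}))" if "q \<in> P - {p}" for q
   unfolding int_dvd_int_iff by (rule dvd_prodI) (use P(1) p that in auto)
  then have rest: "int p dvd (\<Sum>q\<in>P - {p}. int (y q * \<Prod>(P - {q})))"
   by (intro dvd_sum) simp
  have "[y p * \<Prod>(P - {p}) * 2 ^ T = X * E * 2 ^ T] (mod p)"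
   using y(2)[OF p] unfolding E[symmetric] by (simp add: ac_simps)
  moreover have "coprime (2 ^ T) p"
   using odd_p[OF p] by simp
  ultimately have "[y p * \<Prod>(P - {p}) = X * E] (mod p)"
   by (simp add: cong_mult_rcancel_nat)
  then have "[int (X * E) = int (y p * \<Prod>(P - {p}))] (mod int p)"
   by (simp only: cong_int_iff cong_sym_eq)
  then have "int p dvd int (X * E) - int (y p * \<Prod>(P - {p}))" by (simp only: cong_iff_dvd_diff)
  then have "int p dvd (int (X * E) - int (y p * \<Prod>(P - {p}))) - (\<Sum>q\<in>P - {p}. int (y q * \<Prod>(P - {q})))"
   using rest by (rule dvd_diff)
  then show "prime p \<and> int p dvd int (X * E) - (\<Sum>p\<in>P. int (y p * \<Prod>(P - {p})))"
   using P p by (simp add: sum.remove algebra_simps)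
 qed
 then obtain v where v: "int (X * E) - (\<Sum>p\<in>P. int (y p * \<Prod>(P - {p}))) = int M * v" by (elim dvdE)
 define R where "R = (\<Sum>p\<in>P. real (y p) / real p)"
 define r where "r = (\<Prod>g<T. 1 + 1 / real (A g))"
 have R: "real X * real E / real M = R + of_int v"
 proof -
  have "int (X * E) = int M * v + (\<Sum>p\<in>P. int (y p * \<Prod>(P - {p})))"
   unfolding v[symmetric] by simp
  then have "real_of_int (int (X * E)) = real_of_int (int M * v + (\<Sum>p\<in>P. int (y p * \<Prod>(P - {p}))))"
   by (rule arg_cong)
  then have "real X * real E = real M * of_int v + (\<Sum>p\<in>P. real (y p) * real (\<Prod>(P - {p})))"
   by (simp only: of_int_add of_int_mult of_int_of_nat_eq of_int_sum of_nat_mult)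
  also have "(\<Sum>p\<in>P. real (y p) * real (\<Prod>(P - {p}))) = real M * R"
   unfolding R_def sum_distrib_left by (intro sum.cong refl) (use Mp pos in "simp add: field_simps")
  finally show ?thesis using M0 by (simp add: field_simps)
 qed
 have E_M: "2 ^ T * real E / real M = r"
 proof -
  have "2 ^ T * real E = real (2 ^ T * E)" by simp
  also have "... = (\<Prod>g<T. real (A g) + 1)" unfolding E by (simp add: add.commute)
  finally have "2 ^ T * real E / real M = (\<Prod>g<T. real (A g) + 1) / (\<Prod>g<T. real (A g))" by (simp add: M)
  also have "... = r"
   unfolding r_def prod_dividef[symmetric] using A0 by (intro prod.cong refl) (simp add: field_simps)
  finally show ?thesis .
 qed
 have sum_le: "(\<Sum>g<T. 1 / real (A g)) <= 1 / (8 * 2 ^ T)"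
 proof -
  have "(\<Sum>g<T. 1 / real (A g)) <= (\<Sum>g<T. 1 / (8 * real T * 2 ^ T))"
  proof (rule sum_mono)
   fix g assume "g \<in> {..<T}"
   then have "0 < T" "real (8 * T * 2 ^ T) <= real (A g)" using A by (auto simp only: of_nat_le_iff lessThan_iff)
   then show "1 / real (A g) <= 1 / (8 * real T * 2 ^ T)" by (intro divide_left_mono) (auto simp: A0)
  qed
  also have "... <= 1 / (8 * 2 ^ T)" by (cases "T = 0") auto
  finally show ?thesis .
 qed
 have "1 <= r" unfolding r_def by (rule prod_ge_1) auto
 moreover have "r <= 1 + 1 / (4 * 2 ^ T)"
 proof -
  have "1 / (8 * 2 ^ T) <= 1 / (8 * (1 :: real))"
   by (intro divide_left_mono mult_left_mono one_le_power) simp_all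
  then have "1 / (8 * 2 ^ T) <= (1 / 2 :: real)" by linarith
  then have "r <= 1 + 2 * (\<Sum>g<T. 1 / real (A g))"
   unfolding r_def by (intro prod_one_plus_le order_trans[OF sum_le]) auto
  then show ?thesis using sum_le by simp
 qed
 ultimately have X\<rho>: "real X <= real X * r" "real X * r <= real X + 1 / 4"
 proof -
  assume r: "1 <= r" "r <= 1 + 1 / (4 * 2 ^ T)"
  show "real X <= real X * r" using mult_left_mono[OF r(1), of "real X"] by simp
  have "real X * r <= real X * (1 + 1 / (4 * 2 ^ T))" using r(2) by (rule mult_left_mono) simp
  also have "... = real X + real X / 2 ^ T / 4" by (simp add: field_simps)
  also have "real X / 2 ^ T <= 1" using of_nat_mono[OF less_imp_le[OF X], where 'a = real] by simp
  finally show "real X * r <= real X + 1 / 4" by simp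
 qed
 \<comment> \<open>A fixed-point version of \<open>R\<close>. Each rounding loses at most
   \<open>y p < p\<close>, in total at most a quarter of \<open>2 ^ s\<close>.\<close>
 define F where "F = (\<Sum>p\<in>P. y p * (2 ^ (T + s) div p))"
 have scaled: "2 ^ (T + s) * (R + of_int v) = 2 ^ s * (real X * r)"
  unfolding R[symmetric] E_M[symmetric] by (simp add: power_add)
 have F_le: "real F <= 2 ^ (T + s) * R"
  unfolding F_def R_def sum_distrib_left of_nat_sum
 proof (rule sum_mono)
  fix p assume "p \<in> P"
  have "real (2 ^ (T + s) div p) <= real (2 ^ (T + s)) / real p" by (rule of_nat_div_le_of_nat)
  then have "real (y p) * real (2 ^ (T + s) div p) <= real (y p) * (real (2 ^ (T + s)) / real p)" by (rule mult_left_mono) simp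
  then show "real (y p * (2 ^ (T + s) div p)) <= 2 ^ (T + s) * (real (y p) / real p)" by (simp add: mult.commute)
 qed
 have F_ge: "2 ^ (T + s) * R - 2 ^ s / 4 <= real F"
 proof -
  have "2 ^ (T + s) * R - real F <= (\<Sum>p\<in>P. real p)"
   unfolding F_def R_def sum_distrib_left of_nat_sum sum_subtractf[symmetric]
  proof (rule sum_mono)
   fix p assume p: "p \<in> P"
   have "real (2 ^ (T + s)) / real p - real (2 ^ (T + s) div p) <= 1"
    using real_of_int_div3[of "int (2 ^ (T + s))" "int p"] by (simp only: of_int_of_nat_eq flip: of_nat_div)
   then have "real (y p) * (real (2 ^ (T + s)) / real p - real (2 ^ (T + s) div p)) <= real (y p) * 1" by (rule mult_left_mono) simp
   then show "2 ^ (T + s) * (real (y p) / real p) - real (y p * (2 ^ (T + s) div p)) <= real p"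
    using y(1)[OF p] by (simp add: algebra_simps)
  qed
  also have "... <= 2 ^ s / 4" using of_nat_mono[OF s(1), where 'a = real] by simp
  finally show ?thesis by simp
 qed
 \<comment> \<open>The relative error of \<open>E / M\<close> pushes up by at most a quarter of
   \<open>2 ^ s\<close> and rounding pushes down by at most a quarter. The added half keeps
   \<open>w\<close> inside one interval of length \<open>2 ^ s\<close>, so truncation returns
   \<open>X\<close>; the integer part \<open>v\<close> disappears modulo
   \<open>2 ^ (T + s)\<close>.\<close>
 define w where "w = int F + 2 ^ (s - 1) + 2 ^ (T + s) * v - 2 ^ s * int X"
 have half: "2 * 2 ^ (s - 1) = (2 ^ s :: real)" using s(2) by (cases s) auto
 have w: "real_of_int w = real F + 2 ^ (s - 1) + 2 ^ (T + s) * of_int v - 2 ^ s * real X" by (simp add: w_def)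
 have bounds: "2 ^ s * real X <= 2 ^ s * (real X * r)" "2 ^ s * (real X * r) <= 2 ^ s * (real X + 1 / 4)"
  using X\<rho> by (auto intro: mult_left_mono)
 have pow_pos: "0 < (2 :: real) ^ s" by simp
 have "0 <= real_of_int w" "real_of_int w < 2 ^ s"
  using w half bounds F_le F_ge scaled pow_pos unfolding distrib_left by linarith+
 then have w01: "0 <= w" "w < 2 ^ s" by simp_all
 have eq: "int F + 2 ^ (s - 1) = (2 ^ s * int X + w) + 2 ^ (T + s) * (- v)" by (simp add: w_def)
 have less: "2 ^ s * int X + w < 2 ^ (T + s)"
 proof -
  have "int X + 1 <= 2 ^ T" using X by (metis add.commute of_nat_Suc of_nat_less_iff of_nat_numeral of_nat_power zless_imp_add1_zle add_left_mono)
  then have "2 ^ s * (int X + 1) <= 2 ^ s * 2 ^ T" by (rule mult_left_mono) simp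
  then show ?thesis using w01 by (simp add: power_add algebra_simps)
 qed
 have "int ((F + 2 ^ (s - 1)) mod 2 ^ (T + s) div 2 ^ s) = (int F + 2 ^ (s - 1)) mod 2 ^ (T + s) div 2 ^ s"
  by (simp add: of_nat_div of_nat_mod)
 also have "... = (2 ^ s * int X + w) div 2 ^ s"
  unfolding eq using less w01 by (simp del: mult_minus_right)
 also have "... = int X" using w01 by simp
 finally show ?thesis by (simp add: F_def)
qed

section \<open>Iterated products\<close>

text \<open>The disjunct \<open>a E <= x\<close> makes the search terminate at \<open>a E\<close> in
  any case, so the function is total whether or not a witness exists.\<close>

lemma lsf_Least_upto:
 assumes "lsf a" "lsp (\<lambda>E. P (E 0) (\<lambda>k. E (Suc k)))"
 shows "lsf (\<lambda>E. LEAST x. a E <= x \<or> P x E)"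
 by (rule lsf_Least[of "\<lambda>x E. a E <= x \<or> P x E", OF _ assms(1)]) (auto intro!: lsf_intros lsf_weaken[OF assms(1)] assms(2))

lemma Least_upto:
 fixes p :: nat
 assumes "z < p" "P z"
 shows "P (LEAST x. p <= x \<or> P x)" "(LEAST x. p <= x \<or> P x) < p"
proof -
 have "(LEAST x. p <= x \<or> P x) <= z" by (rule Least_le) (use assms in simp)
 then show "(LEAST x. p <= x \<or> P x) < p" using assms by simp
 then show "P (LEAST x. p <= x \<or> P x)" using LeastI[of "\<lambda>x. p <= x \<or> P x" z] assms by auto
qed

lemma lsp_prime [lsf_intros]:
 assumes "lsf p"
 shows "lsp (\<lambda>E. prime (p E))"
proof -
 have "prime p \<longleftrightarrow> 1 < p \<and> (\<forall>d<p. d dvd p --> d = 1)" for p :: nat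
 proof
  assume p: "1 < p \<and> (\<forall>d<p. d dvd p --> d = 1)"
  show "prime p"
   unfolding prime_nat_iff
  proof (intro conjI allI impI)
   fix d assume "d dvd p"
   then have "d <= p" using p by (intro dvd_imp_le) auto
   then show "d = 1 \<or> d = p" using p \<open>d dvd p\<close> by (cases "d < p") auto
  qed (use p in simp)
 qed (auto simp: prime_nat_iff)
 then show ?thesis by (simp only:) (intro lsf_intros assms lsf_weaken[OF assms])
qed

text \<open>A primitive root, found by exhaustive search. \<open>Suc (p - 1)\<close> is
  \<open>p\<close> for every prime and positive for every argument, as the closure rules for modular
  operations demand.\<close>

definition generator :: "nat => nat" where
 "generator p = (LEAST x. p <= x \<or> (\<forall>r<p. 0 < r --> (\<exists>k<p. x ^ k mod Suc (p - 1) = r)))"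

definition dlog :: "nat => nat => nat" where
 "dlog p r = (LEAST k. p <= k \<or> generator p ^ k mod Suc (p - 1) = r)"

lemma lsf_generator [lsf_intros]:
 assumes "lsf p"
 shows "lsf (\<lambda>E. generator (p E))"
 unfolding generator_def
 by (intro lsf_Least_upto lsf_power_mod lsf_intros assms lsf_env[OF assms]) simp

lemma lsf_dlog [lsf_intros]:
 assumes "lsf p" "lsf r"
 shows "lsf (\<lambda>E. dlog (p E) (r E))"
 unfolding dlog_def
 by (intro lsf_Least_upto lsf_power_mod lsf_intros assms lsf_env[OF assms(1)] lsf_env[OF assms(2)]) simp

lemma generator_dlog:
 assumes p: "prime p" and r: "0 < r" "r < p"
 shows "generator p ^ dlog p r mod p = r"
proof -
 have p1: "1 < p" "Suc (p - 1) = p" using prime_gt_1_nat[OF p] by auto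
 obtain g where "residue_primroot p g" using prime_primitive_root_exists[of p] p p1 by auto
 then have bij: "bij_betw (\<lambda>i. g ^ i mod p) {..<p - 1} {0<..<p}"
  using residue_primroot_is_generator[OF p1(1)] p by (simp add: totatives_prime totient_prime)
 let ?P = "\<lambda>x. \<forall>r<p. 0 < r --> (\<exists>k<p. x ^ k mod Suc (p - 1) = r)"
 have "?P (g mod p)"
 proof (intro allI impI)
  fix r assume "r < p" "0 < r"
  then have "r \<in> (\<lambda>i. g ^ i mod p) ` {..<p - 1}" using bij by (simp add: bij_betw_def)
  then obtain k where "k < p - 1" "g ^ k mod p = r" by auto
  then show "\<exists>k<p. (g mod p) ^ k mod Suc (p - 1) = r"
   using p1 by (intro exI[of _ k]) (simp add: power_mod)
 qed
 then have "?P (generator p)"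
  unfolding generator_def by (rule Least_upto(1)[of "g mod p" p ?P, rotated]) (use p1 in simp)
 then obtain k where k: "k < p" "generator p ^ k mod Suc (p - 1) = r" using r by blast
 show ?thesis
  using Least_upto(1)[of k p "\<lambda>k. generator p ^ k mod Suc (p - 1) = r", OF k] unfolding dlog_def p1(2) .
qed

text \<open>Discrete logarithms turn the product into a sum; a factor divisible by \<open>p\<close>
  has no logarithm and is treated separately.\<close>

definition prod_mod :: "nat => nat => (nat => nat) => nat" where
 "prod_mod p w g = (if \<exists>i<w. g i mod Suc (p - 1) = 0 then 0
   else generator p ^ (\<Sum>i<w. dlog p (g i mod Suc (p - 1))) mod Suc (p - 1))"

lemma prod_mod:
 assumes p: "prime p"
 shows "prod_mod p w g = (\<Prod>i<w. g i) mod p"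
proof -
 have p1: "1 < p" "Suc (p - 1) = p" using prime_gt_1_nat[OF p] by auto
 show ?thesis
 proof (cases "\<exists>i<w. g i mod p = 0")
  case True
  then have "p dvd (\<Prod>i<w. g i)" by (metis dvd_eq_mod_eq_0 dvd_prodI dvd_trans finite_lessThan lessThan_iff)
  then show ?thesis using True unfolding prod_mod_def p1(2) by simp
 next
  case False
  have "generator p ^ (\<Sum>i<w. dlog p (g i mod p)) mod p = (\<Prod>i<w. generator p ^ dlog p (g i mod p) mod p) mod p"
   by (simp add: power_sum mod_prod_eq)
  also have "... = (\<Prod>i<w. g i mod p) mod p"
   using False p1(1) by (intro arg_cong[where f = "\<lambda>x. x mod p"] prod.cong refl generator_dlog p) auto
  finally show ?thesis unfolding prod_mod_def p1(2) if_not_P[OF False] by (simp add: mod_prod_eq)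
 qed
qed

text \<open>Only the sum of the logarithms is a genuine sum over input data. Logarithm and power are
  log-space functions of one small value and so cost one level each.\<close>

lemma tcn_prod_mod:
 assumes p: "lsf p" and w: "lsf w" and g: "tcb (\<lambda>E. g (E 0) (\<lambda>k. E (Suc k)))"
 shows "tcn (\<lambda>E X. prod_mod (p E) (w E) (\<lambda>i. g i E X))"
proof -
 have g_mod: "tcn (\<lambda>E X. g (E 0) (\<lambda>k. E (Suc k)) X mod Suc (p (\<lambda>k. E (Suc k)) - 1))"
  by (intro tcn_intros g lsf_intros lsf_weaken[OF p]) simp
 have dlog: "tcn (\<lambda>E X. dlog (p (\<lambda>k. E (Suc k))) (g (E 0) (\<lambda>k. E (Suc k)) X mod Suc (p (\<lambda>k. E (Suc k)) - 1)))"
  by (rule tcn_app1[where f = "\<lambda>r E. dlog (p (\<lambda>k. E (Suc k))) r", OF _ g_mod]) (intro lsf_intros lsf_env[OF p])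
 have "tcn (\<lambda>E X. \<Sum>i<w E. dlog (p E) (g i E X mod Suc (p E - 1)))"
  by (intro tcn_intros w dlog)
 then have pow: "tcn (\<lambda>E X. generator (p E) ^ (\<Sum>i<w E. dlog (p E) (g i E X mod Suc (p E - 1))) mod Suc (p E - 1))"
  by (rule tcn_app1[where f = "\<lambda>e E. generator (p E) ^ e mod Suc (p E - 1)", rotated])
   (intro lsf_power_mod lsf_intros lsf_weaken[OF p], simp)
 show ?thesis unfolding prod_mod_def by (intro tcn_intros tcn_lsf lsf_const w g_mod pow)
qed


section \<open>Choice of the moduli\<close>

definition odd_prime :: "nat => bool" where
 "odd_prime p \<longleftrightarrow> prime p \<and> p ~= 2"

definition prime_rank :: "nat => nat" where
 "prime_rank p = (\<Sum>q<p. of_bool (odd_prime q))"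

text \<open>The smallest \<open>T * (2 * T + 3)\<close> odd primes, to be cut by rank into
  \<open>T\<close> groups of \<open>2 * T + 3\<close>. The product of a group is at least
  \<open>2 ^ (2 * T + 3) = 8 * 2 ^ T * 2 ^ T\<close>, which exceeds the required
  \<open>8 * T * 2 ^ T\<close>.\<close>

definition moduli :: "nat => nat set" where
 "moduli T = {p. odd_prime p \<and> prime_rank p < T * (2 * T + 3)}"

definition modulus_group :: "nat => nat => nat" where
 "modulus_group T p = prime_rank p div (2 * T + 3)"

definition moduli_limit :: "nat => nat" where
 "moduli_limit T = prime_limit (T * (2 * T + 3))"

lemma lsp_odd_prime [lsf_intros]: "lsf p ==> lsp (\<lambda>E. odd_prime (p E))"
 unfolding odd_prime_def by (intro lsf_intros)

lemma lsf_prime_rank [lsf_intros]: "lsf p ==> lsf (\<lambda>E. prime_rank (p E))"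
 unfolding prime_rank_def by (intro lsf_intros)

lemma lsp_moduli [lsf_intros]: "lsf T ==> lsf p ==> lsp (\<lambda>E. p E \<in> moduli (T E))"
 unfolding moduli_def mem_Collect_eq by (intro lsf_intros)

lemma lsf_modulus_group [lsf_intros]: "lsf T ==> lsf p ==> lsf (\<lambda>E. modulus_group (T E) (p E))"
 unfolding modulus_group_def by (intro lsf_intros)

lemma lsf_moduli_limit [lsf_intros]: "lsf T ==> lsf (\<lambda>E. moduli_limit (T E))"
 unfolding moduli_limit_def prime_limit_def power2_eq_square by (intro lsf_intros)

lemma prime_rank_card: "prime_rank p = card {q. odd_prime q \<and> q < p}"
proof -
 have "{..<p} \<inter> {q. odd_prime q} = {q. odd_prime q \<and> q < p}" by auto
 then show ?thesis by (simp add: prime_rank_def)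
qed

lemma prime_rank_less: "odd_prime p ==> p < q ==> prime_rank p < prime_rank q"
 unfolding prime_rank_card by (rule psubset_card_mono) auto

lemma many_odd_primes: "m <= card {p. odd_prime p \<and> p < prime_limit m}"
 using many_primes[of m] by (simp add: odd_prime_def conj_assoc)

text \<open>Ranks are strictly increasing on the odd primes below the limit and less than their
  number, so by counting they take every value below it.\<close>

lemma prime_rank_surj:
 assumes "r < m"
 shows "\<exists>p. odd_prime p \<and> p < prime_limit m \<and> prime_rank p = r"
proof -
 let ?O = "{p. odd_prime p \<and> p < prime_limit m}"
 have fin: "finite ?O" by (rule finite_subset[of _ "{..<prime_limit m}"]) auto
 have inj: "inj_on prime_rank ?O"
  by (intro inj_onI) (metis (mono_tags, lifting) less_irrefl linorder_neqE_nat mem_Collect_eq prime_rank_less)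
 have "prime_rank ` ?O \<subseteq> {..<card ?O}"
 proof safe
  fix p assume "odd_prime p" "p < prime_limit m"
  then have "prime_rank p < prime_rank (prime_limit m)" by (rule prime_rank_less)
  then show "prime_rank p < card ?O" by (simp add: prime_rank_card)
 qed
 then have "prime_rank ` ?O = {..<card ?O}"
  by (rule card_subset_eq[rotated]) (simp_all add: card_image[OF inj])
 then have "r \<in> prime_rank ` ?O" using assms many_odd_primes[of m] by auto
 then show ?thesis by auto
qed

lemma moduli_less: "p \<in> moduli T ==> p < moduli_limit T"
proof (rule ccontr)
 assume p: "p \<in> moduli T" "\<not> p < moduli_limit T"
 have "T * (2 * T + 3) <= card {q. odd_prime q \<and> q < moduli_limit T}"
  unfolding moduli_limit_def by (rule many_odd_primes)
 also have "... <= prime_rank p"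
  unfolding prime_rank_card by (rule card_mono) (use p(2) in auto)
 finally show False using p(1) by (simp add: moduli_def)
qed

lemma finite_moduli: "finite (moduli T)"
 by (rule finite_subset[of _ "{..<moduli_limit T}"]) (use moduli_less in auto)

lemma modulus_group_less: "p \<in> moduli T ==> modulus_group T p < T"
 by (simp add: moduli_def modulus_group_def div_less_iff_less_mult)

lemma group_prod_ge:
 assumes "g < T"
 shows "8 * T * 2 ^ T <= \<Prod>{p\<in>moduli T. modulus_group T p = g}"
proof -
 let ?K = "2 * T + 3" and ?S = "{p\<in>moduli T. modulus_group T p = g}"
 have fin: "finite ?S" using finite_moduli by simp
 have "{g * ?K..<g * ?K + ?K} \<subseteq> prime_rank ` ?S"
 proof
  fix r assume r: "r \<in> {g * ?K..<g * ?K + ?K}"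
  have "Suc g * ?K <= T * ?K" using assms by (intro mult_le_mono1) simp
  then have rT: "r < T * ?K" using r by simp
  then obtain p where "odd_prime p" "prime_rank p = r" using prime_rank_surj by blast
  moreover have "r div ?K = g" using r div_mod_block[of g ?K r] by simp
  ultimately show "r \<in> prime_rank ` ?S" using rT by (auto simp: moduli_def modulus_group_def)
 qed
 then have "card {g * ?K..<g * ?K + ?K} <= card (prime_rank ` ?S)" by (rule card_mono[OF finite_imageI[OF fin]])
 also have "... <= card ?S" using fin by (rule card_image_le)
 finally have card: "?K <= card ?S" by simp
 have "8 * T * 2 ^ T <= 8 * 2 ^ T * 2 ^ T" by (simp add: less_imp_le)
 also have "... = 2 ^ ?K"
 proof -
  have "?K = 3 + (T + T)" by simp
  then show ?thesis by (simp only: power_add) simp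
 qed
 also have "... <= 2 ^ card ?S" using card by (intro power_increasing) auto
 also have "... = (\<Prod>p\<in>?S. 2)" by simp
 also have "... <= \<Prod>?S" by (rule prod_mono) (auto simp: moduli_def odd_prime_def prime_ge_2_nat)
 finally show ?thesis .
qed

definition rest_mod :: "nat => nat => nat" where
 "rest_mod T p = (\<Prod>q<moduli_limit T. if q \<in> moduli T \<and> q ~= p then q else 1) mod Suc (p - 1)"

definition group_mod :: "nat => nat => nat => nat" where
 "group_mod T p g = (\<Prod>q<moduli_limit T. if q \<in> moduli T \<and> modulus_group T q = g then q else 1) mod Suc (p - 1)"

text \<open>The quotient of the product of all \<open>A g + 1\<close> by \<open>2 ^ T\<close> and
  the other moduli, modulo \<open>p\<close>. It depends on \<open>T\<close> and \<open>p\<close>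
  only and is a constant for the circuit, which has to multiply it by the residue of the represented
  number.\<close>

definition crr_factor :: "nat => nat => nat" where
 "crr_factor T p = (LEAST z. p <= z \<or>
   z * rest_mod T p * (2 ^ T mod Suc (p - 1)) mod Suc (p - 1) = (\<Prod>g<T. group_mod T p g + 1) mod Suc (p - 1))"

lemma lsf_crr_factor [lsf_intros]:
 assumes "lsf T" "lsf p"
 shows "lsf (\<lambda>E. crr_factor (T E) (p E))"
proof -
 have rest: "lsf (\<lambda>E. rest_mod (t E) (q E))" if "lsf t" "lsf q" for t q
  unfolding rest_mod_def by (intro lsf_intros lsf_prod_mod that lsf_weaken[OF that(1)] lsf_weaken[OF that(2)]) simp
 have grp: "lsf (\<lambda>E. group_mod (t E) (q E) (h E))" if "lsf t" "lsf q" "lsf h" for t q h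
  unfolding group_mod_def
  by (intro lsf_intros lsf_prod_mod that lsf_weaken[OF that(1)] lsf_weaken[OF that(2)] lsf_weaken[OF that(3)]) simp
 show ?thesis
  unfolding crr_factor_def
  by (intro lsf_Least_upto rest grp lsf_power_mod lsf_prod_mod lsf_intros assms lsf_weaken[OF assms(1)] lsf_weaken[OF assms(2)]
    lsf_env[OF assms(1)] lsf_env[OF assms(2)]) simp_all
qed

lemma prod_restrict:
 fixes S :: "nat set"
 assumes "S \<subseteq> {..<B}"
 shows "(\<Prod>q<B. if q \<in> S then q else 1) = \<Prod>S"
 using assms by (intro prod.mono_neutral_cong_right) auto

lemma crr_factor:
 assumes p: "p \<in> moduli T"
 shows "[crr_factor T p * \<Prod>(moduli T - {p}) * 2 ^ T = (\<Prod>g<T. \<Prod>{q\<in>moduli T. modulus_group T q = g} + 1)] (mod p)"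
proof -
 have pp: "prime p" "p ~= 2" using p by (auto simp: moduli_def odd_prime_def)
 then have p0: "0 < p" "Suc (p - 1) = p" by (auto simp: prime_gt_0_nat)
 have sub: "moduli T - {p} \<subseteq> {..<moduli_limit T}" "{q\<in>moduli T. modulus_group T q = g} \<subseteq> {..<moduli_limit T}" for g
  using moduli_less by auto
 have rest: "rest_mod T p = \<Prod>(moduli T - {p}) mod p"
  unfolding rest_mod_def p0(2) prod_restrict[OF sub(1), symmetric] by simp
 have grp: "group_mod T p g = \<Prod>{q\<in>moduli T. modulus_group T q = g} mod p" for g
  unfolding group_mod_def p0(2) prod_restrict[OF sub(2), symmetric] by simp
 let ?c = "\<Prod>(moduli T - {p}) * 2 ^ T" and ?e = "\<Prod>g<T. \<Prod>{q\<in>moduli T. modulus_group T q = g} + 1"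
 have "coprime 2 p" using pp primes_coprime two_is_prime_nat by metis
 moreover have "coprime (\<Prod>(moduli T - {p})) p"
  by (rule prod_coprime_left) (use pp in "auto simp: moduli_def odd_prime_def intro!: primes_coprime")
 ultimately have "coprime ?c p" by simp
 then obtain x where "[?c * x = Suc 0] (mod p)" using cong_solve_coprime_nat by blast
 then have x: "[?c * x = 1] (mod p)" by simp
 have lhs: "z * rest_mod T p * (2 ^ T mod Suc (p - 1)) mod Suc (p - 1) = z * ?c mod p" for z
  unfolding rest p0(2) by (metis mod_mult_left_eq mod_mult_right_eq mult.assoc)
 have rhs: "(\<Prod>g<T. group_mod T p g + 1) mod Suc (p - 1) = ?e mod p"
  unfolding grp p0(2) by (subst (1 2) mod_prod_eq[symmetric]) (simp add: mod_Suc_eq)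
 have "(x * ?e mod p) * ?c mod p = ?e mod p"
 proof -
  have "(x * ?e mod p) * ?c mod p = (?c * x mod p) * ?e mod p"
   by (simp only: mod_mult_left_eq) (simp only: ac_simps)
  also have "... = ?e mod p" using x unfolding cong_def by (simp add: mod_mult_left_eq)
  finally show ?thesis .
 qed
 then have "crr_factor T p * ?c mod p = ?e mod p"
  using Least_upto(1)[of "x * ?e mod p" p "\<lambda>z. z * ?c mod p = ?e mod p"] p0
  unfolding crr_factor_def lhs rhs by simp
 then show ?thesis unfolding cong_def by (simp add: mult.assoc)
qed

text \<open>Digit \<open>i\<close> of the quotient is the parity of
  \<open>2 ^ (t - i) div p\<close>, and this parity can be read off the small number
  \<open>2 ^ (t - i) mod (2 * p)\<close>.\<close>

lemma tcb_power_div: "lsf t ==> lsf p ==> (!!E. 0 < p E) ==> tcb (\<lambda>E X. 2 ^ t E div p E)"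
proof (rule tcb_bitwise)
 assume t: "lsf t" and p: "lsf p" and p0: "!!E. 0 < p E"
 show "lsf (\<lambda>E. Suc (t E))" by (intro lsf_intros t)
 show "2 ^ t E div p E < 2 ^ Suc (t E)" for E
  by (rule order_le_less_trans[OF div_le_dividend]) simp
 show "bit (2 ^ t E div p E) i \<longleftrightarrow> i <= t E \<and> 2 ^ (t E - i) mod (2 * p E) div p E = 1" for E i
 proof (cases "i <= t E")
  case True
  let ?x = "2 ^ (t E - i) :: nat"
  have "2 ^ t E div p E div 2 ^ i = ?x div p E"
   using True by (metis div_mult2_eq mult.commute power_diff_power_eq nat_neq_iff pos2 power_diff zero_neq_numeral)
  then have "bit (2 ^ t E div p E) i \<longleftrightarrow> odd (?x div p E)" by (simp add: bit_iff_odd)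
  also have "?x mod (2 * p E) div p E = ?x div p E mod 2"
   using p0[of E] by (simp add: mod_mult2_eq mult.commute[of 2])
  then have "odd (?x div p E) \<longleftrightarrow> ?x mod (2 * p E) div p E = 1" by (simp add: odd_iff_mod_2_eq_one)
  finally show ?thesis using True by simp
 next
  case False
  have "2 ^ t E div p E < 2 ^ i"
   by (rule order_le_less_trans[OF div_le_dividend]) (use False in simp)
  then show ?thesis using False by (auto simp: less_exp_bits)
 qed
 show "tcp (\<lambda>E X. E 0 <= t (\<lambda>k. E (Suc k)) \<and> 2 ^ (t (\<lambda>k. E (Suc k)) - E 0) mod (2 * p (\<lambda>k. E (Suc k))) div p (\<lambda>k. E (Suc k)) = 1)"
  by (intro tcp_lsp lsf_power_mod lsf_intros lsf_weaken[OF t] lsf_weaken[OF p]) (simp add: p0)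
qed

text \<open>Passing from residues to binary digits. Each residue is multiplied by its constant
  factor modulo \<open>p\<close>; what remains is one sum of shifted or scaled constants, hence an
  iterated addition.\<close>

theorem tcb_residues:
 assumes T: "lsf T" "!!E X. F E X < 2 ^ T E"
  and r: "tcn (\<lambda>E. r (E 0) (\<lambda>k. E (Suc k)))" "!!p E X. prime p ==> r p E X = F E X mod p"
 shows "tcb F"
proof -
 \<comment> \<open>The moduli sum to at most the square of their limit, which is below two to that
   square; the summand 2 supplies the required factor 4.\<close>
 define s where "s E = moduli_limit (T E) * moduli_limit (T E) + 2" for E
 define y where "y p E X = r p E X * crr_factor (T E) p mod Suc (p - 1)" for p E X
 let ?G = "\<lambda>E X. \<Sum>p<moduli_limit (T E). if p \<in> moduli (T E) then y p E X * (2 ^ (T E + s E) div Suc (p - 1)) else 0"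
 have s: "lsf s" unfolding s_def[abs_def] by (intro lsf_intros T)
 have eq: "F E X = drop_bit (s E) (take_bit (T E + s E) (?G E X + push_bit (s E - 1) 1))" for E X
 proof -
  let ?T = "T E" and ?s = "s E" and ?P = "moduli (T E)" and ?B = "moduli_limit (T E)"
  have P: "prime p \<and> p ~= 2 \<and> modulus_group ?T p < ?T" "0 < p" "Suc (p - 1) = p" if "p \<in> ?P" for p
   using that modulus_group_less[OF that] by (auto simp: moduli_def odd_prime_def prime_gt_0_nat)
  have "F E X = ((\<Sum>p\<in>?P. y p E X * (2 ^ (?T + ?s) div p)) + 2 ^ (?s - 1)) mod 2 ^ (?T + ?s) div 2 ^ ?s"
  proof (rule crr_binary[of ?P "modulus_group ?T", OF finite_moduli _ group_prod_ge T(2)])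
   show "prime p \<and> p ~= 2 \<and> modulus_group ?T p < ?T" if "p \<in> ?P" for p using P(1)[OF that] .
   have "\<Sum>?P <= (\<Sum>p\<in>?P. ?B)" by (rule sum_mono) (use moduli_less in "simp add: less_imp_le")
   also have "... = card ?P * ?B" by simp
   also have "card ?P <= card {..<?B}" by (rule card_mono) (use moduli_less in auto)
   then have "card ?P * ?B <= ?B * ?B" by simp
   also have "?B * ?B <= 2 ^ (?B * ?B)" by (rule less_imp_le[OF less_exp])
   finally show "4 * \<Sum>?P <= 2 ^ ?s" by (simp add: s_def)
   show "0 < ?s" by (simp add: s_def)
   fix p assume p: "p \<in> ?P"
   show "y p E X < p" using P(2,3)[OF p] by (simp add: y_def)
   have "[y p E X = F E X * crr_factor ?T p] (mod p)"
    using P[OF p] by (simp add: y_def r(2) cong_def mod_mult_left_eq)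
   then have "[y p E X * (\<Prod>(?P - {p}) * 2 ^ ?T) = F E X * crr_factor ?T p * (\<Prod>(?P - {p}) * 2 ^ ?T)] (mod p)"
    by (rule cong_scalar_right)
   also have "F E X * crr_factor ?T p * (\<Prod>(?P - {p}) * 2 ^ ?T) = F E X * (crr_factor ?T p * \<Prod>(?P - {p}) * 2 ^ ?T)"
    by (simp add: mult.assoc)
   also have "[... = F E X * (\<Prod>g<?T. \<Prod>{q\<in>?P. modulus_group ?T q = g} + 1)] (mod p)"
    by (rule cong_scalar_left[OF crr_factor[OF p]])
   finally show "[y p E X * \<Prod>(?P - {p}) * 2 ^ ?T = F E X * (\<Prod>g<?T. \<Prod>{q\<in>?P. modulus_group ?T q = g} + 1)] (mod p)"
    by (simp add: mult.assoc)
  qed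
  moreover have "(\<Sum>p\<in>?P. y p E X * (2 ^ (?T + ?s) div p)) = ?G E X"
   by (rule sum.mono_neutral_cong_left) (use moduli_less P(3) in auto)
  ultimately show ?thesis by (simp add: drop_bit_eq_div take_bit_eq_mod push_bit_eq_mult)
 qed
 have "tcb (\<lambda>E X. drop_bit (s E) (take_bit (T E + s E) (?G E X + push_bit (s E - 1) 1)))"
  unfolding y_def
  by (intro tcb_intros tcn_intros tcp_lsp tcb_tcn[of "\<lambda>_ _. 1"] tcb_tcn[of "\<lambda>_ _. 0"] tcb_power_div tcb_tcn[OF tcn_ops(4)]
    tcn_lsf lsf_intros s T(1) r(1) lsf_weaken[OF T(1)] lsf_weaken[OF s]) simp
 then show ?thesis unfolding eq[symmetric] .
qed

theorem tcb_prod [tcb_intros]: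
 assumes w: "lsf w" and g: "tcb (\<lambda>E. g (E 0) (\<lambda>k. E (Suc k)))"
 shows "tcb (\<lambda>E X. \<Prod>i<w E. g i E X)"
proof -
 obtain v where v: "lsf v" "!!E X. g (E 0) (\<lambda>k. E (Suc k)) X < 2 ^ v E" using tcb_bound[OF g] by blast
 have g': "tcb (\<lambda>E. g (E 0) (\<lambda>k. E (Suc (Suc k))))"
  using tcb_env[OF g, of "\<lambda>E. push (E 0) (\<lambda>k. E (Suc (Suc k)))", OF lsf_push_env[OF lsf_var lsf_var]] by simp
 show ?thesis
 proof (rule tcb_residues[where r = "\<lambda>p E X. prod_mod p (w E) (\<lambda>i. g i E X)"])
  show "lsf (\<lambda>E. Suc (\<Sum>i<w E. v (push i E)))" by (intro lsf_intros w lsf_env[OF v(1)] lsf_push_env)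
  show "(\<Prod>i<w E. g i E X) < 2 ^ Suc (\<Sum>i<w E. v (push i E))" for E X
  proof -
   have "(\<Prod>i<w E. g i E X) <= (\<Prod>i<w E. 2 ^ v (push i E))"
    using v(2)[of "push i E" X for i] by (intro prod_mono) (simp add: less_imp_le)
   also have "... = 2 ^ (\<Sum>i<w E. v (push i E))" by (simp add: power_sum)
   also have "... < 2 ^ Suc (\<Sum>i<w E. v (push i E))" by simp
   finally show ?thesis .
  qed
  show "tcn (\<lambda>E X. prod_mod (E 0) (w (\<lambda>k. E (Suc k))) (\<lambda>i. g i (\<lambda>k. E (Suc k)) X))"
   by (rule tcn_prod_mod[OF lsf_var lsf_weaken[OF w] g'])
 qed (rule prod_mod)
qed

section \<open>Division, two's complement and sorting\<close>

lemma tcb_const [tcb_intros]: "tcb (\<lambda>s X. c)"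
 by (intro tcb_tcn tcn_lsf lsf_const)

lemma bit_top_iff: "z < 2 ^ Suc w ==> bit z w \<longleftrightarrow> 2 ^ w <= (z :: nat)"
proof (cases "2 ^ w <= z")
 case True
 assume "z < 2 ^ Suc w"
 then have "z div 2 ^ w = 1" using True by (intro div_nat_eqI) auto
 then show ?thesis using True by (simp add: bit_iff_odd)
next
 case False
 then have "z div 2 ^ w = 0" by simp
 then show ?thesis using False by (simp add: bit_iff_odd)
qed

text \<open>The comparison is read off the digit \<open>2 ^ (v + w)\<close> of
  \<open>2 ^ (v + w) + F - G\<close>, which is lost exactly if \<open>F\<close> is smaller than
  \<open>G\<close>.\<close>

lemma tcp_less [tcn_intros]:
 assumes F: "tcb F" and G: "tcb G"
 shows "tcp (\<lambda>s X. F s X < G s X)"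
proof -
 obtain v where v: "lsf v" "!!s X. F s X < 2 ^ v s" using tcb_bound[OF F] by blast
 obtain w where w: "lsf w" "!!s X. G s X < 2 ^ w s" using tcb_bound[OF G] by blast
 have le: "G s X <= push_bit (v s + w s) 1 + F s X" for s X
 proof -
  have "(2::nat) ^ w s <= 2 ^ (v s + w s)" by (rule power_increasing) auto
  then show ?thesis using w(2)[of s X] unfolding push_bit_eq_mult mult_1 by linarith
 qed
 have eq: "F s X < G s X \<longleftrightarrow> \<not> bit (push_bit (v s + w s) 1 + F s X - G s X) (v s + w s)" for s X
 proof -
  have "(2::nat) ^ v s <= 2 ^ (v s + w s)" by (rule power_increasing) auto
  then have "push_bit (v s + w s) 1 + F s X - G s X < 2 ^ Suc (v s + w s)"
   using v(2)[of s X] unfolding push_bit_eq_mult mult_1 power_Suc by linarith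
  then show ?thesis
   using le[of s X] unfolding bit_top_iff[OF \<open>_ < 2 ^ Suc (v s + w s)\<close>] by (auto simp: push_bit_eq_mult)
 qed
 show ?thesis
  unfolding eq by (intro tcn_intros tcb_diff tcb_intros tcn_lsf lsf_intros v w F G le)
qed

lemma tcb_power:
 assumes F: "tcb F" and e: "lsf e"
 shows "tcb (\<lambda>s X. F s X ^ e s)"
 using tcb_prod[OF e tcb_shift[OF F]] by simp

lemma less_clog_iff: "i < clog (Suc v) \<longleftrightarrow> 2 ^ i <= v"
proof
 assume "2 ^ i <= v"
 show "i < clog (Suc v)"
 proof (rule ccontr)
  assume "\<not> i < clog (Suc v)"
  then have "(2::nat) ^ clog (Suc v) <= 2 ^ i" by (intro power_increasing) auto
  then show False using le_power_clog[of "Suc v"] \<open>2 ^ i <= v\<close> by linarith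
 qed
qed (use power_less_clog[of i "Suc v"] in simp)

text \<open>Division by \<open>v\<close> through a truncated geometric series for the inverse of \<open>v / 2 ^ k\<close>.\<close>

lemma div_series:
 fixes u v k I :: nat
 assumes v: "v < 2 ^ k" "2 ^ k <= 2 * v" and u: "2 * u + 1 <= 2 ^ Suc I"
 shows "u div v = (2 * u + 1) * (\<Sum>i<Suc I. (2 ^ k - v) ^ i * 2 ^ (k * (I - i))) div 2 ^ (k * Suc I + 1)"
proof -
 let ?b = "2 ^ k :: nat"
 let ?a = "?b - v"
 define S where "S = (\<Sum>i<Suc I. ?a ^ i * 2 ^ (k * (I - i)))"
 have v0: "0 < v" using v by (intro gr0I) simp
 \<comment> \<open>The finite geometric sum: up to the error term \<open>?a ^ Suc I\<close>,
   \<open>S\<close> is \<open>?b ^ Suc I / v\<close>. Since \<open>?a\<close> is at most half of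
   \<open>?b\<close>, \<open>I + 1\<close> terms suffice for a dividend of about \<open>I\<close>
   bits.\<close>
 have "int ?a ^ Suc I - int ?b ^ Suc I = (int ?a - int ?b) * (\<Sum>i<Suc I. int ?a ^ i * int ?b ^ (I - i))"
  by (rule diff_power_eq_sum)
 also have "(\<Sum>i<Suc I. int ?a ^ i * int ?b ^ (I - i)) = int S"
  by (simp add: S_def power_mult)
 also have "int ?a - int ?b = - int v" using v(1) by (simp add: of_nat_diff)
 finally have "int (v * S + ?a ^ Suc I) = int (?b ^ Suc I)" by simp
 then have S: "v * S + ?a ^ Suc I = ?b ^ Suc I" by (simp only: of_nat_eq_iff)
 let ?q = "u div v" and ?r = "u mod v"
 have uqr: "u = ?q * v + ?r" "?r < v" using v0 by simp_all
 have "(2 * ?a) ^ Suc I <= ?b ^ Suc I" using v by (intro power_mono) auto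
 then have "2 ^ Suc I * ?a ^ Suc I <= ?b ^ Suc I" by (simp only: power_mult_distrib)
 then have small: "(2 * u + 1) * ?a ^ Suc I <= ?b ^ Suc I"
  using mult_le_mono1[OF u, of "?a ^ Suc I"] by linarith
 let ?B = "?b ^ Suc I"
 have vW: "v * ((2 * u + 1) * S) + (2 * u + 1) * ?a ^ Suc I = (2 * u + 1) * ?B"
  unfolding S[symmetric] by (simp only: algebra_simps)
 have B0: "0 < ?B" by simp
 \<comment> \<open>The dividend is replaced by \<open>u + 1 / 2\<close>, scaled by 2. This lifts it
   off the multiples of \<open>v\<close>, and the half unit gained absorbs the truncation error,
   which could otherwise lower the quotient by one.\<close>
 have "v * ((2 * ?B) * ?q) <= v * ((2 * u + 1) * S)"
 proof -
  have "(2 * u + 1) * ?B = v * ((2 * ?B) * ?q) + (2 * ?r + 1) * ?B"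
   by (subst uqr(1)) (simp only: algebra_simps)
  moreover have "?B <= (2 * ?r + 1) * ?B" by simp
  ultimately show ?thesis using vW small by linarith
 qed
 then have lower: "(2 * ?B) * ?q <= (2 * u + 1) * S" using v0 by simp
 have "v * ((2 * u + 1) * S) < v * ((2 * ?B) * Suc ?q)"
 proof -
  have "u < v * Suc ?q" using dividend_less_times_div[OF v0, of u] by simp
  then have "2 * u + 1 < 2 * (v * Suc ?q)" by linarith
  then have "(2 * u + 1) * ?B < 2 * (v * Suc ?q) * ?B" using B0 by (rule mult_strict_right_mono)
  moreover have "v * ((2 * u + 1) * S) <= (2 * u + 1) * ?B" using vW by linarith
  ultimately show ?thesis by (simp only: ac_simps)
 qed
 then have upper: "(2 * u + 1) * S < (2 * ?B) * Suc ?q" using v0 by simp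
 have "(2 * u + 1) * S div (2 * ?B) = ?q"
  using lower upper by (intro div_nat_eqI) (simp_all only: ac_simps)
 moreover have "2 ^ (k * Suc I + 1) = 2 * ?B" by (simp add: power_mult power_add)
 ultimately show ?thesis by (simp add: S_def)
qed

lemma tcb_div:
 assumes F: "tcb F" and G: "tcb G" and pos: "!!s X. 0 < G s X"
 shows "tcb (\<lambda>s X. F s X div G s X)"
proof -
 obtain n where n: "lsf n" "!!s X. F s X < 2 ^ n s" using tcb_bound[OF F] by blast
 obtain m where m: "lsf m" "!!s X. G s X < 2 ^ m s" using tcb_bound[OF G] by blast
 let ?k = "\<lambda>s X. clog (Suc (G s X))"
 have k: "tcn ?k"
 proof -
  \<comment> \<open>The bit length of the divisor depends on the input, so it is obtained as the
    number of powers of two not exceeding the divisor.\<close>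
  have "clog (Suc (G s X)) = (\<Sum>i<m s. of_bool (\<not> G s X < push_bit i 1))" for s X
  proof -
   have "clog (Suc (G s X)) <= m s" using m(2) by (intro clog_le) (simp add: Suc_leI)
   then have "{..<m s} \<inter> {i. \<not> G s X < push_bit i 1} = {..<clog (Suc (G s X))}"
    by (auto simp: push_bit_eq_mult less_clog_iff not_less intro: order_less_le_trans)
   then show ?thesis by simp
  qed
  then show ?thesis by (simp only:) (intro tcn_intros tcb_intros tcn_lsf lsf_intros m tcb_shift[OF G])
 qed
 have k_le: "G s X <= push_bit (?k s X) 1" for s X
  using le_power_clog[of "Suc (G s X)"] by (simp add: push_bit_eq_mult)
 have "F s X div G s X = drop_bit (?k s X * Suc (n s) + 1) ((2 * F s X + 1) *
   (\<Sum>i<Suc (n s). push_bit (?k s X * (n s - i)) ((push_bit (?k s X) 1 - G s X) ^ i)))" for s X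
 proof -
  have "2 ^ ?k s X <= 2 * G s X"
  proof (cases "?k s X")
   case 0
   then show ?thesis using pos[of s X] by simp
  next
   case (Suc j)
   then have "2 ^ j <= G s X" using less_clog_iff[of j "G s X"] by simp
   then show ?thesis by (simp add: Suc)
  qed
  moreover have "G s X < 2 ^ ?k s X" using le_power_clog[of "Suc (G s X)"] by simp
  moreover have "2 * F s X + 1 <= 2 ^ Suc (n s)" using n(2)[of s X] by simp
  ultimately show ?thesis
   using div_series[of "G s X" "?k s X" "F s X" "n s"] by (simp only: push_bit_eq_mult drop_bit_eq_div mult_1)
 qed
 note eq = this
 have a: "tcb (\<lambda>s X. push_bit (?k s X) 1 - G s X)"
  by (intro tcb_diff tcb_intros k G k_le)
 show ?thesis
  unfolding eq
  by (intro tcb_intros tcn_intros tcb_power tcb_shift[OF a] tcn_shift[OF k] k F n(1) tcn_lsf lsf_intros lsf_weaken[OF n(1)])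
qed


section \<open>Two's complement and signed division\<close>

lemma int_encode_int: "int (encode_int w z) = take_bit w z"
 by (simp add: encode_int_def)

lemma encode_int_less: "encode_int w z < 2 ^ w"
proof -
 have "int (encode_int w z) < int (2 ^ w)" by (simp add: int_encode_int)
 then show ?thesis by (simp only: of_nat_less_iff)
qed

lemma encode_int_eqI: "take_bit w z = take_bit w (int x) ==> encode_int w z = take_bit w x"
 by (simp add: encode_int_def take_bit_of_nat)

lemma bit_encode_int: "bit (encode_int w z) i \<longleftrightarrow> i < w \<and> bit z i"
 by (simp add: encode_int_def bit_nat_iff bit_take_bit_iff)

lemma bit_int_at: "bit (int_at p w X) i \<longleftrightarrow> bit X (p + min i (w - 1))"
 by (simp add: int_at_def bit_signed_take_bit_iff bit_drop_bit_eq bit_of_nat_iff min.commute)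

lemma tcb_encode_int_at [tcb_intros]:
 assumes W: "lsf W" and p: "lsf p" and w: "lsf w"
 shows "tcb (\<lambda>s X. encode_int (W s) (int_at (p s) (w s) X))"
proof (rule tcb_bitwise[OF _ W encode_int_less])
 show "bit (encode_int (W s) (int_at (p s) (w s) X)) i \<longleftrightarrow> i < W s \<and> bit X (p s + min i (w s - 1))" for s X i
  by (simp add: bit_encode_int bit_int_at)
 show "tcp (\<lambda>s X. s 0 < W (\<lambda>k. s (Suc k)) \<and> bit X (p (\<lambda>k. s (Suc k)) + min (s 0) (w (\<lambda>k. s (Suc k)) - 1)))"
  by (intro tcn_intros tcn_lsf lsf_intros lsf_weaken[OF W] lsf_weaken[OF p] lsf_weaken[OF w])
qed

lemma encode_int_sum_list:
 "encode_int W (sum_list (decode_ints n m X)) = take_bit W (\<Sum>i<n. encode_int W (int_at (m * i) m X))"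
proof (rule encode_int_eqI)
 have "sum_list (decode_ints n m X) = (\<Sum>i<n. int_at (m * i) m X)"
  unfolding decode_ints_def by (simp add: interv_sum_list_conv_sum_set_nat atLeast0LessThan)
 then show "take_bit W (sum_list (decode_ints n m X)) = take_bit W (int (\<Sum>i<n. encode_int W (int_at (m * i) m X)))"
  by (simp add: int_encode_int take_bit_eq_mod mod_sum_eq)
qed

lemma encode_int_prod_list:
 "encode_int W (prod_list (decode_ints n m X)) = take_bit W (\<Prod>i<n. encode_int W (int_at (m * i) m X))"
proof (rule encode_int_eqI)
 have "prod_list (decode_ints n m X) = (\<Prod>i<n. int_at (m * i) m X)"
  unfolding decode_ints_def by (induction n) (simp_all add: mult.commute)
 then show "take_bit W (prod_list (decode_ints n m X)) = take_bit W (int (\<Prod>i<n. encode_int W (int_at (m * i) m X)))"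
  by (simp add: int_encode_int take_bit_eq_mod mod_prod_eq)
qed

lemma tcb_addition: "tcb (\<lambda>s X. encode_int (s 0 + s 1) (sum_list (decode_ints (s 0) (s 1) X)))"
 unfolding encode_int_sum_list by (intro tcb_intros tcn_lsf lsf_intros)

lemma tcb_multiplication: "tcb (\<lambda>s X. encode_int (s 0 * s 1) (prod_list (decode_ints (s 0) (s 1) X)))"
 unfolding encode_int_prod_list by (intro tcb_intros tcn_lsf lsf_intros)


text \<open>The absolute value of the divisor, with 1 substituted for 0: division of
  \<open>tcb\<close> numbers needs a positive divisor for every input, also outside the domain of
  the operator.\<close>

definition abs_code :: "nat => nat => nat => nat" where
 "abs_code n m X = (let E = encode_int m (int_at n m X);
   V = (if bit X (n + m - 1) then push_bit m 1 - E else E) in if V < 1 then 1 else V)"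

text \<open>Adding \<open>2 ^ n\<close> times the divisor makes the dividend nonnegative without
  changing the remainder; the quotient is shifted by \<open>2 ^ n\<close>. Cutting to
  \<open>n + m + 2\<close> bits removes the wrap-around of a negative dividend.\<close>

definition dividend_code :: "nat => nat => nat => nat" where
 "dividend_code n m X = take_bit (n + m + 2) (encode_int (n + m + 2) (int_at 0 n X) + push_bit n (abs_code n m X))"

definition quotient_code :: "nat => nat => nat => nat" where
 "quotient_code n m X = dividend_code n m X div abs_code n m X"

text \<open>Modulo \<open>2 ^ (n + 1)\<close>, adding \<open>2 ^ n\<close> to the shifted quotient
  undoes the shift, and subtracting the shifted quotient from \<open>2 ^ n\<close> also negates it,
  as a negative divisor requires. The large power in front only keeps that subtraction
  nonnegative.\<close>

definition division_code :: "nat => nat => nat => nat" where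
 "division_code n m X =
   take_bit (n + 1) (if bit X (n + m - 1) then push_bit (n + m + 2) 1 + push_bit n 1 - quotient_code n m X
    else quotient_code n m X + push_bit n 1)
   + push_bit (n + 1) (dividend_code n m X - quotient_code n m X * abs_code n m X)"

lemma abs_code_pos: "0 < abs_code n m X"
 by (simp add: abs_code_def Let_def)

lemma quotient_code_le: "quotient_code n m X <= push_bit (n + m + 2) 1 + push_bit n 1"
proof -
 have "quotient_code n m X <= dividend_code n m X" unfolding quotient_code_def by (rule div_le_dividend)
 also have "... < 2 ^ (n + m + 2)" unfolding dividend_code_def by (rule take_bit_nat_less_exp)
 finally show ?thesis by (simp add: push_bit_eq_mult)
qed

lemma tcb_division_code: "tcb (\<lambda>s X. division_code (s 0) (s 1) X)"
proof -
 have le: "encode_int m z <= push_bit m 1" for m z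
  using encode_int_less[of m z] by (simp add: push_bit_eq_mult)
 have V: "tcb (\<lambda>s X. abs_code (s 0) (s 1) X)"
  unfolding abs_code_def Let_def by (intro tcb_diff tcb_intros tcn_intros tcn_lsf lsf_intros le)
 have U: "tcb (\<lambda>s X. dividend_code (s 0) (s 1) X)"
  unfolding dividend_code_def by (intro tcb_intros tcn_lsf lsf_intros V)
 have Q: "tcb (\<lambda>s X. quotient_code (s 0) (s 1) X)"
  unfolding quotient_code_def by (rule tcb_div[OF U V abs_code_pos])
 have QV: "quotient_code n m X * abs_code n m X <= dividend_code n m X" for n m X
  unfolding quotient_code_def by (rule div_times_less_eq_dividend)
 show ?thesis
  unfolding division_code_def
  by (intro tcb_diff[OF _ _ QV] tcb_diff[OF _ _ quotient_code_le] tcb_intros tcn_intros tcn_lsf lsf_intros U V Q)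
qed

lemma division_code:
 assumes nm: "0 < n" "0 < m" and v0: "int_at n m X ~= 0"
 shows "division_code n m X = (let u = int_at 0 n X; v = int_at n m X; q = sgn v * (u div \<bar>v\<bar>); r = u mod \<bar>v\<bar>
   in encode_int (n + 1) q + 2 ^ (n + 1) * encode_int m r)"
proof -
 define u v where "u = int_at 0 n X" and "v = int_at n m X"
 let ?V = "abs_code n m X" and ?U = "dividend_code n m X" and ?Q = "quotient_code n m X"
 have neg: "bit X (n + m - 1) \<longleftrightarrow> v < 0"
  unfolding v_def int_at_def using nm by (simp add: bit_drop_bit_eq bit_of_nat_iff)
 have m2: "2 ^ m = 2 * (2 :: int) ^ (m - 1)" using nm by (cases m) auto
 have n2: "2 ^ n = 2 * (2 :: int) ^ (n - 1)" using nm by (cases n) auto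
 have v: "- (2 ^ (m - 1)) <= v" "v < 2 ^ (m - 1)"
  unfolding v_def int_at_def by (simp_all add: signed_take_bit_int_greater_eq_minus_exp signed_take_bit_int_less_exp)
 have u: "- (2 ^ (n - 1)) <= u" "u < 2 ^ (n - 1)"
  unfolding u_def int_at_def by (simp_all add: signed_take_bit_int_greater_eq_minus_exp signed_take_bit_int_less_exp)
 have E: "int (encode_int m v) = (if v < 0 then v + 2 ^ m else v)"
 proof (cases "v < 0")
  case True
  have "v mod 2 ^ m = (v + 2 ^ m) mod 2 ^ m" by simp
  also have "... = v + 2 ^ m" using True v m2 by (intro mod_pos_pos_trivial) auto
  finally show ?thesis using True by (simp add: int_encode_int take_bit_eq_mod)
 next
  case False
  then show ?thesis using v m2 by (simp add: int_encode_int take_bit_eq_mod)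
 qed
 have V: "int ?V = \<bar>v\<bar>"
 proof -
  have "int (if bit X (n + m - 1) then push_bit m 1 - encode_int m v else encode_int m v) = \<bar>v\<bar>"
   using E neg encode_int_less[of m v] by (simp add: push_bit_eq_mult of_nat_diff less_imp_le)
  then show ?thesis using v0 unfolding abs_code_def Let_def v_def[symmetric] by (auto split: if_splits)
 qed
 have V1: "1 <= \<bar>v\<bar>" using v0 v_def by simp
 have U: "int ?U = u + \<bar>v\<bar> * 2 ^ n"
 proof -
  have "2 ^ n <= \<bar>v\<bar> * 2 ^ n" using mult_right_mono[OF V1, of "2 ^ n"] by simp
  then have 1: "0 <= u + \<bar>v\<bar> * 2 ^ n" using u n2 by linarith
  have "\<bar>v\<bar> * 2 ^ n <= 2 ^ m * 2 ^ n" using v m2 by (intro mult_right_mono) auto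
  moreover have "u <= 2 ^ m * 2 ^ n"
  proof -
   have "(2::int) ^ n <= 2 ^ m * 2 ^ n" by simp
   then show ?thesis using u n2 by linarith
  qed
  moreover have "(2::int) ^ (n + m + 2) = 4 * (2 ^ m * 2 ^ n)" by (simp add: power_add)
  moreover have "(0::int) < 2 ^ m * 2 ^ n" by simp
  ultimately have 2: "u + \<bar>v\<bar> * 2 ^ n < 2 ^ (n + m + 2)" by linarith
  have "int ?U = take_bit (n + m + 2) (take_bit (n + m + 2) u + \<bar>v\<bar> * 2 ^ n)"
   unfolding dividend_code_def u_def[symmetric]
   by (simp add: take_bit_of_nat[symmetric] int_encode_int push_bit_eq_mult V)
  also have "... = (u + \<bar>v\<bar> * 2 ^ n) mod 2 ^ (n + m + 2)"
   by (simp add: take_bit_eq_mod mod_add_left_eq)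
  also have "... = u + \<bar>v\<bar> * 2 ^ n" using 1 2 by simp
  finally show ?thesis .
 qed
 have Q: "int ?Q = u div \<bar>v\<bar> + 2 ^ n"
  unfolding quotient_code_def of_nat_div U V using V1 by (subst mult.commute) simp
 have R: "int (?U - ?Q * ?V) = u mod \<bar>v\<bar>"
 proof -
  have "?U - ?Q * ?V = ?U mod ?V" unfolding quotient_code_def by (simp add: minus_div_mult_eq_mod)
  then show ?thesis by (simp add: of_nat_mod U V mult.commute)
 qed
 have "encode_int m (u mod \<bar>v\<bar>) = ?U - ?Q * ?V"
 proof -
  have "0 <= u mod \<bar>v\<bar>" "u mod \<bar>v\<bar> < \<bar>v\<bar>" using V1 by simp_all
  then have "take_bit m (u mod \<bar>v\<bar>) = u mod \<bar>v\<bar>" using v m2 by (simp add: take_bit_int_eq_self_iff)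
  then show ?thesis unfolding encode_int_def R[symmetric] by simp
 qed
 moreover have "encode_int (n + 1) (sgn v * (u div \<bar>v\<bar>)) =
   take_bit (n + 1) (if bit X (n + m - 1) then push_bit (n + m + 2) 1 + push_bit n 1 - ?Q else ?Q + push_bit n 1)"
 proof (rule encode_int_eqI)
  have eq: "take_bit (n + 1) (x :: int) = take_bit (n + 1) y" if "x = y + 2 ^ (n + 1) * z" for x y z
   by (simp add: that take_bit_eq_mod del: power_Suc)
  show "take_bit (n + 1) (sgn v * (u div \<bar>v\<bar>)) = take_bit (n + 1) (int (if bit X (n + m - 1)
    then push_bit (n + m + 2) 1 + push_bit n 1 - ?Q else ?Q + push_bit n 1))"
  proof (cases "v < 0")
   case True
   have "int (push_bit (n + m + 2) 1 + push_bit n 1 - ?Q) = 2 ^ (n + m + 2) + 2 ^ n - int ?Q"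
    using quotient_code_le[of n m X] by (simp add: of_nat_diff push_bit_eq_mult)
   moreover have "take_bit (n + 1) (sgn v * (u div \<bar>v\<bar>)) = take_bit (n + 1) (2 ^ (n + m + 2) + 2 ^ n - int ?Q)"
    by (rule eq[where z = "- (2 ^ (m + 1))"]) (use True Q in "simp add: power_add")
   ultimately show ?thesis using True neg by simp
  next
   case False
   then have "sgn v = 1" using V1 by simp
   then have "take_bit (n + 1) (sgn v * (u div \<bar>v\<bar>)) = take_bit (n + 1) (int ?Q + 2 ^ n)"
    by (intro eq[where z = "- 1"]) (use Q in simp)
   then show ?thesis using False neg by (simp add: push_bit_eq_mult)
  qed
 qed
 ultimately show ?thesis
  unfolding division_code_def Let_def u_def[symmetric] v_def[symmetric] by (simp add: push_bit_eq_mult)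
qed


section \<open>Sorting by ranks\<close>

definition rank :: "'a::linorder list => nat => nat" where
 "rank zs a = card {b. b < length zs \<and> (zs ! b < zs ! a \<or> (zs ! b = zs ! a \<and> b < a))}"

lemma rank_less:
 assumes "a < length zs" "zs ! a < zs ! b \<or> (zs ! a = zs ! b \<and> a < b)"
 shows "rank zs a < rank zs b"
 unfolding rank_def by (rule psubset_card_mono) (use assms in auto)

lemma rank_bij: "bij_betw (rank zs) {..<length zs} {..<length zs}"
proof -
 have inj: "inj_on (rank zs) {..<length zs}"
 proof (rule inj_onI)
  fix a b assume ab: "a \<in> {..<length zs}" "b \<in> {..<length zs}" "rank zs a = rank zs b"
  show "a = b"
  proof (rule ccontr)
   assume "a ~= b"
   then have "(zs ! a < zs ! b \<or> (zs ! a = zs ! b \<and> a < b)) \<or> (zs ! b < zs ! a \<or> (zs ! b = zs ! a \<and> b < a))"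
    by (auto simp: neq_iff)
   then show False using rank_less[of a zs b] rank_less[of b zs a] ab by auto
  qed
 qed
 have "rank zs ` {..<length zs} \<subseteq> {..<length zs}"
 proof safe
  fix a assume "a < length zs"
  then have "rank zs a < card {..<length zs}"
   unfolding rank_def by (intro psubset_card_mono) auto
  then show "rank zs a < length zs" by simp
 qed
 then have "rank zs ` {..<length zs} = {..<length zs}" using inj by (intro endo_inj_surj) auto
 then show ?thesis using inj by (simp add: bij_betw_def)
qed

text \<open>Equal elements are ordered by position, so ranks form a permutation. The list read along
  the inverse permutation is sorted and has the same elements, which determines it.\<close>

lemma sort_nth_rank:
 assumes a: "a < length zs"
 shows "sort zs ! rank zs a = zs ! a"
proof -
 let ?n = "length zs" and ?q = "inv_into {..<length zs} (rank zs)"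
 note bij = rank_bij[of zs]
 have q: "bij_betw ?q {..<?n} {..<?n}" using bij by (rule bij_betw_inv_into)
 have rq: "rank zs (?q i) = i" if "i < ?n" for i using bij_betw_inv_into_right[OF bij] that by simp
 have q_less: "?q i < ?n" if "i < ?n" for i using q that by (auto simp: bij_betw_def)
 let ?ys = "map (\<lambda>i. zs ! ?q i) [0..<?n]"
 have "sorted ?ys"
  unfolding sorted_iff_nth_mono
 proof (intro allI impI)
  fix i j assume ij: "i <= j" "j < length ?ys"
  show "?ys ! i <= ?ys ! j"
  proof (rule ccontr)
   assume "\<not> ?ys ! i <= ?ys ! j"
   then have "zs ! ?q j < zs ! ?q i" using ij by simp
   then have "rank zs (?q j) < rank zs (?q i)" using rank_less[of "?q j" zs "?q i"] q_less[of j] ij by simp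
   then show False using rq ij by simp
  qed
 qed
 moreover have "mset ?ys = mset zs"
 proof -
  have "mset ?ys = image_mset ((!) zs) (image_mset ?q (mset_set {..<?n}))"
   by (simp add: image_mset.compositionality o_def atLeast0LessThan)
  also have "image_mset ?q (mset_set {..<?n}) = mset_set {..<?n}"
   using q by (simp add: image_mset_mset_set bij_betw_def)
  also have "image_mset ((!) zs) (mset_set {..<?n}) = mset (map ((!) zs) [0..<?n])"
   by (simp add: atLeast0LessThan)
  also have "... = mset zs" by (simp only: map_nth)
  finally show ?thesis .
 qed
 ultimately have "sort zs = ?ys" by (intro properties_for_sort)
 moreover have "rank zs a < ?n" using bij a by (auto simp: bij_betw_def)
 moreover have "?q (rank zs a) = a" using bij_betw_inv_into_left[OF bij] a by simp
 ultimately show ?thesis by simp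
qed

lemma bit_encode_ints:
 assumes "0 < m" "k < length zs * m"
 shows "bit (encode_ints m zs) k \<longleftrightarrow> bit (encode_int m (zs ! (k div m))) (k mod m)"
 using assms(2)
proof (induction zs arbitrary: k)
 case (Cons z zs)
 have eq: "encode_ints m (z # zs) = encode_int m z + push_bit m (encode_ints m zs)"
  by (simp add: encode_ints_def push_bit_eq_mult mult.commute)
 have or: "encode_int m z + push_bit m (encode_ints m zs) = Bit_Operations.or (encode_int m z) (push_bit m (encode_ints m zs))"
  by (rule disjunctive_add) (simp add: bit_encode_int bit_push_bit_iff)
 show ?case
 proof (cases "k < m")
  case True
  then show ?thesis unfolding eq or by (simp add: bit_or_iff bit_push_bit_iff)
 next
  case False
  then have "k div m = Suc ((k - m) div m)" "k mod m = (k - m) mod m" "k - m < length zs * m"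
   using assms(1) Cons.prems by (simp_all add: le_div_geq le_mod_geq)
  then show ?thesis
   unfolding eq or using False Cons.IH[of "k - m"] by (simp add: bit_or_iff bit_push_bit_iff bit_encode_int)
 qed
qed simp

text \<open>Offset binary: adding \<open>2 ^ (m - 1)\<close> modulo \<open>2 ^ m\<close> translates
  the order of signed integers into that of natural numbers, for which comparison is
  available.\<close>

definition order_key :: "nat => nat => nat => nat" where
 "order_key m a X = take_bit m (encode_int m (int_at (m * a) m X) + push_bit (m - 1) 1)"

lemma order_key: "0 < m ==> int (order_key m a X) = int_at (m * a) m X + 2 ^ (m - 1)"
proof -
 assume m: "0 < m"
 let ?z = "int_at (m * a) m X"
 have m2: "2 ^ m = 2 * (2 :: int) ^ (m - 1)" using m by (cases m) auto
 have z: "- (2 ^ (m - 1)) <= ?z" "?z < 2 ^ (m - 1)"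
  unfolding int_at_def by (simp_all add: signed_take_bit_int_greater_eq_minus_exp signed_take_bit_int_less_exp)
 have "int (order_key m a X) = take_bit m (take_bit m ?z + 2 ^ (m - 1))"
  by (simp add: order_key_def take_bit_of_nat[symmetric] int_encode_int push_bit_eq_mult)
 also have "... = (?z + 2 ^ (m - 1)) mod 2 ^ m" by (simp add: take_bit_eq_mod mod_add_left_eq)
 also have "... = ?z + 2 ^ (m - 1)" using z m2 by (intro mod_pos_pos_trivial) auto
 finally show ?thesis .
qed

text \<open>Ties are expressed by comparison alone: next to the strict alternative, the absence of
  the reverse inequality amounts to equality of the keys.\<close>

definition rank_code :: "nat => nat => nat => nat => nat" where
 "rank_code n m X a = (\<Sum>b<n. of_bool (order_key m b X < order_key m a X \<or> (\<not> order_key m a X < order_key m b X \<and> b < a)))"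

lemma rank_code:
 assumes m: "0 < m" and a: "a < n"
 shows "rank_code n m X a = rank (decode_ints n m X) a"
proof -
 have key: "order_key m b X < order_key m c X \<longleftrightarrow> int_at (m * b) m X < int_at (m * c) m X" for b c
 proof -
  have "order_key m b X < order_key m c X \<longleftrightarrow> int (order_key m b X) < int (order_key m c X)" by simp
  then show ?thesis unfolding order_key[OF m] by simp
 qed
 have "{..<n} \<inter> {b. order_key m b X < order_key m a X \<or> (\<not> order_key m a X < order_key m b X \<and> b < a)}
   = {b. b < n \<and> (int_at (m * b) m X < int_at (m * a) m X \<or> (int_at (m * b) m X = int_at (m * a) m X \<and> b < a))}"
  unfolding key by auto
 also have "... = {b. b < length (decode_ints n m X) \<and> (decode_ints n m X ! b < decode_ints n m X ! a \<or>
   (decode_ints n m X ! b = decode_ints n m X ! a \<and> b < a))}"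
  using a by (auto simp: decode_ints_def)
 finally show ?thesis by (simp only: rank_code_def rank_def sum_of_bool_eq finite_lessThan of_nat_id)
qed

definition sorting_code :: "nat => nat => nat => nat" where
 "sorting_code n m X = bits_nat {k. k < n * m \<and>
   (\<exists>a<n. rank_code n m X a = k div m \<and> bit (encode_int m (int_at (m * a) m X)) (k mod m))}"

lemma tcb_sorting_code: "tcb (\<lambda>s X. sorting_code (s 0) (s 1) X)"
proof -
 have key: "tcb (\<lambda>s X. order_key (m s) (a s) X)" if "lsf m" "lsf a" for m a
  unfolding order_key_def by (intro tcb_intros tcn_lsf lsf_intros that)
 show ?thesis
  unfolding sorting_code_def rank_code_def
  by (intro tcb_of_bits tcn_intros key tcb_intros tcp_lsp tcn_lsf lsf_intros)
qed

lemma bit_sorting_code: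
 assumes "0 < m" "k < n * m"
 shows "bit (encode_ints m (sort (decode_ints n m X))) k \<longleftrightarrow> bit (sorting_code n m X) k"
proof -
 let ?zs = "decode_ints n m X"
 have len: "length ?zs = n" by (simp add: decode_ints_def)
 have kn: "k div m < n" using assms by (simp add: div_less_iff_less_mult)
 then have "k div m \<in> rank ?zs ` {..<n}" using rank_bij[of ?zs] by (simp add: bij_betw_def len)
 then obtain c where c: "c < n" "rank ?zs c = k div m" by auto
 have uniq: "a = c" if "a < n" "rank ?zs a = k div m" for a
  using rank_bij[of ?zs] that c by (auto simp: bij_betw_def len inj_on_def)
 have "bit (encode_ints m (sort ?zs)) k \<longleftrightarrow> bit (encode_int m (sort ?zs ! (k div m))) (k mod m)"
  by (rule bit_encode_ints) (use assms len in simp_all)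
 also have "sort ?zs ! (k div m) = int_at (m * c) m X"
  using sort_nth_rank[of c ?zs] c len by (simp add: decode_ints_def)
 also have "bit (encode_int m (int_at (m * c) m X)) (k mod m) \<longleftrightarrow>
   (\<exists>a<n. rank_code n m X a = k div m \<and> bit (encode_int m (int_at (m * a) m X)) (k mod m))"
  using rank_code[OF assms(1), of _ n X] c uniq by metis
 also have "... \<longleftrightarrow> bit (sorting_code n m X) k"
  unfolding sorting_code_def using assms(2) by (subst bit_bits_nat) auto
 finally show ?thesis .
qed

corollary BQNC0f_tcb:
  assumes R: "tcb R" and a: "lsf a" and b: "lsf b"
    and U: "\<And>n m. 0 < n \<Longrightarrow> 0 < m \<Longrightarrow>
      U n m = fun_operator (a (push n (push m (\<lambda>_. 0)))) (b (push n (push m (\<lambda>_. 0)))) (Dom n m) (f n m)"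
    and f: "\<And>n m X i. 0 < n \<Longrightarrow> 0 < m \<Longrightarrow> X \<in> Dom n m \<Longrightarrow> i < b (push n (push m (\<lambda>_. 0))) \<Longrightarrow>
      bit (f n m X) i = bit (R (push n (push m (\<lambda>_. 0))) X) i"
  shows "U \<in> BQNC0f"
proof (rule BQNC0f_fun_operator[OF _ a b U])
  show "tcn (\<lambda>\<sigma> X. of_bool (bit (R (\<lambda>k. \<sigma> (Suc k)) X) (\<sigma> 0)))"
    using R by (simp add: tcb_def tcp_def)
qed (use f in auto)

theorem theorem7:
  shows "addition_op \<in> BQNC0f \<and> multiplication_op \<in> BQNC0f \<and>
         division_op \<in> BQNC0f \<and> sorting_op \<in> BQNC0f"
proof (intro conjI)
  show "addition_op \<in> BQNC0f"
    by (rule BQNC0f_tcb[OF tcb_addition, where a = "\<lambda>\<sigma>. \<sigma> 0 * \<sigma> 1" and b = "\<lambda>\<sigma>. \<sigma> 0 + \<sigma> 1"])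
      (intro lsf_intros | simp add: addition_op_def)+
  show "multiplication_op \<in> BQNC0f"
    by (rule BQNC0f_tcb[OF tcb_multiplication, where a = "\<lambda>\<sigma>. \<sigma> 0 * \<sigma> 1" and b = "\<lambda>\<sigma>. \<sigma> 0 * \<sigma> 1"])
      (intro lsf_intros | simp add: multiplication_op_def)+
  show "division_op \<in> BQNC0f"
  proof (rule BQNC0f_tcb[OF tcb_division_code, where a = "\<lambda>\<sigma>. \<sigma> 0 + \<sigma> 1" and b = "\<lambda>\<sigma>. \<sigma> 0 + 1 + \<sigma> 1"])
    fix n m X i :: nat
    assume "0 < n" "0 < m" "X \<in> {x. int_at n m x \<noteq> 0}"
    then have eq: "division_code n m X = (let u = int_at 0 n X; v = int_at n m X; q = sgn v * (u div \<bar>v\<bar>); r = u mod \<bar>v\<bar>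
       in encode_int (n + 1) q + 2 ^ (n + 1) * encode_int m r)"
      by (intro division_code) auto
    show "bit (let u = int_at 0 n X; v = int_at n m X; q = sgn v * (u div \<bar>v\<bar>); r = u mod \<bar>v\<bar>
        in encode_int (n + 1) q + 2 ^ (n + 1) * encode_int m r) i
      = bit (division_code (push n (push m (\<lambda>_. 0)) 0) (push n (push m (\<lambda>_. 0)) 1) X) i"
      unfolding eq[symmetric] by simp
  qed (intro lsf_intros | simp add: division_op_def)+
  show "sorting_op \<in> BQNC0f"
    by (rule BQNC0f_tcb[OF tcb_sorting_code, where a = "\<lambda>\<sigma>. \<sigma> 0 * \<sigma> 1" and b = "\<lambda>\<sigma>. \<sigma> 0 * \<sigma> 1"])
      (intro lsf_intros | simp add: sorting_op_def bit_sorting_code)+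
qed

end
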